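(* Fix rational numbers $\beta,\gamma$ such that $\min\{\beta,\gamma\}<0$ and $-2<\beta+\gamma<1$, but $(\beta,\gamma)\notin\{(1,-1),(-1,1)\}$. Then the following problem is \#P-hard: given an input graph $G$, determine the sign of the partition function $Z_G$.
   Context: Graphs are finite undirected multigraphs, possibly with self-loops and parallel edges. For fixed $\beta,\gamma$, let $A=\begin{bmatrix}\beta&1\\1&\gamma\end{bmatrix}$ and for a graph $G=(V,E)$ define $Z_G=\sum_{\sigma\in\{0,1\}^V}\prod_{\{u,v\}\in E}A_{\sigma(u),\sigma(v)}$ (a self-loop at $u$ contributes the factor $A_{\sigma(u),\sigma(u)}$). *)

theory Defs
  imports
    Complex_Main
    "HOL-Library.FuncSet"
    "HOL-Library.Multiset"
    "HOL-Library.Uprod"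
    "HOL-Computational_Algebra.Polynomial"
begin

section \<open>Multigraphs and the partition function\<close>

record 'a multigraph =
  verts :: "'a set"
  edges :: "'a uprod multiset"

definition wf_multigraph :: "'a multigraph \<Rightarrow> bool" where
  "wf_multigraph G \<longleftrightarrow> finite (verts G) \<and> (\<forall>e \<in># edges G. set_uprod e \<subseteq> verts G)"

(* The matrix A; only the indices 0 and 1 matter. *)
lift_definition interaction :: "rat \<Rightarrow> rat \<Rightarrow> (nat, rat) commute" is
  "\<lambda>\<beta> \<gamma> i j. if i = 0 \<and> j = 0 then \<beta> else if i = 1 \<and> j = 1 then \<gamma> else 1"
  by auto

definition edge_weight :: "rat \<Rightarrow> rat \<Rightarrow> ('a \<Rightarrow> nat) \<Rightarrow> 'a uprod \<Rightarrow> rat" where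
  "edge_weight \<beta> \<gamma> \<sigma> e = case_uprod (interaction \<beta> \<gamma>) (map_uprod \<sigma> e)"

lemma edge_weight_Upair:
  "edge_weight \<beta> \<gamma> \<sigma> (Upair u v) =
    (if \<sigma> u = 0 \<and> \<sigma> v = 0 then \<beta> else if \<sigma> u = 1 \<and> \<sigma> v = 1 then \<gamma> else 1)"
  by (simp add: edge_weight_def interaction.rep_eq)

definition partition_function :: "rat \<Rightarrow> rat \<Rightarrow> 'a multigraph \<Rightarrow> rat" where
  "partition_function \<beta> \<gamma> G =
    (\<Sum>\<sigma> \<in> verts G \<rightarrow>\<^sub>E {0, 1}. \<Prod>e \<in># edges G. edge_weight \<beta> \<gamma> \<sigma> e)"


section \<open>Deterministic multi-tape Turing machines\<close>

(* Tapes are infinite in both directions. Symbol 0 is the blank, symbols 1 and 2 stand for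
   the bits 0 and 1, and further symbols may be used as work symbols. *)

type_synonym tape = "(int \<Rightarrow> nat) \<times> int"
type_synonym config = "nat \<times> tape list"

record tm =
  num_tapes :: nat
  num_symbols :: nat
  num_states :: nat
  start :: nat
  halt :: nat
  delta :: "nat \<Rightarrow> nat list \<Rightarrow> nat \<times> (nat \<times> int) list"

definition wf_tm :: "'m tm_scheme \<Rightarrow> bool" where
  "wf_tm M \<longleftrightarrow>
    1 \<le> num_tapes M \<and> 3 \<le> num_symbols M \<and>
    start M < num_states M \<and> halt M < num_states M \<and>
    (\<forall>q < num_states M. \<forall>ss. length ss = num_tapes M \<and> set ss \<subseteq> {..<num_symbols M} \<longrightarrow>
      (case delta M q ss of (q', acts) \<Rightarrow>
        q' < num_states M \<and> length acts = num_tapes M \<and>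
        set acts \<subseteq> {..<num_symbols M} \<times> {-1, 0, 1}))"

definition act :: "tape \<Rightarrow> nat \<times> int \<Rightarrow> tape" where
  "act = (\<lambda>(c, h) (s, d). (c(h := s), h + d))"

definition step :: "'m tm_scheme \<Rightarrow> config \<Rightarrow> config" where
  "step M = (\<lambda>(q, ts).
    if q = halt M then (q, ts)
    else case delta M q (map (\<lambda>(c, h). c h) ts) of (q', acts) \<Rightarrow> (q', map2 act ts acts))"

definition word_tape :: "bool list \<Rightarrow> int \<Rightarrow> nat" where
  "word_tape w i = (if 0 \<le> i \<and> i < int (length w) then (if w ! nat i then 2 else 1) else 0)"

(* The maximal block of bits that starts at cell 0. *)
definition tape_word :: "(int \<Rightarrow> nat) \<Rightarrow> bool list" where
  "tape_word c = map (\<lambda>i. c (int i) = 2) [0..<(LEAST n. c (int n) \<notin> {1, 2})]"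

lemma tape_word_word_tape: "tape_word (word_tape w) = w"
proof -
  have "(LEAST n. word_tape w (int n) \<notin> {1, 2}) = length w"
    by (rule Least_equality) (auto simp: word_tape_def split: if_splits)
  then show ?thesis
    by (auto simp: tape_word_def word_tape_def intro: nth_equalityI)
qed

definition init :: "'m tm_scheme \<Rightarrow> bool list \<Rightarrow> config" where
  "init M w = (start M, (word_tape w, 0) # replicate (num_tapes M - 1) (\<lambda>_. 0, 0))"

definition halts_with :: "'m tm_scheme \<Rightarrow> config \<Rightarrow> bool list \<Rightarrow> bool" where
  "halts_with M = (\<lambda>(q, ts) w. q = halt M \<and> tape_word (fst (ts ! 0)) = w)"

(* Halting configurations are fixed points of step, so the run may also stop before the bound. *)
definition polytime_computable :: "(bool list \<Rightarrow> bool list) \<Rightarrow> bool" where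
  "polytime_computable f \<longleftrightarrow>
    (\<exists>(M :: tm) (p :: nat poly). wf_tm M \<and>
      (\<forall>x. halts_with M ((step M ^^ poly p (length x)) (init M x)) (f x)))"

definition polytime_decidable :: "bool list set \<Rightarrow> bool" where
  "polytime_decidable L \<longleftrightarrow> polytime_computable (\<lambda>w. [w \<in> L])"


section \<open>The class #P\<close>

definition pair_code :: "bool list \<Rightarrow> bool list \<Rightarrow> bool list" where
  "pair_code x y = concat (map (\<lambda>b. [b, b]) x) @ [False, True] @ y"

lemma pair_code_inject: "pair_code x y = pair_code x' y' \<longleftrightarrow> x = x' \<and> y = y'"
proof (induction x arbitrary: x')
  case Nil
  then show ?case by (cases x') (auto simp: pair_code_def)
next
  case (Cons b x)
  then show ?case by (cases x') (auto simp: pair_code_def)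
qed

definition sharpP :: "(bool list \<Rightarrow> nat) set" where
  "sharpP = {f. \<exists>L (p :: nat poly). polytime_decidable L \<and>
     (\<forall>x. f x = card {y. length y = poly p (length x) \<and> pair_code x y \<in> L})}"


section \<open>Polynomial-time Turing reductions and #P-hardness\<close>

(* In state query, tape 1 is replaced in a single step by the answer of the oracle to the
   word on it, and the machine continues in state answer. *)
record otm = tm +
  query :: nat
  answer :: nat

definition wf_otm :: "otm \<Rightarrow> bool" where
  "wf_otm M \<longleftrightarrow> wf_tm M \<and> 2 \<le> num_tapes M \<and>
    query M < num_states M \<and> answer M < num_states M \<and> query M \<noteq> halt M"

definition ostep :: "(bool list \<Rightarrow> bool list) \<Rightarrow> otm \<Rightarrow> config \<Rightarrow> config" where
  "ostep Q M = (\<lambda>(q, ts).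
    if q = query M then (answer M, ts[1 := (word_tape (Q (tape_word (fst (ts ! 1)))), 0)])
    else step M (q, ts))"

(* A computational problem relates the code of an instance to the codes of its correct
   answers. Words that are not the code of an instance are outside its domain; a solver may
   do anything on them. *)
type_synonym problem = "(bool list \<times> bool list) set"

definition solves :: "(bool list \<Rightarrow> bool list) \<Rightarrow> problem \<Rightarrow> bool" where
  "solves Q P \<longleftrightarrow> (\<forall>w \<in> Domain P. (w, Q w) \<in> P)"

(* Binary representation, least significant bit first. *)
fun nat_code :: "nat \<Rightarrow> bool list" where
  "nat_code n = (if n = 0 then [] else odd n # nat_code (n div 2))"

declare nat_code.simps [simp del]

definition polytime_turing_reducible :: "(bool list \<Rightarrow> nat) \<Rightarrow> problem \<Rightarrow> bool" where
  "polytime_turing_reducible f P \<longleftrightarrow>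
    (\<exists>M (p :: nat poly). wf_otm M \<and>
      (\<forall>Q. solves Q P \<longrightarrow>
        (\<forall>x. halts_with M ((ostep Q M ^^ poly p (length x)) (init M x)) (nat_code (f x)))))"

definition sharpP_hard :: "problem \<Rightarrow> bool" where
  "sharpP_hard P \<longleftrightarrow> (\<forall>f \<in> sharpP. polytime_turing_reducible f P)"


section \<open>The sign problem\<close>

definition unary :: "nat \<Rightarrow> bool list" where
  "unary n = replicate n True @ [False]"

definition graph_code :: "nat \<Rightarrow> (nat \<times> nat) list \<Rightarrow> bool list" where
  "graph_code n es = unary n @ concat (map (\<lambda>(u, v). unary u @ unary v) es)"

(* Input graphs have vertex set {0, ..., n-1} and are given by n and a list of their edges
   with multiplicity. Unary numbers change the length of the code only polynomially, since n
   vertices count as size n. *)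
definition encodes :: "bool list \<Rightarrow> nat multigraph \<Rightarrow> bool" where
  "encodes w G \<longleftrightarrow> wf_multigraph G \<and>
    (\<exists>n es. verts G = {..<n} \<and> edges G = mset (map (\<lambda>(u, v). Upair u v) es) \<and>
      w = graph_code n es)"

lemma unary_append_inject: "unary m @ xs = unary n @ ys \<longleftrightarrow> m = n \<and> xs = ys"
proof (induction m arbitrary: n)
  case 0
  then show ?case by (cases n) (auto simp: unary_def)
next
  case (Suc m)
  then show ?case by (cases n) (auto simp: unary_def)
qed

lemma graph_code_inject: "graph_code m es = graph_code n fs \<longleftrightarrow> m = n \<and> es = fs"
proof -
  let ?c = "\<lambda>es. concat (map (\<lambda>(u, v). unary u @ unary v) es)"
  have "?c es = ?c fs \<longleftrightarrow> es = fs" for es fs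
  proof (induction es arbitrary: fs)
    case Nil
    then show ?case by (cases fs) (auto simp: unary_def)
  next
    case (Cons e es)
    show ?case
    proof (cases fs)
      case Nil
      then show ?thesis by (cases e) (simp add: unary_def)
    next
      case (Cons f fs')
      then show ?thesis
        using Cons.IH[of fs'] by (cases e; cases f) (simp add: unary_append_inject)
    qed
  qed
  then show ?thesis by (simp add: graph_code_def unary_append_inject)
qed

lemma encodes_unique:
  assumes "encodes w G" "encodes w H"
  shows "G = H"
  using assms unfolding encodes_def
  by (auto simp: graph_code_inject intro: multigraph.equality)

lemma encodes_exists:
  assumes "wf_multigraph G" "verts G = {..<n}"
  shows "\<exists>w. encodes w G"
proof -
  obtain xs where xs: "mset xs = edges G"
    using ex_mset by blast
  have "\<exists>p. x = (case p of (u, v) \<Rightarrow> Upair u v)" for x :: "nat uprod"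
    by (cases x) auto
  then have "\<exists>es. xs = map (\<lambda>(u, v). Upair u v) es" for xs :: "nat uprod list"
    by (metis ex_map_conv)
  then show ?thesis
    using assms xs unfolding encodes_def by metis
qed

definition sign_code :: "rat \<Rightarrow> bool list" where
  "sign_code s = (if s = 0 then [] else [s > 0])"

definition sign_problem :: "rat \<Rightarrow> rat \<Rightarrow> problem" where
  "sign_problem \<beta> \<gamma> =
    {(w, sign_code (sgn (partition_function \<beta> \<gamma> G))) | w G. encodes w G}"

end

theory Submission
  imports Defs
begin

text \<open>
  Write \<open>N\<close> for the number of witnesses of an instance of a problem in #P and \<open>\<beta> = - p / q\<close>, where
  by symmetry \<open>\<beta> \<le> \<gamma>\<close>. For each \<open>k\<close> a NAND circuit simulating the verifier can be given a marked
  input wire \<open>s\<close> such that it has \<open>2 p N\<close> satisfying assignments with \<open>s\<close> true and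
  \<open>q (2 k + 1)\<close> with \<open>s\<close> false. Series-parallel gadgets turn the interaction \<open>A\<close> into one that is
  nearly hard: many copies of it make the correct configurations of the gates dominate the partition
  function, all with the same weight. A last edge between \<open>s\<close> and a vertex pinned to 0 weighs the
  assignments with \<open>s\<close> false by \<open>\<beta>\<close>, so the sign of the partition function is that of
  \<open>2 p N + \<beta> q (2 k + 1) = p (2 N - 2 k - 1)\<close>, and binary search over \<open>k\<close> finds \<open>N\<close>. The
  reduction is written in a small loop language that is compiled to oracle machines running in
  polynomial time.
\<close>

section \<open>Structured programs for oracle machines\<close>

text \<open>The negative entry has two opposite roles: in the gadgets that enforce the circuit its
  sign is squared away, so that wrong configurations are merely light, and it survives only in the
  last edge at \<open>s\<close>, where it produces the cancellation. Since the correct part of the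
  sum is \<open>p\<close> times an odd integer, it is at least 1 in modulus; an error of half the
  weight of one correct configuration is harmless, and a number of copies linear in the number of
  vertices makes the error that small. Correct configurations of a single NAND gadget have
  input-dependent weights, which would spoil the count; hence the companions of each gate. The
  gadgets come from the fields that pendant parts induce at a vertex: \<beta> + \<gamma> < 1 yields
  one of modulus below 1, \<beta> + \<gamma> > -2 one of modulus above 1, while at (-1, 1) the
  available operations only give 0, 1 and -1. If \<beta> = \<gamma>, spin flip is a symmetry and no
  vertex can be pinned; there the two halves of the sum agree instead. All constants depend on
  \<beta> and \<gamma> only, which keeps the reduction polynomial.\<close>

datatype prog =
    Act nat "nat \<Rightarrow> nat" int
  | Seq prog prog (infixr ";;" 60)
  | Cond nat "nat set" prog prog
  | While nat "nat set" prog
  | Ask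

fun plen :: "prog \<Rightarrow> nat" where
  "plen (Act j f d) = 1"
| "plen (a ;; b) = plen a + plen b"
| "plen (Cond j S a b) = Suc (plen a + plen b)"
| "plen (While j S a) = Suc (plen a)"
| "plen Ask = 1"

lemma plen_pos: "0 < plen p"
  by (induction p) auto

definition symbol_at :: "tape list \<Rightarrow> nat \<Rightarrow> nat" where
  "symbol_at ts j = fst (ts ! j) (snd (ts ! j))"

text \<open>\<open>t\<close> is the exact number of machine steps, one per action and one per
  evaluated test: jumps are part of the transitions and cost nothing extra.\<close>

inductive exec :: "(bool list \<Rightarrow> bool list) \<Rightarrow> prog \<Rightarrow> tape list \<Rightarrow> nat \<Rightarrow> tape list \<Rightarrow> bool"
  for Q where
  Act: "exec Q (Act j f d) ts 1 (ts[j := act (ts ! j) (f (symbol_at ts j), d)])"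
| Seq: "exec Q a ts t ts' \<Longrightarrow> exec Q b ts' t' ts'' \<Longrightarrow> exec Q (a ;; b) ts (t + t') ts''"
| CondT: "symbol_at ts j \<in> S \<Longrightarrow> exec Q a ts t ts' \<Longrightarrow> exec Q (Cond j S a b) ts (Suc t) ts'"
| CondF: "symbol_at ts j \<notin> S \<Longrightarrow> exec Q b ts t ts' \<Longrightarrow> exec Q (Cond j S a b) ts (Suc t) ts'"
| WhileT: "symbol_at ts j \<in> S \<Longrightarrow> exec Q a ts t ts' \<Longrightarrow> exec Q (While j S a) ts' t' ts''
    \<Longrightarrow> exec Q (While j S a) ts (Suc (t + t')) ts''"
| WhileF: "symbol_at ts j \<notin> S \<Longrightarrow> exec Q (While j S a) ts 1 ts"
| Ask: "exec Q Ask ts 1 (ts[1 := (word_tape (Q (tape_word (fst (ts ! 1)))), 0)])"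

lemma exec_length: "exec Q p ts t ts' \<Longrightarrow> length ts' = length ts"
  by (induction rule: exec.induct) auto

definition idle :: "nat list \<Rightarrow> (nat \<times> int) list" where
  "idle ss = map (\<lambda>s. (s, 0)) ss"

text \<open>The code of a program occupies the states \<^term>\<open>{s..<s + plen p}\<close>; control leaves it to
  state \<^term>\<open>e\<close>.\<close>

fun transition :: "prog \<Rightarrow> nat \<Rightarrow> nat \<Rightarrow> nat \<Rightarrow> nat list \<Rightarrow> nat \<times> (nat \<times> int) list" where
  "transition (Act j f d) s e q ss = (e, (idle ss)[j := (f (ss ! j), d)])"
| "transition (a ;; b) s e q ss =
    (if q < s + plen a then transition a s (s + plen a) q ss
     else transition b (s + plen a) e q ss)"
| "transition (Cond j S a b) s e q ss =
    (if q = s then (if ss ! j \<in> S then Suc s else Suc (s + plen a), idle ss)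
     else if q < Suc (s + plen a) then transition a (Suc s) e q ss
     else transition b (Suc (s + plen a)) e q ss)"
| "transition (While j S a) s e q ss =
    (if q = s then (if ss ! j \<in> S then Suc s else e, idle ss) else transition a (Suc s) s q ss)"
| "transition Ask s e q ss = (e, idle ss)"

fun prog_ok :: "nat \<Rightarrow> nat \<Rightarrow> prog \<Rightarrow> bool" where
  "prog_ok k G (Act j f d) \<longleftrightarrow> j < k \<and> (\<forall>s<G. f s < G) \<and> d \<in> {-1, 0, 1}"
| "prog_ok k G (a ;; b) \<longleftrightarrow> prog_ok k G a \<and> prog_ok k G b"
| "prog_ok k G (Cond j S a b) \<longleftrightarrow> j < k \<and> prog_ok k G a \<and> prog_ok k G b"
| "prog_ok k G (While j S a) \<longleftrightarrow> j < k \<and> prog_ok k G a"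
| "prog_ok k G Ask \<longleftrightarrow> True"

definition acts_ok :: "nat \<Rightarrow> nat \<Rightarrow> (nat \<times> int) list \<Rightarrow> bool" where
  "acts_ok k G as \<longleftrightarrow> length as = k \<and> set as \<subseteq> {..<G} \<times> {-1, 0, 1}"

lemma acts_ok_idle: "length ss = k \<Longrightarrow> set ss \<subseteq> {..<G} \<Longrightarrow> acts_ok k G (idle ss)"
  by (auto simp: acts_ok_def idle_def)

lemma transition_ok:
  assumes "prog_ok k G p" "s \<le> q" "q < s + plen p" "length ss = k" "set ss \<subseteq> {..<G}"
  shows "fst (transition p s e q ss) \<in> {s..<s + plen p} \<union> {e} \<and>
    acts_ok k G (snd (transition p s e q ss))"
  using assms
proof (induction p arbitrary: s e)
  case (Act j f d)
  have "set ((idle ss)[j := (f (ss ! j), d)]) \<subseteq> insert (f (ss ! j), d) (set (idle ss))"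
    by (rule set_update_subset_insert)
  moreover have "f (ss ! j) < G"
    using Act by (auto simp: subset_iff)
  ultimately show ?case
    using Act acts_ok_idle[of ss k G] by (auto simp: acts_ok_def)
next
  case (Seq a b)
  show ?case
  proof (cases "q < s + plen a")
    case True
    then show ?thesis
      using Seq.IH(1)[of s "s + plen a"] Seq.prems plen_pos[of b] by auto
  next
    case False
    then show ?thesis
      using Seq.IH(2)[of "s + plen a" e] Seq.prems by auto
  qed
next
  case (Cond j S a b)
  consider "q = s" | "q \<noteq> s" "q < Suc (s + plen a)" | "q \<noteq> s" "\<not> q < Suc (s + plen a)"
    by blast
  then show ?case
  proof cases
    case 1
    then show ?thesis
      using Cond.prems plen_pos[of a] plen_pos[of b] acts_ok_idle[of ss k G] by auto
  next
    case 2
    then show ?thesis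
      using Cond.IH(1)[of "Suc s" e] Cond.prems by auto
  next
    case 3
    then show ?thesis
      using Cond.IH(2)[of "Suc (s + plen a)" e] Cond.prems by auto
  qed
next
  case (While j S a)
  show ?case
  proof (cases "q = s")
    case True
    then show ?thesis
      using While.prems plen_pos[of a] acts_ok_idle[of ss k G] by auto
  next
    case False
    then show ?thesis
      using While.IH[of "Suc s" s] While.prems by auto
  qed
next
  case Ask
  then show ?case using acts_ok_idle[of ss k G] by auto
qed

text \<open>An oracle machine has a single query state. Hence a program can only be compiled if
  \<open>Ask\<close> occurs in it exactly once; \<open>ask_state\<close> then yields the query state
  and the answer state.\<close>

fun asks :: "prog \<Rightarrow> nat" where
  "asks (Act j f d) = 0"
| "asks (a ;; b) = asks a + asks b"
| "asks (Cond j S a b) = asks a + asks b"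
| "asks (While j S a) = asks a"
| "asks Ask = 1"

fun ask_state :: "prog \<Rightarrow> nat \<Rightarrow> nat \<Rightarrow> nat \<times> nat" where
  "ask_state (Act j f d) s e = (s, e)"
| "ask_state (a ;; b) s e =
    (if asks a = 1 then ask_state a s (s + plen a) else ask_state b (s + plen a) e)"
| "ask_state (Cond j S a b) s e =
    (if asks a = 1 then ask_state a (Suc s) e else ask_state b (Suc (s + plen a)) e)"
| "ask_state (While j S a) s e = ask_state a (Suc s) s"
| "ask_state Ask s e = (s, e)"

lemma ask_state_range:
  "asks p = 1 \<Longrightarrow> fst (ask_state p s e) \<in> {s..<s + plen p} \<and>
    snd (ask_state p s e) \<in> {s..<s + plen p} \<union> {e}"
proof (induction p arbitrary: s e)
  case (Seq a b)
  show ?case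
    using Seq.IH(1)[of s "s + plen a"] Seq.IH(2)[of "s + plen a" e] Seq.prems plen_pos[of b]
    by (auto split: if_splits)
next
  case (Cond j S a b)
  show ?case
    using Cond.IH(1)[of "Suc s" e] Cond.IH(2)[of "Suc (s + plen a)" e] Cond.prems
    by (auto split: if_splits)
next
  case (While j S a)
  show ?case
    using While.IH[of "Suc s" s] While.prems by auto
qed auto

text \<open>\<open>ostep\<close> overrides \<open>delta\<close> in the query state \<open>u\<close>,
  so no instruction but \<open>Ask\<close> may start there. Stating this along the structure of the
  program lets it pass to subprograms in an induction over executions.\<close>

fun ask_ok :: "nat \<Rightarrow> nat \<Rightarrow> prog \<Rightarrow> nat \<Rightarrow> nat \<Rightarrow> bool" where
  "ask_ok u v (Act j f d) s e \<longleftrightarrow> u \<noteq> s"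
| "ask_ok u v (a ;; b) s e \<longleftrightarrow> ask_ok u v a s (s + plen a) \<and> ask_ok u v b (s + plen a) e"
| "ask_ok u v (Cond j S a b) s e \<longleftrightarrow>
    u \<noteq> s \<and> ask_ok u v a (Suc s) e \<and> ask_ok u v b (Suc (s + plen a)) e"
| "ask_ok u v (While j S a) s e \<longleftrightarrow> u \<noteq> s \<and> ask_ok u v a (Suc s) s"
| "ask_ok u v Ask s e \<longleftrightarrow> u = s \<and> v = e"

lemma ask_ok_none: "asks p = 0 \<Longrightarrow> u \<notin> {s..<s + plen p} \<Longrightarrow> ask_ok u v p s e"
  by (induction p arbitrary: s e) (use plen_pos in auto)

lemma ask_ok_ask_state:
  "asks p = 1 \<Longrightarrow> ask_ok (fst (ask_state p s e)) (snd (ask_state p s e)) p s e"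
proof (induction p arbitrary: s e)
  case (Seq a b)
  show ?case
  proof (cases "asks a = 1")
    case True
    then have "asks b = 0" using Seq.prems by simp
    then show ?thesis
      using True Seq.IH(1)[of s "s + plen a"] ask_state_range[of a s "s + plen a"]
      by (auto intro!: ask_ok_none)
  next
    case False
    then have "asks a = 0" "asks b = 1" using Seq.prems by auto
    then show ?thesis
      using False Seq.IH(2)[of "s + plen a" e] ask_state_range[of b "s + plen a" e]
      by (auto intro!: ask_ok_none)
  qed
next
  case (Cond j S a b)
  show ?case
  proof (cases "asks a = 1")
    case True
    then have "asks b = 0" using Cond.prems by simp
    then show ?thesis
      using True Cond.IH(1)[of "Suc s" e] ask_state_range[of a "Suc s" e]
      by (auto intro!: ask_ok_none)
  next
    case False
    then have "asks a = 0" "asks b = 1" using Cond.prems by auto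
    then show ?thesis
      using False Cond.IH(2)[of "Suc (s + plen a)" e] ask_state_range[of b "Suc (s + plen a)" e]
      by (auto intro!: ask_ok_none)
  qed
next
  case (While j S a)
  then show ?case
    using While.IH[of "Suc s" s] ask_state_range[of a "Suc s" s] by auto
qed auto

section \<open>Executions of programs as runs of machines containing their code\<close>

definition embeds :: "otm \<Rightarrow> prog \<Rightarrow> nat \<Rightarrow> nat \<Rightarrow> bool" where
  "embeds M p s e \<longleftrightarrow>
    (\<forall>q ss. s \<le> q \<and> q < s + plen p \<longrightarrow> delta M q ss = transition p s e q ss) \<and>
    halt M \<notin> {s..<s + plen p} \<and> ask_ok (query M) (answer M) p s e"

lemma map2_act_idle: "map2 act ts (idle (map (\<lambda>(c, h). c h) ts)) = ts"
  by (rule nth_equalityI) (auto simp: idle_def act_def split: prod.splits)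

lemma map2_act_idle_update:
  assumes "j < length ts"
  shows "map2 act ts ((idle (map (\<lambda>(c, h). c h) ts))[j := a]) = ts[j := act (ts ! j) a]"
proof (rule nth_equalityI)
  fix i assume "i < length (map2 act ts ((idle (map (\<lambda>(c, h). c h) ts))[j := a]))"
  then have "i < length ts" by (simp add: idle_def)
  then show "map2 act ts ((idle (map (\<lambda>(c, h). c h) ts))[j := a]) ! i = ts[j := act (ts ! j) a] ! i"
    by (cases "i = j") (auto simp: idle_def act_def nth_list_update split: prod.splits)
qed (simp add: idle_def)

lemma ostep_transition:
  assumes "q \<noteq> halt M" "q \<noteq> query M"
    and "delta M q (map (\<lambda>(c, h). c h) ts) = (q', as)"
  shows "ostep Q M (q, ts) = (q', map2 act ts as)"
  using assms by (simp add: ostep_def step_def)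

lemma embeds_SeqD:
  assumes "embeds M (a ;; b) s e"
  shows "embeds M a s (s + plen a)" "embeds M b (s + plen a) e"
  using assms plen_pos[of a] plen_pos[of b] unfolding embeds_def by auto

lemma embeds_CondD:
  assumes "embeds M (Cond j S a b) s e"
  shows "embeds M a (Suc s) e" "embeds M b (Suc (s + plen a)) e"
  using assms unfolding embeds_def by auto

lemma embeds_WhileD:
  assumes "embeds M (While j S a) s e"
  shows "embeds M a (Suc s) s"
  using assms unfolding embeds_def by auto

text \<open>Start and exit state have to vary in the induction: the body of a loop is placed with
  the test state of the loop as its exit, so after one iteration the machine is where the remaining
  loop starts.\<close>

lemma exec_ostep:
  assumes "exec Q p ts t ts'" "embeds M p s e" "prog_ok (length ts) G p"
  shows "(ostep Q M ^^ t) (s, ts) = (e, ts')"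
  using assms
proof (induction arbitrary: s e rule: exec.induct)
  case (Act j f d ts)
  have "delta M s (map (\<lambda>(c, h). c h) ts) =
      (e, (idle (map (\<lambda>(c, h). c h) ts))[j := (f (symbol_at ts j), d)])"
    using Act by (simp add: embeds_def symbol_at_def case_prod_beta)
  then have "ostep Q M (s, ts) =
      (e, map2 act ts ((idle (map (\<lambda>(c, h). c h) ts))[j := (f (symbol_at ts j), d)]))"
    using Act by (intro ostep_transition) (auto simp: embeds_def)
  then show ?case
    using Act by (simp only: map2_act_idle_update prog_ok.simps) simp
next
  case (Seq a ts t ts' b t' ts'')
  have "(ostep Q M ^^ t) (s, ts) = (s + plen a, ts')"
    using Seq embeds_SeqD by auto
  moreover have "(ostep Q M ^^ t') (s + plen a, ts') = (e, ts'')"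
    using Seq embeds_SeqD exec_length[OF Seq.hyps(1)] by auto
  ultimately show ?case
    by (simp add: add.commute[of t] funpow_add)
next
  case (CondT ts j S a t ts' b)
  have "delta M s (map (\<lambda>(c, h). c h) ts) = (Suc s, idle (map (\<lambda>(c, h). c h) ts))"
    using CondT by (simp add: embeds_def symbol_at_def case_prod_beta)
  then have "ostep Q M (s, ts) = (Suc s, ts)"
    using CondT by (subst ostep_transition) (auto simp: embeds_def map2_act_idle)
  moreover have "(ostep Q M ^^ t) (Suc s, ts) = (e, ts')"
    using CondT embeds_CondD by auto
  ultimately show ?case
    by (simp add: funpow_Suc_right del: funpow.simps)
next
  case (CondF ts j S b t ts' a)
  have "delta M s (map (\<lambda>(c, h). c h) ts) = (Suc (s + plen a), idle (map (\<lambda>(c, h). c h) ts))"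
    using CondF by (simp add: embeds_def symbol_at_def case_prod_beta)
  then have "ostep Q M (s, ts) = (Suc (s + plen a), ts)"
    using CondF by (subst ostep_transition) (auto simp: embeds_def map2_act_idle)
  moreover have "(ostep Q M ^^ t) (Suc (s + plen a), ts) = (e, ts')"
    using CondF embeds_CondD by auto
  ultimately show ?case
    by (simp add: funpow_Suc_right del: funpow.simps)
next
  case (WhileT ts j S a t ts' t' ts'')
  have "delta M s (map (\<lambda>(c, h). c h) ts) = (Suc s, idle (map (\<lambda>(c, h). c h) ts))"
    using WhileT by (simp add: embeds_def symbol_at_def case_prod_beta)
  then have 1: "ostep Q M (s, ts) = (Suc s, ts)"
    using WhileT by (subst ostep_transition) (auto simp: embeds_def map2_act_idle)
  have 2: "(ostep Q M ^^ t) (Suc s, ts) = (s, ts')"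
    using WhileT embeds_WhileD by auto
  have 3: "(ostep Q M ^^ t') (s, ts') = (e, ts'')"
    using WhileT exec_length[OF WhileT.hyps(2)] by auto
  have "(ostep Q M ^^ Suc (t + t')) (s, ts) = (ostep Q M ^^ t') ((ostep Q M ^^ t) (ostep Q M (s, ts)))"
    by (simp add: add.commute[of t] funpow_add funpow_Suc_right del: funpow.simps)
  then show ?case
    using 1 2 3 by simp
next
  case (WhileF ts j S a)
  have "delta M s (map (\<lambda>(c, h). c h) ts) = (e, idle (map (\<lambda>(c, h). c h) ts))"
    using WhileF by (simp add: embeds_def symbol_at_def case_prod_beta)
  then have "ostep Q M (s, ts) = (e, ts)"
    using WhileF by (subst ostep_transition) (auto simp: embeds_def map2_act_idle)
  then show ?case by simp
next
  case (Ask ts)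
  then show ?case by (simp add: embeds_def ostep_def)
qed

definition machine :: "nat \<Rightarrow> nat \<Rightarrow> prog \<Rightarrow> otm" where
  "machine k G p = \<lparr>num_tapes = k, num_symbols = G, num_states = Suc (plen p),
    start = 0, halt = plen p,
    delta = (\<lambda>q ss. if q < plen p then transition p 0 (plen p) q ss else (plen p, idle ss)),
    query = fst (ask_state p 0 (plen p)), answer = snd (ask_state p 0 (plen p))\<rparr>"

lemma wf_machine:
  assumes "2 \<le> k" "3 \<le> G" "prog_ok k G p" "asks p = 1"
  shows "wf_otm (machine k G p)"
proof -
  have "case delta (machine k G p) q ss of (q', as) \<Rightarrow>
      q' < Suc (plen p) \<and> length as = k \<and> set as \<subseteq> {..<G} \<times> {-1, 0, 1}"
    if "length ss = k" "set ss \<subseteq> {..<G}" for q ss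
    using transition_ok[OF assms(3), of 0 q ss "plen p"] acts_ok_idle[of ss k G] that
    by (auto simp: machine_def acts_ok_def split: prod.splits)
  then show ?thesis
    using assms ask_state_range[of p 0 "plen p"]
    by (auto simp: wf_otm_def wf_tm_def machine_def)
qed

text \<open>The halting state differs from the query state and is therefore a fixed point of
  \<open>ostep\<close>; a run of \<open>t\<close> steps can be padded to any larger bound.\<close>

lemma machine_halts:
  assumes "exec Q p (snd (init (machine k G p) x)) t ts'" "t \<le> n" "1 \<le> k"
    and "prog_ok k G p" "asks p = 1"
  shows "(ostep Q (machine k G p) ^^ n) (init (machine k G p) x) = (plen p, ts')"
proof -
  let ?M = "machine k G p"
  have "embeds ?M p 0 (plen p)"
    using ask_ok_ask_state[OF assms(5)] by (auto simp: embeds_def machine_def)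
  moreover have "init ?M x = (0, snd (init ?M x))"
    by (simp add: init_def machine_def)
  moreover have "length (snd (init ?M x)) = k"
    using assms(3) by (simp add: init_def machine_def)
  ultimately have run: "(ostep Q ?M ^^ t) (init ?M x) = (plen p, ts')"
    using exec_ostep[OF assms(1)] assms(4) by metis
  have "ostep Q ?M (plen p, ts') = (plen p, ts')"
    using ask_state_range[OF assms(5), of 0 "plen p"]
    by (auto simp: ostep_def step_def machine_def)
  then have fix1: "(ostep Q ?M ^^ i) (plen p, ts') = (plen p, ts')" for i
    by (induction i) auto
  have "n = (n - t) + t" using assms(2) by simp
  then have "(ostep Q ?M ^^ n) (init ?M x) = (ostep Q ?M ^^ (n - t)) ((ostep Q ?M ^^ t) (init ?M x))"
    by (metis comp_apply funpow_add)
  then show ?thesis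
    by (simp add: run fix1)
qed

text \<open>Exact times depend on the tape contents. Polynomial bounds only need upper estimates,
  which compose along the program.\<close>

definition runs :: "(bool list \<Rightarrow> bool list) \<Rightarrow> prog \<Rightarrow> tape list \<Rightarrow> nat \<Rightarrow> tape list \<Rightarrow> bool" where
  "runs Q p ts T ts' \<longleftrightarrow> (\<exists>t\<le>T. exec Q p ts t ts')"

lemma runs_mono: "runs Q p ts T ts' \<Longrightarrow> T \<le> T' \<Longrightarrow> runs Q p ts T' ts'"
  unfolding runs_def using le_trans by blast

lemma runs_Seq:
  assumes "runs Q a ts T ts'" "runs Q b ts' T' ts''"
  shows "runs Q (a ;; b) ts (T + T') ts''"
proof -
  obtain t t' where "t \<le> T" "exec Q a ts t ts'" "t' \<le> T'" "exec Q b ts' t' ts''"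
    using assms unfolding runs_def by blast
  then show ?thesis
    unfolding runs_def by (intro exI[of _ "t + t'"]) (auto intro: exec.Seq)
qed

lemma runs_Cond:
  assumes "symbol_at ts j \<in> S \<Longrightarrow> runs Q a ts T ts'" "symbol_at ts j \<notin> S \<Longrightarrow> runs Q b ts T ts'"
  shows "runs Q (Cond j S a b) ts (Suc T) ts'"
proof (cases "symbol_at ts j \<in> S")
  case True
  then obtain t where "t \<le> T" "exec Q a ts t ts'"
    using assms unfolding runs_def by blast
  then show ?thesis
    unfolding runs_def using True by (intro exI[of _ "Suc t"]) (auto intro: exec.CondT)
next
  case False
  then obtain t where "t \<le> T" "exec Q b ts t ts'"
    using assms unfolding runs_def by blast
  then show ?thesis
    unfolding runs_def using False by (intro exI[of _ "Suc t"]) (auto intro: exec.CondF)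
qed

lemma runs_While:
  assumes "\<And>i. i < n \<Longrightarrow> symbol_at (X i) j \<in> S" "symbol_at (X n) j \<notin> S"
    and "\<And>i. i < n \<Longrightarrow> runs Q p (X i) T (X (Suc i))"
  shows "runs Q (While j S p) (X 0) (n * Suc T + 1) (X n)"
proof -
  \<comment> \<open>Induction on the number \<open>k\<close> of iterations still to come, since
    \<open>WhileT\<close> splits off the first of them.\<close>
  have "k \<le> n \<Longrightarrow> runs Q (While j S p) (X (n - k)) (k * Suc T + 1) (X n)" for k
  proof (induction k)
    case 0
    then show ?case
      unfolding runs_def using exec.WhileF[OF assms(2)] by (intro exI[of _ 1]) auto
  next
    case (Suc k)
    have n: "n - Suc k < n" "Suc (n - Suc k) = n - k"
      using Suc.prems by auto
    obtain t where t: "t \<le> T" "exec Q p (X (n - Suc k)) t (X (n - k))"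
      using assms(3)[OF n(1)] n(2) unfolding runs_def by auto
    obtain t' where t': "t' \<le> k * Suc T + 1" "exec Q (While j S p) (X (n - k)) t' (X n)"
      using Suc unfolding runs_def by auto
    show ?case
      unfolding runs_def using t t' exec.WhileT[OF assms(1)[OF n(1)] t(2) t'(2)]
      by (intro exI[of _ "Suc (t + t')"]) auto
  qed
  from this[of n] show ?thesis by simp
qed

section \<open>Registers as head positions\<close>

text \<open>A register is a tape marked at cell 0 whose value is the position of the head.
  Incrementing and decrementing are head moves, and the test for zero is the test for the mark;
  nothing has to be written.\<close>

definition mark :: "int \<Rightarrow> nat" where
  "mark i = (if i = 0 then 1 else 0)"

definition tps :: "nat \<Rightarrow> tape \<Rightarrow> tape \<Rightarrow> tape \<Rightarrow> (nat \<Rightarrow> nat) \<Rightarrow> tape list" where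
  "tps R A B C env = A # B # C # map (\<lambda>j. (mark, int (env j))) [0..<R]"

lemma tps_nth [simp]:
  "tps R A B C env ! 0 = A" "tps R A B C env ! Suc 0 = B" "tps R A B C env ! 2 = C"
  by (auto simp: tps_def numeral_2_eq_2)

lemma tps_nth_reg [simp]: "j < R \<Longrightarrow> tps R A B C env ! (3 + j) = (mark, int (env j))"
  by (auto simp: tps_def numeral_3_eq_3)

lemma tps_update [simp]:
  "(tps R A B C env)[0 := X] = tps R X B C env"
  "(tps R A B C env)[Suc 0 := X] = tps R A X C env"
  "(tps R A B C env)[2 := X] = tps R A B X env"
  by (auto simp: tps_def numeral_2_eq_2)

lemma tps_update_reg:
  "j < R \<Longrightarrow> (tps R A B C env)[3 + j := (mark, int v)] = tps R A B C (env(j := v))"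
  by (auto simp: tps_def numeral_3_eq_3 nth_list_update intro!: nth_equalityI)

lemma symbol_at_tps [simp]:
  "symbol_at (tps R A B C env) 0 = fst A (snd A)"
  "symbol_at (tps R A B C env) (Suc 0) = fst B (snd B)"
  "symbol_at (tps R A B C env) 2 = fst C (snd C)"
  "j < R \<Longrightarrow> symbol_at (tps R A B C env) (3 + j) = mark (int (env j))"
  by (auto simp: symbol_at_def)

definition inc :: "nat \<Rightarrow> prog" where "inc j = Act (3 + j) id 1"
definition dec :: "nat \<Rightarrow> prog" where "dec j = Act (3 + j) id (-1)"
definition skip :: prog where "skip = Act 0 id 0"
definition loop :: "nat \<Rightarrow> prog \<Rightarrow> prog" where "loop j p = While (3 + j) {0} p"

lemma runs_Act: "ts' = ts[j := act (ts ! j) (f (symbol_at ts j), d)] \<Longrightarrow> runs Q (Act j f d) ts (Suc 0) ts'"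
  using exec.Act[of Q j f d ts]
  unfolding runs_def by auto

lemma runs_inc:
  assumes "j < R" "env' = env(j := Suc (env j))"
  shows "runs Q (inc j) (tps R A B C env) (Suc 0) (tps R A B C env')"
  unfolding inc_def
proof (rule runs_Act)
  have "act (mark, int (env j)) (mark (int (env j)), 1) = (mark, int (Suc (env j)))"
    by (simp add: act_def)
  then show "tps R A B C env' =
      (tps R A B C env)[3 + j := act (tps R A B C env ! (3 + j)) (id (symbol_at (tps R A B C env) (3 + j)), 1)]"
    using assms by (simp add: tps_update_reg del: of_nat_Suc)
qed

lemma runs_dec:
  assumes "j < R" "0 < env j" "env' = env(j := env j - 1)"
  shows "runs Q (dec j) (tps R A B C env) (Suc 0) (tps R A B C env')"
  unfolding dec_def
proof (rule runs_Act)
  obtain n where n: "env j = Suc n"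
    using assms(2) gr0_implies_Suc by blast
  have "act (mark, int (Suc n)) (mark (int (Suc n)), -1) = (mark, int n)"
    by (simp add: act_def)
  then show "tps R A B C env' =
      (tps R A B C env)[3 + j := act (tps R A B C env ! (3 + j)) (id (symbol_at (tps R A B C env) (3 + j)), -1)]"
    using assms n by (simp add: tps_update_reg del: of_nat_Suc)
qed

lemma runs_skip: "runs Q skip (tps R A B C env) (Suc 0) (tps R A B C env)"
  unfolding skip_def by (rule runs_Act) (cases A, simp add: act_def)

lemma runs_loop:
  assumes "j < R" "\<And>i. i \<le> n \<Longrightarrow> E i j = n - i"
    and "\<And>i. i < n \<Longrightarrow> runs Q p (tps R (A i) (B i) (C i) (E i)) T
      (tps R (A (Suc i)) (B (Suc i)) (C (Suc i)) (E (Suc i)))"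
    and "ts = tps R (A 0) (B 0) (C 0) (E 0)" "ts' = tps R (A n) (B n) (C n) (E n)"
  shows "runs Q (loop j p) ts (n * Suc T + 1) ts'"
  unfolding loop_def assms(4,5)
  using assms(1-3)
  by (intro runs_While[of n "\<lambda>i. tps R (A i) (B i) (C i) (E i)"]) (auto simp: mark_def)

lemma runs_clear:
  assumes "j < R"
  shows "runs Q (loop j (dec j)) (tps R A B C env) (env j * 2 + 1) (tps R A B C (env(j := 0)))"
proof -
  have "runs Q (loop j (dec j)) (tps R A B C env) (env j * Suc (Suc 0) + 1) (tps R A B C (env(j := 0)))"
    using assms
    by (intro runs_loop[of j R "env j" "\<lambda>i. env(j := env j - i)" Q _ "\<lambda>_. A" "\<lambda>_. B" "\<lambda>_. C"])
      (auto intro!: runs_dec simp: fun_eq_iff)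
  then show ?thesis by (rule runs_mono) simp
qed

definition word_idx :: "bool \<Rightarrow> nat" where "word_idx b = (if b then 2 else 0)"

lemma runs_word_act:
  assumes "A' = (if b then (c0, h0) else act (c0, h0) (f (c0 h0), d))"
    and "C' = (if b then act (c2, h2) (f (c2 h2), d) else (c2, h2))"
  shows "runs Q (Act (word_idx b) f d) (tps R (c0, h0) B (c2, h2) env) (Suc 0) (tps R A' B C' env)"
  using assms by (intro runs_Act) (auto simp: word_idx_def)

text \<open>A loop consumes its counter. While the head moves out, the index is therefore
  transferred from register \<open>k\<close> to \<open>Suc k\<close>, and \<open>goback_cell\<close>
  counts that copy down on the way back.\<close>

definition goto_cell :: "bool \<Rightarrow> nat \<Rightarrow> prog" where
  "goto_cell b k = loop k (dec k ;; inc (Suc k) ;; Act (word_idx b) id 1)"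
definition goback_cell :: "bool \<Rightarrow> nat \<Rightarrow> prog" where
  "goback_cell b k = loop k (dec k ;; Act (word_idx b) id (-1))"

lemma runs_goto_cell:
  assumes "Suc k < R" "env (Suc k) = 0"
  shows "runs Q (goto_cell b k) (tps R (c0, 0) B (c2, 0) env) (env k * 4 + 1)
    (tps R (c0, if b then 0 else int (env k)) B (c2, if b then int (env k) else 0)
      (env(k := 0, Suc k := env k)))"
proof -
  have "runs Q (goto_cell b k) (tps R (c0, 0) B (c2, 0) env) (env k * Suc (Suc 0 + (Suc 0 + Suc 0)) + 1)
    (tps R (c0, if b then 0 else int (env k)) B (c2, if b then int (env k) else 0)
      (env(k := 0, Suc k := env k)))"
    unfolding goto_cell_def
  proof (rule runs_loop[of k R "env k" "\<lambda>i. env(k := env k - i, Suc k := i)" Q _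
        "\<lambda>i. (c0, if b then 0 else int i)" "\<lambda>_. B" "\<lambda>i. (c2, if b then int i else 0)"], goal_cases)
    case (3 i)
    show ?case
      apply (rule runs_Seq[OF runs_dec[OF _ _ refl] runs_Seq[OF runs_inc[OF _ refl]]])
         prefer 4
      apply (rule back_subst[of "\<lambda>x. runs _ _ _ _ (tps _ _ _ _ x)"])
          apply (rule runs_word_act)
      using 3 assms by (auto simp: act_def fun_eq_iff)
  qed (use assms in \<open>auto simp: fun_eq_iff intro!: arg_cong[of _ _ "tps _ _ _ _"]\<close>)
  then show ?thesis by (rule runs_mono) simp
qed

lemma runs_goback_cell:
  assumes "k < R"
  shows "runs Q (goback_cell b k)
    (tps R (c0, if b then 0 else int (env k)) B (c2, if b then int (env k) else 0) env)
    (env k * 3 + 1) (tps R (c0, 0) B (c2, 0) (env(k := 0)))"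
proof -
  have "runs Q (goback_cell b k)
    (tps R (c0, if b then 0 else int (env k)) B (c2, if b then int (env k) else 0) env)
    (env k * Suc (Suc 0 + Suc 0) + 1) (tps R (c0, 0) B (c2, 0) (env(k := 0)))"
    unfolding goback_cell_def
  proof (rule runs_loop[of k R "env k" "\<lambda>i. env(k := env k - i)" Q _
        "\<lambda>i. (c0, if b then 0 else int (env k - i))" "\<lambda>_. B" "\<lambda>i. (c2, if b then int (env k - i) else 0)"],
        goal_cases)
    case (3 i)
    show ?case
      apply (rule runs_Seq[OF runs_dec[OF _ _ refl]])
        prefer 3
      apply (rule back_subst[of "\<lambda>x. runs _ _ _ _ (tps _ _ _ _ x)"])
         apply (rule runs_word_act)
      using 3 assms by (auto simp: act_def fun_eq_iff)
  qed (use assms in \<open>auto simp: fun_eq_iff\<close>)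
  then show ?thesis by (rule runs_mono) simp
qed

section \<open>A loop language and its compilation\<close>

text \<open>Every operation keeps values polynomially bounded in the variables. As loops run for the
  value of an expression computed beforehand, each program obtains a polynomial time bound by
  recursion over its syntax.\<close>

datatype expr =
    Cst nat | Var nat | Add expr expr | Mul expr expr | IsZero expr | Bit bool expr | Reply

type_synonym store = "(int \<Rightarrow> nat) \<times> bool list \<times> bool list \<times> (int \<Rightarrow> nat)"

text \<open>In a store \<open>(c0, v, w, c2)\<close> tapes 0 and 2 hold \<open>c0\<close> and \<open>c2\<close> with the head on cell 0, and
  tape 1 holds the last oracle answer \<open>v\<close>, overwritten by the word \<open>w\<close> whose end is under the
  head.\<close>

definition over_tape :: "bool list \<Rightarrow> bool list \<Rightarrow> int \<Rightarrow> nat" where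
  "over_tape v w i =
    (if 0 \<le> i \<and> i < int (length w) then (if w ! nat i then 2 else 1) else word_tape v i)"

definition tapes :: "nat \<Rightarrow> (nat \<Rightarrow> nat) \<Rightarrow> store \<Rightarrow> tape list" where
  "tapes R env = (\<lambda>(c0, v, w, c2).
    tps R (c0, 0) (over_tape v w, int (length w)) (c2, 0) env)"

fun val :: "expr \<Rightarrow> (nat \<Rightarrow> nat) \<Rightarrow> store \<Rightarrow> nat" where
  "val (Cst n) env st = n"
| "val (Var v) env st = env v"
| "val (Add e f) env st = val e env st + val f env st"
| "val (Mul e f) env st = val e env st * val f env st"
| "val (IsZero e) env st = of_bool (val e env st = 0)"
| "val (Bit b e) env st = (case st of (c0, v, w, c2) \<Rightarrow>
    of_bool ((if b then c2 else c0) (int (val e env st)) = 2))"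
| "val Reply env st = (case st of (c0, v, w, c2) \<Rightarrow> of_bool (over_tape v w (int (length w)) = 2))"

fun wf_expr :: "nat \<Rightarrow> expr \<Rightarrow> bool" where
  "wf_expr d (Cst n) \<longleftrightarrow> True"
| "wf_expr d (Var v) \<longleftrightarrow> v < d"
| "wf_expr d (Add e f) \<longleftrightarrow> wf_expr d e \<and> wf_expr d f"
| "wf_expr d (Mul e f) \<longleftrightarrow> wf_expr d e \<and> wf_expr d f"
| "wf_expr d (IsZero e) \<longleftrightarrow> wf_expr d e"
| "wf_expr d (Bit b e) \<longleftrightarrow> wf_expr d e"
| "wf_expr d Reply \<longleftrightarrow> True"

text \<open>The argument of this polynomial, and of those giving running times below, is a common
  bound on all variables.\<close>

fun val_bound :: "expr \<Rightarrow> nat poly" where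
  "val_bound (Cst n) = [:n:]"
| "val_bound (Var v) = [:0, 1:]"
| "val_bound (Add e f) = val_bound e + val_bound f"
| "val_bound (Mul e f) = val_bound e * val_bound f"
| "val_bound (IsZero e) = 1"
| "val_bound (Bit b e) = 1"
| "val_bound Reply = 1"

fun expr_time :: "expr \<Rightarrow> nat poly" where
  "expr_time (Cst n) = [:Suc n:]"
| "expr_time (Var v) = [:2, 7:]"
| "expr_time (Add e f) = expr_time e + expr_time f"
| "expr_time (Mul e f) = expr_time e + (val_bound e * (expr_time f + 2) + 1)"
| "expr_time (IsZero e) = expr_time e + (2 + (val_bound e * 2 + 1))"
| "expr_time (Bit b e) = expr_time e + ((val_bound e * 4 + 1) + (2 + (val_bound e * 3 + 1)))"
| "expr_time Reply = 2"

fun expr_regs :: "expr \<Rightarrow> nat" where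
  "expr_regs (Cst n) = 0"
| "expr_regs (Var v) = 1"
| "expr_regs (Add e f) = max (expr_regs e) (expr_regs f)"
| "expr_regs (Mul e f) = Suc (max (expr_regs e) (expr_regs f))"
| "expr_regs (IsZero e) = Suc (expr_regs e)"
| "expr_regs (Bit b e) = Suc (Suc (expr_regs e))"
| "expr_regs Reply = 0"

text \<open>The compiled expression adds its value to register \<open>a\<close>, using registers from \<open>k\<close> on as
  scratch space.\<close>

fun comp_expr :: "expr \<Rightarrow> nat \<Rightarrow> nat \<Rightarrow> prog" where
  "comp_expr (Cst n) a k = ((\<lambda>p. inc a ;; p) ^^ n) skip"
| "comp_expr (Var v) a k = loop v (dec v ;; inc a ;; inc k) ;; loop k (dec k ;; inc v)"
| "comp_expr (Add e f) a k = comp_expr e a k ;; comp_expr f a k"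
| "comp_expr (Mul e f) a k =
    comp_expr e k (Suc k) ;; loop k (dec k ;; comp_expr f a (Suc k))"
| "comp_expr (IsZero e) a k =
    comp_expr e k (Suc k) ;; Cond (3 + k) {1} (inc a) skip ;; loop k (dec k)"
| "comp_expr (Bit b e) a k =
    comp_expr e k (Suc k) ;; goto_cell b k ;; Cond (word_idx b) {2} (inc a) skip ;;
    goback_cell b (Suc k)"
| "comp_expr Reply a k = Cond 1 {2} (inc a) skip"

lemma val_cong: "wf_expr d e \<Longrightarrow> (\<And>v. v < d \<Longrightarrow> env v = env' v) \<Longrightarrow> val e env st = val e env' st"
  by (induction e) (auto split: prod.splits)

lemma val_bound: "wf_expr d e \<Longrightarrow> (\<And>v. v < d \<Longrightarrow> env v \<le> S) \<Longrightarrow> val e env st \<le> poly (val_bound e) S"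
  by (induction e) (auto split: prod.splits intro: add_le_mono mult_le_mono)

text \<open>Accumulating into \<open>a\<close> rather than assigning makes a sum a mere sequence of
  two programs and a product a repetition of the second factor. The scratch registers are 0 again at
  the end, so subexpressions can share them.\<close>

lemma runs_comp_expr:
  assumes "wf_expr d e" "d \<le> a" "a < k" "k + expr_regs e \<le> R"
    and "\<And>v. k \<le> v \<Longrightarrow> env v = 0" "\<And>v. v < d \<Longrightarrow> env v \<le> S"
  shows "runs Q (comp_expr e a k) (tapes R env st) (poly (expr_time e) S)
    (tapes R (env(a := env a + val e env st)) st)"
  using assms
proof (induction e arbitrary: a k env)
  case (Cst n)
  have "runs Q (((\<lambda>p. inc a ;; p) ^^ n) skip) (tapes R env st) (Suc n)
      (tapes R (env(a := env a + n)) st)" for env :: "nat \<Rightarrow> nat"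
  proof (induction n arbitrary: env)
    case 0
    then show ?case by (cases st) (auto simp: tapes_def intro: runs_skip)
  next
    case (Suc n)
    have 1: "runs Q (inc a) (tapes R env st) (Suc 0) (tapes R (env(a := Suc (env a))) st)"
      using Cst.prems by (cases st) (auto simp: tapes_def intro!: runs_inc)
    have eq: "(env(a := Suc (env a)))(a := (env(a := Suc (env a))) a + n) = env(a := env a + Suc n)"
      by (simp add: fun_eq_iff)
    show ?case
      using runs_Seq[OF 1 Suc[of "env(a := Suc (env a))"]] unfolding eq by simp
  qed
  from this[of env] show ?case by (simp del: fun_upd_apply)
next
  case (Var v)
  obtain c0 u w c2 where st: "st = (c0, u, w, c2)" by (cases st)
  have tp: "tapes R E st = tps R (c0, 0) (over_tape u w, int (length w)) (c2, 0) E" for E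
    by (simp add: st tapes_def)
  let ?n = "env v"
  let ?A = "(c0, 0)" and ?B = "(over_tape u w, int (length w))" and ?C = "(c2, 0)"
  have ne: "v \<noteq> a" "v \<noteq> k" "a \<noteq> k" "v < R" "a < R" "k < R" "env k = 0" "?n \<le> S"
    using Var.prems by auto
  \<comment> \<open>Reading a register empties it: the first loop moves \<open>v\<close> to
    \<open>a\<close> and to the scratch register \<open>k\<close>, the second one restores
    \<open>v\<close> from \<open>k\<close>.\<close>
  have 1: "runs Q (loop v (dec v ;; inc a ;; inc k)) (tps R ?A ?B ?C env) (?n * Suc (Suc 0 + (Suc 0 + Suc 0)) + 1)
      (tps R ?A ?B ?C (env(v := 0, a := env a + ?n, k := ?n)))"
  proof (rule runs_loop[of v R ?n "\<lambda>i. env(v := ?n - i, a := env a + i, k := i)" Q _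
        "\<lambda>_. ?A" "\<lambda>_. ?B" "\<lambda>_. ?C"], goal_cases)
    case (3 i)
    show ?case
      apply (rule runs_Seq[OF runs_dec[OF _ _ refl] runs_Seq[OF runs_inc[OF _ refl] runs_inc]])
      using ne 3 by (auto simp: fun_eq_iff)
  qed (use ne in \<open>auto simp: fun_eq_iff intro!: arg_cong[of _ _ "tps _ _ _ _"]\<close>)
  have 2: "runs Q (loop k (dec k ;; inc v))
      (tps R ?A ?B ?C (env(v := 0, a := env a + ?n, k := ?n))) (?n * Suc (Suc 0 + Suc 0) + 1)
      (tps R ?A ?B ?C (env(a := env a + ?n)))"
  proof (rule runs_loop[of k R ?n "\<lambda>i. env(v := i, a := env a + ?n, k := ?n - i)" Q _
        "\<lambda>_. ?A" "\<lambda>_. ?B" "\<lambda>_. ?C"], goal_cases)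
    case (3 i)
    show ?case
      apply (rule runs_Seq[OF runs_dec[OF _ _ refl] runs_inc])
      using ne 3 by (auto simp: fun_eq_iff)
  qed (use ne in \<open>auto simp: fun_eq_iff intro!: arg_cong[of _ _ "tps _ _ _ _"]\<close>)
  show ?case
    using runs_Seq[OF 1 2] ne by (auto simp: st tapes_def simp del: fun_upd_apply elim!: runs_mono)
next
  case (Add e f)
  let ?E = "env(a := env a + val e env st)"
  have 1: "runs Q (comp_expr e a k) (tapes R env st) (poly (expr_time e) S) (tapes R ?E st)"
    using Add.prems by (intro Add.IH(1)) auto
  have 2: "runs Q (comp_expr f a k) (tapes R ?E st) (poly (expr_time f) S)
      (tapes R (?E(a := ?E a + val f ?E st)) st)"
    using Add.prems by (intro Add.IH(2)) auto
  have "val f ?E st = val f env st"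
    using Add.prems by (intro val_cong[of d]) auto
  then have eq: "?E(a := ?E a + val f ?E st) = env(a := env a + val (Add e f) env st)"
    by (simp add: fun_eq_iff)
  show ?case
    using runs_Seq[OF 1 2[unfolded eq]] by (simp del: fun_upd_apply)
next
  case (Mul e f)
  obtain c0 u w c2 where st: "st = (c0, u, w, c2)" by (cases st)
  have tp: "tapes R E st = tps R (c0, 0) (over_tape u w, int (length w)) (c2, 0) E" for E
    by (simp add: st tapes_def)
  let ?A = "(c0, 0)" and ?B = "(over_tape u w, int (length w))" and ?C = "(c2, 0)"
  let ?n = "val e env st" and ?m = "val f env st"
  have eq: "val f env' st = ?m" if "\<And>v. v < d \<Longrightarrow> env' v = env v" for env'
    using Mul.prems that by (intro val_cong[of d]) auto
  have ne: "a \<noteq> k" "k < R" "env k = 0" "?n \<le> poly (val_bound e) S"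
    using Mul.prems by (auto intro: val_bound)
  have 1: "runs Q (comp_expr e k (Suc k)) (tapes R env st) (poly (expr_time e) S)
      (tapes R (env(k := ?n)) st)"
  proof -
    have "runs Q (comp_expr e k (Suc k)) (tapes R env st) (poly (expr_time e) S)
        (tapes R (env(k := env k + ?n)) st)"
      using Mul.prems by (intro Mul.IH(1)) auto
    then show ?thesis using ne by (simp del: fun_upd_apply)
  qed
  have 2: "runs Q (loop k (dec k ;; comp_expr f a (Suc k))) (tapes R (env(k := ?n)) st)
      (?n * Suc (Suc 0 + poly (expr_time f) S) + 1) (tapes R (env(a := env a + ?n * ?m)) st)"
    unfolding tp
  proof (rule runs_loop[of k R ?n "\<lambda>i. env(k := ?n - i, a := env a + i * ?m)" Q _
        "\<lambda>_. ?A" "\<lambda>_. ?B" "\<lambda>_. ?C"], goal_cases)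
    case (3 i)
    let ?E = "env(k := ?n - Suc i, a := env a + i * ?m)"
    have "runs Q (comp_expr f a (Suc k)) (tapes R ?E st) (poly (expr_time f) S)
        (tapes R (?E(a := ?E a + val f ?E st)) st)"
      using Mul.prems by (intro Mul.IH(2)) auto
    moreover have "val f ?E st = ?m"
      using Mul.prems by (intro eq) auto
    moreover have "?E(a := ?E a + ?m) = env(k := ?n - Suc i, a := env a + Suc i * ?m)"
      using ne by (auto simp: fun_eq_iff)
    ultimately have b: "runs Q (comp_expr f a (Suc k)) (tps R ?A ?B ?C ?E) (poly (expr_time f) S)
        (tps R ?A ?B ?C (env(k := ?n - Suc i, a := env a + Suc i * ?m)))"
      by (simp only: tp)
    show ?case
      apply (rule runs_Seq[OF runs_dec b])
      using ne 3 by (auto simp: fun_eq_iff)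
  qed (use ne in \<open>auto simp: st fun_eq_iff intro!: arg_cong[of _ _ "tps _ _ _ _"]\<close>)
  have "?n * Suc (Suc 0 + poly (expr_time f) S) \<le> poly (val_bound e) S * (poly (expr_time f) S + 2)"
    using ne by (intro mult_le_mono) auto
  then show ?case
    using runs_Seq[OF 1 2] by (auto simp del: fun_upd_apply elim!: runs_mono)
next
  case (IsZero e)
  obtain c0 u w c2 where st: "st = (c0, u, w, c2)" by (cases st)
  have tp: "tapes R E st = tps R (c0, 0) (over_tape u w, int (length w)) (c2, 0) E" for E
    by (simp add: st tapes_def)
  let ?n = "val e env st"
  have ne: "a \<noteq> k" "k < R" "a < R" "env k = 0" "?n \<le> poly (val_bound e) S"
    using IsZero.prems by (auto intro: val_bound)
  have 1: "runs Q (comp_expr e k (Suc k)) (tapes R env st) (poly (expr_time e) S)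
      (tapes R (env(k := ?n)) st)"
  proof -
    have "runs Q (comp_expr e k (Suc k)) (tapes R env st) (poly (expr_time e) S)
        (tapes R (env(k := env k + ?n)) st)"
      using IsZero.prems by (intro IsZero.IH) auto
    then show ?thesis using ne by (simp del: fun_upd_apply)
  qed
  let ?E = "env(k := ?n, a := env a + of_bool (?n = 0))"
  have 2: "runs Q (Cond (3 + k) {1} (inc a) skip) (tapes R (env(k := ?n)) st) (Suc (Suc 0)) (tapes R ?E st)"
    unfolding tp
  proof (rule runs_Cond, goal_cases)
    case 1
    then show ?case using ne by (intro runs_inc) (auto simp: fun_eq_iff mark_def split: if_splits)
  next
    case 2
    then have "?E = env(k := ?n)"
      using ne by (auto simp: fun_eq_iff mark_def split: if_splits)
    then show ?case using runs_skip by metis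
  qed
  have 3: "runs Q (loop k (dec k)) (tapes R ?E st) (?n * 2 + 1)
      (tapes R (env(a := env a + val (IsZero e) env st)) st)"
  proof -
    have "?E(k := 0) = env(a := env a + val (IsZero e) env st)" "?E k = ?n"
      using ne by (auto simp: fun_eq_iff)
    then show ?thesis
      using runs_clear[of k R Q _ _ _ ?E, OF ne(2)] unfolding tp by metis
  qed
  show ?case
    using runs_Seq[OF 1 runs_Seq[OF 2 3]] ne by (auto simp del: fun_upd_apply elim!: runs_mono)
next
  case (Bit b e)
  obtain c0 u w c2 where st: "st = (c0, u, w, c2)" by (cases st)
  have tp: "tapes R E st = tps R (c0, 0) (over_tape u w, int (length w)) (c2, 0) E" for E
    by (simp add: st tapes_def)
  let ?n = "val e env st" and ?B = "(over_tape u w, int (length w))"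
  have ne: "a \<noteq> k" "a \<noteq> Suc k" "k < R" "Suc k < R" "a < R" "env k = 0" "env (Suc k) = 0"
      "?n \<le> poly (val_bound e) S"
    using Bit.prems by (auto intro: val_bound)
  have 1: "runs Q (comp_expr e k (Suc k)) (tapes R env st) (poly (expr_time e) S)
      (tapes R (env(k := ?n)) st)"
  proof -
    have "runs Q (comp_expr e k (Suc k)) (tapes R env st) (poly (expr_time e) S)
        (tapes R (env(k := env k + ?n)) st)"
      using Bit.prems by (intro Bit.IH) auto
    then show ?thesis using ne by (simp del: fun_upd_apply)
  qed
  let ?h0 = "if b then 0 else int ?n" and ?h2 = "if b then int ?n else 0"
  let ?x = "of_bool ((if b then c2 else c0) (int ?n) = 2) :: nat"
  have 2: "runs Q (goto_cell b k) (tapes R (env(k := ?n)) st) (?n * 4 + 1)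
      (tps R (c0, ?h0) ?B (c2, ?h2) (env(Suc k := ?n)))"
  proof -
    have "(env(k := ?n))(k := 0, Suc k := ?n) = env(Suc k := ?n)"
      using ne by (auto simp: fun_eq_iff)
    then show ?thesis
      using runs_goto_cell[of k R "env(k := ?n)" Q b c0 ?B c2] ne unfolding tp
      by (metis fun_upd_other fun_upd_same n_not_Suc_n)
  qed
  have 3: "runs Q (Cond (word_idx b) {2} (inc a) skip) (tps R (c0, ?h0) ?B (c2, ?h2) (env(Suc k := ?n)))
      (Suc (Suc 0)) (tps R (c0, ?h0) ?B (c2, ?h2) (env(Suc k := ?n, a := env a + ?x)))"
  proof (rule runs_Cond, goal_cases)
    case 1
    then show ?case using ne by (intro runs_inc) (auto simp: fun_eq_iff word_idx_def split: if_splits)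
  next
    case 2
    then have "env(Suc k := ?n, a := env a + ?x) = env(Suc k := ?n)"
      using ne by (auto simp: fun_eq_iff word_idx_def split: if_splits)
    then show ?case using runs_skip by metis
  qed
  have 4: "runs Q (goback_cell b (Suc k)) (tps R (c0, ?h0) ?B (c2, ?h2) (env(Suc k := ?n, a := env a + ?x)))
      (?n * 3 + 1) (tapes R (env(a := env a + val (Bit b e) env st)) st)"
  proof -
    let ?F = "env(Suc k := ?n, a := env a + ?x)"
    have "?F(Suc k := 0) = env(a := env a + val (Bit b e) env st)" "?F (Suc k) = ?n"
      using ne by (auto simp: fun_eq_iff st)
    then show ?thesis
      using runs_goback_cell[of "Suc k" R Q b c0 ?F ?B c2, OF ne(4)] unfolding tp by metis
  qed
  show ?case
    using runs_Seq[OF 1 runs_Seq[OF 2 runs_Seq[OF 3 4]]] ne by (auto simp del: fun_upd_apply elim!: runs_mono)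
next
  case Reply
  obtain c0 u w c2 where st: "st = (c0, u, w, c2)" by (cases st)
  have tp: "tapes R E st = tps R (c0, 0) (over_tape u w, int (length w)) (c2, 0) E" for E
    by (simp add: st tapes_def)
  have "runs Q (Cond 1 {2} (inc a) skip) (tapes R env st) (Suc (Suc 0))
      (tapes R (env(a := env a + val Reply env st)) st)"
    unfolding tp
  proof (rule runs_Cond, goal_cases)
    case 1
    then show ?case using Reply.prems by (intro runs_inc) (auto simp: fun_eq_iff st)
  next
    case 2
    then have "env(a := env a + val Reply env st) = env" by (auto simp: st)
    then show ?case using runs_skip by metis
  qed
  then show ?case by (simp add: numeral_2_eq_2 del: fun_upd_apply)
qed

section \<open>Commands, their semantics and their compilation\<close>

datatype cmd =
    Nop | Emit expr | Write bool expr nat | SeqC cmd cmd | IfC expr cmd cmd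
  | ForC expr cmd | LetC expr cmd | QueryC

text \<open>Variables are de Bruijn levels: at depth \<open>d\<close>, \<^const>\<open>LetC\<close> binds variable \<open>d\<close>, and
  \<^const>\<open>ForC\<close> binds \<open>d\<close> to the number of remaining iterations and \<open>Suc d\<close> to the index of the
  current one.\<close>

fun sem :: "(bool list \<Rightarrow> bool list) \<Rightarrow> nat \<Rightarrow> cmd \<Rightarrow> (nat \<Rightarrow> nat) \<Rightarrow> store \<Rightarrow> store" where
  "sem Q d Nop env st = st"
| "sem Q d (Emit e) env st = (case st of (c0, v, w, c2) \<Rightarrow> (c0, v, w @ unary (val e env st), c2))"
| "sem Q d (Write b e s) env st = (case st of (c0, v, w, c2) \<Rightarrow>
    if b then (c0, v, w, c2(int (val e env st) := s)) else (c0(int (val e env st) := s), v, w, c2))"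
| "sem Q d (SeqC a b) env st = sem Q d b env (sem Q d a env st)"
| "sem Q d (IfC e a b) env st = (if val e env st \<noteq> 0 then sem Q d a env st else sem Q d b env st)"
| "sem Q d (ForC e c) env st = (let n = val e env st in
    fold (\<lambda>i. sem Q (d + 2) c (env(d := n - Suc i, Suc d := i))) [0..<n] st)"
| "sem Q d (LetC e c) env st = sem Q (Suc d) c (env(d := val e env st)) st"
| "sem Q d QueryC env st = (case st of (c0, v, w, c2) \<Rightarrow> (c0, Q (tape_word (over_tape v w)), [], c2))"

fun wf_cmd :: "nat \<Rightarrow> cmd \<Rightarrow> bool" where
  "wf_cmd d Nop \<longleftrightarrow> True"
| "wf_cmd d (Emit e) \<longleftrightarrow> wf_expr d e"
| "wf_cmd d (Write b e s) \<longleftrightarrow> wf_expr d e \<and> s < 3"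
| "wf_cmd d (SeqC a b) \<longleftrightarrow> wf_cmd d a \<and> wf_cmd d b"
| "wf_cmd d (IfC e a b) \<longleftrightarrow> wf_expr d e \<and> wf_cmd d a \<and> wf_cmd d b"
| "wf_cmd d (ForC e c) \<longleftrightarrow> wf_expr d e \<and> wf_cmd (d + 2) c"
| "wf_cmd d (LetC e c) \<longleftrightarrow> wf_expr d e \<and> wf_cmd (Suc d) c"
| "wf_cmd d QueryC \<longleftrightarrow> True"

fun cmd_regs :: "cmd \<Rightarrow> nat" where
  "cmd_regs Nop = 0"
| "cmd_regs (Emit e) = Suc (expr_regs e)"
| "cmd_regs (Write b e s) = Suc (Suc (expr_regs e))"
| "cmd_regs (SeqC a b) = max (cmd_regs a) (cmd_regs b)"
| "cmd_regs (IfC e a b) = max (Suc (expr_regs e)) (max (cmd_regs a) (cmd_regs b))"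
| "cmd_regs (ForC e c) = 2 + max (expr_regs e) (cmd_regs c)"
| "cmd_regs (LetC e c) = Suc (max (expr_regs e) (cmd_regs c))"
| "cmd_regs QueryC = 0"

text \<open>Inside a loop or a binding, the new variables may be as large as the value of
  \<open>e\<close>, so the bound \<open>S\<close> on the variables becomes
  \<open>S + poly (val_bound e) S\<close>. This substitution is the composition of
  polynomials.\<close>

fun cmd_time :: "cmd \<Rightarrow> nat poly" where
  "cmd_time Nop = 1"
| "cmd_time (Emit e) = expr_time e + ((val_bound e * 3 + 1) + 1)"
| "cmd_time (Write b e s) = expr_time e + ((val_bound e * 4 + 1) + (1 + (val_bound e * 3 + 1)))"
| "cmd_time (SeqC a b) = cmd_time a + cmd_time b"
| "cmd_time (IfC e a b) = expr_time e + (1 + (val_bound e * 2 + 1 + (cmd_time a + cmd_time b)))"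
| "cmd_time (ForC e c) = expr_time e +
    ((val_bound e * (pcompose (cmd_time c) ([:0, 1:] + val_bound e) + 3) + 1) + (val_bound e * 2 + 1))"
| "cmd_time (LetC e c) = expr_time e +
    (pcompose (cmd_time c) ([:0, 1:] + val_bound e) + (val_bound e * 2 + 1))"
| "cmd_time QueryC = 1"

fun comp_cmd :: "cmd \<Rightarrow> nat \<Rightarrow> prog" where
  "comp_cmd Nop d = skip"
| "comp_cmd (Emit e) d = comp_expr e d (Suc d) ;; loop d (dec d ;; Act 1 (\<lambda>_. 2) 1) ;; Act 1 (\<lambda>_. 1) 1"
| "comp_cmd (Write b e s) d = comp_expr e d (Suc d) ;; goto_cell b d ;; Act (word_idx b) (\<lambda>_. s) 0 ;;
    goback_cell b (Suc d)"
| "comp_cmd (SeqC a b) d = comp_cmd a d ;; comp_cmd b d"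
| "comp_cmd (IfC e a b) d = comp_expr e d (Suc d) ;;
    Cond (3 + d) {1} (comp_cmd b d) (loop d (dec d) ;; comp_cmd a d)"
| "comp_cmd (ForC e c) d = comp_expr e d (d + 2) ;;
    loop d (dec d ;; comp_cmd c (d + 2) ;; inc (Suc d)) ;; loop (Suc d) (dec (Suc d))"
| "comp_cmd (LetC e c) d = comp_expr e d (Suc d) ;; comp_cmd c (Suc d) ;; loop d (dec d)"
| "comp_cmd QueryC d = Ask"

fun queries :: "cmd \<Rightarrow> nat" where
  "queries (SeqC a b) = queries a + queries b"
| "queries (IfC e a b) = queries a + queries b"
| "queries (ForC e c) = queries c"
| "queries (LetC e c) = queries c"
| "queries QueryC = 1"
| "queries _ = 0"

lemma asks_comp_expr: "asks (comp_expr e a k) = 0"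
proof (induction e arbitrary: a k)
  case (Cst n)
  have "asks (((\<lambda>p. inc a ;; p) ^^ n) skip) = 0"
    by (induction n) (auto simp: inc_def skip_def)
  then show ?case by simp
qed (auto simp: inc_def dec_def skip_def loop_def goto_cell_def goback_cell_def)

lemma asks_comp_cmd: "asks (comp_cmd c d) = queries c"
  by (induction c arbitrary: d)
    (auto simp: inc_def dec_def skip_def loop_def goto_cell_def goback_cell_def asks_comp_expr)

lemma prog_ok_comp_expr:
  "wf_expr d e \<Longrightarrow> d \<le> a \<Longrightarrow> a < k \<Longrightarrow> k + expr_regs e \<le> R \<Longrightarrow> a < R \<Longrightarrow> prog_ok (3 + R) 3 (comp_expr e a k)"
proof (induction e arbitrary: a k)
  case (Cst n)
  then have "prog_ok (3 + R) 3 (((\<lambda>p. inc a ;; p) ^^ n) skip)"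
    by (induction n) (auto simp: inc_def skip_def)
  then show ?case by simp
qed (auto simp: inc_def dec_def skip_def loop_def goto_cell_def goback_cell_def word_idx_def)

lemma prog_ok_comp_cmd:
  "wf_cmd d c \<Longrightarrow> d + cmd_regs c \<le> R \<Longrightarrow> prog_ok (3 + R) 3 (comp_cmd c d)"
  by (induction c arbitrary: d)
    (auto simp: inc_def dec_def skip_def loop_def goto_cell_def goback_cell_def word_idx_def
      intro!: prog_ok_comp_expr)

lemma runs_inc_tapes:
  "j < R \<Longrightarrow> env' = env(j := Suc (env j)) \<Longrightarrow> runs Q (inc j) (tapes R env st) (Suc 0) (tapes R env' st)"
  by (cases st) (auto simp: tapes_def intro!: runs_inc)

lemma runs_dec_tapes:
  "j < R \<Longrightarrow> 0 < env j \<Longrightarrow> env' = env(j := env j - 1) \<Longrightarrow>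
    runs Q (dec j) (tapes R env st) (Suc 0) (tapes R env' st)"
  by (cases st) (auto simp: tapes_def intro!: runs_dec)

lemma runs_clear_tapes:
  "j < R \<Longrightarrow> env' = env(j := 0) \<Longrightarrow> n = env j \<Longrightarrow>
    runs Q (loop j (dec j)) (tapes R env st) (n * 2 + 1) (tapes R env' st)"
  using runs_clear[of j R] by (cases st) (auto simp: tapes_def)

lemma runs_loop_tapes:
  assumes "j < R" "\<And>i. i \<le> n \<Longrightarrow> E i j = n - i"
    and "\<And>i. i < n \<Longrightarrow> runs Q p (tapes R (E i) (s i)) T (tapes R (E (Suc i)) (s (Suc i)))"
  shows "runs Q (loop j p) (tapes R (E 0) (s 0)) (n * Suc T + 1) (tapes R (E n) (s n))"
proof -
  have "symbol_at (tapes R env st) (3 + j) = mark (int (env j))" for env st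
    using assms(1) by (cases st) (simp add: tapes_def)
  then show ?thesis
    unfolding loop_def using assms
    by (intro runs_While[of n "\<lambda>i. tapes R (E i) (s i)"]) (auto simp: mark_def)
qed

lemma over_tape_snoc: "(over_tape v w)(int (length w) := if b then 2 else 1) = over_tape v (w @ [b])"
  by (auto simp: over_tape_def fun_eq_iff nth_append)

lemma runs_emit:
  assumes "s = (if b then 2 else 1)" "st' = (c0, v, w @ [b], c2)"
  shows "runs Q (Act 1 (\<lambda>_. s) 1) (tapes R env (c0, v, w, c2)) (Suc 0) (tapes R env st')"
  unfolding assms(2)
proof (rule runs_Act)
  show "tapes R env (c0, v, w @ [b], c2) = (tapes R env (c0, v, w, c2))[1 :=
      act (tapes R env (c0, v, w, c2) ! 1) (s, 1)]"
    using over_tape_snoc[of v w b] assms(1) by (auto simp: tapes_def act_def add.commute)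
qed

lemma runs_comp_expr0:
  assumes "wf_expr d e" "d \<le> a" "a < k" "k + expr_regs e \<le> R"
    and "\<And>v. d \<le> v \<Longrightarrow> env v = 0" "\<And>v. env v \<le> S"
  shows "runs Q (comp_expr e a k) (tapes R env st) (poly (expr_time e) S)
    (tapes R (env(a := val e env st)) st)"
  using runs_comp_expr[of d e a k R env S Q st] assms by (simp del: fun_upd_apply)

text \<open>The registers from \<open>d\<close> on are 0 before and after every command, which is
  why the environment is unchanged and only the store evolves. \<open>S\<close> is generalized
  because the body of a binder is run under a larger bound.\<close>

lemma runs_comp_cmd:
  assumes "wf_cmd d c" "d + cmd_regs c \<le> R" "\<And>v. d \<le> v \<Longrightarrow> env v = 0" "\<And>v. env v \<le> S"
  shows "runs Q (comp_cmd c d) (tapes R env st) (poly (cmd_time c) S)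
    (tapes R env (sem Q d c env st))"
  using assms
proof (induction c arbitrary: d env st S)
  case Nop
  then show ?case using runs_skip by (cases st) (simp add: tapes_def)
next
  case (Emit e)
  obtain c0 v w c2 where st: "st = (c0, v, w, c2)" by (cases st)
  let ?n = "val e env st"
  have 1: "runs Q (comp_expr e d (Suc d)) (tapes R env st) (poly (expr_time e) S)
      (tapes R (env(d := ?n)) st)"
    using Emit.prems by (intro runs_comp_expr0) auto
  have n: "?n \<le> poly (val_bound e) S"
    using Emit.prems by (intro val_bound[of d]) auto
  have 2: "runs Q (loop d (dec d ;; Act 1 (\<lambda>_. 2) 1)) (tapes R (env(d := ?n)) st)
      (?n * Suc (Suc 0 + Suc 0) + 1) (tapes R env (c0, v, w @ replicate ?n True, c2))"
  proof -
    have "runs Q (loop d (dec d ;; Act 1 (\<lambda>_. 2) 1))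
      (tapes R (env(d := ?n - 0)) (c0, v, w @ replicate 0 True, c2)) (?n * Suc (Suc 0 + Suc 0) + 1)
      (tapes R (env(d := ?n - ?n)) (c0, v, w @ replicate ?n True, c2))"
    proof (rule runs_loop_tapes[of d R ?n "\<lambda>i. env(d := ?n - i)" Q _ "\<lambda>i. (c0, v, w @ replicate i True, c2)"],
        goal_cases)
      case (3 i)
      show ?case
        apply (rule runs_Seq[OF runs_dec_tapes runs_emit])
        using 3 Emit.prems by (auto simp: replicate_append_same fun_eq_iff)
    qed (use Emit.prems in auto)
    moreover have "env(d := ?n - ?n) = env"
      using Emit.prems(3)[of d] by auto
    ultimately show ?thesis by (simp add: st)
  qed
  have 3: "runs Q (Act 1 (\<lambda>_. 1) 1) (tapes R env (c0, v, w @ replicate ?n True, c2)) (Suc 0)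
      (tapes R env (sem Q d (Emit e) env st))"
    by (rule runs_emit[where b = False]) (auto simp: st unary_def)
  show ?case
    using runs_Seq[OF 1 runs_Seq[OF 2 3]] n by (auto elim!: runs_mono)
next
  case (Write b e s)
  obtain c0 v w c2 where st: "st = (c0, v, w, c2)" by (cases st)
  let ?n = "val e env st" and ?B = "(over_tape v w, int (length w))"
  let ?h0 = "if b then 0 else int ?n" and ?h2 = "if b then int ?n else 0"
  let ?c0 = "if b then c0 else c0(int ?n := s)" and ?c2 = "if b then c2(int ?n := s) else c2"
  have ne: "Suc d < R" "env d = 0" "env (Suc d) = 0" "?n \<le> poly (val_bound e) S"
    using Write.prems by (auto intro: val_bound[of d])
  have 1: "runs Q (comp_expr e d (Suc d)) (tapes R env st) (poly (expr_time e) S)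
      (tapes R (env(d := ?n)) st)"
    using Write.prems by (intro runs_comp_expr0) auto
  have 2: "runs Q (goto_cell b d) (tapes R (env(d := ?n)) st) (?n * 4 + 1)
      (tps R (c0, ?h0) ?B (c2, ?h2) (env(Suc d := ?n)))"
  proof -
    have "(env(d := ?n))(d := 0, Suc d := ?n) = env(Suc d := ?n)" "(env(d := ?n)) d = ?n"
      "(env(d := ?n)) (Suc d) = 0" "tapes R (env(d := ?n)) st = tps R (c0, 0) ?B (c2, 0) (env(d := ?n))"
      using ne by (auto simp: fun_eq_iff st tapes_def)
    then show ?thesis
      using runs_goto_cell[of d R "env(d := ?n)" Q b c0 ?B c2, OF ne(1)] by metis
  qed
  have 3: "runs Q (Act (word_idx b) (\<lambda>_. s) 0) (tps R (c0, ?h0) ?B (c2, ?h2) (env(Suc d := ?n))) (Suc 0)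
      (tps R (?c0, ?h0) ?B (?c2, ?h2) (env(Suc d := ?n)))"
    by (rule runs_word_act) (auto simp: act_def)
  have 4: "runs Q (goback_cell b (Suc d)) (tps R (?c0, ?h0) ?B (?c2, ?h2) (env(Suc d := ?n)))
      (?n * 3 + 1) (tapes R env (sem Q d (Write b e s) env st))"
  proof -
    let ?F = "env(Suc d := ?n)"
    have "?F(Suc d := 0) = env" "?F (Suc d) = ?n"
      "tapes R env (sem Q d (Write b e s) env st) = tps R (?c0, 0) ?B (?c2, 0) env"
      using ne by (auto simp: fun_eq_iff st tapes_def)
    then show ?thesis
      using runs_goback_cell[of "Suc d" R Q b ?c0 ?F ?B ?c2, OF ne(1)] by metis
  qed
  show ?case
    using runs_Seq[OF 1 runs_Seq[OF 2 runs_Seq[OF 3 4]]] ne by (auto elim!: runs_mono)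
next
  case (SeqC a b)
  have "runs Q (comp_cmd a d) (tapes R env st) (poly (cmd_time a) S) (tapes R env (sem Q d a env st))"
    using SeqC.prems by (intro SeqC.IH(1)) auto
  moreover have "runs Q (comp_cmd b d) (tapes R env (sem Q d a env st)) (poly (cmd_time b) S)
      (tapes R env (sem Q d b env (sem Q d a env st)))"
    using SeqC.prems by (intro SeqC.IH(2)) auto
  ultimately show ?case
    using runs_Seq by fastforce
next
  case (IfC e a b)
  let ?n = "val e env st"
  have ne: "d < R" "env d = 0" "?n \<le> poly (val_bound e) S"
    using IfC.prems by (auto intro: val_bound[of d])
  have 1: "runs Q (comp_expr e d (Suc d)) (tapes R env st) (poly (expr_time e) S)
      (tapes R (env(d := ?n)) st)"
    using IfC.prems by (intro runs_comp_expr0) auto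
  have 2: "runs Q (Cond (3 + d) {1} (comp_cmd b d) (loop d (dec d) ;; comp_cmd a d)) (tapes R (env(d := ?n)) st)
      (Suc (?n * 2 + 1 + (poly (cmd_time a) S + poly (cmd_time b) S))) (tapes R env (sem Q d (IfC e a b) env st))"
  proof (rule runs_Cond, goal_cases)
    case 1
    then have "?n = 0"
      using ne by (cases st) (auto simp: tapes_def mark_def split: if_splits)
    moreover have "env(d := ?n) = env" using calculation ne by auto
    moreover have "runs Q (comp_cmd b d) (tapes R env st) (poly (cmd_time b) S) (tapes R env (sem Q d b env st))"
      using IfC.prems by (intro IfC.IH(2)) auto
    ultimately show ?case by (auto elim!: runs_mono simp del: fun_upd_apply)
  next
    case 2
    then have "?n \<noteq> 0"
      using ne by (cases st) (auto simp: tapes_def mark_def split: if_splits)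
    moreover have "runs Q (comp_cmd a d) (tapes R env st) (poly (cmd_time a) S) (tapes R env (sem Q d a env st))"
      using IfC.prems by (intro IfC.IH(1)) auto
    moreover have "runs Q (loop d (dec d)) (tapes R (env(d := ?n)) st) (?n * 2 + 1) (tapes R env st)"
      using ne by (intro runs_clear_tapes) (auto simp: fun_eq_iff)
    ultimately show ?case
      using runs_Seq[of Q "loop d (dec d)" _ "?n * 2 + 1" _ "comp_cmd a d"]
      by (fastforce elim!: runs_mono simp del: fun_upd_apply)
  qed
  show ?case
    using runs_Seq[OF 1 2] ne by (auto elim!: runs_mono simp del: sem.simps) 
next
  case (ForC e c)
  let ?n = "val e env st"
  let ?S = "S + poly (val_bound e) S"
  let ?T = "poly (cmd_time c) ?S"
  define g where "g i = sem Q (d + 2) c (env(d := ?n - Suc i, Suc d := i))" for i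
  define s where "s i = fold g [0..<i] st" for i
  have ne: "Suc d < R" "env d = 0" "env (Suc d) = 0" "?n \<le> poly (val_bound e) S"
    using ForC.prems by (auto intro: val_bound[of d])
  have 1: "runs Q (comp_expr e d (d + 2)) (tapes R env st) (poly (expr_time e) S)
      (tapes R (env(d := ?n)) st)"
    using ForC.prems by (intro runs_comp_expr0) auto
  have 2: "runs Q (loop d (dec d ;; comp_cmd c (d + 2) ;; inc (Suc d))) (tapes R (env(d := ?n)) st)
      (?n * Suc (Suc 0 + (?T + Suc 0)) + 1) (tapes R (env(Suc d := ?n)) (s ?n))"
  proof -
    have "runs Q (loop d (dec d ;; comp_cmd c (d + 2) ;; inc (Suc d)))
        (tapes R (env(d := ?n - 0, Suc d := 0)) (s 0))
        (?n * Suc (Suc 0 + (?T + Suc 0)) + 1) (tapes R (env(d := ?n - ?n, Suc d := ?n)) (s ?n))"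
    proof (rule runs_loop_tapes[of d R ?n "\<lambda>i. env(d := ?n - i, Suc d := i)"], goal_cases)
      case (3 i)
      have b: "runs Q (comp_cmd c (d + 2)) (tapes R (env(d := ?n - Suc i, Suc d := i)) (s i)) ?T
          (tapes R (env(d := ?n - Suc i, Suc d := i)) (s (Suc i)))"
      proof -
        have "runs Q (comp_cmd c (d + 2)) (tapes R (env(d := ?n - Suc i, Suc d := i)) (s i)) ?T
          (tapes R (env(d := ?n - Suc i, Suc d := i))
            (sem Q (d + 2) c (env(d := ?n - Suc i, Suc d := i)) (s i)))"
          using ForC.prems 3 ne by (intro ForC.IH) (auto simp: trans_le_add1)
        then show ?thesis by (simp add: s_def g_def)
      qed
      show ?case
        apply (rule runs_Seq[OF runs_dec_tapes runs_Seq[OF b runs_inc_tapes]])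
        using 3 ne by (auto simp: fun_eq_iff)
    qed (use ne in auto)
    moreover have "env(d := ?n - 0, Suc d := 0) = env(d := ?n)" "env(d := ?n - ?n, Suc d := ?n) = env(Suc d := ?n)"
      using ne by (auto simp: fun_eq_iff)
    ultimately show ?thesis by (simp add: s_def del: fun_upd_apply)
  qed
  have 3: "runs Q (loop (Suc d) (dec (Suc d))) (tapes R (env(Suc d := ?n)) (s ?n)) (?n * 2 + 1) (tapes R env (s ?n))"
    using ne by (intro runs_clear_tapes) (auto simp: fun_eq_iff)
  have eq: "sem Q d (ForC e c) env st = s ?n"
    by (simp add: s_def g_def[abs_def] Let_def)
  have "?n * Suc (Suc 0 + (?T + Suc 0)) \<le> poly (val_bound e) S * (?T + 3)"
    using ne by (intro mult_le_mono) auto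
  then show ?case
    using runs_Seq[OF 1 runs_Seq[OF 2 3]] ne unfolding eq
    by (auto elim!: runs_mono simp: poly_pcompose)
next
  case (LetC e c)
  let ?n = "val e env st"
  have ne: "d < R" "env d = 0" "?n \<le> poly (val_bound e) S"
    using LetC.prems by (auto intro: val_bound[of d])
  have 1: "runs Q (comp_expr e d (Suc d)) (tapes R env st) (poly (expr_time e) S)
      (tapes R (env(d := ?n)) st)"
    using LetC.prems by (intro runs_comp_expr0) auto
  have 2: "runs Q (comp_cmd c (Suc d)) (tapes R (env(d := ?n)) st)
      (poly (cmd_time c) (S + poly (val_bound e) S)) (tapes R (env(d := ?n)) (sem Q (Suc d) c (env(d := ?n)) st))"
    using LetC.prems ne by (intro LetC.IH) (auto simp: trans_le_add1)
  have 3: "runs Q (loop d (dec d)) (tapes R (env(d := ?n)) (sem Q (Suc d) c (env(d := ?n)) st)) (?n * 2 + 1)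
      (tapes R env (sem Q d (LetC e c) env st))"
    using ne by (intro runs_clear_tapes[where env = "env(d := ?n)", THEN back_subst[of "\<lambda>x. runs _ _ _ _ (tapes _ _ x)"]])
      (auto simp: fun_eq_iff)
  show ?case
    using runs_Seq[OF 1 runs_Seq[OF 2 3]] ne
    by (auto elim!: runs_mono simp: poly_pcompose simp del: fun_upd_apply)
next
  case QueryC
  obtain c0 v w c2 where st: "st = (c0, v, w, c2)" by (cases st)
  \<comment> \<open>After an answer the overwriting word is empty and the head is on cell 0, so
    \<open>Reply\<close> reads the first bit of the answer.\<close>
  have "over_tape u [] = word_tape u" for u
    by (auto simp: over_tape_def)
  then show ?case
    using exec.Ask[of Q "tapes R env st"]
    by (auto simp: runs_def st tapes_def)
qed

section \<open>Preparation of the tapes and the resulting criterion for reducibility\<close>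

primrec marks :: "nat \<Rightarrow> prog" where
  "marks 0 = skip"
| "marks (Suc j) = marks j ;; Act (3 + j) (\<lambda>_. 1) 0"

text \<open>The length of the input becomes variable 0. It is parked in register 1 while the head
  returns, because the returning loop consumes register 0.\<close>

definition measure_input :: prog where
  "measure_input = While 0 {1, 2} (Act 0 id 1 ;; inc 0) ;;
    loop 0 (dec 0 ;; inc 1 ;; Act 0 id (-1)) ;; loop 1 (dec 1 ;; inc 0)"

lemma runs_marks:
  assumes "j \<le> R"
  shows "runs Q (marks j) ((c, 0) # replicate (2 + R) (\<lambda>_. 0, 0)) (Suc j)
    ((c, 0) # (\<lambda>_. 0, 0) # (\<lambda>_. 0, 0) # map (\<lambda>i. if i < j then (mark, 0) else (\<lambda>_. 0, 0)) [0..<R])"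
  using assms
proof (induction j)
  case 0
  have "map (\<lambda>i. (\<lambda>_. 0, 0)) [0..<R] = replicate R (\<lambda>_. 0, 0)" for R
    by (induction R) (auto simp: replicate_append_same)
  then show ?case
    by (auto simp: skip_def act_def symbol_at_def intro!: runs_Act)
next
  case (Suc j)
  have "runs Q (Act (3 + j) (\<lambda>_. 1) 0)
    ((c, 0) # (\<lambda>_. 0, 0) # (\<lambda>_. 0, 0) # map (\<lambda>i. if i < j then (mark, 0) else (\<lambda>_. 0, 0)) [0..<R]) (Suc 0)
    ((c, 0) # (\<lambda>_. 0, 0) # (\<lambda>_. 0, 0) # map (\<lambda>i. if i < Suc j then (mark, 0) else (\<lambda>_. 0, 0)) [0..<R])"
  proof (rule runs_Act)
    have "(\<lambda>_. 0)(0 := 1) = mark" by (auto simp: mark_def)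
    then show "(c, 0) # (\<lambda>_. 0, 0) # (\<lambda>_. 0, 0) # map (\<lambda>i. if i < Suc j then (mark, 0) else (\<lambda>_. 0, 0)) [0..<R] =
      ((c, 0) # (\<lambda>_. 0, 0) # (\<lambda>_. 0, 0) # map (\<lambda>i. if i < j then (mark, 0) else (\<lambda>_. 0, 0)) [0..<R])
      [3 + j := act (((c, 0) # (\<lambda>_. 0, 0) # (\<lambda>_. 0, 0) # map (\<lambda>i. if i < j then (mark, 0) else (\<lambda>_. 0, 0)) [0..<R]) ! (3 + j)) (1, 0)]"
      using Suc.prems
      by (auto simp: numeral_3_eq_3 act_def nth_list_update intro!: nth_equalityI)
  qed
  from runs_Seq[OF Suc.IH this] Suc.prems show ?case by simp
qed

lemma runs_tape0_act:
  assumes "A' = act A (f (fst A (snd A)), d)"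
  shows "runs Q (Act 0 f d) (tps R A B C env) (Suc 0) (tps R A' B C env)"
  using assms by (intro runs_Act) auto

lemma runs_measure_input:
  assumes "2 \<le> R"
  shows "runs Q measure_input (tps R (word_tape x, 0) B C (\<lambda>_. 0)) (10 * length x + 3)
    (tps R (word_tape x, 0) B C ((\<lambda>_. 0)(0 := length x)))"
proof -
  let ?n = "length x"
  have 1: "runs Q (While 0 {1, 2} (Act 0 id 1 ;; inc 0)) (tps R (word_tape x, 0) B C (\<lambda>_. 0))
    (?n * Suc (Suc 0 + Suc 0) + 1) (tps R (word_tape x, int ?n) B C ((\<lambda>_. 0)(0 := ?n)))"
  proof -
    have "runs Q (While 0 {1, 2} (Act 0 id 1 ;; inc 0))
      (tps R (word_tape x, int 0) B C ((\<lambda>_. 0)(0 := 0)))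
      (?n * Suc (Suc 0 + Suc 0) + 1) (tps R (word_tape x, int ?n) B C ((\<lambda>_. 0)(0 := ?n)))"
    proof (rule runs_While[of ?n "\<lambda>i. tps R (word_tape x, int i) B C ((\<lambda>_. 0)(0 := i))"], goal_cases)
      case (3 i)
      show ?case
        apply (rule runs_Seq[OF runs_tape0_act[OF refl] back_subst[of "\<lambda>X. runs _ _ _ _ (tps _ X _ _ _)", OF runs_inc]])
        using assms by (auto simp: act_def fun_eq_iff)
    qed (auto simp: word_tape_def)
    then show ?thesis by (simp add: fun_upd_def)
  qed
  have 2: "runs Q (loop 0 (dec 0 ;; inc 1 ;; Act 0 id (-1)))
    (tps R (word_tape x, int ?n) B C ((\<lambda>_. 0)(0 := ?n))) (?n * Suc (Suc 0 + (Suc 0 + Suc 0)) + 1)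
    (tps R (word_tape x, 0) B C ((\<lambda>_. 0)(1 := ?n)))"
  proof (rule runs_loop[of 0 R ?n "\<lambda>i. (\<lambda>_. 0)(0 := ?n - i, 1 := i)" Q _
        "\<lambda>i. (word_tape x, int (?n - i))" "\<lambda>_. B" "\<lambda>_. C"], goal_cases)
    case (3 i)
    show ?case
      apply (rule runs_Seq[OF runs_dec[OF _ _ refl] runs_Seq[OF runs_inc[OF _ refl]
              back_subst[of "\<lambda>X. runs _ _ _ _ (tps _ _ _ _ X)", OF runs_tape0_act]]])
      using assms 3 by (auto simp: act_def fun_eq_iff)
  qed (use assms in \<open>auto simp: fun_eq_iff intro!: arg_cong[of _ _ "tps _ _ _ _"]\<close>)
  have 3: "runs Q (loop 1 (dec 1 ;; inc 0)) (tps R (word_tape x, 0) B C ((\<lambda>_. 0)(1 := ?n)))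
    (?n * Suc (Suc 0 + Suc 0) + 1) (tps R (word_tape x, 0) B C ((\<lambda>_. 0)(0 := ?n)))"
  proof (rule runs_loop[of 1 R ?n "\<lambda>i. (\<lambda>_. 0)(1 := ?n - i, 0 := i)" Q _
        "\<lambda>i. (word_tape x, 0)" "\<lambda>_. B" "\<lambda>_. C"], goal_cases)
    case (3 i)
    show ?case
      apply (rule runs_Seq[OF runs_dec[OF _ _ refl] runs_inc])
      using assms 3 by (auto simp: act_def fun_eq_iff)
  qed (use assms in \<open>auto simp: fun_eq_iff intro!: arg_cong[of _ _ "tps _ _ _ _"]\<close>)
  show ?thesis
    unfolding measure_input_def
    using runs_Seq[OF 1 runs_Seq[OF 2 3]] by (rule runs_mono) simp
qed

text \<open>This is all that the later sections use of the machine model: a well-formed command with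
  one query instruction, and its semantics under every correct oracle. The polynomial time bound
  comes for free from the syntax.\<close>

theorem polytime_turing_reducibleI:
  assumes "wf_cmd 1 c" "queries c = 1"
    and "\<And>Q x. solves Q P \<Longrightarrow>
      tape_word (fst (sem Q 1 c ((\<lambda>_. 0)(0 := length x)) (word_tape x, [], [], \<lambda>_. 0))) = nat_code (f x)"
  shows "polytime_turing_reducible f P"
proof -
  \<comment> \<open>The command at depth 1 needs \<open>1 + cmd_regs c\<close> registers, and
    \<open>measure_input\<close> needs two.\<close>
  define R where "R = Suc (Suc (cmd_regs c))"
  define p where "p = marks R ;; measure_input ;; comp_cmd c 1"
  \<comment> \<open>\<open>Suc R\<close> steps for the marks, \<open>10 * length x + 3\<close> for
    measuring the input, and the time of the command.\<close>
  define T where "T = [:R + 4, 10:] + cmd_time c"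
  let ?M = "machine (3 + R) 3 p"
  have "prog_ok (3 + R) 3 (marks j) \<and> asks (marks j) = 0" if "j \<le> R" for j
    using that by (induction j) (auto simp: skip_def)
  moreover have "prog_ok (3 + R) 3 measure_input \<and> asks measure_input = 0"
    by (auto simp: measure_input_def loop_def inc_def dec_def R_def)
  moreover have "prog_ok (3 + R) 3 (comp_cmd c 1)"
    by (rule prog_ok_comp_cmd[OF assms(1)]) (simp add: R_def)
  ultimately have p: "prog_ok (3 + R) 3 p" "asks p = 1"
    using assms(2) by (auto simp: p_def asks_comp_cmd)
  have "halts_with ?M ((ostep Q ?M ^^ poly T (length x)) (init ?M x)) (nat_code (f x))"
    if "solves Q P" for Q x
  proof -
    let ?env = "(\<lambda>_. 0)(0 := length x)" and ?st = "(word_tape x, [], [], \<lambda>_. 0)"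
    let ?Z = "\<lambda>_::int. 0::nat"
    have wt: "over_tape [] [] = ?Z"
      by (auto simp: over_tape_def word_tape_def)
    have init: "snd (init ?M x) = (word_tape x, 0) # replicate (2 + R) (?Z, 0)"
      by (simp add: init_def machine_def)
    have "runs Q (marks R) (snd (init ?M x)) (Suc R)
        ((word_tape x, 0) # (?Z, 0) # (?Z, 0) # map (\<lambda>i. if i < R then (mark, 0) else (?Z, 0)) [0..<R])"
      unfolding init by (rule runs_marks) simp
    moreover have "map (\<lambda>i. if i < R then (mark, 0) else (?Z, 0)) [0..<R] = map (\<lambda>j. (mark, int 0)) [0..<R]"
      by auto
    ultimately have 1: "runs Q (marks R) (snd (init ?M x)) (Suc R)
        (tps R (word_tape x, 0) (?Z, 0) (?Z, 0) (\<lambda>_. 0))"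
      by (simp add: tps_def)
    have 2: "runs Q measure_input (tps R (word_tape x, 0) (?Z, 0) (?Z, 0) (\<lambda>_. 0))
        (10 * length x + 3) (tapes R ?env ?st)"
      using runs_measure_input[of R Q x] by (simp add: tapes_def wt R_def)
    have 3: "runs Q (comp_cmd c 1) (tapes R ?env ?st) (poly (cmd_time c) (length x))
        (tapes R ?env (sem Q 1 c ?env ?st))"
      by (rule runs_comp_cmd[OF assms(1)]) (auto simp: R_def)
    obtain t where t: "t \<le> Suc R + (10 * length x + 3 + poly (cmd_time c) (length x))"
      "exec Q p (snd (init ?M x)) t (tapes R ?env (sem Q 1 c ?env ?st))"
      using runs_Seq[OF 1 runs_Seq[OF 2 3]] unfolding p_def runs_def by blast
    have "(ostep Q ?M ^^ poly T (length x)) (init ?M x) = (plen p, tapes R ?env (sem Q 1 c ?env ?st))"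
      using t(1) by (intro machine_halts[OF t(2)] p) (auto simp: T_def)
    then show ?thesis
      using assms(3)[OF that, of x]
      by (auto simp: halts_with_def machine_def tapes_def split: prod.splits)
  qed
  moreover have "wf_otm ?M"
    using p by (intro wf_machine) auto
  ultimately show ?thesis
    unfolding polytime_turing_reducible_def by blast
qed

section \<open>Gadgets\<close>

text \<open>Series-parallel graphs with two terminals, seen as 2 by 2 matrices: parallel composition
  is the entrywise product, series composition the matrix product. \<open>Loop\<close> is a
  self-loop at the first terminal; \<open>Tr\<close> exchanges the terminals and so moves such
  one-sided effects to the other end.\<close>

datatype gadget =
    Edge | Loop | Ones | Par gadget gadget | Ser gadget gadget | Tr gadget

definition spin_weight :: "rat \<Rightarrow> rat \<Rightarrow> bool \<Rightarrow> bool \<Rightarrow> rat" where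
  "spin_weight \<beta> \<gamma> x y = (if x \<and> y then \<gamma> else if x \<or> y then 1 else \<beta>)"

fun mat :: "rat \<Rightarrow> rat \<Rightarrow> gadget \<Rightarrow> bool \<Rightarrow> bool \<Rightarrow> rat" where
  "mat \<beta> \<gamma> Edge x y = spin_weight \<beta> \<gamma> x y"
| "mat \<beta> \<gamma> Loop x y = spin_weight \<beta> \<gamma> x x"
| "mat \<beta> \<gamma> Ones x y = 1"
| "mat \<beta> \<gamma> (Par g h) x y = mat \<beta> \<gamma> g x y * mat \<beta> \<gamma> h x y"
| "mat \<beta> \<gamma> (Ser g h) x y = (\<Sum>z\<in>UNIV. mat \<beta> \<gamma> g x z * mat \<beta> \<gamma> h z y)"
| "mat \<beta> \<gamma> (Tr g) x y = mat \<beta> \<gamma> g y x"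

fun gsize :: "gadget \<Rightarrow> nat" where
  "gsize (Par g h) = gsize g + gsize h"
| "gsize (Ser g h) = Suc (gsize g + gsize h)"
| "gsize (Tr g) = gsize g"
| "gsize _ = 0"

text \<open>Vertices are of arbitrary type so that the same recursion lists edges between numbers
  and, when the graph is generated by a program, edges between expressions;
  \<open>map_gedges\<close> relates the two.\<close>

fun gedges :: "gadget \<Rightarrow> 'v \<Rightarrow> 'v \<Rightarrow> (nat \<Rightarrow> 'v) \<Rightarrow> nat \<Rightarrow> ('v \<times> 'v) list" where
  "gedges Edge u v i b = [(u, v)]"
| "gedges Loop u v i b = [(u, u)]"
| "gedges Ones u v i b = []"
| "gedges (Par g h) u v i b = gedges g u v i b @ gedges h u v i (b + gsize g)"
| "gedges (Ser g h) u v i b = gedges g u (i b) i (Suc b) @ gedges h (i b) v i (Suc (b + gsize g))"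
| "gedges (Tr g) u v i b = gedges g v u i b"

lemma map_gedges: "map (map_prod f f) (gedges g u v i b) = gedges g (f u) (f v) (f \<circ> i) b"
  by (induction g arbitrary: u v b) auto

lemma gedges_shift: "gedges g u v (\<lambda>j. c + j) b = gedges g u v (\<lambda>j. j) (c + b)"
  by (induction g arbitrary: u v b) (auto simp: add.assoc)

lemma gedges_verts:
  "(x, y) \<in> set (gedges g u v (\<lambda>j. j) b) \<Longrightarrow>
    x \<in> {u, v} \<union> {b..<b + gsize g} \<and> y \<in> {u, v} \<union> {b..<b + gsize g}"
  by (induction g arbitrary: u v b) fastforce+

definition edges_weight :: "rat \<Rightarrow> rat \<Rightarrow> (nat \<times> nat) list \<Rightarrow> (nat \<Rightarrow> bool) \<Rightarrow> rat" where
  "edges_weight \<beta> \<gamma> es \<sigma> = (\<Prod>(u, v)\<leftarrow>es. spin_weight \<beta> \<gamma> (\<sigma> u) (\<sigma> v))"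

lemma edges_weight_append [simp]:
  "edges_weight \<beta> \<gamma> (xs @ ys) = (\<lambda>\<sigma>. edges_weight \<beta> \<gamma> xs \<sigma> * edges_weight \<beta> \<gamma> ys \<sigma>)"
  by (simp add: edges_weight_def fun_eq_iff)

lemma edges_weight_cong:
  "(\<And>x y. (x, y) \<in> set es \<Longrightarrow> \<sigma> x = \<tau> x \<and> \<sigma> y = \<tau> y) \<Longrightarrow> edges_weight \<beta> \<gamma> es \<sigma> = edges_weight \<beta> \<gamma> es \<tau>"
  unfolding edges_weight_def by (intro arg_cong[of _ _ prod_list] map_cong) auto

text \<open>Summing out vertices one by one, with the spins of all other vertices kept in
  \<open>\<sigma>\<close>, allows the inner vertices of a gadget to be eliminated locally.\<close>

fun sumv :: "nat list \<Rightarrow> ((nat \<Rightarrow> bool) \<Rightarrow> rat) \<Rightarrow> (nat \<Rightarrow> bool) \<Rightarrow> rat" where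
  "sumv [] f \<sigma> = f \<sigma>"
| "sumv (v # vs) f \<sigma> = (\<Sum>x\<in>UNIV. sumv vs f (\<sigma>(v := x)))"

lemma sumv_append: "sumv (vs @ ws) f = sumv vs (sumv ws f)"
proof
  show "sumv (vs @ ws) f \<sigma> = sumv vs (sumv ws f) \<sigma>" for \<sigma>
    by (induction vs arbitrary: \<sigma>) auto
qed

lemma sumv_cong:
  "(\<And>\<tau>. (\<And>v. v \<notin> set vs \<Longrightarrow> \<tau> v = \<sigma> v) \<Longrightarrow> f \<tau> = g \<tau>) \<Longrightarrow> sumv vs f \<sigma> = sumv vs g \<sigma>"
  by (induction vs arbitrary: \<sigma>) (auto intro!: arg_cong2[of _ _ _ _ "(+)"] simp: UNIV_bool)

lemma sumv_const: "(\<And>\<tau>. (\<And>v. v \<notin> set vs \<Longrightarrow> \<tau> v = \<sigma> v) \<Longrightarrow> f \<tau> = c) \<Longrightarrow> sumv vs f \<sigma> = 2 ^ length vs * c"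
  by (induction vs arbitrary: \<sigma>) (auto simp: UNIV_bool)

lemma sumv_factor:
  assumes "\<And>\<tau>. (\<And>v. v \<notin> set vs \<Longrightarrow> \<tau> v = \<sigma> v) \<Longrightarrow> a \<tau> = a \<sigma>"
  shows "sumv vs (\<lambda>\<sigma>. a \<sigma> * f \<sigma>) \<sigma> = a \<sigma> * sumv vs f \<sigma>"
proof -
  have "sumv vs (\<lambda>\<sigma>. c * f \<sigma>) \<tau> = c * sumv vs f \<tau>" for c \<tau>
    by (induction vs arbitrary: \<tau>) (auto simp: sum_distrib_left)
  moreover have "sumv vs (\<lambda>\<sigma>. a \<sigma> * f \<sigma>) \<sigma> = sumv vs (\<lambda>\<tau>. a \<sigma> * f \<tau>) \<sigma>"
  proof (rule sumv_cong)
    fix \<tau> assume "\<And>v. v \<notin> set vs \<Longrightarrow> \<tau> v = \<sigma> v"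
    then have "a \<tau> = a \<sigma>" by (rule assms)
    then show "a \<tau> * f \<tau> = a \<sigma> * f \<tau>" by simp
  qed
  ultimately show ?thesis by simp
qed

lemma upt_append: "a \<le> b \<Longrightarrow> b \<le> c \<Longrightarrow> [a..<c] = [a..<b] @ [b..<c]"
  by (metis le_add_diff_inverse upt_add_eq_append)

lemma edges_weight_gedges_indep:
  assumes "\<And>x. x \<notin> set vs \<Longrightarrow> \<tau> x = \<sigma> x"
    and "u \<notin> set vs" "v \<notin> set vs" "{b..<b + gsize g} \<inter> set vs = {}"
  shows "edges_weight \<beta> \<gamma> (gedges g u v (\<lambda>j. j) b) \<tau> = edges_weight \<beta> \<gamma> (gedges g u v (\<lambda>j. j) b) \<sigma>"
proof (rule edges_weight_cong)
  have indep: "\<tau> z = \<sigma> z" if "z \<in> {u, v} \<union> {b..<b + gsize g}" for z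
  proof (rule assms(1))
    show "z \<notin> set vs"
      using that assms(2-4) by (auto simp: disjoint_iff)
  qed
  fix x y assume "(x, y) \<in> set (gedges g u v (\<lambda>j. j) b)"
  from gedges_verts[OF this] show "\<tau> x = \<sigma> x \<and> \<tau> y = \<sigma> y"
    by (simp only: indep)
qed

lemma sumv_factor_gedges:
  assumes "u \<notin> set vs" "v \<notin> set vs" "{b..<b + gsize g} \<inter> set vs = {}"
  shows "sumv vs (\<lambda>\<sigma>. edges_weight \<beta> \<gamma> (gedges g u v (\<lambda>j. j) b) \<sigma> * f \<sigma>) \<sigma> =
    edges_weight \<beta> \<gamma> (gedges g u v (\<lambda>j. j) b) \<sigma> * sumv vs f \<sigma>"
  by (rule sumv_factor) (rule edges_weight_gedges_indep[OF _ assms])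

lemma sumv_factor_mat:
  assumes "u \<notin> set vs" "v \<notin> set vs"
  shows "sumv vs (\<lambda>\<sigma>. mat \<beta> \<gamma> g (\<sigma> u) (\<sigma> v) * f \<sigma>) \<sigma> = mat \<beta> \<gamma> g (\<sigma> u) (\<sigma> v) * sumv vs f \<sigma>"
  using assms by (intro sumv_factor) simp

text \<open>The parts of a gadget have their inner vertices in disjoint intervals, so the weight of
  one part is a constant while the inner vertices of the other are summed out. In a series
  composition the joint \<open>b\<close> is summed last.\<close>

lemma sumv_gedges:
  assumes "u \<notin> {b..<b + gsize g}" "v \<notin> {b..<b + gsize g}"
  shows "sumv [b..<b + gsize g] (edges_weight \<beta> \<gamma> (gedges g u v (\<lambda>j. j) b)) \<sigma> = mat \<beta> \<gamma> g (\<sigma> u) (\<sigma> v)"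
  using assms
proof (induction g arbitrary: u v b \<sigma>)
  case (Par g h)
  let ?c = "b + gsize g"
  have "sumv [b..<b + gsize (Par g h)] (edges_weight \<beta> \<gamma> (gedges (Par g h) u v (\<lambda>j. j) b)) \<sigma> =
      sumv [b..<?c] (sumv [?c..<?c + gsize h] (\<lambda>\<sigma>. edges_weight \<beta> \<gamma> (gedges g u v (\<lambda>j. j) b) \<sigma> *
        edges_weight \<beta> \<gamma> (gedges h u v (\<lambda>j. j) ?c) \<sigma>)) \<sigma>"
  proof -
    have "[b..<b + gsize (Par g h)] = [b..<?c] @ [?c..<?c + gsize h]"
      using upt_append[of b ?c "?c + gsize h"] by (simp add: add.assoc)
    then show ?thesis
      by (simp only: sumv_append gedges.simps edges_weight_append)
  qed
  also have "\<dots> = sumv [b..<?c] (\<lambda>\<sigma>. mat \<beta> \<gamma> h (\<sigma> u) (\<sigma> v) * edges_weight \<beta> \<gamma> (gedges g u v (\<lambda>j. j) b) \<sigma>) \<sigma>"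
  proof (rule sumv_cong)
    fix \<tau> :: "nat \<Rightarrow> bool"
    have "sumv [?c..<?c + gsize h] (\<lambda>\<sigma>. edges_weight \<beta> \<gamma> (gedges g u v (\<lambda>j. j) b) \<sigma> *
        edges_weight \<beta> \<gamma> (gedges h u v (\<lambda>j. j) ?c) \<sigma>) \<tau> =
      edges_weight \<beta> \<gamma> (gedges g u v (\<lambda>j. j) b) \<tau> * sumv [?c..<?c + gsize h] (edges_weight \<beta> \<gamma> (gedges h u v (\<lambda>j. j) ?c)) \<tau>"
      using Par.prems
      by (intro sumv_factor_gedges) auto
    also have "sumv [?c..<?c + gsize h] (edges_weight \<beta> \<gamma> (gedges h u v (\<lambda>j. j) ?c)) \<tau> = mat \<beta> \<gamma> h (\<tau> u) (\<tau> v)"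
      using Par.prems by (intro Par.IH) auto
    finally show "sumv [?c..<?c + gsize h] (\<lambda>\<sigma>. edges_weight \<beta> \<gamma> (gedges g u v (\<lambda>j. j) b) \<sigma> *
        edges_weight \<beta> \<gamma> (gedges h u v (\<lambda>j. j) ?c) \<sigma>) \<tau> = mat \<beta> \<gamma> h (\<tau> u) (\<tau> v) * edges_weight \<beta> \<gamma> (gedges g u v (\<lambda>j. j) b) \<tau>"
      by (simp only: mult.commute)
  qed
  also have "\<dots> = mat \<beta> \<gamma> h (\<sigma> u) (\<sigma> v) * sumv [b..<?c] (edges_weight \<beta> \<gamma> (gedges g u v (\<lambda>j. j) b)) \<sigma>"
    using Par.prems by (intro sumv_factor_mat) auto
  also have "sumv [b..<?c] (edges_weight \<beta> \<gamma> (gedges g u v (\<lambda>j. j) b)) \<sigma> = mat \<beta> \<gamma> g (\<sigma> u) (\<sigma> v)"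
    using Par.prems by (intro Par.IH) auto
  finally show ?case by (simp add: mult.commute)
next
  case (Ser g h)
  let ?c = "Suc (b + gsize g)"
  have main: "sumv [Suc b..<?c + gsize h] (\<lambda>\<sigma>. edges_weight \<beta> \<gamma> (gedges g u b (\<lambda>j. j) (Suc b)) \<sigma> *
        edges_weight \<beta> \<gamma> (gedges h b v (\<lambda>j. j) ?c) \<sigma>) \<sigma> = mat \<beta> \<gamma> g (\<sigma> u) (\<sigma> b) * mat \<beta> \<gamma> h (\<sigma> b) (\<sigma> v)" for \<sigma>
  proof -
    have "sumv [Suc b..<?c + gsize h] (\<lambda>\<sigma>. edges_weight \<beta> \<gamma> (gedges g u b (\<lambda>j. j) (Suc b)) \<sigma> *
          edges_weight \<beta> \<gamma> (gedges h b v (\<lambda>j. j) ?c) \<sigma>) \<sigma> =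
        sumv [Suc b..<?c] (sumv [?c..<?c + gsize h] (\<lambda>\<sigma>. edges_weight \<beta> \<gamma> (gedges g u b (\<lambda>j. j) (Suc b)) \<sigma> *
          edges_weight \<beta> \<gamma> (gedges h b v (\<lambda>j. j) ?c) \<sigma>)) \<sigma>"
    proof -
      have "[Suc b..<?c + gsize h] = [Suc b..<?c] @ [?c..<?c + gsize h]"
        by (intro upt_append) auto
      then show ?thesis
        by (simp only: sumv_append)
    qed
    also have "\<dots> = sumv [Suc b..<?c] (\<lambda>\<sigma>. mat \<beta> \<gamma> h (\<sigma> b) (\<sigma> v) * edges_weight \<beta> \<gamma> (gedges g u b (\<lambda>j. j) (Suc b)) \<sigma>) \<sigma>"
    proof (rule sumv_cong)
      fix \<tau> :: "nat \<Rightarrow> bool"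
      have "sumv [?c..<?c + gsize h] (\<lambda>\<sigma>. edges_weight \<beta> \<gamma> (gedges g u b (\<lambda>j. j) (Suc b)) \<sigma> *
          edges_weight \<beta> \<gamma> (gedges h b v (\<lambda>j. j) ?c) \<sigma>) \<tau> =
        edges_weight \<beta> \<gamma> (gedges g u b (\<lambda>j. j) (Suc b)) \<tau> * sumv [?c..<?c + gsize h] (edges_weight \<beta> \<gamma> (gedges h b v (\<lambda>j. j) ?c)) \<tau>"
        using Ser.prems
        by (intro sumv_factor_gedges) auto
      also have "sumv [?c..<?c + gsize h] (edges_weight \<beta> \<gamma> (gedges h b v (\<lambda>j. j) ?c)) \<tau> = mat \<beta> \<gamma> h (\<tau> b) (\<tau> v)"
        using Ser.prems by (intro Ser.IH) auto
      finally show "sumv [?c..<?c + gsize h] (\<lambda>\<sigma>. edges_weight \<beta> \<gamma> (gedges g u b (\<lambda>j. j) (Suc b)) \<sigma> *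
          edges_weight \<beta> \<gamma> (gedges h b v (\<lambda>j. j) ?c) \<sigma>) \<tau> =
          mat \<beta> \<gamma> h (\<tau> b) (\<tau> v) * edges_weight \<beta> \<gamma> (gedges g u b (\<lambda>j. j) (Suc b)) \<tau>"
        by (simp only: mult.commute)
    qed
    also have "\<dots> = mat \<beta> \<gamma> h (\<sigma> b) (\<sigma> v) * sumv [Suc b..<?c] (edges_weight \<beta> \<gamma> (gedges g u b (\<lambda>j. j) (Suc b))) \<sigma>"
      using Ser.prems by (intro sumv_factor_mat) auto
    also have "sumv [Suc b..<?c] (edges_weight \<beta> \<gamma> (gedges g u b (\<lambda>j. j) (Suc b))) \<sigma> = mat \<beta> \<gamma> g (\<sigma> u) (\<sigma> b)"
    proof -
      have "u \<notin> {Suc b..<Suc b + gsize g}" "b \<notin> {Suc b..<Suc b + gsize g}"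
        using Ser.prems by auto
      from Ser.IH(1)[OF this] show ?thesis by (simp del: upt_Suc)
    qed
    finally show ?thesis by simp
  qed
  have "[b..<b + gsize (Ser g h)] = b # [Suc b..<?c + gsize h]"
    by (simp add: upt_conv_Cons add.assoc del: upt_Suc)
  moreover have "u \<noteq> b" "v \<noteq> b"
    using Ser.prems by auto
  ultimately show ?case
    using main[of "\<sigma>(b := False)"] main[of "\<sigma>(b := True)"] by (simp add: UNIV_bool del: upt_Suc)
next
  case (Tr g)
  then show ?case using Tr.IH[of v b u \<sigma>] by simp
qed (auto simp: edges_weight_def)

subsection \<open>Placing gadgets in a graph\<close>

type_synonym placement = "gadget \<times> nat \<times> nat \<times> nat"

definition place_edges :: "placement \<Rightarrow> (nat \<times> nat) list" where
  "place_edges = (\<lambda>(g, u, v, b). gedges g u v (\<lambda>j. j) b)"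

definition place_mat :: "rat \<Rightarrow> rat \<Rightarrow> placement \<Rightarrow> (nat \<Rightarrow> bool) \<Rightarrow> rat" where
  "place_mat \<beta> \<gamma> = (\<lambda>(g, u, v, b) \<sigma>. mat \<beta> \<gamma> g (\<sigma> u) (\<sigma> v))"

fun chain :: "nat \<Rightarrow> placement list \<Rightarrow> nat \<Rightarrow> bool" where
  "chain lo [] hi \<longleftrightarrow> lo \<le> hi"
| "chain lo ((g, u, v, b) # ps) hi \<longleftrightarrow> lo \<le> b \<and> chain (b + gsize g) ps hi"

lemma chain_le: "chain lo ps hi \<Longrightarrow> lo \<le> hi"
  by (induction lo ps hi rule: chain.induct) auto

lemma chain_append: "chain lo ps mid \<Longrightarrow> chain mid qs hi \<Longrightarrow> chain lo (ps @ qs) hi"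
proof (induction lo ps mid rule: chain.induct)
  case (1 lo mid)
  then show ?case by (cases qs) auto
qed auto

lemma chain_concat:
  assumes "\<And>i. i < n \<Longrightarrow> chain (lo + i * s) (f i) (lo + Suc i * s)"
  shows "chain lo (concat (map f [0..<n])) (lo + n * s)"
  using assms
proof (induction n)
  case (Suc n)
  then have "chain lo (concat (map f [0..<n])) (lo + n * s)" by simp
  with Suc.prems[of n] show ?case
    by (auto intro: chain_append)
qed auto

lemma place_mat_cong: "(\<And>g u v b. p = (g, u, v, b) \<Longrightarrow> \<sigma> u = \<tau> u \<and> \<sigma> v = \<tau> v) \<Longrightarrow>
    place_mat \<beta> \<gamma> p \<sigma> = place_mat \<beta> \<gamma> p \<tau>"
  by (cases p) (auto simp: place_mat_def)

text \<open>The blocks of a chain are disjoint and are eliminated one after another. A chain may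
  have gaps; vertices in gaps are isolated and contribute a factor 2 each. The exponent does not
  depend on \<open>\<sigma>\<close>, so it cannot affect the sign.\<close>

lemma sumv_chain:
  assumes "chain lo ps hi" "\<And>g u v b. (g, u, v, b) \<in> set ps \<Longrightarrow> u < V \<and> v < V" "V \<le> lo"
  shows "\<exists>k. \<forall>\<sigma>. sumv [lo..<hi] (edges_weight \<beta> \<gamma> (concat (map place_edges ps))) \<sigma> =
    2 ^ k * (\<Prod>p\<leftarrow>ps. place_mat \<beta> \<gamma> p \<sigma>)"
  using assms
proof (induction lo ps hi rule: chain.induct)
  case (1 lo hi)
  show ?case
    by (rule exI[of _ "hi - lo"]) (simp add: sumv_const[where c = 1] edges_weight_def)
next
  case (2 lo g u v b ps hi)
  let ?c = "b + gsize g" and ?E = "edges_weight \<beta> \<gamma> (concat (map place_edges ps))"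
  let ?G = "edges_weight \<beta> \<gamma> (gedges g u v (\<lambda>j. j) b)"
  let ?P = "\<lambda>\<tau>. \<Prod>p\<leftarrow>ps. place_mat \<beta> \<gamma> p \<tau>"
  have le: "lo \<le> b" "?c \<le> hi" "u < V" "v < V" "V \<le> lo"
    using "2.prems" chain_le by auto
  have ps: "u' < V \<and> v' < V" if "(g', u', v', b') \<in> set ps" for g' u' v' b'
    using that 2(3)[of g' u' v' b'] by auto
  obtain k where k: "\<And>\<tau>. sumv [?c..<hi] ?E \<tau> = 2 ^ k * ?P \<tau>"
  proof -
    have "chain ?c ps hi" "V \<le> ?c" using 2(2) le by auto
    from 2(1)[OF this(1) _ this(2)] ps show ?thesis using that by blast
  qed
  have P: "?P \<tau> = ?P \<sigma>" if "\<And>v. v < V \<Longrightarrow> \<tau> v = \<sigma> v" for \<sigma> \<tau>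
    using ps that by (intro arg_cong[of _ _ prod_list] map_cong refl place_mat_cong) auto
  have "sumv [lo..<hi] (\<lambda>\<sigma>. ?G \<sigma> * ?E \<sigma>) \<sigma> = 2 ^ (b - lo + k) * (mat \<beta> \<gamma> g (\<sigma> u) (\<sigma> v) * ?P \<sigma>)" for \<sigma>
  proof -
    have "sumv [lo..<hi] (\<lambda>\<sigma>. ?G \<sigma> * ?E \<sigma>) \<sigma> =
        sumv [lo..<b] (sumv [b..<?c] (sumv [?c..<hi] (\<lambda>\<sigma>. ?G \<sigma> * ?E \<sigma>))) \<sigma>"
      using le by (simp add: upt_append[of lo b hi] upt_append[of b ?c hi] sumv_append)
    also have "\<dots> = sumv [lo..<b] (\<lambda>\<tau>. 2 ^ k * (mat \<beta> \<gamma> g (\<tau> u) (\<tau> v) * ?P \<tau>)) \<sigma>"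
    proof (rule sumv_cong)
      fix \<tau> :: "nat \<Rightarrow> bool"
      have "sumv [b..<?c] (sumv [?c..<hi] (\<lambda>\<sigma>. ?G \<sigma> * ?E \<sigma>)) \<tau> = sumv [b..<?c] (\<lambda>\<sigma>. (2 ^ k * ?P \<sigma>) * ?G \<sigma>) \<tau>"
      proof (rule sumv_cong)
        fix \<tau> :: "nat \<Rightarrow> bool"
        have "sumv [?c..<hi] (\<lambda>\<sigma>. ?G \<sigma> * ?E \<sigma>) \<tau> = ?G \<tau> * sumv [?c..<hi] ?E \<tau>"
          using le by (intro sumv_factor_gedges) auto
        then show "sumv [?c..<hi] (\<lambda>\<sigma>. ?G \<sigma> * ?E \<sigma>) \<tau> = 2 ^ k * ?P \<tau> * ?G \<tau>"
          by (simp add: k)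
      qed
      also have "\<dots> = (2 ^ k * ?P \<tau>) * sumv [b..<?c] ?G \<tau>"
        using le by (intro sumv_factor arg_cong[of _ _ "\<lambda>x. 2 ^ k * x"] P) auto
      also have "sumv [b..<?c] ?G \<tau> = mat \<beta> \<gamma> g (\<tau> u) (\<tau> v)"
        using le by (intro sumv_gedges) auto
      finally show "sumv [b..<?c] (sumv [?c..<hi] (\<lambda>\<sigma>. ?G \<sigma> * ?E \<sigma>)) \<tau> =
          2 ^ k * (mat \<beta> \<gamma> g (\<tau> u) (\<tau> v) * ?P \<tau>)"
        by simp
    qed
    also have "\<dots> = 2 ^ length [lo..<b] * (2 ^ k * (mat \<beta> \<gamma> g (\<sigma> u) (\<sigma> v) * ?P \<sigma>))"
    proof (rule sumv_const)
      fix \<tau> assume *: "\<And>v. v \<notin> set [lo..<b] \<Longrightarrow> \<tau> v = \<sigma> v"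
      have "\<tau> u = \<sigma> u" "\<tau> v = \<sigma> v" "?P \<tau> = ?P \<sigma>"
        using le by (auto intro!: * P)
      then show "2 ^ k * (mat \<beta> \<gamma> g (\<tau> u) (\<tau> v) * ?P \<tau>) = 2 ^ k * (mat \<beta> \<gamma> g (\<sigma> u) (\<sigma> v) * ?P \<sigma>)"
        by simp
    qed
    finally show ?thesis by (simp add: power_add)
  qed
  then show ?case
    by (intro exI[of _ "b - lo + k"]) (simp add: place_edges_def place_mat_def)
qed

subsection \<open>The partition function of a coded graph\<close>

text \<open>Fixing the value False outside the graph makes the functions unique representatives and
  the set finite.\<close>

definition assignments :: "nat \<Rightarrow> (nat \<Rightarrow> bool) set" where
  "assignments n = {\<sigma>. \<forall>v. \<sigma> v \<longrightarrow> v < n}"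

lemma assignments_Suc:
  "assignments (Suc n) = assignments n \<union> (\<lambda>\<sigma>. \<sigma>(n := True)) ` assignments n"
proof (intro set_eqI iffI)
  fix \<sigma> assume \<sigma>: "\<sigma> \<in> assignments (Suc n)"
  show "\<sigma> \<in> assignments n \<union> (\<lambda>\<sigma>. \<sigma>(n := True)) ` assignments n"
  proof (cases "\<sigma> n")
    case True
    then have "\<sigma> = (\<sigma>(n := False))(n := True)" by (auto simp: fun_eq_iff)
    moreover have "\<sigma>(n := False) \<in> assignments n"
      using \<sigma> by (auto simp: assignments_def less_Suc_eq)
    ultimately show ?thesis by blast
  next
    case False
    then have "v < n" if "\<sigma> v" for v
      using \<sigma> that by (cases "v = n") (auto simp: assignments_def less_Suc_eq)
    then show ?thesis by (simp add: assignments_def)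
  qed
next
  fix \<sigma> assume "\<sigma> \<in> assignments n \<union> (\<lambda>\<sigma>. \<sigma>(n := True)) ` assignments n"
  then show "\<sigma> \<in> assignments (Suc n)"
    by (auto simp: assignments_def less_Suc_eq split: if_splits)
qed

lemma finite_assignments [simp]: "finite (assignments n)"
proof (induction n)
  case 0
  have "assignments 0 = {\<lambda>_. False}" by (auto simp: assignments_def)
  then show ?case by simp
qed (simp add: assignments_Suc)

lemma sumv_assignments: "sumv [0..<n] f (\<lambda>_. False) = sum f (assignments n)"
proof (induction n arbitrary: f)
  case 0
  have "assignments 0 = {\<lambda>_. False}" by (auto simp: assignments_def)
  then show ?case by simp
next
  case (Suc n)
  have "sumv [0..<Suc n] f (\<lambda>_. False) = sumv [0..<n] (\<lambda>\<sigma>. \<Sum>x\<in>UNIV. f (\<sigma>(n := x))) (\<lambda>_. False)"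
  proof -
    have "sumv [n] f = (\<lambda>\<sigma>. \<Sum>x\<in>UNIV. f (\<sigma>(n := x)))"
      by (simp add: fun_eq_iff)
    then show ?thesis by (simp add: sumv_append)
  qed
  also have "\<dots> = (\<Sum>\<sigma>\<in>assignments n. f (\<sigma>(n := False)) + f (\<sigma>(n := True)))"
    by (simp add: Suc UNIV_bool)
  also have "\<dots> = (\<Sum>\<sigma>\<in>assignments n. f \<sigma>) + (\<Sum>\<sigma>\<in>assignments n. f (\<sigma>(n := True)))"
  proof -
    have "\<sigma>(n := False) = \<sigma>" if "\<sigma> \<in> assignments n" for \<sigma>
      using that by (auto simp: assignments_def fun_eq_iff)
    then show ?thesis by (simp add: sum.distrib)
  qed
  also have "(\<Sum>\<sigma>\<in>assignments n. f (\<sigma>(n := True))) = sum f ((\<lambda>\<sigma>. \<sigma>(n := True)) ` assignments n)"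
  proof (rule sum.reindex_cong[symmetric])
    show "inj_on (\<lambda>\<sigma>. \<sigma>(n := True)) (assignments n)"
    proof (rule inj_onI)
      fix \<sigma> \<tau> assume *: "\<sigma> \<in> assignments n" "\<tau> \<in> assignments n" "\<sigma>(n := True) = \<tau>(n := True)"
      then have "\<not> \<sigma> n" "\<not> \<tau> n" by (auto simp: assignments_def)
      moreover have "\<sigma> x = \<tau> x" if "x \<noteq> n" for x
        using fun_cong[OF *(3), of x] that by simp
      ultimately show "\<sigma> = \<tau>" by (intro ext) metis
    qed
  qed auto
  also have "(\<Sum>\<sigma>\<in>assignments n. f \<sigma>) + sum f ((\<lambda>\<sigma>. \<sigma>(n := True)) ` assignments n) =
      sum f (assignments (Suc n))"
    unfolding assignments_Suc
  proof (rule sum.union_disjoint[symmetric])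
    show "assignments n \<inter> (\<lambda>\<sigma>. \<sigma>(n := True)) ` assignments n = {}"
      unfolding assignments_def by (fastforce dest: spec[of _ n])
  qed auto
  finally show ?case .
qed

lemma card_assignments: "card (assignments n) = 2 ^ n"
proof -
  have "of_nat (card (assignments n)) = sumv [0..<n] (\<lambda>_. 1) (\<lambda>_. False)"
    by (simp add: sumv_assignments)
  also have "\<dots> = 2 ^ n"
    using sumv_const[of "[0..<n]" "\<lambda>_. False" "\<lambda>_. 1" 1] by simp
  finally show ?thesis
    by (metis of_nat_eq_iff of_nat_numeral of_nat_power)
qed

definition coded_graph :: "nat \<Rightarrow> (nat \<times> nat) list \<Rightarrow> nat multigraph" where
  "coded_graph n es = \<lparr>verts = {..<n}, edges = mset (map (\<lambda>(u, v). Upair u v) es)\<rparr>"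

lemma encodes_coded_graph:
  assumes "\<And>u v. (u, v) \<in> set es \<Longrightarrow> u < n \<and> v < n"
  shows "encodes (graph_code n es) (coded_graph n es)"
  using assms unfolding encodes_def coded_graph_def wf_multigraph_def by auto

lemma partition_function_coded_graph:
  assumes "\<And>u v. (u, v) \<in> set es \<Longrightarrow> u < n \<and> v < n"
  shows "partition_function \<beta> \<gamma> (coded_graph n es) = sum (edges_weight \<beta> \<gamma> es) (assignments n)"
proof -
  have "(\<Prod>e\<in>#mset (map (\<lambda>(u, v). Upair u v) es). edge_weight \<beta> \<gamma> \<sigma> e) =
      (\<Prod>(u, v)\<leftarrow>es. edge_weight \<beta> \<gamma> \<sigma> (Upair u v))" for \<sigma>
    by (induction es) auto
  then have "partition_function \<beta> \<gamma> (coded_graph n es) =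
      (\<Sum>\<sigma>\<in>{..<n} \<rightarrow>\<^sub>E {0, 1}. \<Prod>(u, v)\<leftarrow>es. edge_weight \<beta> \<gamma> \<sigma> (Upair u v))"
    by (simp only: partition_function_def coded_graph_def multigraph.simps)
  also have "\<dots> = sum (edges_weight \<beta> \<gamma> es) (assignments n)"
  proof (rule sum.reindex_bij_witness[of _ "\<lambda>\<tau>. \<lambda>v\<in>{..<n}. of_bool (\<tau> v)" "\<lambda>\<sigma> v. v < n \<and> \<sigma> v = 1"])
    fix \<sigma> :: "nat \<Rightarrow> nat" assume \<sigma>: "\<sigma> \<in> {..<n} \<rightarrow>\<^sub>E {0, 1}"
    have 01: "\<sigma> v = 0 \<or> \<sigma> v = 1" if "v < n" for v
      using PiE_mem[OF \<sigma>, of v] that by auto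
    show "(\<lambda>v\<in>{..<n}. of_bool (v < n \<and> \<sigma> v = 1)) = \<sigma>"
    proof
      fix v
      show "(\<lambda>v\<in>{..<n}. of_bool (v < n \<and> \<sigma> v = 1)) v = \<sigma> v"
        using 01[of v] PiE_arb[OF \<sigma>, of v] by (cases "v < n") auto
    qed
    show "edges_weight \<beta> \<gamma> es (\<lambda>v. v < n \<and> \<sigma> v = 1) = (\<Prod>(u, v)\<leftarrow>es. edge_weight \<beta> \<gamma> \<sigma> (Upair u v))"
      unfolding edges_weight_def
    proof (intro arg_cong[of _ _ prod_list] map_cong refl, clarify)
      fix u v assume "(u, v) \<in> set es"
      then have "u < n" "v < n" using assms by auto
      then show "spin_weight \<beta> \<gamma> (u < n \<and> \<sigma> u = 1) (v < n \<and> \<sigma> v = 1) = edge_weight \<beta> \<gamma> \<sigma> (Upair u v)"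
        using 01[of u] 01[of v] by (auto simp: spin_weight_def edge_weight_Upair)
    qed
  qed (auto simp: assignments_def fun_eq_iff)
  finally show ?thesis .
qed

lemma sum_edges_weight_swap:
  assumes "\<And>u v. (u, v) \<in> set es \<Longrightarrow> u < n \<and> v < n"
  shows "sum (edges_weight \<beta> \<gamma> es) (assignments n) = sum (edges_weight \<gamma> \<beta> es) (assignments n)"
proof (rule sum.reindex_bij_witness[of _ "\<lambda>\<sigma> v. v < n \<and> \<not> \<sigma> v" "\<lambda>\<sigma> v. v < n \<and> \<not> \<sigma> v"])
  fix \<sigma>
  show "edges_weight \<gamma> \<beta> es (\<lambda>v. v < n \<and> \<not> \<sigma> v) = edges_weight \<beta> \<gamma> es \<sigma>"
    unfolding edges_weight_def
  proof (intro arg_cong[of _ _ prod_list] map_cong refl, clarify)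
    fix u v assume "(u, v) \<in> set es"
    then show "spin_weight \<gamma> \<beta> (u < n \<and> \<not> \<sigma> u) (v < n \<and> \<not> \<sigma> v) = spin_weight \<beta> \<gamma> (\<sigma> u) (\<sigma> v)"
      using assms by (simp add: spin_weight_def)
  qed
qed (auto simp: assignments_def fun_eq_iff)

lemma sign_problem_swap: "sign_problem \<beta> \<gamma> = sign_problem \<gamma> \<beta>"
proof -
  have "partition_function \<beta> \<gamma> G = partition_function \<gamma> \<beta> G" if enc: "encodes w G" for w G
  proof -
    obtain n es where G: "verts G = {..<n}" "edges G = mset (map (\<lambda>(u, v). Upair u v) es)" "wf_multigraph G"
      using enc unfolding encodes_def by metis
    have "G = coded_graph n es"
      using G by (auto simp: coded_graph_def intro: multigraph.equality)
    moreover have "u < n \<and> v < n" if "(u, v) \<in> set es" for u v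
      using G that by (fastforce simp: wf_multigraph_def)
    ultimately show ?thesis
      by (simp add: partition_function_coded_graph sum_edges_weight_swap)
  qed
  then show ?thesis
    unfolding sign_problem_def by (intro Collect_cong iff_exI) metis
qed

text \<open>The terminals are numbered below \<open>V\<close> and all inner vertices from
  \<open>V\<close> on; summing out the latter leaves a sum over the terminals, up to a power of
  2.\<close>

theorem partition_function_placements:
  assumes "chain V ps n" "\<And>g u v b. (g, u, v, b) \<in> set ps \<Longrightarrow> u < V \<and> v < V"
  defines "es \<equiv> concat (map place_edges ps)"
  shows "encodes (graph_code n es) (coded_graph n es)"
    and "sgn (partition_function \<beta> \<gamma> (coded_graph n es)) =
      sgn (\<Sum>\<sigma>\<in>assignments V. \<Prod>p\<leftarrow>ps. place_mat \<beta> \<gamma> p \<sigma>)"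
proof -
  have bound: "b + gsize g \<le> hi" if "chain lo qs hi" "(g, u, v, b) \<in> set qs" for lo qs hi g u v b
    using that
  proof (induction lo qs hi rule: chain.induct)
    case (2 lo g' u' v' b' ps hi)
    then show ?case using chain_le by auto
  qed auto
  have V: "V \<le> n" using assms(1) chain_le by blast
  have es: "x < n \<and> y < n" if "(x, y) \<in> set es" for x y
  proof -
    obtain p where p: "p \<in> set ps" "(x, y) \<in> set (place_edges p)"
      using \<open>(x, y) \<in> set es\<close> unfolding es_def by auto
    obtain g u v b where "p = (g, u, v, b)" by (cases p)
    with p have *: "(g, u, v, b) \<in> set ps" "(x, y) \<in> set (gedges g u v (\<lambda>j. j) b)"
      by (simp_all add: place_edges_def)
    then show ?thesis
      using assms(2)[OF *(1)] bound[OF assms(1) *(1)] V gedges_verts[OF *(2)] by auto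
  qed
  show "encodes (graph_code n es) (coded_graph n es)"
    using es by (rule encodes_coded_graph)
  obtain k where k: "\<And>\<sigma>. sumv [V..<n] (edges_weight \<beta> \<gamma> es) \<sigma> = 2 ^ k * (\<Prod>p\<leftarrow>ps. place_mat \<beta> \<gamma> p \<sigma>)"
    using sumv_chain[OF assms(1), of V] assms(2) unfolding es_def by blast
  have "partition_function \<beta> \<gamma> (coded_graph n es) = sumv [0..<n] (edges_weight \<beta> \<gamma> es) (\<lambda>_. False)"
    using es by (simp add: partition_function_coded_graph sumv_assignments)
  also have "\<dots> = sumv [0..<V] (sumv [V..<n] (edges_weight \<beta> \<gamma> es)) (\<lambda>_. False)"
    using V upt_append[of 0 V n] by (simp add: sumv_append)
  also have "\<dots> = 2 ^ k * (\<Sum>\<sigma>\<in>assignments V. \<Prod>p\<leftarrow>ps. place_mat \<beta> \<gamma> p \<sigma>)"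
    by (simp add: k[abs_def] sumv_assignments sum_distrib_left)
  finally show "sgn (partition_function \<beta> \<gamma> (coded_graph n es)) =
      sgn (\<Sum>\<sigma>\<in>assignments V. \<Prod>p\<leftarrow>ps. place_mat \<beta> \<gamma> p \<sigma>)"
    by (simp add: sgn_mult)
qed

section \<open>Existence of gadgets\<close>

lemma rat_power_unbounded: "(1::rat) < x \<Longrightarrow> \<exists>n. y < x ^ n"
proof -
  assume x: "1 < x"
  have bern: "1 + of_nat n * (x - 1) \<le> x ^ n" for n
  proof (induction n)
    case (Suc n)
    have "0 \<le> of_nat n * (x - 1) ^ 2" by simp
    then have "1 + of_nat (Suc n) * (x - 1) \<le> (1 + of_nat n * (x - 1)) * x"
      by (simp add: algebra_simps power2_eq_square)
    also have "\<dots> \<le> x ^ n * x"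
      using Suc x by (intro mult_right_mono) auto
    finally show ?case by (simp add: mult.commute)
  qed auto
  obtain n where "y / (x - 1) < of_nat n"
    using reals_Archimedean2 by blast
  then have "y < of_nat n * (x - 1)"
    using x by (simp add: field_simps)
  then show ?thesis
    using bern[of n] by (intro exI[of _ n]) linarith
qed

lemma rat_power_small: "(0::rat) < x \<Longrightarrow> x < 1 \<Longrightarrow> 0 < e \<Longrightarrow> \<exists>n. x ^ n < e"
  using rat_power_unbounded[of "1 / x" "1 / e"] by (auto simp: field_simps power_divide)

lemma least_natE:
  assumes "\<exists>n. P n"
  obtains "P 0" | m where "P (Suc m)" "\<not> P m"
  using assms by (metis not0_implies_Suc LeastI Suc_n_not_le_n Least_le)

text \<open>For large \<open>m\<close> the ratio of the ends of the interval from
  \<open>x ^ m\<close> to \<open>y ^ m\<close> exceeds the step \<open>p\<close>, respectively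
  \<open>1 / q\<close>. If \<open>y > 1\<close>, the first power of \<open>p\<close> above the lower
  end cannot jump over the interval; otherwise the interval lies below 1 and is hit by the first
  power of \<open>q\<close> under its upper end.\<close>

lemma power_between:
  fixes x y p q :: rat
  assumes "0 < x" "x < y" "1 < p" "0 < q" "q < 1"
  shows "\<exists>m i. (x ^ m < p ^ i \<and> p ^ i < y ^ m) \<or> (x ^ m < q ^ i \<and> q ^ i < y ^ m)"
proof (cases "1 < y")
  case True
  obtain m where m: "p < (y / x) ^ m"
    using rat_power_unbounded[of "y / x" p] assms by auto
  have pm: "p * x ^ m < y ^ m"
    using m assms by (simp add: power_divide field_simps)
  have "m \<noteq> 0" using m assms by (metis power_0 less_asym)
  then have y: "1 < y ^ m" using True by simp
  have "\<exists>i. x ^ m < p ^ i" using rat_power_unbounded assms by blast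
  then show ?thesis
  proof (cases rule: least_natE)
    case 1
    then show ?thesis using y by (intro exI[of _ m] exI[of _ 0]) simp
  next
    case (2 i)
    then have "p ^ Suc i \<le> p * x ^ m" using assms by (simp add: mult_left_mono)
    then show ?thesis using 2 pm by (intro exI[of _ m] exI[of _ "Suc i"]) linarith
  qed
next
  case False
  obtain m where m: "1 / q < (y / x) ^ m"
    using rat_power_unbounded[of "y / x" "1 / q"] assms by auto
  have qm: "x ^ m < q * y ^ m"
    using m assms by (simp add: power_divide field_simps)
  have y: "0 < y ^ m" "y ^ m \<le> 1"
    using False assms by (auto intro: power_le_one)
  have "\<exists>i. q ^ i < y ^ m" using rat_power_small assms y by blast
  then show ?thesis
  proof (cases rule: least_natE)
    case 1
    then show ?thesis using y by simp
  next
    case (2 i)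
    then have "q * y ^ m \<le> q ^ Suc i" using assms by (simp add: mult_left_mono)
    then show ?thesis using 2 qm by (intro exI[of _ m] exI[of _ "Suc i"]) linarith
  qed
qed

section \<open>External fields: the ratio of the weights of the two spins that a gadget induces at
  its first terminal\<close>

definition field :: "rat \<Rightarrow> rat \<Rightarrow> rat \<Rightarrow> bool" where
  "field \<beta> \<gamma> r \<longleftrightarrow> (\<exists>g c. c \<noteq> 0 \<and> (\<forall>y. mat \<beta> \<gamma> g False y = c \<and> mat \<beta> \<gamma> g True y = c * r))"

lemma field_one: "field \<beta> \<gamma> 1"
  unfolding field_def by (intro exI[of _ Ones] exI[of _ 1]) auto

lemma field_loop: "\<beta> \<noteq> 0 \<Longrightarrow> field \<beta> \<gamma> (\<gamma> / \<beta>)"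
  unfolding field_def by (intro exI[of _ Loop] exI[of _ \<beta>]) (auto simp: spin_weight_def)

lemma field_mult: "field \<beta> \<gamma> r \<Longrightarrow> field \<beta> \<gamma> s \<Longrightarrow> field \<beta> \<gamma> (r * s)"
proof -
  assume r: "field \<beta> \<gamma> r" and s: "field \<beta> \<gamma> s"
  obtain g c where g: "c \<noteq> 0" "\<forall>y. mat \<beta> \<gamma> g False y = c \<and> mat \<beta> \<gamma> g True y = c * r"
    using r unfolding field_def by metis
  obtain h d where h: "d \<noteq> 0" "\<forall>y. mat \<beta> \<gamma> h False y = d \<and> mat \<beta> \<gamma> h True y = d * s"
    using s unfolding field_def by metis
  show ?thesis
    unfolding field_def using g h by (intro exI[of _ "Par g h"] exI[of _ "c * d"]) auto
qed

lemma field_power: "field \<beta> \<gamma> r \<Longrightarrow> field \<beta> \<gamma> (r ^ n)"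
  by (induction n) (simp_all add: field_one field_mult)

text \<open>Attaching by one edge a vertex that feels the field \<open>r\<close> applies the matrix
  \<open>A\<close> to the vector (1, r). On ratios this is the Moebius map given by
  \<open>A\<close>.\<close>

lemma field_pendant:
  assumes "field \<beta> \<gamma> r" "\<beta> + r \<noteq> 0"
  shows "field \<beta> \<gamma> ((1 + \<gamma> * r) / (\<beta> + r))"
proof -
  obtain g c where g: "c \<noteq> 0" "\<forall>y. mat \<beta> \<gamma> g False y = c \<and> mat \<beta> \<gamma> g True y = c * r"
    using assms unfolding field_def by blast
  have "mat \<beta> \<gamma> (Ser Edge g) False y = c * (\<beta> + r)" "mat \<beta> \<gamma> (Ser Edge g) True y = c * (1 + \<gamma> * r)" for y
    using g by (auto simp: spin_weight_def UNIV_bool algebra_simps)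
  moreover have "c * (\<beta> + r) * ((1 + \<gamma> * r) / (\<beta> + r)) = c * (1 + \<gamma> * r)"
    using assms(2) by simp
  ultimately show ?thesis
    using assms(2) g(1) unfolding field_def
    by (intro exI[of _ "Ser Edge g"] exI[of _ "c * (\<beta> + r)"]) auto
qed

text \<open>If |\<gamma>| < |\<beta>|, a loop gives the field. Otherwise \<gamma> \<ge> -\<beta> >
  0, and one pendant step from \<gamma>/\<beta> gives
  \<open>(\<beta> + \<gamma> ^ 2) / (\<beta> ^ 2 + \<gamma>)\<close>, which is below 1 since
  \<open>(\<gamma> - \<beta>) * (\<gamma> + \<beta> - 1) < 0\<close>. In both cases the field found
  may vanish, and then 0 is a new starting point.\<close>

lemma field_small:
  assumes "\<beta> < \<gamma>" "\<beta> < 0" "-2 < \<beta> + \<gamma>" "\<beta> + \<gamma> < 1" "(\<beta>, \<gamma>) \<noteq> (-1, 1)"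
  shows "\<exists>r. field \<beta> \<gamma> r \<and> 0 < \<bar>r\<bar> \<and> \<bar>r\<bar> < 1"
proof -
  have loop: "field \<beta> \<gamma> (\<gamma> / \<beta>)"
    using assms by (intro field_loop) auto
  \<comment> \<open>Two pendant steps from the field 0: it is sent to \<open>1 / \<beta>\<close> and
    then to \<open>(\<beta> + \<gamma>) / (\<beta> ^ 2 + 1)\<close>.\<close>
  have zero: ?thesis if "field \<beta> \<gamma> 0" "\<beta> + \<gamma> \<noteq> 0" "\<bar>\<beta> + \<gamma>\<bar> < \<beta> ^ 2 + 1"
  proof -
    have "field \<beta> \<gamma> (1 / \<beta>)"
      using field_pendant[OF that(1)] assms by simp
    moreover have "\<beta> + 1 / \<beta> \<noteq> 0"
      using assms by (simp add: field_simps) (metis add_less_cancel_left add_pos_pos less_asym mult_neg_neg zero_less_one)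
    ultimately have "field \<beta> \<gamma> ((1 + \<gamma> * (1 / \<beta>)) / (\<beta> + 1 / \<beta>))"
      by (rule field_pendant)
    moreover have "(1 + \<gamma> * (1 / \<beta>)) / (\<beta> + 1 / \<beta>) = (\<beta> + \<gamma>) / (\<beta> ^ 2 + 1)"
    proof -
      have "1 + \<gamma> * (1 / \<beta>) = (\<beta> + \<gamma>) / \<beta>" "\<beta> + 1 / \<beta> = (\<beta> ^ 2 + 1) / \<beta>"
        using assms by (auto simp: field_simps power2_eq_square)
      then show ?thesis using assms by simp
    qed
    moreover have "0 < \<bar>(\<beta> + \<gamma>) / (\<beta> ^ 2 + 1)\<bar>" "\<bar>(\<beta> + \<gamma>) / (\<beta> ^ 2 + 1)\<bar> < 1"
      using that by (auto simp: abs_divide add_nonneg_pos zero_less_divide_iff)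
    ultimately show ?thesis by auto
  qed
  consider "\<gamma> = 0" | "\<gamma> \<noteq> 0" "\<bar>\<gamma>\<bar> < \<bar>\<beta>\<bar>" | "-\<beta> \<le> \<gamma>" using assms by linarith
  then show ?thesis
  proof cases
    case 1
    have "\<bar>\<beta>\<bar> < \<beta> ^ 2 + 1"
    proof -
      have "0 \<le> (\<bar>\<beta>\<bar> - 1) ^ 2" by simp
      then have "2 * \<bar>\<beta>\<bar> \<le> \<beta> ^ 2 + 1" by (simp add: power2_diff)
      then show ?thesis using assms by linarith
    qed
    then show ?thesis using zero loop 1 assms by simp
  next
    case 2
    then have "0 < \<bar>\<gamma>\<bar> / \<bar>\<beta>\<bar>" "\<bar>\<gamma>\<bar> / \<bar>\<beta>\<bar> < 1"
      by (auto simp: divide_less_eq_1 intro!: divide_pos_pos)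
    then show ?thesis using loop by (intro exI[of _ "\<gamma> / \<beta>"]) (simp only: abs_divide simp_thms)
  next
    case 3
    let ?r = "(\<beta> + \<gamma> ^ 2) / (\<beta> ^ 2 + \<gamma>)"
    have pos: "0 < \<beta> ^ 2 + \<gamma>" using assms 3 by (simp add: add_nonneg_pos)
    have "\<beta> + \<gamma> / \<beta> \<noteq> 0"
      using pos assms by (simp add: field_simps power2_eq_square)
    then have "field \<beta> \<gamma> ((1 + \<gamma> * (\<gamma> / \<beta>)) / (\<beta> + \<gamma> / \<beta>))"
      by (rule field_pendant[OF loop])
    moreover have "(1 + \<gamma> * (\<gamma> / \<beta>)) / (\<beta> + \<gamma> / \<beta>) = ?r"
    proof -
      have "1 + \<gamma> * (\<gamma> / \<beta>) = (\<beta> + \<gamma> ^ 2) / \<beta>" "\<beta> + \<gamma> / \<beta> = (\<beta> ^ 2 + \<gamma>) / \<beta>"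
        using assms by (auto simp: field_simps power2_eq_square)
      then show ?thesis using assms by simp
    qed
    ultimately have r: "field \<beta> \<gamma> ?r" by simp
    show ?thesis
    proof (cases "\<beta> + \<gamma> ^ 2 = 0")
      case True
      \<comment> \<open>Together with \<open>\<beta> + \<gamma> ^ 2 = 0\<close> this would leave
        only the excluded pair (-1, 1).\<close>
      have "\<beta> + \<gamma> \<noteq> 0"
      proof
        assume "\<beta> + \<gamma> = 0"
        then have "\<gamma> ^ 2 = \<gamma>" using True by linarith
        then have "\<gamma> = 1" using assms 3 by (auto simp: power2_eq_square)
        then show False using \<open>\<beta> + \<gamma> = 0\<close> assms by auto
      qed
      moreover have "\<bar>\<beta> + \<gamma>\<bar> < \<beta> ^ 2 + 1"
        using 3 assms zero_le_power2[of \<beta>] by linarith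
      ultimately show ?thesis using zero r True by simp
    next
      case False
      have "(\<gamma> - \<beta>) * (\<gamma> + \<beta> - 1) < 0"
        using assms by (intro mult_pos_neg) auto
      then have "\<beta> + \<gamma> ^ 2 < \<beta> ^ 2 + \<gamma>"
        by (simp add: algebra_simps power2_eq_square)
      moreover have "- (\<beta> + \<gamma> ^ 2) < \<beta> ^ 2 + \<gamma>"
        using 3 assms zero_less_power2[of \<beta>] zero_le_power2[of \<gamma>] by linarith
      ultimately have "\<bar>\<beta> + \<gamma> ^ 2\<bar> < \<beta> ^ 2 + \<gamma>" by linarith
      then show ?thesis
        using r False pos by (intro exI[of _ ?r]) (auto simp: abs_divide)
    qed
  qed
qed

text \<open>A high even power \<open>p\<close> of \<open>r\<close> is positive and so small that
  \<open>\<beta> + p\<close> is still negative while \<open>1 + \<gamma> * p\<close> is positive;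
  one pendant step then yields a negative field.\<close>

lemma field_negative:
  assumes "\<beta> < 0" "field \<beta> \<gamma> r" "0 < \<bar>r\<bar>" "\<bar>r\<bar> < 1"
  shows "\<exists>s < 0. field \<beta> \<gamma> s"
proof -
  define e where "e = min (-\<beta>) (1 / (1 + \<bar>\<gamma>\<bar>))"
  have e: "0 < e" using assms by (simp add: e_def)
  obtain k where k: "(r ^ 2) ^ k < e"
    using rat_power_small[of "r ^ 2" e] assms e by (auto simp: abs_square_less_1)
  define p where "p = (r ^ 2) ^ k"
  have p: "0 < p" "\<beta> + p < 0" "p * (1 + \<bar>\<gamma>\<bar>) < 1" "field \<beta> \<gamma> p"
    using assms k by (auto simp: e_def p_def field_simps intro!: field_power)
  have "- (\<gamma> * p) \<le> \<bar>\<gamma>\<bar> * p"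
    using abs_ge_minus_self[of "\<gamma> * p"] p(1) by (simp add: abs_mult)
  moreover have "\<bar>\<gamma>\<bar> * p < 1"
    using p(1,3) by (simp add: distrib_left mult.commute)
  ultimately have "0 < 1 + \<gamma> * p" by linarith
  moreover have "field \<beta> \<gamma> ((1 + \<gamma> * p) / (\<beta> + p))"
    using p by (intro field_pendant) auto
  ultimately show ?thesis
    using p by (intro exI[of _ "(1 + \<gamma> * p) / (\<beta> + p)"]) (auto simp: divide_pos_neg)
qed

text \<open>A pendant edge without field gives \<open>(1 + \<gamma>) / (1 + \<beta>)\<close>, of
  modulus above 1 because -2 < \<beta> + \<gamma> and \<beta> < \<gamma>. For \<beta> = -1 this is a
  pole; there the field \<open>r ^ 2\<close> just off the pole's preimage value 1 is used, and 1 +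
  \<gamma> > 0 decides.\<close>

lemma field_large:
  assumes "\<beta> < \<gamma>" "\<beta> < 0" "-2 < \<beta> + \<gamma>" "field \<beta> \<gamma> r" "0 < \<bar>r\<bar>" "\<bar>r\<bar> < 1"
  shows "\<exists>s. field \<beta> \<gamma> s \<and> 1 < \<bar>s\<bar>"
proof (cases "\<beta> = -1")
  case False
  have "field \<beta> \<gamma> ((1 + \<gamma> * 1) / (\<beta> + 1))"
    using False by (intro field_pendant field_one) auto
  moreover have "\<bar>\<beta> + 1\<bar> < \<bar>1 + \<gamma>\<bar>" using assms by linarith
  then have "1 < \<bar>(1 + \<gamma> * 1) / (\<beta> + 1)\<bar>"
    using False by (simp add: abs_divide)
  ultimately show ?thesis by blast
next
  case True
  let ?p = "r ^ 2"
  have p: "0 < ?p" "?p < 1" using assms by (auto simp: abs_square_less_1)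
  have "field \<beta> \<gamma> ((1 + \<gamma> * ?p) / (\<beta> + ?p))"
    using True assms p by (intro field_pendant field_power) auto
  moreover have "1 < \<bar>(1 + \<gamma> * ?p) / (\<beta> + ?p)\<bar>"
  proof -
    have "0 < (1 + \<gamma>) * ?p" using True assms p by (intro mult_pos_pos) auto
    then have "1 - ?p < 1 + \<gamma> * ?p" by (simp add: algebra_simps)
    then show ?thesis using p True by (auto simp: abs_divide)
  qed
  ultimately show ?thesis by blast
qed

text \<open>An antiferromagnetic interaction with positive entries, in which unequal spins are
  strictly preferred; the two diagonal entries may differ.\<close>

definition hard_edge :: "rat \<Rightarrow> rat \<Rightarrow> gadget \<Rightarrow> bool" where
  "hard_edge \<beta> \<gamma> M \<longleftrightarrow> mat \<beta> \<gamma> M True False = mat \<beta> \<gamma> M False True \<and>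
    0 < mat \<beta> \<gamma> M False False \<and> mat \<beta> \<gamma> M False False < mat \<beta> \<gamma> M False True \<and>
    0 < mat \<beta> \<gamma> M True True \<and> mat \<beta> \<gamma> M True True < mat \<beta> \<gamma> M False True"

text \<open>Both terminals will be put on the same vertex, so only the diagonal matters: the gadget
  favours the spin 0 there.\<close>

definition pin :: "rat \<Rightarrow> rat \<Rightarrow> gadget \<Rightarrow> bool" where
  "pin \<beta> \<gamma> P \<longleftrightarrow> 0 \<le> mat \<beta> \<gamma> P True True \<and> mat \<beta> \<gamma> P True True < mat \<beta> \<gamma> P False False"

fun par_power :: "gadget \<Rightarrow> nat \<Rightarrow> gadget" where
  "par_power g 0 = Ones"
| "par_power g (Suc n) = Par g (par_power g n)"

lemma mat_par_power: "mat \<beta> \<gamma> (par_power g n) x y = mat \<beta> \<gamma> g x y ^ n"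
  by (induction n) auto

text \<open>Doubling the gadget squares its entries, which removes the unknown signs of
  \<open>c\<close> and \<open>r\<close>.\<close>

lemma ex_pin:
  assumes "field \<beta> \<gamma> r" "0 < \<bar>r\<bar>" "\<bar>r\<bar> < 1"
  shows "\<exists>P. pin \<beta> \<gamma> P"
proof -
  obtain g c where g: "c \<noteq> 0" "\<forall>y. mat \<beta> \<gamma> g False y = c \<and> mat \<beta> \<gamma> g True y = c * r"
    using assms unfolding field_def by blast
  have "(c * r) * (c * r) < c * c"
  proof -
    have "(c * r) * (c * r) = c ^ 2 * r ^ 2" by (simp add: power2_eq_square)
    also have "\<dots> < c ^ 2 * 1"
      using g(1) assms by (intro mult_strict_left_mono) (auto simp: abs_square_less_1)
    finally show ?thesis by (simp add: power2_eq_square)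
  qed
  then show ?thesis
    unfolding pin_def using g by (intro exI[of _ "Par g g"]) auto
qed

text \<open>A path of two edges whose middle vertex feels a small negative field has positive
  diagonal and negative off-diagonal entries, and its determinant is negative, that is
  \<open>a * d < b ^ 2\<close>. Off-diagonal dominance is then only a matter of balance: a power of
  the path and a suitable field at both ends push both diagonal entries below the off-diagonal one,
  and squaring removes the signs.\<close>

lemma ex_hard_edge:
  assumes "\<beta> < 0" "\<beta> * \<gamma> \<noteq> 1"
    and "field \<beta> \<gamma> r" "0 < \<bar>r\<bar>" "\<bar>r\<bar> < 1" "field \<beta> \<gamma> s" "1 < \<bar>s\<bar>" "field \<beta> \<gamma> t" "t < 0"
  shows "\<exists>M. hard_edge \<beta> \<gamma> M"
proof -
  \<comment> \<open>The three thresholds ensure, in this order, \<open>0 < a\<close>,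
    \<open>0 < d\<close> and \<open>0 < b\<close> below.\<close>
  define e where "e = min (\<beta> ^ 2) (min (1 / (1 + \<gamma> ^ 2)) (-\<beta> / (1 + \<bar>\<gamma>\<bar>)))"
  have e: "0 < e" using assms(1) by (auto simp: e_def add_pos_nonneg divide_pos_pos intro!: divide_neg_pos)
  obtain k where k: "(r ^ 2) ^ k < e / (-t)"
  proof -
    have "0 < e / (-t)" using e assms by (intro divide_pos_pos) auto
    then show ?thesis
      using rat_power_small[of "r ^ 2" "e / (-t)"] assms that by (auto simp: abs_square_less_1)
  qed
  define \<phi> where "\<phi> = t * (r ^ 2) ^ k"
  have \<phi>: "field \<beta> \<gamma> \<phi>" "\<phi> < 0" "-\<phi> < e"
    using assms k by (auto simp: \<phi>_def mult_neg_pos field_simps intro!: field_mult field_power)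
  define a b d where "a = \<beta> ^ 2 + \<phi>" and "b = -(\<beta> + \<phi> * \<gamma>)" and "d = 1 + \<phi> * \<gamma> ^ 2"
  have a: "0 < a" using \<phi> by (simp add: a_def e_def)
  have d: "0 < d"
  proof -
    have "-\<phi> * (1 + \<gamma> ^ 2) < 1" using \<phi> by (simp add: e_def field_simps add_pos_nonneg)
    then show ?thesis using \<phi> by (simp add: d_def algebra_simps)
  qed
  have b: "0 < b"
  proof -
    have "-\<phi> * (1 + \<bar>\<gamma>\<bar>) < -\<beta>" using \<phi> by (simp add: e_def field_simps add_pos_nonneg)
    moreover have "\<phi> * \<gamma> \<le> -\<phi> * \<bar>\<gamma>\<bar>" using abs_ge_self[of "\<phi> * \<gamma>"] \<phi>(2) by (simp add: abs_mult)
    ultimately show ?thesis using \<phi>(2) by (simp add: b_def algebra_simps)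
  qed
  \<comment> \<open>This is the determinant of the product of \<open>A\<close>, the diagonal matrix
    with entries 1 and \<open>\<phi>\<close>, and \<open>A\<close>.\<close>
  have "a * d - b ^ 2 = \<phi> * (\<beta> * \<gamma> - 1) ^ 2"
    by (simp add: a_def b_def d_def algebra_simps power2_eq_square)
  also have "\<dots> < 0" using assms(2) \<phi>(2) by (intro mult_neg_pos) auto
  finally have "a / b < b / d" using a b d by (simp add: field_simps power2_eq_square)
  moreover have "1 < s ^ 2" "0 < r ^ 2" "r ^ 2 < 1"
    using one_less_power[OF assms(7), of 2] assms by (auto simp: abs_square_less_1)
  \<comment> \<open>The field \<open>f\<close> at both ends turns the entries into
    \<open>a ^ m\<close>, \<open>f * b ^ m\<close> and \<open>f ^ 2 * d ^ m\<close>; the middle one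
    is the largest exactly if \<open>f\<close> lies between \<open>(a / b) ^ m\<close> and
    \<open>(b / d) ^ m\<close>.\<close>
  ultimately obtain m i where mi: "((a / b) ^ m < (s ^ 2) ^ i \<and> (s ^ 2) ^ i < (b / d) ^ m) \<or>
      ((a / b) ^ m < (r ^ 2) ^ i \<and> (r ^ 2) ^ i < (b / d) ^ m)"
    using power_between[of "a / b" "b / d" "s ^ 2" "r ^ 2"] a b d by auto
  obtain f where f: "field \<beta> \<gamma> f" "(a / b) ^ m < f" "f < (b / d) ^ m"
    using mi assms field_power by metis
  have f0: "0 < f" using f(2) a b by (meson divide_pos_pos less_trans zero_less_power)
  have f1: "a ^ m < f * b ^ m" "f * d ^ m < b ^ m"
    using f b d by (auto simp: power_divide field_simps)
  obtain g c where g: "c \<noteq> 0" "\<forall>y. mat \<beta> \<gamma> g False y = c \<and> mat \<beta> \<gamma> g True y = c * \<phi>"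
    using \<phi>(1) unfolding field_def by blast
  obtain h c' where h: "c' \<noteq> 0" "\<forall>y. mat \<beta> \<gamma> h False y = c' \<and> mat \<beta> \<gamma> h True y = c' * f"
    using f(1) unfolding field_def by blast
  define G where "G = Ser Edge (Par g Edge)"
  \<comment> \<open>\<open>h\<close> acts on the first terminal only, \<open>Tr h\<close> on the
    second.\<close>
  define X where "X = Par (par_power G m) (Par h (Tr h))"
  define C where "C = c ^ m * c' ^ 2"
  have X: "mat \<beta> \<gamma> X False False = C * a ^ m" "mat \<beta> \<gamma> X False True = C * (-1) ^ m * (f * b ^ m)"
      "mat \<beta> \<gamma> X True False = C * (-1) ^ m * (f * b ^ m)" "mat \<beta> \<gamma> X True True = C * (f * (f * d ^ m))"
  proof -
    have E: "mat \<beta> \<gamma> G False False = c * a" "mat \<beta> \<gamma> G False True = - (c * b)"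
      "mat \<beta> \<gamma> G True False = - (c * b)" "mat \<beta> \<gamma> G True True = c * d"
      using g by (auto simp: G_def spin_weight_def UNIV_bool a_def b_def d_def algebra_simps power2_eq_square)
    have "(- (c * b)) ^ m = (-1) ^ m * (c ^ m * b ^ m)"
      using power_minus[of "c * b" m] by (simp add: power_mult_distrib)
    then show "mat \<beta> \<gamma> X False False = C * a ^ m" "mat \<beta> \<gamma> X False True = C * (-1) ^ m * (f * b ^ m)"
      "mat \<beta> \<gamma> X True False = C * (-1) ^ m * (f * b ^ m)" "mat \<beta> \<gamma> X True True = C * (f * (f * d ^ m))"
      using h unfolding X_def mat.simps mat_par_power E
      by (auto simp: C_def power_mult_distrib power2_eq_square)
  qed
  have C: "0 < C ^ 2" using g(1) h(1) by (simp add: C_def)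
  have sq: "u ^ 2 < v ^ 2" if "0 < u" "u < v" for u v :: rat
    using that by (intro power_strict_mono) auto
  have "a ^ m < f * b ^ m" "0 < a ^ m" "f * (f * d ^ m) < f * b ^ m" "0 < f * (f * d ^ m)"
    using f1 f0 a d by (auto intro: mult_strict_left_mono)
  then have "(a ^ m) ^ 2 < (f * b ^ m) ^ 2" "(f * (f * d ^ m)) ^ 2 < (f * b ^ m) ^ 2"
      "0 < (a ^ m) ^ 2" "0 < (f * (f * d ^ m)) ^ 2"
    using a d f0 by (auto intro!: sq)
  then have "C ^ 2 * (a ^ m) ^ 2 < C ^ 2 * (f * b ^ m) ^ 2" "C ^ 2 * (f * (f * d ^ m)) ^ 2 < C ^ 2 * (f * b ^ m) ^ 2"
      "0 < C ^ 2 * (a ^ m) ^ 2" "0 < C ^ 2 * (f * (f * d ^ m)) ^ 2"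
    using C by (auto intro!: mult_strict_left_mono mult_pos_pos)
  moreover have "mat \<beta> \<gamma> (Par X X) False False = C ^ 2 * (a ^ m) ^ 2"
    "mat \<beta> \<gamma> (Par X X) False True = C ^ 2 * (f * b ^ m) ^ 2"
    "mat \<beta> \<gamma> (Par X X) True False = C ^ 2 * (f * b ^ m) ^ 2"
    "mat \<beta> \<gamma> (Par X X) True True = C ^ 2 * (f * (f * d ^ m)) ^ 2"
  proof -
    have "C * (-1) ^ m * (f * b ^ m) * (C * (-1) ^ m * (f * b ^ m)) = C ^ 2 * (f * b ^ m) ^ 2"
      by (simp add: power2_eq_square mult_ac flip: power_mult_distrib)
    then show "mat \<beta> \<gamma> (Par X X) False False = C ^ 2 * (a ^ m) ^ 2"
      "mat \<beta> \<gamma> (Par X X) False True = C ^ 2 * (f * b ^ m) ^ 2"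
      "mat \<beta> \<gamma> (Par X X) True False = C ^ 2 * (f * b ^ m) ^ 2"
      "mat \<beta> \<gamma> (Par X X) True True = C ^ 2 * (f * (f * d ^ m)) ^ 2"
      unfolding mat.simps X by (simp_all add: power2_eq_square)
  qed
  ultimately show ?thesis
    unfolding hard_edge_def by (intro exI[of _ "Par X X"]) presburger
qed

text \<open>For \<beta> = \<gamma> all gadgets are symmetric under spin flip, so no pin is claimed;
  two parallel edges are already hard as |\<beta>| < 1. Otherwise the gadgets are assembled from a
  small, a large and a negative field.\<close>

theorem ex_gadgets:
  assumes "\<beta> \<le> \<gamma>" "\<beta> < 0" "-2 < \<beta> + \<gamma>" "\<beta> + \<gamma> < 1" "(\<beta>, \<gamma>) \<noteq> (-1, 1)"
  shows "(\<exists>M. hard_edge \<beta> \<gamma> M) \<and> (\<beta> = \<gamma> \<or> (\<exists>P. pin \<beta> \<gamma> P))"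
proof (cases "\<beta> = \<gamma>")
  case True
  then have "0 < \<beta> * \<beta>" "\<beta> * \<beta> < 1"
    using assms mult_strict_mono[of "-\<beta>" 1 "-\<beta>" 1] by (auto simp: mult_neg_neg)
  then have "hard_edge \<beta> \<gamma> (Par Edge Edge)"
    using True by (auto simp: hard_edge_def spin_weight_def)
  then show ?thesis using True by blast
next
  case False
  then have lt: "\<beta> < \<gamma>" using assms by simp
  obtain r where r: "field \<beta> \<gamma> r" "0 < \<bar>r\<bar>" "\<bar>r\<bar> < 1"
    using field_small[OF lt] assms by blast
  obtain s where s: "field \<beta> \<gamma> s" "1 < \<bar>s\<bar>"
    using field_large[OF lt assms(2,3) r] by blast
  obtain t where t: "t < 0" "field \<beta> \<gamma> t"
    using field_negative[OF assms(2) r] by blast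
  \<comment> \<open>Otherwise \<open>A\<close> would be singular. Both entries would then be
    negative, with \<open>(\<beta> + \<gamma>) ^ 2 \<ge> 4\<close> by the inequality of arithmetic
    and geometric means, against -2 < \<beta> + \<gamma>.\<close>
  have "\<beta> * \<gamma> \<noteq> 1"
  proof
    assume eq: "\<beta> * \<gamma> = 1"
    then have "\<gamma> < 0" using assms(2) by (metis mult_neg_pos not_less_iff_gr_or_eq mult_zero_right zero_less_one not_one_less_zero)
    have "0 \<le> (\<beta> - \<gamma>) ^ 2" by simp
    then have "4 \<le> (\<beta> + \<gamma>) ^ 2" using eq by (simp add: power2_eq_square algebra_simps)
    moreover have "(-(\<beta> + \<gamma>)) ^ 2 < 2 ^ 2"
      using assms \<open>\<gamma> < 0\<close> by (intro power_strict_mono) auto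
    ultimately show False unfolding power2_minus by simp
  qed
  then show ?thesis
    using ex_hard_edge[OF assms(2) _ r s t(2,1)] ex_pin[OF r] by blast
qed

section \<open>From circuits to graphs\<close>

text \<open>The local vertices of a gate are the constant 0, the inputs \<open>x\<close> and \<open>y\<close> (1 and 2), the
  output (3), the negated inputs (4 and 5) and the outputs of the three gates that take \<open>x\<close> or \<open>y\<close>
  negated (6 to 8). Those three gates only serve to make the weight of a correct configuration
  independent of the inputs.\<close>

definition hub_pairs :: "nat \<Rightarrow> nat \<Rightarrow> nat \<Rightarrow> nat \<Rightarrow> (nat \<times> nat) list" where
  "hub_pairs q y u v = [(y, u), (y, v)] @ replicate q (y, 0)"

definition gate_pairs :: "nat \<Rightarrow> nat \<Rightarrow> (nat \<times> nat) list" where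
  "gate_pairs q K = replicate K (1, 4) @ replicate K (2, 5) @
    hub_pairs q 3 1 2 @ hub_pairs q 6 4 2 @ hub_pairs q 7 1 5 @ hub_pairs q 8 4 5"

fun place_pairs :: "gadget \<Rightarrow> (nat \<times> nat) list \<Rightarrow> (nat \<Rightarrow> nat) \<Rightarrow> nat \<Rightarrow> placement list" where
  "place_pairs M [] \<tau> b = []"
| "place_pairs M ((u, v) # es) \<tau> b = (M, \<tau> u, \<tau> v, b) # place_pairs M es \<tau> (b + gsize M)"

text \<open>The places 0 to 3 of a gate are wires of the circuit, the output being wire
  \<open>n0 + i\<close>. The places 4 to 8 are private vertices of gate \<open>i\<close>, five per
  gate, numbered after all wires.\<close>

definition terminal :: "nat \<Rightarrow> nat \<Rightarrow> nat \<times> nat \<Rightarrow> nat \<Rightarrow> nat \<Rightarrow> nat" where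
  "terminal n0 W g i k = (if k = 0 then 0 else if k = 1 then fst g else if k = 2 then snd g
    else if k = 3 then n0 + i else W + 5 * i + (k - 4))"

text \<open>The \<open>n0\<close> input wires are followed by one output wire per gate. Wire 0 is
  the constant and wire 1 the marked input \<open>s\<close>.\<close>

definition wires :: "nat \<Rightarrow> (nat \<times> nat) list \<Rightarrow> nat" where
  "wires n0 C = n0 + length C"

definition core_size :: "nat \<Rightarrow> (nat \<times> nat) list \<Rightarrow> nat" where
  "core_size n0 C = wires n0 C + 5 * length C"

text \<open>Linear in the number of terminals, so that the loss caused by one error, raised to this
  power, outweighs the number of all configurations.\<close>

definition copies :: "nat \<Rightarrow> nat \<Rightarrow> (nat \<times> nat) list \<Rightarrow> nat" where
  "copies Cm n0 C = Cm * Suc (core_size n0 C)"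

text \<open>\<open>Cp\<close> pins for each copy of each gate absorb what that gate might gain if
  vertex 0 had the wrong spin; \<open>Cp\<close> further ones for each of the \<open>copies\<close>
  supply the loss required of an error.\<close>

definition pin_copies :: "nat \<Rightarrow> nat \<Rightarrow> nat \<Rightarrow> (nat \<times> nat) list \<Rightarrow> nat" where
  "pin_copies Cp Cm n0 C = Cp * (copies Cm n0 C * Suc (length C))"

definition gate_span :: "gadget \<Rightarrow> nat \<Rightarrow> nat \<Rightarrow> nat" where
  "gate_span M q K = length (gate_pairs q K) * gsize M"

definition gate_placements :: "gadget \<Rightarrow> nat \<Rightarrow> nat \<Rightarrow> nat \<Rightarrow> nat \<Rightarrow> nat \<Rightarrow> nat \<times> nat \<Rightarrow> nat \<Rightarrow> nat \<Rightarrow> placement list" where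
  "gate_placements M q K m n0 W g i b =
    concat (map (\<lambda>j. place_pairs M (gate_pairs q K) (terminal n0 W g i) (b + j * gate_span M q K)) [0..<m])"

text \<open>The copies of \<open>M\<close> between \<open>out\<close> and vertex 0 prefer unequal
  spins and thus demand that the output be 1. The final \<open>Edge\<close> is the only place where
  the original interaction appears unamplified, and the only factor that can be negative on a
  correct configuration.\<close>

definition circuit_placements ::
    "gadget \<Rightarrow> gadget \<Rightarrow> nat \<Rightarrow> nat \<Rightarrow> nat \<Rightarrow> nat \<Rightarrow> nat \<Rightarrow> (nat \<times> nat) list \<Rightarrow> nat \<Rightarrow> placement list" where
  "circuit_placements M P q K Cp Cm n0 C out = (let
      m = copies Cm n0 C; V = core_size n0 C; s = gate_span M q K;
      b1 = V + length C * (m * s); b2 = b1 + pin_copies Cp Cm n0 C * gsize P in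
    concat (map (\<lambda>i. gate_placements M q K m n0 (wires n0 C) (C ! i) i (V + i * (m * s))) [0..<length C]) @
    map (\<lambda>j. (P, 0, 0, b1 + j * gsize P)) [0..<pin_copies Cp Cm n0 C] @
    map (\<lambda>j. (M, out, 0, b2 + j * gsize M)) [0..<m] @
    [(Edge, 1, 0, b2 + m * gsize M)])"

definition graph_size :: "gadget \<Rightarrow> gadget \<Rightarrow> nat \<Rightarrow> nat \<Rightarrow> nat \<Rightarrow> nat \<Rightarrow> nat \<Rightarrow> (nat \<times> nat) list \<Rightarrow> nat" where
  "graph_size M P q K Cp Cm n0 C = core_size n0 C +
    length C * (copies Cm n0 C * gate_span M q K) +
    pin_copies Cp Cm n0 C * gsize P + copies Cm n0 C * gsize M"

lemma chain_place_pairs: "chain b (place_pairs M es \<tau> b) (b + length es * gsize M)"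
proof (induction M es \<tau> b rule: place_pairs.induct)
  case (2 M u v es \<tau> b)
  then show ?case by (simp add: add.assoc add.commute add.left_commute)
qed auto

lemma chain_circuit:
  "chain (core_size n0 C) (circuit_placements M P q K Cp Cm n0 C out) (graph_size M P q K Cp Cm n0 C)"
proof -
  define m V s where "m = copies Cm n0 C" and "V = core_size n0 C" and "s = gate_span M q K"
  define mp b1 b2 where "mp = pin_copies Cp Cm n0 C" and "b1 = V + length C * (m * s)"
    and "b2 = b1 + mp * gsize P"
  have gate: "chain b (gate_placements M q K m n0 W g i b) (b + m * s)" for W g i b
    unfolding gate_placements_def
  proof (rule chain_concat)
    fix j
    show "chain (b + j * s) (place_pairs M (gate_pairs q K) (terminal n0 W g i) (b + j * gate_span M q K)) (b + Suc j * s)"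
      using chain_place_pairs[of "b + j * s" M "gate_pairs q K" "terminal n0 W g i"]
      by (simp add: s_def gate_span_def algebra_simps)
  qed
  have gates: "chain V (concat (map (\<lambda>i. gate_placements M q K m n0 (wires n0 C) (C ! i) i (V + i * (m * s))) [0..<length C])) b1"
    unfolding b1_def
  proof (rule chain_concat)
    fix i
    show "chain (V + i * (m * s)) (gate_placements M q K m n0 (wires n0 C) (C ! i) i (V + i * (m * s))) (V + Suc i * (m * s))"
      using gate[of "V + i * (m * s)" "wires n0 C" "C ! i" i] by (simp add: algebra_simps)
  qed
  have copies: "chain b (map (\<lambda>j. (g, u, v, b + j * gsize g)) [0..<k]) (b + k * gsize g)" for b g u v k
    using chain_concat[of k b "gsize g" "\<lambda>j. [(g, u, v, b + j * gsize g)]"] by simp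
  show ?thesis
    unfolding circuit_placements_def graph_size_def Let_def
      m_def[symmetric] V_def[symmetric] s_def[symmetric] mp_def[symmetric]
      b1_def[symmetric] b2_def[symmetric]
    by (rule chain_append[OF gates chain_append[OF copies[of b1 P 0 0 mp, folded b2_def]
            chain_append[OF copies[of b2 M out 0 m]]]]) simp
qed

lemma place_pairs_terminals:
  "(g, u, v, b') \<in> set (place_pairs M es \<tau> b) \<Longrightarrow> \<exists>k l. (k, l) \<in> set es \<and> u = \<tau> k \<and> v = \<tau> l"
  by (induction M es \<tau> b rule: place_pairs.induct) auto

lemma circuit_terminals:
  assumes "(g, u, v, b) \<in> set (circuit_placements M P q K Cp Cm n0 C out)"
    and "2 \<le> n0" "out < wires n0 C" "\<And>x y. (x, y) \<in> set C \<Longrightarrow> x < wires n0 C \<and> y < wires n0 C"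
  shows "u < core_size n0 C \<and> v < core_size n0 C"
proof -
  have trm: "terminal n0 (wires n0 C) (C ! i) i k < core_size n0 C" if "i < length C" "k < 9" for i k
  proof -
    have "fst (C ! i) < wires n0 C \<and> snd (C ! i) < wires n0 C"
      using assms(4)[of "fst (C ! i)" "snd (C ! i)"] that by simp
    moreover have "5 * i + 5 \<le> 5 * length C" using that by simp
    ultimately show ?thesis
      using that assms(2) by (auto simp: terminal_def core_size_def wires_def)
  qed
  have pairs: "k < 9 \<and> l < 9" if "(k, l) \<in> set (gate_pairs q K)" for k l
    using that by (auto simp: gate_pairs_def hub_pairs_def)
  have V: "0 < core_size n0 C" "1 < core_size n0 C" "out < core_size n0 C"
    using assms(2,3) by (auto simp: core_size_def wires_def)
  consider (gate) i b' where "i < length C"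
      "(g, u, v, b) \<in> set (place_pairs M (gate_pairs q K) (terminal n0 (wires n0 C) (C ! i) i) b')"
    | "u = 0" "v = 0" | "u = out" "v = 0" | "u = 1" "v = 0"
    using assms(1) unfolding circuit_placements_def Let_def gate_placements_def by auto
  then show ?thesis
  proof cases
    case gate
    then obtain k l where "(k, l) \<in> set (gate_pairs q K)"
      "u = terminal n0 (wires n0 C) (C ! i) i k" "v = terminal n0 (wires n0 C) (C ! i) i l"
      using place_pairs_terminals by blast
    then show ?thesis using pairs trm gate(1) by simp
  qed (use V in auto)
qed

definition pairs_weight :: "rat \<Rightarrow> rat \<Rightarrow> gadget \<Rightarrow> (nat \<times> nat) list \<Rightarrow> (nat \<Rightarrow> bool) \<Rightarrow> rat" where
  "pairs_weight \<beta> \<gamma> M es \<sigma> = (\<Prod>(u, v)\<leftarrow>es. mat \<beta> \<gamma> M (\<sigma> u) (\<sigma> v))"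

lemma place_mat_simp: "place_mat \<beta> \<gamma> (g, u, v, b) \<sigma> = mat \<beta> \<gamma> g (\<sigma> u) (\<sigma> v)"
  by (simp add: place_mat_def)

lemma prod_place_pairs:
  "(\<Prod>p\<leftarrow>place_pairs M es \<tau> b. place_mat \<beta> \<gamma> p \<sigma>) = pairs_weight \<beta> \<gamma> M es (\<sigma> \<circ> \<tau>)"
  by (induction M es \<tau> b rule: place_pairs.induct) (auto simp: pairs_weight_def place_mat_def)

lemma prod_list_concat: "prod_list (map f (concat (map g [0..<n]))) = (\<Prod>i<n. prod_list (map f (g i)))"
  for f :: "'a \<Rightarrow> rat"
  by (induction n) auto

lemma prod_list_map_upt: "prod_list (map f [0..<n]) = (\<Prod>i<n. f i)" for f :: "nat \<Rightarrow> rat"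
  by (induction n) auto

definition core_weight where
  "core_weight \<beta> \<gamma> M P q K Cp Cm n0 C out \<sigma> =
    (\<Prod>i<length C. pairs_weight \<beta> \<gamma> M (gate_pairs q K) (\<sigma> \<circ> terminal n0 (wires n0 C) (C ! i) i) ^ copies Cm n0 C) *
    mat \<beta> \<gamma> P (\<sigma> 0) (\<sigma> 0) ^ pin_copies Cp Cm n0 C * mat \<beta> \<gamma> M (\<sigma> out) (\<sigma> 0) ^ copies Cm n0 C *
    spin_weight \<beta> \<gamma> (\<sigma> 1) (\<sigma> 0)"

lemma prod_circuit_placements:
  "(\<Prod>p\<leftarrow>circuit_placements M P q K Cp Cm n0 C out. place_mat \<beta> \<gamma> p \<sigma>) =
    core_weight \<beta> \<gamma> M P q K Cp Cm n0 C out \<sigma>"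
  by (simp add: circuit_placements_def Let_def core_weight_def gate_placements_def prod_list_concat
      prod_place_pairs prod_list_map_upt place_mat_simp mult.assoc)

text \<open>For \<beta> = \<gamma> flipping all spins preserves the weight of an edge, hence by
  induction every entry of every gadget.\<close>

lemma core_weight_flip:
  assumes "\<beta> = \<gamma>" "2 \<le> n0" "out < wires n0 C" "\<And>x y. (x, y) \<in> set C \<Longrightarrow> x < wires n0 C \<and> y < wires n0 C"
    and "\<And>v. v < core_size n0 C \<Longrightarrow> \<sigma>' v = (\<not> \<sigma> v)"
  shows "core_weight \<beta> \<gamma> M P q K Cp Cm n0 C out \<sigma>' = core_weight \<beta> \<gamma> M P q K Cp Cm n0 C out \<sigma>"
proof -
  have "mat \<beta> \<gamma> g (\<not> x) (\<not> y) = mat \<beta> \<gamma> g x y" for g x y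
  proof (induction g arbitrary: x y)
    case (Ser g h)
    then show ?case
      using Ser.IH(1)[of x True] Ser.IH(1)[of x False] Ser.IH(2)[of True y] Ser.IH(2)[of False y]
      by (simp add: UNIV_bool add.commute)
  qed (auto simp: spin_weight_def assms(1))
  then have flip: "mat \<beta> \<gamma> g (\<sigma>' u) (\<sigma>' v) = mat \<beta> \<gamma> g (\<sigma> u) (\<sigma> v)"
    if "u < core_size n0 C" "v < core_size n0 C" for g u v
    using that assms(5) by simp
  have "place_mat \<beta> \<gamma> p \<sigma>' = place_mat \<beta> \<gamma> p \<sigma>"
    if p: "p \<in> set (circuit_placements M P q K Cp Cm n0 C out)" for p
  proof -
    obtain g u v b where p': "p = (g, u, v, b)" by (cases p)
    have "u < core_size n0 C \<and> v < core_size n0 C"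
      using p assms(4) unfolding p' by (intro circuit_terminals[OF _ assms(2,3)])
    then show ?thesis by (simp add: p' place_mat_simp flip)
  qed
  then have "map (\<lambda>p. place_mat \<beta> \<gamma> p \<sigma>') (circuit_placements M P q K Cp Cm n0 C out) =
      map (\<lambda>p. place_mat \<beta> \<gamma> p \<sigma>) (circuit_placements M P q K Cp Cm n0 C out)"
    by auto
  then show ?thesis
    unfolding prod_circuit_placements[symmetric] by (rule arg_cong)
qed

subsection \<open>Weights of gates\<close>

text \<open>In a hub, a centre \<open>y\<close> is joined to \<open>u\<close>, \<open>v\<close> and
  \<open>q\<close> times to vertex 0, which has spin 0. These \<open>q\<close> edges bias
  \<open>y\<close> towards 1. By the first condition on \<open>q\<close> the bias wins when
  \<open>u\<close> and \<open>v\<close> differ, by the second it loses when both are 1; so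
  \<open>y\<close> prefers the NAND of \<open>u\<close> and \<open>v\<close>. The condition on
  \<open>K\<close> says that one violated negation costs more than the four hubs together could
  gain.\<close>

locale hard_gates =
  fixes \<beta> \<gamma> :: rat and M :: gadget and q K :: nat and a b d :: rat
  assumes mats: "mat \<beta> \<gamma> M False False = a" "mat \<beta> \<gamma> M True True = d"
      "mat \<beta> \<gamma> M False True = b" "mat \<beta> \<gamma> M True False = b"
    and pos: "0 < a" "a < b" "0 < d" "d < b"
    and q: "a ^ Suc q < d * b ^ q" "d ^ 2 * b ^ q < b ^ 2 * a ^ q"
    and K: "max a d ^ K * b ^ (4 * (q + 2)) < b ^ K * (b ^ (q + 2) * (d * b ^ Suc q) ^ 2 * (b ^ 2 * a ^ q))"
begin

definition hub :: "bool \<Rightarrow> bool \<Rightarrow> bool \<Rightarrow> bool \<Rightarrow> rat" where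
  "hub c y u v = mat \<beta> \<gamma> M y u * mat \<beta> \<gamma> M y v * mat \<beta> \<gamma> M y c ^ q"

text \<open>The weight of a hub whose centre is the NAND of \<open>u\<close> and \<open>v\<close>,
  provided vertex 0 has spin 0.\<close>

definition hub_max :: "bool \<Rightarrow> bool \<Rightarrow> rat" where
  "hub_max u v = (if u \<and> v then b ^ 2 * a ^ q else if u \<or> v then d * b ^ Suc q else b ^ (q + 2))"

definition right_weight :: rat where
  "right_weight = b ^ (2 * K) * (b ^ (q + 2) * (d * b ^ Suc q) ^ 2 * (b ^ 2 * a ^ q))"

definition right :: "(nat \<Rightarrow> bool) \<Rightarrow> bool" where
  "right \<sigma> \<longleftrightarrow> \<sigma> 3 = (\<not> (\<sigma> 1 \<and> \<sigma> 2)) \<and> \<sigma> 4 = (\<not> \<sigma> 1) \<and> \<sigma> 5 = (\<not> \<sigma> 2) \<and> \<sigma> 6 = (\<not> (\<not> \<sigma> 1 \<and> \<sigma> 2)) \<and>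
    \<sigma> 7 = (\<not> (\<sigma> 1 \<and> \<not> \<sigma> 2)) \<and> \<sigma> 8 = (\<not> (\<not> \<sigma> 1 \<and> \<not> \<sigma> 2))"

abbreviation "G \<equiv> pairs_weight \<beta> \<gamma> M (gate_pairs q K)"

lemma b_pos: "0 < b"
  using pos by linarith

lemma mat_pos: "0 < mat \<beta> \<gamma> M x y" and mat_le: "mat \<beta> \<gamma> M x y \<le> b"
  using mats pos b_pos by (cases x; cases y; simp)+

lemma G_eq: "G \<sigma> = mat \<beta> \<gamma> M (\<sigma> 1) (\<sigma> 4) ^ K * mat \<beta> \<gamma> M (\<sigma> 2) (\<sigma> 5) ^ K *
    (hub (\<sigma> 0) (\<sigma> 3) (\<sigma> 1) (\<sigma> 2) * hub (\<sigma> 0) (\<sigma> 6) (\<sigma> 4) (\<sigma> 2) *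
     hub (\<sigma> 0) (\<sigma> 7) (\<sigma> 1) (\<sigma> 5) * hub (\<sigma> 0) (\<sigma> 8) (\<sigma> 4) (\<sigma> 5))"
  by (simp add: pairs_weight_def gate_pairs_def hub_pairs_def hub_def mult_ac)

lemma hub_pos: "0 < hub c y u v"
  unfolding hub_def using mat_pos by simp

lemma hub_le: "hub c y u v \<le> b ^ (q + 2)"
proof -
  have "hub c y u v \<le> b * b * b ^ q"
    unfolding hub_def using mat_pos mat_le b_pos
    by (intro mult_mono power_mono) (auto intro: less_imp_le mult_pos_pos)
  then show ?thesis by (simp add: mult_ac)
qed

lemma hub_right: "y = (\<not> (u \<and> v)) \<Longrightarrow> hub False y u v = hub_max u v"
  by (cases u; cases v) (auto simp: hub_def hub_max_def mats power2_eq_square mult_ac)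

lemma hub_wrong: "y = (u \<and> v) \<Longrightarrow> hub False y u v < hub_max u v"
proof -
  assume y: "y = (u \<and> v)"
  have "a ^ (q + 2) < b ^ (q + 2)"
    using pos by (intro power_strict_mono) auto
  moreover have "b * (a * a ^ q) < b * (d * b ^ q)"
    using q(1) b_pos by (intro mult_strict_left_mono) auto
  ultimately show ?thesis
    using y q(2) by (cases u; cases v) (auto simp: hub_def hub_max_def mats power2_eq_square mult_ac)
qed

lemma hub_le_max: "hub False y u v \<le> hub_max u v"
  using hub_right hub_wrong by (metis order.order_iff_strict)

text \<open>Negating the inputs permutes the four input pairs, so whatever \<open>u\<close> and
  \<open>v\<close> are, the product has one factor for each pair. This is the purpose of the
  additional hubs.\<close>

lemma hub_max_prod:
  "hub_max u v * hub_max (\<not> u) v * hub_max u (\<not> v) * hub_max (\<not> u) (\<not> v) =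
    b ^ (q + 2) * (d * b ^ Suc q) ^ 2 * (b ^ 2 * a ^ q)"
  by (cases u; cases v) (simp_all add: hub_max_def power2_eq_square mult_ac)

lemma right_weight_pos: "0 < right_weight"
  using pos b_pos by (simp add: right_weight_def)

lemma pow4: "x ^ n * x ^ n * x ^ n * x ^ n = x ^ (4 * n)" for x :: rat
proof -
  have "4 * n = n + n + n + n" by simp
  then show ?thesis by (simp only: power_add)
qed

lemma G_pos: "0 < G \<sigma>"
  unfolding G_eq using mat_pos hub_pos by simp

lemma G_right: "\<not> \<sigma> 0 \<Longrightarrow> right \<sigma> \<Longrightarrow> G \<sigma> = right_weight"
proof -
  assume *: "\<not> \<sigma> 0" "right \<sigma>"
  have h: "hub (\<sigma> 0) (\<sigma> 3) (\<sigma> 1) (\<sigma> 2) = hub_max (\<sigma> 1) (\<sigma> 2)"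
    "hub (\<sigma> 0) (\<sigma> 6) (\<sigma> 4) (\<sigma> 2) = hub_max (\<not> \<sigma> 1) (\<sigma> 2)"
    "hub (\<sigma> 0) (\<sigma> 7) (\<sigma> 1) (\<sigma> 5) = hub_max (\<sigma> 1) (\<not> \<sigma> 2)"
    "hub (\<sigma> 0) (\<sigma> 8) (\<sigma> 4) (\<sigma> 5) = hub_max (\<not> \<sigma> 1) (\<not> \<sigma> 2)"
    using * hub_right[of "\<sigma> 3" "\<sigma> 1" "\<sigma> 2"] hub_right[of "\<sigma> 6" "\<not> \<sigma> 1" "\<sigma> 2"]
      hub_right[of "\<sigma> 7" "\<sigma> 1" "\<not> \<sigma> 2"] hub_right[of "\<sigma> 8" "\<not> \<sigma> 1" "\<not> \<sigma> 2"]
    by (simp_all add: right_def)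
  have n: "mat \<beta> \<gamma> M (\<sigma> 1) (\<sigma> 4) = b" "mat \<beta> \<gamma> M (\<sigma> 2) (\<sigma> 5) = b"
    using * mats by (auto simp: right_def)
  show ?thesis
    unfolding G_eq h n hub_max_prod right_weight_def by (simp add: mult_2 power_add)
qed

text \<open>If a negation fails, the condition on \<open>K\<close> applies, whatever the hubs weigh.
  If both hold, all four hubs see the inputs they should see; none exceeds its maximum and at least
  one misses it.\<close>

lemma G_wrong: "\<not> \<sigma> 0 \<Longrightarrow> \<not> right \<sigma> \<Longrightarrow> G \<sigma> < right_weight"
proof -
  assume *: "\<not> \<sigma> 0" "\<not> right \<sigma>"
  let ?H = "b ^ (q + 2) * (d * b ^ Suc q) ^ 2 * (b ^ 2 * a ^ q)"
  let ?h = "hub (\<sigma> 0) (\<sigma> 3) (\<sigma> 1) (\<sigma> 2) * hub (\<sigma> 0) (\<sigma> 6) (\<sigma> 4) (\<sigma> 2) *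
     hub (\<sigma> 0) (\<sigma> 7) (\<sigma> 1) (\<sigma> 5) * hub (\<sigma> 0) (\<sigma> 8) (\<sigma> 4) (\<sigma> 5)"
  have h0: "0 < ?h" using hub_pos by simp
  show ?thesis
  proof (cases "\<sigma> 4 = (\<not> \<sigma> 1) \<and> \<sigma> 5 = (\<not> \<sigma> 2)")
    case False
    have "?h \<le> b ^ (q + 2) * b ^ (q + 2) * b ^ (q + 2) * b ^ (q + 2)"
      using hub_le hub_pos b_pos by (intro mult_mono) (auto intro: less_imp_le mult_pos_pos)
    then have h: "?h \<le> b ^ (4 * (q + 2))"
      by (simp only: pow4)
    have eq: "mat \<beta> \<gamma> M x x ^ K \<le> max a d ^ K" for x
      using mats pos by (cases x) (auto intro!: power_mono)
    have le: "mat \<beta> \<gamma> M x y ^ K \<le> b ^ K" for x y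
      using mat_le mat_pos by (intro power_mono) (auto intro: less_imp_le)
    have "mat \<beta> \<gamma> M (\<sigma> 1) (\<sigma> 4) ^ K * mat \<beta> \<gamma> M (\<sigma> 2) (\<sigma> 5) ^ K \<le> max a d ^ K * b ^ K"
    proof (cases "\<sigma> 4 = \<sigma> 1")
      case True
      then show ?thesis
        using eq[of "\<sigma> 1"] le[of "\<sigma> 2" "\<sigma> 5"] mat_pos pos
        by (intro mult_mono) (auto intro: less_imp_le)
    next
      case F: False
      then have "\<sigma> 5 = \<sigma> 2" using False by auto
      then have "mat \<beta> \<gamma> M (\<sigma> 1) (\<sigma> 4) ^ K * mat \<beta> \<gamma> M (\<sigma> 2) (\<sigma> 5) ^ K \<le> b ^ K * max a d ^ K"
        using eq[of "\<sigma> 2"] le[of "\<sigma> 1" "\<sigma> 4"] mat_pos b_pos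
        by (intro mult_mono) (auto intro: less_imp_le)
      then show ?thesis by (simp add: mult.commute)
    qed
    note le1 = this
    have "G \<sigma> \<le> (max a d ^ K * b ^ K) * b ^ (4 * (q + 2))"
      unfolding G_eq by (rule mult_mono[OF le1 h]) (use h0 pos b_pos in \<open>auto intro: less_imp_le\<close>)
    also have "\<dots> = b ^ K * (max a d ^ K * b ^ (4 * (q + 2)))" by (simp only: mult_ac)
    also have "\<dots> < b ^ K * (b ^ K * ?H)"
      using K b_pos by (intro mult_strict_left_mono) auto
    also have "\<dots> = right_weight"
      unfolding right_weight_def by (simp only: mult_2 power_add mult.assoc)
    finally show ?thesis .
  next
    case True
    let ?g = "hub False (\<sigma> 3) (\<sigma> 1) (\<sigma> 2) * hub False (\<sigma> 6) (\<not> \<sigma> 1) (\<sigma> 2) *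
       hub False (\<sigma> 7) (\<sigma> 1) (\<not> \<sigma> 2) * hub False (\<sigma> 8) (\<not> \<sigma> 1) (\<not> \<sigma> 2)"
    have G: "G \<sigma> = b ^ (2 * K) * ?g"
    proof -
      have "mat \<beta> \<gamma> M x (\<not> x) = b" for x using mats by (cases x) auto
      then show ?thesis
        using True * unfolding G_eq by (simp add: mult_2 power_add)
    qed
    have "\<not> (\<sigma> 3 = (\<not> (\<sigma> 1 \<and> \<sigma> 2)) \<and> \<sigma> 6 = (\<not> (\<not> \<sigma> 1 \<and> \<sigma> 2)) \<and>
        \<sigma> 7 = (\<not> (\<sigma> 1 \<and> \<not> \<sigma> 2)) \<and> \<sigma> 8 = (\<not> (\<not> \<sigma> 1 \<and> \<not> \<sigma> 2)))"
      using True * by (auto simp: right_def)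
    then have "hub False (\<sigma> 3) (\<sigma> 1) (\<sigma> 2) < hub_max (\<sigma> 1) (\<sigma> 2) \<or>
        hub False (\<sigma> 6) (\<not> \<sigma> 1) (\<sigma> 2) < hub_max (\<not> \<sigma> 1) (\<sigma> 2) \<or>
        hub False (\<sigma> 7) (\<sigma> 1) (\<not> \<sigma> 2) < hub_max (\<sigma> 1) (\<not> \<sigma> 2) \<or>
        hub False (\<sigma> 8) (\<not> \<sigma> 1) (\<not> \<sigma> 2) < hub_max (\<not> \<sigma> 1) (\<not> \<sigma> 2)"
      using hub_wrong[of "\<sigma> 3" "\<sigma> 1" "\<sigma> 2"] hub_wrong[of "\<sigma> 6" "\<not> \<sigma> 1" "\<sigma> 2"]
        hub_wrong[of "\<sigma> 7" "\<sigma> 1" "\<not> \<sigma> 2"] hub_wrong[of "\<sigma> 8" "\<not> \<sigma> 1" "\<not> \<sigma> 2"]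
      by satx
    moreover have prod4: "x * y * z * w < x' * y' * z' * w'"
      if "x < x' \<or> y < y' \<or> z < z' \<or> w < w'" "0 < x" "0 < y" "0 < z" "0 < w"
        "x \<le> x'" "y \<le> y'" "z \<le> z'" "w \<le> w'" for x y z w x' y' z' w' :: rat
    proof -
      have *: "u * v < u' * v'" if "u < u' \<or> v < v'" "0 < u" "0 < v" "u \<le> u'" "v \<le> v'" for u v u' v' :: rat
      proof (cases "u < u'")
        case True
        then show ?thesis using that by (intro mult_less_le_imp_less) auto
      next
        case False
        then show ?thesis using that by (intro mult_le_less_imp_less) auto
      qed
      have le: "u * v \<le> u' * v'" if "0 < u" "0 < v" "u \<le> u'" "v \<le> v'" for u v u' v' :: rat
        using that by (intro mult_mono) auto
      have pos: "0 < x * y" "0 < x * y * z" using that by simp_all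
      have le2: "x * y \<le> x' * y'" "x * y * z \<le> x' * y' * z'"
        using that pos by (auto intro!: le)
      have "x * y < x' * y' \<or> z < z' \<or> w < w'"
        using that(1) *[OF _ that(2,3,6,7)] by satx
      then have "x * y * z < x' * y' * z' \<or> w < w'"
        using *[OF _ pos(1) that(4) le2(1) that(8)] by satx
      then show ?thesis
        by (rule *[OF _ pos(2) that(5) le2(2) that(9)])
    qed
    ultimately have "?g < hub_max (\<sigma> 1) (\<sigma> 2) * hub_max (\<not> \<sigma> 1) (\<sigma> 2) * hub_max (\<sigma> 1) (\<not> \<sigma> 2) * hub_max (\<not> \<sigma> 1) (\<not> \<sigma> 2)"
      using hub_le_max hub_pos by (intro prod4) auto
    then show ?thesis
      unfolding G hub_max_prod right_weight_def using b_pos by simp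
  qed
qed

text \<open>Valid without any assumption on vertex 0, where a gate may weigh more than
  \<open>right_weight\<close>.\<close>

definition gate_bound :: rat where "gate_bound = b ^ (2 * K + 4 * (q + 2))"

lemma G_le: "G \<sigma> \<le> gate_bound"
proof -
  have "mat \<beta> \<gamma> M (\<sigma> 1) (\<sigma> 4) ^ K * mat \<beta> \<gamma> M (\<sigma> 2) (\<sigma> 5) ^ K *
    (hub (\<sigma> 0) (\<sigma> 3) (\<sigma> 1) (\<sigma> 2) * hub (\<sigma> 0) (\<sigma> 6) (\<sigma> 4) (\<sigma> 2) *
     hub (\<sigma> 0) (\<sigma> 7) (\<sigma> 1) (\<sigma> 5) * hub (\<sigma> 0) (\<sigma> 8) (\<sigma> 4) (\<sigma> 5)) \<le>
    b ^ K * b ^ K * (b ^ (q + 2) * b ^ (q + 2) * b ^ (q + 2) * b ^ (q + 2))"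
    using mat_le mat_pos hub_le hub_pos b_pos
    by (intro mult_mono power_mono) (auto intro: less_imp_le mult_pos_pos)
  then show ?thesis
    unfolding G_eq gate_bound_def pow4 by (simp only: power_add mult_2)
qed

text \<open>The weight of a gate depends on nine local spins only, so the strict inequalities are
  finitely many and have a common ratio below 1. The ratio \<open>a / b\<close> is included for an
  output with value 0.\<close>

lemma ex_ratio: "\<exists>\<eta><1. 0 < \<eta> \<and> a \<le> \<eta> * b \<and> (\<forall>\<sigma>. \<not> \<sigma> 0 \<longrightarrow> \<not> right \<sigma> \<longrightarrow> G \<sigma> \<le> \<eta> * right_weight)"
proof -
  let ?S = "insert (a / b) ((\<lambda>\<sigma>. G \<sigma> / right_weight) ` {\<sigma> \<in> assignments 9. \<not> \<sigma> 0 \<and> \<not> right \<sigma>})"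
  define \<eta> where "\<eta> = Max ?S"
  have fin: "finite ?S" by simp
  have "x < 1" if "x \<in> ?S" for x
    using that G_wrong right_weight_pos pos b_pos by auto
  then have "\<eta> < 1" unfolding \<eta>_def using fin by (subst Max_less_iff) auto
  moreover have ab: "a / b \<le> \<eta>" unfolding \<eta>_def using fin by (intro Max_ge) auto
  moreover have "0 < \<eta>" using ab divide_pos_pos[OF pos(1) b_pos] by linarith
  moreover have "G \<sigma> \<le> \<eta> * right_weight" if "\<not> \<sigma> 0" "\<not> right \<sigma>" for \<sigma>
  proof -
    let ?\<tau> = "\<lambda>v. v < 9 \<and> \<sigma> v"
    have eq: "?\<tau> v = \<sigma> v" if "v < 9" for v using that by simp
    have "G ?\<tau> = G \<sigma>" unfolding G_eq by (simp add: eq)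
    moreover have "?\<tau> \<in> assignments 9" "\<not> ?\<tau> 0" "\<not> right ?\<tau>"
      using that by (auto simp: assignments_def right_def)
    then have "G ?\<tau> / right_weight \<le> \<eta>"
      unfolding \<eta>_def using fin by (intro Max_ge) auto
    ultimately show ?thesis
      using right_weight_pos by (simp add: field_simps)
  qed
  ultimately show ?thesis
    using b_pos by (intro exI[of _ \<eta>]) (auto simp: field_simps)
qed

end

text \<open>The least \<open>q\<close> with the first property also has the second: its predecessor
  lacks the first one, so the bias is not yet too strong. A large \<open>K\<close> then satisfies
  the remaining condition.\<close>

lemma ex_hard_gates:
  assumes "hard_edge \<beta> \<gamma> M"
  shows "\<exists>q K a b d. hard_gates \<beta> \<gamma> M q K a b d"
proof -
  define a b d where "a = mat \<beta> \<gamma> M False False" and "b = mat \<beta> \<gamma> M False True"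
    and "d = mat \<beta> \<gamma> M True True"
  have pos: "0 < a" "a < b" "0 < d" "d < b" "0 < b"
    using assms by (auto simp: hard_edge_def a_def b_def d_def)
  have "\<exists>q. (a / b) ^ q < d / a"
    using pos by (intro rat_power_small) auto
  then have "\<exists>q. a ^ Suc q < d * b ^ q"
    using pos by (auto simp: power_divide field_simps)
  then have "\<exists>q. a ^ Suc q < d * b ^ q \<and> d ^ 2 * b ^ q < b ^ 2 * a ^ q"
  proof (cases rule: least_natE)
    case 1
    have "d ^ 2 < b ^ 2" using pos by (intro power_strict_mono) auto
    then show ?thesis using 1 by (intro exI[of _ 0]) simp
  next
    case (2 m)
    have "d ^ 2 * b ^ Suc m = d * (d * b ^ Suc m)" by (simp add: power2_eq_square)
    also have "\<dots> < b * (d * b ^ Suc m)" using pos by (intro mult_strict_right_mono) auto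
    also have "\<dots> = b ^ 2 * (d * b ^ m)" by (simp add: power2_eq_square)
    also have "\<dots> \<le> b ^ 2 * a ^ Suc m" using 2(2) pos by (intro mult_left_mono) auto
    finally show ?thesis using 2(1) by blast
  qed
  then obtain q where q: "a ^ Suc q < d * b ^ q" "d ^ 2 * b ^ q < b ^ 2 * a ^ q" by blast
  let ?H = "b ^ (q + 2) * (d * b ^ Suc q) ^ 2 * (b ^ 2 * a ^ q)"
  have H: "0 < ?H" using pos by simp
  obtain K where "(max a d / b) ^ K < ?H / b ^ (4 * (q + 2))"
    using rat_power_small[of "max a d / b" "?H / b ^ (4 * (q + 2))"] pos H by auto
  then have "max a d ^ K * b ^ (4 * (q + 2)) < b ^ K * ?H"
    using pos by (simp add: power_divide field_simps)
  then have "hard_gates \<beta> \<gamma> M q K a b d"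
    using pos q assms by unfold_locales (auto simp: hard_edge_def a_def b_def d_def)
  then show ?thesis by blast
qed

subsection \<open>The sign of the partition function\<close>

lemma prod_le_power_factor:
  fixes g :: "nat \<Rightarrow> rat"
  assumes "\<And>i. i < n \<Longrightarrow> 0 \<le> g i \<and> g i \<le> w" "j < n" "g j \<le> e * w"
  shows "(\<Prod>i<n. g i) \<le> e * w ^ n"
proof -
  have "(\<Prod>i<n. g i) = g j * (\<Prod>i\<in>{..<n} - {j}. g i)"
    using assms(2) by (intro prod.remove) auto
  also have "\<dots> \<le> (e * w) * (\<Prod>i\<in>{..<n} - {j}. w)"
    using assms by (intro mult_mono prod_mono prod_nonneg) (auto intro: order.trans)
  also have "\<dots> = e * w ^ n"
    using assms(2) by (cases n) (auto simp: card_Diff_singleton)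
  finally show ?thesis .
qed

definition solutions :: "nat \<Rightarrow> (nat \<times> nat) list \<Rightarrow> nat \<Rightarrow> (nat \<Rightarrow> bool) set" where
  "solutions n0 C out = {v \<in> assignments (wires n0 C). \<not> v 0 \<and> v out \<and>
    (\<forall>i<length C. v (n0 + i) = (\<not> (v (fst (C ! i)) \<and> v (snd (C ! i)))))}"

lemma finite_solutions [simp]: "finite (solutions n0 C out)"
  unfolding solutions_def using finite_assignments by simp

context hard_gates
begin

context
  fixes n0 :: nat and C :: "(nat \<times> nat) list" and out :: nat
  assumes n0: "2 \<le> n0" and out: "out < wires n0 C"
    and C: "\<And>x y. (x, y) \<in> set C \<Longrightarrow> x < wires n0 C \<and> y < wires n0 C"
begin

definition good :: "(nat \<Rightarrow> bool) \<Rightarrow> bool" where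
  "good \<sigma> \<longleftrightarrow> \<not> \<sigma> 0 \<and> \<sigma> out \<and> (\<forall>i<length C. right (\<sigma> \<circ> terminal n0 (wires n0 C) (C ! i) i))"

definition aux :: "(nat \<Rightarrow> bool) \<Rightarrow> nat \<Rightarrow> nat \<Rightarrow> bool" where
  "aux v i j = (let x = v (fst (C ! i)); y = v (snd (C ! i)) in
    [\<not> x, \<not> y, \<not> (\<not> x \<and> y), \<not> (x \<and> \<not> y), \<not> (\<not> x \<and> \<not> y)] ! j)"

text \<open>Once the wires have values, a correct gate leaves no choice for its five private
  vertices; \<open>aux\<close> lists their values.\<close>

definition extend :: "(nat \<Rightarrow> bool) \<Rightarrow> nat \<Rightarrow> bool" where
  "extend v x = (if x < wires n0 C then v x
    else x < core_size n0 C \<and> aux v ((x - wires n0 C) div 5) ((x - wires n0 C) mod 5))"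

lemma C_nth: "i < length C \<Longrightarrow> fst (C ! i) < wires n0 C \<and> snd (C ! i) < wires n0 C"
  using C[of "fst (C ! i)" "snd (C ! i)"] by simp

lemma right_terminal:
  "right (\<sigma> \<circ> terminal n0 (wires n0 C) (C ! i) i) \<longleftrightarrow>
    \<sigma> (n0 + i) = (\<not> (\<sigma> (fst (C ! i)) \<and> \<sigma> (snd (C ! i)))) \<and>
    (\<forall>j<5. \<sigma> (wires n0 C + 5 * i + j) = aux \<sigma> i j)"
proof -
  have "(\<forall>j<5. P j) \<longleftrightarrow> P 0 \<and> P 1 \<and> P 2 \<and> P 3 \<and> P 4" for P :: "nat \<Rightarrow> bool"
    by (simp add: numeral_eq_Suc less_Suc_eq_le le_Suc_eq all_conj_distrib)
  then show ?thesis
    unfolding right_def by (simp add: terminal_def aux_def Let_def)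
qed

text \<open>The private vertices are determined by the wires, so each satisfying assignment comes
  from exactly one good configuration.\<close>

lemma sum_good:
  "(\<Sum>\<sigma> \<in> {\<sigma> \<in> assignments (core_size n0 C). good \<sigma>}. f (\<sigma> 1)) = (\<Sum>v\<in>solutions n0 C out. f (v 1))"
  for f :: "bool \<Rightarrow> rat"
proof (rule sum.reindex_bij_witness[of _ extend "\<lambda>\<sigma> x. x < wires n0 C \<and> \<sigma> x"])
  have W: "n0 + i < wires n0 C" if "i < length C" for i
    using that by (simp add: wires_def)
  have W01: "0 < wires n0 C" "1 < wires n0 C"
    using n0 by (auto simp: wires_def)
  {
    fix \<sigma> assume \<sigma>: "\<sigma> \<in> {\<sigma> \<in> assignments (core_size n0 C). good \<sigma>}"
    let ?v = "\<lambda>x. x < wires n0 C \<and> \<sigma> x"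
    have v: "?v x = \<sigma> x" if "x < wires n0 C" for x using that by simp
    have aux: "aux ?v i j = aux \<sigma> i j" if "i < length C" for i j
      using C_nth[OF that] by (simp add: aux_def)
    show "extend ?v = \<sigma>"
    proof
      fix x
      show "extend ?v x = \<sigma> x"
      proof (cases "x < wires n0 C \<or> \<not> x < core_size n0 C")
        case True
        then show ?thesis
          using \<sigma> by (auto simp: extend_def assignments_def core_size_def)
      next
        case False
        define i j where "i = (x - wires n0 C) div 5" and "j = (x - wires n0 C) mod 5"
        have x: "x = wires n0 C + 5 * i + j" using False by (simp add: i_def j_def)
        have i: "i < length C" "j < 5" using False by (auto simp: i_def j_def core_size_def)
        have "\<sigma> x = aux \<sigma> i j" using \<sigma> i unfolding x by (simp add: good_def right_terminal)
        then show ?thesis using False aux[OF i(1)] by (simp add: extend_def i_def j_def)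
      qed
    qed
    show "?v \<in> solutions n0 C out"
      using \<sigma> out W W01 C_nth unfolding solutions_def by (auto simp: assignments_def good_def right_terminal)
    show "f (?v 1) = f (\<sigma> 1)" using W01 by simp
  }
  {
    fix v assume v: "v \<in> solutions n0 C out"
    have le: "wires n0 C \<le> core_size n0 C" by (simp add: core_size_def)
    show "(\<lambda>x. x < wires n0 C \<and> extend v x) = v"
      using v by (auto simp: fun_eq_iff extend_def solutions_def assignments_def)
    have ext: "extend v x = v x" if "x < wires n0 C" for x
      using that by (simp add: extend_def)
    have "right (extend v \<circ> terminal n0 (wires n0 C) (C ! i) i)" if i: "i < length C" for i
    proof -
      have "extend v (wires n0 C + 5 * i + j) = aux (extend v) i j" if "j < 5" for j
      proof -
        have "5 * i + j < 5 * length C" using i that by simp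
        moreover have "(5 * i + j) div 5 = i" "(5 * i + j) mod 5 = j" using that by auto
        ultimately have "extend v (wires n0 C + 5 * i + j) = aux v i j"
          unfolding extend_def by (simp add: core_size_def add.assoc)
        also have "\<dots> = aux (extend v) i j" using C_nth[OF i] by (simp add: aux_def ext)
        finally show ?thesis .
      qed
      then show ?thesis
        using v i C_nth[OF i] W[OF i] by (simp add: right_terminal ext solutions_def)
    qed
    then show "extend v \<in> {\<sigma> \<in> assignments (core_size n0 C). good \<sigma>}"
      using v ext[OF out] ext[OF W01(1)] le by (auto simp: good_def solutions_def assignments_def extend_def)
  }
qed

text \<open>Good configurations all weigh the same up to the last edge, and sum to
  \<open>N * D\<close>. In any other one, vertex 0, the output or some gate is wrong, which costs a
  factor \<open>\<eta> ^ m\<close>; together these stay below \<open>N / 2\<close>, while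
  \<open>N * D\<close> is at least \<open>N\<close> in modulus. Without pins, this comparison is
  made in the half with spin 0 at vertex 0.\<close>

theorem sgn_sum_core_weight:
  fixes P :: gadget and Cp Cm :: nat and \<eta> D :: rat
  defines "p0 \<equiv> mat \<beta> \<gamma> P False False" and "p1 \<equiv> mat \<beta> \<gamma> P True True"
    and "A \<equiv> 1 + \<bar>\<beta>\<bar> + \<bar>\<gamma>\<bar>"
  assumes \<eta>: "0 < \<eta>" "\<eta> < 1" "a \<le> \<eta> * b" "\<And>\<sigma>. \<not> \<sigma> 0 \<Longrightarrow> \<not> right \<sigma> \<Longrightarrow> G \<sigma> \<le> \<eta> * right_weight"
    and p0: "0 < p0"
    and pinned: "\<beta> = \<gamma> \<or> 0 \<le> p1 \<and> p1 ^ Cp * gate_bound \<le> right_weight * p0 ^ Cp \<and> p1 ^ Cp \<le> \<eta> * p0 ^ Cp"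
    and Cm: "\<eta> ^ Cm * (2 * A) \<le> 1"
    and D: "D = of_nat (card {v \<in> solutions n0 C out. v 1}) + \<beta> * of_nat (card {v \<in> solutions n0 C out. \<not> v 1})"
    and D1: "1 \<le> \<bar>D\<bar>"
  shows "sgn (\<Sum>\<sigma>\<in>assignments (core_size n0 C). core_weight \<beta> \<gamma> M P q K Cp Cm n0 C out \<sigma>) = sgn D"
proof -
  define m where "m = copies Cm n0 C"
  define mp where "mp = pin_copies Cp Cm n0 C"
  define V where "V = core_size n0 C"
  define L where "L = length C"
  define g where "g i \<sigma> = G (\<sigma> \<circ> terminal n0 (wires n0 C) (C ! i) i)" for i \<sigma>
  define W where "W = core_weight \<beta> \<gamma> M P q K Cp Cm n0 C out"
  \<comment> \<open>The common weight of the good configurations, except for the last edge.\<close>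
  define N where "N = right_weight ^ (m * L) * p0 ^ mp * b ^ m"
  define U where "U = assignments V"
  have N: "0 < N"
    using p0 b_pos right_weight_pos by (simp add: N_def)
  have A: "1 \<le> A" by (simp add: A_def)
  have sw: "\<bar>spin_weight \<beta> \<gamma> x y\<bar> \<le> A" for x y
    by (auto simp: spin_weight_def A_def)
  have W: "W \<sigma> = (\<Prod>i<L. g i \<sigma> ^ m) * mat \<beta> \<gamma> P (\<sigma> 0) (\<sigma> 0) ^ mp * mat \<beta> \<gamma> M (\<sigma> out) (\<sigma> 0) ^ m *
      spin_weight \<beta> \<gamma> (\<sigma> 1) (\<sigma> 0)" for \<sigma>
    by (simp add: W_def core_weight_def g_def m_def mp_def L_def)
  have g0: "0 < g i \<sigma>" for i \<sigma> unfolding g_def by (rule G_pos)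
  have out_le: "mat \<beta> \<gamma> M x y ^ m \<le> b ^ m" for x y
    using mat_le mat_pos by (intro power_mono) (auto intro: less_imp_le)
  have term0: "\<not> (\<sigma> \<circ> terminal n0 (wires n0 C) (C ! i) i) 0" if "\<not> \<sigma> 0" for \<sigma> i
    using that by (simp add: terminal_def)
  have g_right: "g i \<sigma> = right_weight" if "\<not> \<sigma> 0" "right (\<sigma> \<circ> terminal n0 (wires n0 C) (C ! i) i)" for i \<sigma>
    unfolding g_def using term0[of \<sigma> i, OF that(1)] that(2) by (rule G_right)
  have g_le: "g i \<sigma> \<le> right_weight" if "\<not> \<sigma> 0" for i \<sigma>
  proof (cases "right (\<sigma> \<circ> terminal n0 (wires n0 C) (C ! i) i)")
    case True
    then show ?thesis using g_right[of \<sigma> i] that by simp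
  next
    case False
    from G_wrong[of "\<sigma> \<circ> terminal n0 (wires n0 C) (C ! i) i", OF term0[of \<sigma> i, OF that] this]
    show ?thesis unfolding g_def by simp
  qed
  have good: "W \<sigma> = N * spin_weight \<beta> \<gamma> (\<sigma> 1) False" if "good \<sigma>" for \<sigma>
  proof -
    have "(\<Prod>i<L. g i \<sigma> ^ m) = (\<Prod>i<L. right_weight ^ m)"
      using that g_right by (intro prod.cong) (auto simp: good_def L_def)
    then show ?thesis
      using that unfolding W by (simp add: good_def N_def mats p0_def power_mult)
  qed
  have bound: "\<bar>W \<sigma>\<bar> \<le> N * (\<eta> ^ m * A)"
    if "(\<Prod>i<L. g i \<sigma> ^ m) * mat \<beta> \<gamma> P (\<sigma> 0) (\<sigma> 0) ^ mp * mat \<beta> \<gamma> M (\<sigma> out) (\<sigma> 0) ^ m \<le> N * \<eta> ^ m"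
      "0 \<le> mat \<beta> \<gamma> P (\<sigma> 0) (\<sigma> 0)" for \<sigma>
  proof -
    let ?X = "(\<Prod>i<L. g i \<sigma> ^ m) * mat \<beta> \<gamma> P (\<sigma> 0) (\<sigma> 0) ^ mp * mat \<beta> \<gamma> M (\<sigma> out) (\<sigma> 0) ^ m"
    have "0 \<le> ?X"
      using that(2) g0 mat_pos by (intro mult_nonneg_nonneg prod_nonneg zero_le_power) (auto intro: less_imp_le)
    then have "\<bar>?X\<bar> = ?X" by (rule abs_of_nonneg)
    then have "\<bar>W \<sigma>\<bar> = ?X * \<bar>spin_weight \<beta> \<gamma> (\<sigma> 1) (\<sigma> 0)\<bar>" unfolding W abs_mult[of ?X] by (rule arg_cong)
    also have "\<dots> \<le> (N * \<eta> ^ m) * A"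
      by (rule mult_mono[OF that(1) sw]) (use N \<eta> in auto)
    finally show ?thesis by (simp add: mult.assoc)
  qed
  have bad: "\<bar>W \<sigma>\<bar> \<le> N * (\<eta> ^ m * A)" if z: "\<not> \<sigma> 0" "\<not> good \<sigma>" for \<sigma>
  proof (rule bound)
    have pw: "(\<Prod>i<L. g i \<sigma> ^ m) \<le> right_weight ^ (m * L)"
    proof -
      have "(\<Prod>i<L. g i \<sigma> ^ m) \<le> (\<Prod>i<L. right_weight ^ m)"
        using g_le[of \<sigma>, OF that(1)] g0 by (intro prod_mono) (auto intro!: power_mono intro: less_imp_le)
      then show ?thesis by (simp add: power_mult)
    qed
    have "(\<Prod>i<L. g i \<sigma> ^ m) * mat \<beta> \<gamma> M (\<sigma> out) (\<sigma> 0) ^ m \<le> \<eta> ^ m * right_weight ^ (m * L) * b ^ m"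
    proof (cases "\<sigma> out")
      case True
      then obtain i where i: "i < L" "\<not> right (\<sigma> \<circ> terminal n0 (wires n0 C) (C ! i) i)"
        using z by (auto simp: good_def L_def)
      have "g i \<sigma> \<le> \<eta> * right_weight"
        unfolding g_def using term0[of \<sigma> i, OF that(1)] i(2) by (rule \<eta>(4))
      then have "g i \<sigma> ^ m \<le> \<eta> ^ m * right_weight ^ m"
        using g0[of i \<sigma>] power_mono[of "g i \<sigma>" "\<eta> * right_weight" m] by (simp add: power_mult_distrib less_imp_le)
      then have "(\<Prod>i<L. g i \<sigma> ^ m) \<le> \<eta> ^ m * (right_weight ^ m) ^ L"
        using g_le[of \<sigma>, OF that(1)] g0 i(1)
        by (intro prod_le_power_factor[of _ _ _ i]) (auto intro!: power_mono intro: less_imp_le)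
      then show ?thesis
        using out_le mat_pos \<eta> right_weight_pos by (intro mult_mono) (auto simp: power_mult intro: less_imp_le)
    next
      case False
      have "a ^ m \<le> (\<eta> * b) ^ m" using \<eta>(3) pos by (intro power_mono) auto
      then have "(\<Prod>i<L. g i \<sigma> ^ m) * mat \<beta> \<gamma> M (\<sigma> out) (\<sigma> 0) ^ m \<le> right_weight ^ (m * L) * (\<eta> * b) ^ m"
        using pw False that pos right_weight_pos by (intro mult_mono) (auto simp: mats)
      then show ?thesis by (simp add: power_mult_distrib mult_ac)
    qed
    then have "((\<Prod>i<L. g i \<sigma> ^ m) * mat \<beta> \<gamma> M (\<sigma> out) (\<sigma> 0) ^ m) * p0 ^ mp \<le>
        (\<eta> ^ m * right_weight ^ (m * L) * b ^ m) * p0 ^ mp"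
      using p0 by (intro mult_right_mono) auto
    then show "(\<Prod>i<L. g i \<sigma> ^ m) * mat \<beta> \<gamma> P (\<sigma> 0) (\<sigma> 0) ^ mp * mat \<beta> \<gamma> M (\<sigma> out) (\<sigma> 0) ^ m \<le> N * \<eta> ^ m"
      using that by (simp add: p0_def N_def mult_ac)
    show "0 \<le> mat \<beta> \<gamma> P (\<sigma> 0) (\<sigma> 0)" using that p0 by (simp add: p0_def)
  qed
  \<comment> \<open>The exponent is \<open>m = Cm * (V + 1)\<close>; the power of
    \<open>2 * A\<close> covers the number of configurations, the last edge and a spare factor
    2.\<close>
  have small: "2 ^ V * (\<eta> ^ m * A) \<le> 1 / 2"
  proof -
    have "(\<eta> ^ Cm * (2 * A)) ^ Suc V \<le> 1"
      using Cm \<eta> A by (intro power_le_one) auto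
    then have "\<eta> ^ m * (2 * A) ^ Suc V \<le> 1"
      unfolding power_mult_distrib m_def copies_def V_def power_mult[of \<eta> Cm] .
    moreover have "2 * 2 ^ V * A \<le> (2 * A) ^ Suc V"
      using A one_le_power[of A V] by (simp add: power_mult_distrib mult_ac)
    then have "\<eta> ^ m * (2 * 2 ^ V * A) \<le> \<eta> ^ m * (2 * A) ^ Suc V"
      using \<eta> by (intro mult_left_mono) auto
    ultimately show ?thesis by (simp add: mult_ac)
  qed
  have card_le: "of_nat (card S) * (N * (\<eta> ^ m * A)) \<le> N / 2" if "S \<subseteq> U" for S
  proof -
    have "card S \<le> 2 ^ V"
      using that card_mono[of U S] by (simp add: U_def card_assignments)
    then have "of_nat (card S) \<le> (2::rat) ^ V"
      by (metis of_nat_le_iff of_nat_numeral of_nat_power)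
    then have "of_nat (card S) * (N * (\<eta> ^ m * A)) \<le> 2 ^ V * (N * (\<eta> ^ m * A))"
      using N \<eta> A by (intro mult_right_mono) auto
    also have "\<dots> = N * (2 ^ V * (\<eta> ^ m * A))" by (simp only: mult_ac)
    also have "\<dots> \<le> N * (1 / 2)"
      using small N by (intro mult_left_mono) auto
    finally show ?thesis by simp
  qed
  have sum_good_W: "(\<Sum>\<sigma>\<in>{\<sigma> \<in> U. good \<sigma>}. W \<sigma>) = N * D"
  proof -
    have "(\<Sum>\<sigma>\<in>{\<sigma> \<in> U. good \<sigma>}. W \<sigma>) = N * (\<Sum>\<sigma>\<in>{\<sigma> \<in> U. good \<sigma>}. spin_weight \<beta> \<gamma> (\<sigma> 1) False)"
      unfolding sum_distrib_left by (intro sum.cong) (auto simp: good)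
    also have "(\<Sum>\<sigma>\<in>{\<sigma> \<in> U. good \<sigma>}. spin_weight \<beta> \<gamma> (\<sigma> 1) False) = (\<Sum>v\<in>solutions n0 C out. spin_weight \<beta> \<gamma> (v 1) False)"
      unfolding U_def V_def by (rule sum_good)
    also have "\<dots> = (\<Sum>v\<in>solutions n0 C out. if v 1 then 1 else \<beta>)"
      by (intro sum.cong) (auto simp: spin_weight_def)
    also have "\<dots> = D"
    proof -
      have "solutions n0 C out \<inter> {v. v 1} = {v \<in> solutions n0 C out. v 1}"
        "solutions n0 C out \<inter> - {v. v 1} = {v \<in> solutions n0 C out. \<not> v 1}"
        by auto
      then show ?thesis
        unfolding D sum.If_cases[OF finite_solutions] by (simp add: mult.commute)
    qed
    finally show ?thesis .
  qed
  have sgn: "sgn x = sgn D" if "\<bar>x - N * D\<bar> \<le> N / 2" for x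
  proof (cases "0 < D")
    case True
    then have "N \<le> N * D" using D1 N by simp
    then have "0 < x" using that N by linarith
    then show ?thesis using True by simp
  next
    case False
    then have "N * 1 \<le> N * (-D)" using D1 N by (intro mult_left_mono) auto
    then have "N \<le> - (N * D)" by simp
    then have "x < 0" using that N by linarith
    moreover have "D < 0" using False D1 by auto
    ultimately show ?thesis by simp
  qed
  have fin: "finite U" by (simp add: U_def)
  have abs_sum: "\<bar>\<Sum>\<sigma>\<in>S. W \<sigma>\<bar> \<le> of_nat (card S) * (N * (\<eta> ^ m * A))" if "\<And>\<sigma>. \<sigma> \<in> S \<Longrightarrow> \<bar>W \<sigma>\<bar> \<le> N * (\<eta> ^ m * A)" for S
  proof -
    have "\<bar>sum W S\<bar> \<le> (\<Sum>\<sigma>\<in>S. \<bar>W \<sigma>\<bar>)" by (rule sum_abs)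
    also have "\<dots> \<le> of_nat (card S) * (N * (\<eta> ^ m * A))" using that by (rule sum_bounded_above)
    finally show ?thesis .
  qed
  show ?thesis
  proof (cases "\<beta> = \<gamma>")
    case True
    let ?U0 = "{\<sigma> \<in> U. \<not> \<sigma> 0}"
    have "(\<Sum>\<sigma>\<in>?U0. W \<sigma>) = (\<Sum>\<sigma>\<in>{\<sigma> \<in> U. good \<sigma>}. W \<sigma>) + (\<Sum>\<sigma>\<in>{\<sigma> \<in> U. \<not> \<sigma> 0 \<and> \<not> good \<sigma>}. W \<sigma>)"
      using fin by (subst sum.union_disjoint[symmetric]) (auto intro!: sum.cong simp: good_def)
    moreover have "\<bar>\<Sum>\<sigma>\<in>{\<sigma> \<in> U. \<not> \<sigma> 0 \<and> \<not> good \<sigma>}. W \<sigma>\<bar> \<le> N / 2"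
      using bad by (intro order.trans[OF abs_sum card_le]) auto
    ultimately have "sgn (\<Sum>\<sigma>\<in>?U0. W \<sigma>) = sgn D"
      by (intro sgn) (simp add: sum_good_W)
    \<comment> \<open>Spin flip maps the configurations with spin 1 at vertex 0 to those with spin
      0, so they double the sum instead of spoiling it.\<close>
    moreover have "(\<Sum>\<sigma>\<in>{\<sigma> \<in> U. \<sigma> 0}. W \<sigma>) = (\<Sum>\<sigma>\<in>?U0. W \<sigma>)"
    proof (rule sum.reindex_bij_witness[of _ "\<lambda>\<sigma> v. v < V \<and> \<not> \<sigma> v" "\<lambda>\<sigma> v. v < V \<and> \<not> \<sigma> v"])
      fix \<sigma>
      show "W (\<lambda>v. v < V \<and> \<not> \<sigma> v) = W \<sigma>"
        unfolding W_def by (rule core_weight_flip[OF True n0 out C]) (auto simp: V_def)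
    qed (use n0 in \<open>auto simp: U_def assignments_def fun_eq_iff V_def core_size_def wires_def\<close>)
    moreover have "(\<Sum>\<sigma>\<in>U. W \<sigma>) = (\<Sum>\<sigma>\<in>?U0. W \<sigma>) + (\<Sum>\<sigma>\<in>{\<sigma> \<in> U. \<sigma> 0}. W \<sigma>)"
      using fin by (subst sum.union_disjoint[symmetric]) (auto intro!: sum.cong)
    ultimately have "sgn (\<Sum>\<sigma>\<in>U. W \<sigma>) = sgn (2 * D)"
      by (simp add: sgn_mult flip: mult_2)
    then show ?thesis
      by (simp add: U_def V_def W_def sgn_mult)
  next
    case False
    then have pin: "0 \<le> p1" "p1 ^ Cp * gate_bound \<le> right_weight * p0 ^ Cp" "p1 ^ Cp \<le> \<eta> * p0 ^ Cp"
      using pinned by auto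
    \<comment> \<open>The gates are only bounded by \<open>gate_bound\<close> here. The first
      \<open>Cp * m * L\<close> pins bring that down to the correct weight, the other
      \<open>Cp * m\<close> produce \<open>\<eta> ^ m\<close>.\<close>
    have one: "\<bar>W \<sigma>\<bar> \<le> N * (\<eta> ^ m * A)" if "\<sigma> 0" for \<sigma>
    proof (rule bound)
      have gb: "0 < gate_bound" using b_pos by (simp add: gate_bound_def)
      have mp: "mp = Cp * m * L + Cp * m"
        by (simp add: mp_def pin_copies_def m_def L_def algebra_simps)
      have "(\<Prod>i<L. g i \<sigma> ^ m) \<le> (\<Prod>i<L. gate_bound ^ m)"
        using G_le g0 unfolding g_def by (intro prod_mono) (auto intro!: power_mono intro: less_imp_le)
      then have "(\<Prod>i<L. g i \<sigma> ^ m) \<le> gate_bound ^ (m * L)" by (simp add: power_mult)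
      then have "(\<Prod>i<L. g i \<sigma> ^ m) * p1 ^ mp * mat \<beta> \<gamma> M (\<sigma> out) (\<sigma> 0) ^ m \<le> gate_bound ^ (m * L) * p1 ^ mp * b ^ m"
        using pin(1) out_le mat_pos gb b_pos by (intro mult_mono) (auto intro: less_imp_le)
      also have "\<dots> \<le> right_weight ^ (m * L) * p0 ^ mp * \<eta> ^ m * b ^ m"
      proof (rule mult_right_mono)
        have "gate_bound ^ (m * L) * p1 ^ mp = (p1 ^ Cp * gate_bound) ^ (m * L) * (p1 ^ Cp) ^ m"
          unfolding mp power_add by (simp add: power_mult_distrib power_mult mult_ac flip: power_mult)
        also have "\<dots> \<le> (right_weight * p0 ^ Cp) ^ (m * L) * (\<eta> * p0 ^ Cp) ^ m"
          by (rule mult_mono[OF power_mono[OF pin(2)] power_mono[OF pin(3)]])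
            (use pin(1) gb right_weight_pos p0 in auto)
        also have "\<dots> = right_weight ^ (m * L) * p0 ^ mp * \<eta> ^ m"
          unfolding mp power_add by (simp add: power_mult_distrib mult_ac flip: power_mult)
        finally show "gate_bound ^ (m * L) * p1 ^ mp \<le> right_weight ^ (m * L) * p0 ^ mp * \<eta> ^ m" .
      qed (use b_pos in auto)
      finally show "(\<Prod>i<L. g i \<sigma> ^ m) * mat \<beta> \<gamma> P (\<sigma> 0) (\<sigma> 0) ^ mp * mat \<beta> \<gamma> M (\<sigma> out) (\<sigma> 0) ^ m \<le> N * \<eta> ^ m"
        using that by (simp add: N_def p1_def mult_ac)
      show "0 \<le> mat \<beta> \<gamma> P (\<sigma> 0) (\<sigma> 0)" using that pin(1) by (simp add: p1_def)
    qed
    have "(\<Sum>\<sigma>\<in>U. W \<sigma>) = (\<Sum>\<sigma>\<in>{\<sigma> \<in> U. good \<sigma>}. W \<sigma>) + (\<Sum>\<sigma>\<in>{\<sigma> \<in> U. \<not> good \<sigma>}. W \<sigma>)"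
      using fin by (subst sum.union_disjoint[symmetric]) (auto intro!: sum.cong)
    moreover have "\<bar>\<Sum>\<sigma>\<in>{\<sigma> \<in> U. \<not> good \<sigma>}. W \<sigma>\<bar> \<le> N / 2"
      using bad one by (intro order.trans[OF abs_sum card_le]) auto
    ultimately have "sgn (\<Sum>\<sigma>\<in>U. W \<sigma>) = sgn D"
      by (intro sgn) (simp add: sum_good_W)
    then show ?thesis by (simp add: U_def V_def W_def)
  qed
qed

end

end

text \<open>The order of quantifiers is the point: gadgets and constants are chosen for \<beta> and
  \<gamma> before the circuit is known.\<close>

theorem ex_circuit_graph:
  assumes "\<beta> \<le> \<gamma>" "\<beta> < 0" "-2 < \<beta> + \<gamma>" "\<beta> + \<gamma> < 1" "(\<beta>, \<gamma>) \<noteq> (-1, 1)"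
  shows "\<exists>M P q K Cp Cm. \<forall>n0 C out. 2 \<le> n0 \<longrightarrow> out < wires n0 C \<longrightarrow>
    (\<forall>(x, y) \<in> set C. x < wires n0 C \<and> y < wires n0 C) \<longrightarrow>
    (let D = of_nat (card {v \<in> solutions n0 C out. v 1}) +
          \<beta> * of_nat (card {v \<in> solutions n0 C out. \<not> v 1});
        es = concat (map place_edges (circuit_placements M P q K Cp Cm n0 C out));
        n = graph_size M P q K Cp Cm n0 C in
      1 \<le> \<bar>D\<bar> \<longrightarrow> encodes (graph_code n es) (coded_graph n es) \<and>
        sgn (partition_function \<beta> \<gamma> (coded_graph n es)) = sgn D)"
proof -
  obtain M where M: "hard_edge \<beta> \<gamma> M" using ex_gadgets[OF assms] by blast
  obtain q K a b d where gates: "hard_gates \<beta> \<gamma> M q K a b d" using ex_hard_gates[OF M] by blast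
  interpret hard_gates \<beta> \<gamma> M q K a b d by (rule gates)
  obtain \<eta> where \<eta>: "\<eta> < 1" "0 < \<eta>" "a \<le> \<eta> * b" "\<And>\<sigma>. \<not> \<sigma> 0 \<Longrightarrow> \<not> right \<sigma> \<Longrightarrow> G \<sigma> \<le> \<eta> * right_weight"
    using ex_ratio by blast
  let ?A = "1 + \<bar>\<beta>\<bar> + \<bar>\<gamma>\<bar>"
  obtain Cm where "\<eta> ^ Cm < 1 / (2 * ?A)"
    using rat_power_small[OF \<eta>(2,1), of "1 / (2 * ?A)"] by (auto simp: add_pos_nonneg)
  then have Cm: "\<eta> ^ Cm * (2 * ?A) \<le> 1"
    by (simp add: field_simps add_pos_nonneg)
  obtain P Cp where P: "0 < mat \<beta> \<gamma> P False False"
      "\<beta> = \<gamma> \<or> 0 \<le> mat \<beta> \<gamma> P True True \<and>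
        mat \<beta> \<gamma> P True True ^ Cp * gate_bound \<le> right_weight * mat \<beta> \<gamma> P False False ^ Cp \<and>
        mat \<beta> \<gamma> P True True ^ Cp \<le> \<eta> * mat \<beta> \<gamma> P False False ^ Cp"
  proof (cases "\<beta> = \<gamma>")
    case True
    \<comment> \<open>With \<open>Cp = 0\<close> no pin is placed; \<open>Ones\<close> is a
      dummy.\<close>
    then show ?thesis using that[of Ones 0] by simp
  next
    case False
    then obtain P where P: "pin \<beta> \<gamma> P" using ex_gadgets[OF assms] by blast
    define p0 p1 where "p0 = mat \<beta> \<gamma> P False False" and "p1 = mat \<beta> \<gamma> P True True"
    have p: "0 \<le> p1" "p1 < p0" "0 < p0" using P by (auto simp: pin_def p0_def p1_def)
    have gb: "0 < gate_bound" using b_pos by (simp add: gate_bound_def)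
    define e where "e = min \<eta> (right_weight / gate_bound)"
    have e: "0 < e" using \<eta> gb right_weight_pos by (simp add: e_def)
    \<comment> \<open>If \<open>p1 = 0\<close>, the exponent must be positive since
      \<open>0 ^ 0 = 1\<close>.\<close>
    obtain k where k: "(p1 / p0) ^ k < e"
    proof (cases "p1 = 0")
      case True
      then show ?thesis using e that[of 1] by simp
    next
      case False
      then show ?thesis using rat_power_small[of "p1 / p0" e] p e that by auto
    qed
    then have "p1 ^ k < e * p0 ^ k" using p by (simp add: power_divide field_simps)
    moreover have "e * p0 ^ k \<le> \<eta> * p0 ^ k" "e * p0 ^ k \<le> right_weight / gate_bound * p0 ^ k"
      using p by (intro mult_right_mono; simp add: e_def)+
    ultimately have "p1 ^ k \<le> \<eta> * p0 ^ k" "p1 ^ k \<le> right_weight / gate_bound * p0 ^ k" by auto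
    then show ?thesis
      using that[of P k] p gb by (simp add: p0_def p1_def field_simps)
  qed
  show ?thesis
  proof (intro exI allI impI, unfold Let_def, intro impI)
    fix n0 C out
    assume n0: "2 \<le> n0" and out: "out < wires n0 C" and C: "\<forall>(x, y) \<in> set C. x < wires n0 C \<and> y < wires n0 C"
    assume D: "1 \<le> \<bar>of_nat (card {v \<in> solutions n0 C out. v 1}) +
          \<beta> * of_nat (card {v \<in> solutions n0 C out. \<not> v 1})\<bar>"
    have C': "x < wires n0 C \<and> y < wires n0 C" if "(x, y) \<in> set C" for x y
      using C that by auto
    have "u < core_size n0 C \<and> v < core_size n0 C"
      if "(g, u, v, b') \<in> set (circuit_placements M P q K Cp Cm n0 C out)" for g u v b'
      using that n0 out C' by (rule circuit_terminals)
    note pl = partition_function_placements[OF chain_circuit this]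
    have "sgn (\<Sum>\<sigma>\<in>assignments (core_size n0 C). core_weight \<beta> \<gamma> M P q K Cp Cm n0 C out \<sigma>) =
        sgn (of_nat (card {v \<in> solutions n0 C out. v 1}) + \<beta> * of_nat (card {v \<in> solutions n0 C out. \<not> v 1}))"
      by (rule sgn_sum_core_weight[OF n0 out C' \<eta>(2,1,3,4) P Cm refl D])
    then show "encodes (graph_code (graph_size M P q K Cp Cm n0 C)
          (concat (map place_edges (circuit_placements M P q K Cp Cm n0 C out))))
        (coded_graph (graph_size M P q K Cp Cm n0 C)
          (concat (map place_edges (circuit_placements M P q K Cp Cm n0 C out)))) \<and>
      sgn (partition_function \<beta> \<gamma> (coded_graph (graph_size M P q K Cp Cm n0 C)
          (concat (map place_edges (circuit_placements M P q K Cp Cm n0 C out))))) =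
      sgn (of_nat (card {v \<in> solutions n0 C out. v 1}) + \<beta> * of_nat (card {v \<in> solutions n0 C out. \<not> v 1}))"
      using pl by (simp add: prod_circuit_placements)
  qed
qed

section \<open>NAND circuits\<close>

datatype formula = Inp nat | Nand formula formula

fun fsize :: "formula \<Rightarrow> nat" where
  "fsize (Inp j) = 0"
| "fsize (Nand f g) = Suc (fsize f + fsize g)"

fun feval :: "(nat \<Rightarrow> bool) \<Rightarrow> formula \<Rightarrow> bool" where
  "feval v (Inp j) = v j"
| "feval v (Nand f g) = (\<not> (feval v f \<and> feval v g))"

fun inputs :: "formula \<Rightarrow> nat set" where
  "inputs (Inp j) = {j}"
| "inputs (Nand f g) = inputs f \<union> inputs g"

fun fout :: "(nat \<Rightarrow> nat) \<Rightarrow> nat \<Rightarrow> formula \<Rightarrow> nat" where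
  "fout inp b (Inp j) = inp j"
| "fout inp b (Nand f g) = b + (fsize f + fsize g)"

fun fgates :: "(nat \<Rightarrow> nat) \<Rightarrow> nat \<Rightarrow> formula \<Rightarrow> (nat \<times> nat) list" where
  "fgates inp b (Inp j) = []"
| "fgates inp b (Nand f g) = fgates inp b f @ fgates inp (b + fsize f) g @
    [(fout inp b f, fout inp (b + fsize f) g)]"

lemma length_fgates [simp]: "length (fgates inp b f) = fsize f"
  by (induction f arbitrary: b) auto

text \<open>A bare input contributes no gate. Excluding it guarantees that the output of a formula
  is the last gate of its block.\<close>

definition is_gate :: "formula \<Rightarrow> bool" where
  "is_gate f \<longleftrightarrow> (\<exists>g h. f = Nand g h)"

lemma fout_gate: "is_gate f \<Longrightarrow> fout inp b f = b + fsize f - 1" and fsize_gate: "is_gate f \<Longrightarrow> 0 < fsize f"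
  by (auto simp: is_gate_def)

text \<open>Shannon expansion on the last variable: \<open>?h\<close> below is the NAND form of "if
  r then f else g". Constants are built from input 0, hence the bound
  \<open>max 1 r\<close>.\<close>

theorem formula_complete:
  assumes "\<And>v w. (\<And>j. j < r \<Longrightarrow> v j = w j) \<Longrightarrow> F v = F w"
  shows "\<exists>f. is_gate f \<and> inputs f \<subseteq> {..<max 1 r} \<and> (\<forall>v. feval v f = F v)"
  using assms
proof (induction r arbitrary: F)
  case 0
  have const: "F v = F w" for v w by (rule 0) simp
  let ?t = "Nand (Inp 0) (Nand (Inp 0) (Inp 0))"
  show ?case
  proof (cases "F (\<lambda>_. False)")
    case True
    have "F v" for v using const[of v "\<lambda>_. False"] True by simp
    then show ?thesis by (intro exI[of _ ?t]) (auto simp: is_gate_def)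
  next
    case False
    have "\<not> F v" for v using const[of v "\<lambda>_. False"] False by simp
    then show ?thesis
      by (intro exI[of _ "Nand ?t ?t"]) (auto simp: is_gate_def)
  qed
next
  case (Suc r)
  have dep: "(\<lambda>v. F (v(r := x))) v = (\<lambda>v. F (v(r := x))) w" if "\<And>j. j < r \<Longrightarrow> v j = w j" for v w x
    using that by (intro Suc.prems) (auto simp: less_Suc_eq)
  obtain f where f: "inputs f \<subseteq> {..<max 1 r}" "\<And>v. feval v f = F (v(r := True))"
    using Suc.IH[of "\<lambda>v. F (v(r := True))", OF dep] by blast
  obtain g where g: "inputs g \<subseteq> {..<max 1 r}" "\<And>v. feval v g = F (v(r := False))"
    using Suc.IH[of "\<lambda>v. F (v(r := False))", OF dep] by blast
  let ?h = "Nand (Nand (Inp r) f) (Nand (Nand (Inp r) (Inp r)) g)"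
  have "feval v ?h = F v" for v
  proof -
    have "v = v(r := v r)" by simp
    then show ?thesis using f(2)[of v] g(2)[of v] by (cases "v r") (auto simp: fun_upd_idem)
  qed
  moreover have "inputs ?h \<subseteq> {..<max 1 (Suc r)}"
    using f(1) g(1) by (auto simp: subset_iff max_def split: if_splits)
  ultimately show ?case by (intro exI[of _ ?h]) (auto simp: is_gate_def)
qed

section \<open>Circuits as lists of gates, their blocks and their evaluation\<close>

definition consistent :: "nat \<Rightarrow> (nat \<times> nat) list \<Rightarrow> (nat \<Rightarrow> bool) \<Rightarrow> bool" where
  "consistent n0 C v \<longleftrightarrow> (\<forall>i<length C. v (n0 + i) = (\<not> (v (fst (C ! i)) \<and> v (snd (C ! i)))))"

text \<open>A contiguous block of gates: consistency of the whole circuit restricts to it with the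
  numbering of wires shifted by \<open>i\<close>, so blocks can be analysed separately.\<close>

definition occurs :: "'a list \<Rightarrow> nat \<Rightarrow> 'a list \<Rightarrow> bool" where
  "occurs C i D \<longleftrightarrow> (\<exists>pre post. C = pre @ D @ post \<and> length pre = i)"

lemma occurs_refl: "occurs C 0 C"
  unfolding occurs_def by (intro exI[of _ "[]"]) auto

lemma occurs_append1: "occurs C i (D @ E) \<Longrightarrow> occurs C i D"
  unfolding occurs_def by (metis append.assoc)

lemma occurs_append2: "occurs C i (D @ E) \<Longrightarrow> occurs C (i + length D) E"
proof -
  assume "occurs C i (D @ E)"
  then obtain pre post where "C = pre @ (D @ E) @ post" "length pre = i"
    by (auto simp: occurs_def)
  then show ?thesis
    unfolding occurs_def by (intro exI[of _ "pre @ D"] exI[of _ post]) auto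
qed

lemma occurs_nth: "occurs C i D \<Longrightarrow> k < length D \<Longrightarrow> C ! (i + k) = D ! k \<and> i + k < length C"
  by (auto simp: occurs_def nth_append)

lemma length_concat_upt:
  "(\<And>k. k < n \<Longrightarrow> length (f k) = s) \<Longrightarrow> length (concat (map f [0..<n])) = n * s"
  by (induction n) auto

lemma occurs_concat:
  assumes "occurs C i (concat (map f [0..<n]))" "\<And>k. k < n \<Longrightarrow> length (f k) = s" "k < n"
  shows "occurs C (i + k * s) (f k)"
proof -
  have len: "length (concat (map f [0..<k])) = k * s" if "k \<le> n" for k
    using that assms(2) by (intro length_concat_upt) auto
  have "[0..<n] = [0..<k] @ k # [Suc k..<n]"
    using assms(3) upt_append[of 0 k n] by (simp add: upt_conv_Cons)
  then have "concat (map f [0..<n]) = concat (map f [0..<k]) @ f k @ concat (map f [Suc k..<n])"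
    by simp
  then have "occurs C (i + length (concat (map f [0..<k]))) (f k)"
    using assms(1) occurs_append1 occurs_append2 by metis
  then show ?thesis using len[of k] assms(3) by simp
qed

lemma consistent_occurs:
  "consistent n0 C v \<Longrightarrow> occurs C i D \<Longrightarrow> consistent (n0 + i) D v"
  unfolding consistent_def
proof (intro allI impI)
  fix k
  assume *: "\<forall>i<length C. v (n0 + i) = (\<not> (v (fst (C ! i)) \<and> v (snd (C ! i))))"
    and o: "occurs C i D" and k: "k < length D"
  show "v (n0 + i + k) = (\<not> (v (fst (D ! k)) \<and> v (snd (D ! k))))"
    using *[rule_format, of "i + k"] occurs_nth[OF o k] by (simp add: add.assoc)
qed

lemma fgates_value:
  "consistent b (fgates inp b f) v \<Longrightarrow> v (fout inp b f) = feval (\<lambda>j. v (inp j)) f"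
proof (induction f arbitrary: b)
  case (Nand f g)
  let ?A = "fgates inp b f" and ?B = "fgates inp (b + fsize f) g"
    and ?G = "[(fout inp b f, fout inp (b + fsize f) g)]"
  have C: "consistent b (?A @ ?B @ ?G) v" using Nand.prems by simp
  have A: "consistent b ?A v"
    using consistent_occurs[OF C occurs_append1[OF occurs_refl]] by simp
  have B: "consistent (b + fsize f) ?B v"
    using consistent_occurs[OF C occurs_append1[OF occurs_append2[OF occurs_refl]]] by simp
  have "consistent (b + (fsize f + fsize g)) ?G v"
    using consistent_occurs[OF C occurs_append2[OF occurs_append2[OF occurs_refl]]] by (simp add: add.assoc)
  then show ?case
    using Nand.IH(1)[OF A] Nand.IH(2)[OF B] by (simp add: consistent_def)
qed simp

fun mgates :: "(nat \<Rightarrow> nat) \<Rightarrow> nat \<Rightarrow> formula list \<Rightarrow> (nat \<times> nat) list" where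
  "mgates inp b [] = []"
| "mgates inp b (f # fs) = fgates inp b f @ mgates inp (b + fsize f) fs"

definition msize :: "formula list \<Rightarrow> nat" where
  "msize fs = sum_list (map fsize fs)"

text \<open>The output of the formula with index \<open>j\<close> is the last gate of its block,
  hence the subtraction of 1.\<close>

definition offset :: "formula list \<Rightarrow> nat \<Rightarrow> nat" where
  "offset fs j = msize (take (Suc j) fs) - 1"

lemma length_mgates [simp]: "length (mgates inp b fs) = msize fs"
  by (induction inp b fs rule: mgates.induct) (auto simp: msize_def)

lemma msize_pos: "fs \<noteq> [] \<Longrightarrow> (\<And>f. f \<in> set fs \<Longrightarrow> is_gate f) \<Longrightarrow> 0 < msize fs"
  by (cases fs) (auto simp: msize_def fsize_gate)

lemma mgates_value:
  assumes "consistent b (mgates inp b fs) v" "j < length fs" "\<And>f. f \<in> set fs \<Longrightarrow> is_gate f"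
  shows "v (b + offset fs j) = feval (\<lambda>j. v (inp j)) (fs ! j)"
  using assms
proof (induction inp b fs arbitrary: j rule: mgates.induct)
  case (2 inp b f fs)
  have A: "consistent b (fgates inp b f) v"
    using consistent_occurs[OF 2(2)[unfolded mgates.simps] occurs_append1[OF occurs_refl]] by simp
  have B: "consistent (b + fsize f) (mgates inp (b + fsize f) fs) v"
    using consistent_occurs[OF 2(2)[unfolded mgates.simps] occurs_append2[OF occurs_refl]] by simp
  have f: "is_gate f" "0 < fsize f" using 2(4) fsize_gate by auto
  show ?case
  proof (cases j)
    case 0
    then show ?thesis
      using fgates_value[OF A] f by (simp add: offset_def msize_def fout_gate)
  next
    case (Suc k)
    then have k: "k < length fs" using 2(3) by simp
    have "0 < msize (take (Suc k) fs)"
      using k 2(4) by (intro msize_pos) (auto dest: in_set_takeD)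
    then have "b + offset (f # fs) j = b + fsize f + offset fs k"
      by (simp add: Suc offset_def msize_def)
    then show ?thesis
      using 2(1)[OF B k] 2(4) by (simp add: Suc add.assoc)
  qed
qed simp

lemma offset_less:
  assumes "j < length fs" "\<And>f. f \<in> set fs \<Longrightarrow> is_gate f"
  shows "offset fs j < msize fs"
proof -
  have "msize fs = msize (take (Suc j) fs) + msize (drop (Suc j) fs)"
    unfolding msize_def by (metis append_take_drop_id map_append sum_list_append)
  moreover have "0 < msize fs"
    using assms by (intro msize_pos) auto
  ultimately show ?thesis by (auto simp: offset_def)
qed

definition feedforward :: "nat \<Rightarrow> (nat \<times> nat) list \<Rightarrow> bool" where
  "feedforward n0 C \<longleftrightarrow> (\<forall>i<length C. fst (C ! i) < n0 + i \<and> snd (C ! i) < n0 + i)"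

lemma feedforward_Nil: "feedforward n0 []"
  by (simp add: feedforward_def)

lemma feedforward_append:
  "feedforward n0 C \<Longrightarrow> feedforward (n0 + length C) D \<Longrightarrow> feedforward n0 (C @ D)"
  unfolding feedforward_def
proof (intro allI impI)
  fix i
  assume C: "\<forall>i<length C. fst (C ! i) < n0 + i \<and> snd (C ! i) < n0 + i"
    and D: "\<forall>i<length D. fst (D ! i) < n0 + length C + i \<and> snd (D ! i) < n0 + length C + i"
    and i: "i < length (C @ D)"
  show "fst ((C @ D) ! i) < n0 + i \<and> snd ((C @ D) ! i) < n0 + i"
  proof (cases "i < length C")
    case True
    then show ?thesis using C by (simp add: nth_append)
  next
    case False
    then show ?thesis using D[rule_format, of "i - length C"] i by (simp add: nth_append)
  qed
qed

lemma feedforward_concat: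
  assumes "\<And>k. k < n \<Longrightarrow> length (f k) = s" "\<And>k. k < n \<Longrightarrow> feedforward (n0 + k * s) (f k)"
  shows "feedforward n0 (concat (map f [0..<n]))"
  using assms
proof (induction n)
  case (Suc n)
  have "length (concat (map f [0..<n])) = n * s"
    using Suc.prems(1) by (intro length_concat_upt) auto
  then show ?case
    using Suc by (auto intro!: feedforward_append)
qed (simp add: feedforward_Nil)

lemma fout_less: "(\<And>j. j \<in> inputs f \<Longrightarrow> inp j < b) \<Longrightarrow> fout inp b f < b + fsize f"
  by (cases f) auto

lemma feedforward_fgates:
  "(\<And>j. j \<in> inputs f \<Longrightarrow> inp j < b) \<Longrightarrow> feedforward b (fgates inp b f)"
proof (induction f arbitrary: b)
  case (Nand f g)
  have f: "inp j < b" if "j \<in> inputs f" for j using that Nand.prems by simp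
  have g: "inp j < b + fsize f" if "j \<in> inputs g" for j
    using that Nand.prems[of j] by simp
  have "fout inp b f < b + fsize f" "fout inp (b + fsize f) g < b + fsize f + fsize g"
    using f g by (auto intro: fout_less)
  then have "feedforward (b + fsize f + fsize g) [(fout inp b f, fout inp (b + fsize f) g)]"
    by (simp add: feedforward_def)
  then show ?case
    using Nand.IH(1)[OF f] Nand.IH(2)[OF g] by (auto intro!: feedforward_append)
qed (simp add: feedforward_Nil)

lemma feedforward_mgates:
  "(\<And>f j. f \<in> set fs \<Longrightarrow> j \<in> inputs f \<Longrightarrow> inp j < b) \<Longrightarrow> feedforward b (mgates inp b fs)"
proof (induction inp b fs rule: mgates.induct)
  case (2 inp b f fs)
  have "feedforward (b + fsize f) (mgates inp (b + fsize f) fs)"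
  proof (rule 2(1))
    fix f' j assume "f' \<in> set fs" "j \<in> inputs f'"
    then have "inp j < b" using 2(2)[of f' j] by simp
    then show "inp j < b + fsize f" by simp
  qed
  moreover have "feedforward b (fgates inp b f)"
    using 2(2) by (intro feedforward_fgates) auto
  ultimately show ?case
    by (auto intro!: feedforward_append)
qed (simp add: feedforward_Nil)

text \<open>Gates only read earlier wires, so the value of each new wire is forced. Satisfying
  assignments are thereby in bijection with inputs, and simulating a computation does not change any
  count.\<close>

lemma ex1_consistent:
  assumes "feedforward n0 C" "u \<in> assignments n0"
  shows "\<exists>!v. v \<in> assignments (wires n0 C) \<and> (\<forall>j<n0. v j = u j) \<and> consistent n0 C v"
  using assms(1)
proof (induction C rule: rev_induct)
  case Nil
  show ?case
  proof (rule ex1I[of _ u])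
    show "u \<in> assignments (wires n0 []) \<and> (\<forall>j<n0. u j = u j) \<and> consistent n0 [] u"
      using assms(2) by (simp add: wires_def consistent_def)
    show "v = u" if "v \<in> assignments (wires n0 []) \<and> (\<forall>j<n0. v j = u j) \<and> consistent n0 [] v" for v
      using that assms(2) by (auto simp: assignments_def fun_eq_iff wires_def)
  qed
next
  case (snoc g C)
  let ?W = "wires n0 C"
  have W: "wires n0 (C @ [g]) = Suc ?W" "?W = n0 + length C" by (auto simp: wires_def)
  have "\<forall>i<length C. fst (C ! i) < n0 + i \<and> snd (C ! i) < n0 + i"
    and g: "fst g < ?W" "snd g < ?W"
    using snoc.prems W unfolding feedforward_def by (auto simp: nth_append split: if_splits dest: spec)
  then have ff: "feedforward n0 C" by (simp add: feedforward_def)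
  have cons: "consistent n0 (C @ [g]) v \<longleftrightarrow> consistent n0 C v \<and> v ?W = (\<not> (v (fst g) \<and> v (snd g)))" for v
    unfolding consistent_def W(2) by (auto simp: nth_append less_Suc_eq)
  have local: "consistent n0 C (v(?W := x)) = consistent n0 C v" for v x
  proof -
    have bd: "fst (C ! i) < ?W \<and> snd (C ! i) < ?W \<and> n0 + i < ?W" if "i < length C" for i
      using ff that W by (fastforce simp: feedforward_def)
    have "(v(?W := x)) (n0 + i) = v (n0 + i) \<and> (v(?W := x)) (fst (C ! i)) = v (fst (C ! i)) \<and>
        (v(?W := x)) (snd (C ! i)) = v (snd (C ! i))" if "i < length C" for i
      using bd[OF that] by auto
    then show ?thesis unfolding consistent_def by (intro all_cong) (simp only:)
  qed
  obtain v where v: "v \<in> assignments ?W" "\<forall>j<n0. v j = u j" "consistent n0 C v"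
    and uniq: "\<And>v'. v' \<in> assignments ?W \<Longrightarrow> \<forall>j<n0. v' j = u j \<Longrightarrow> consistent n0 C v' \<Longrightarrow> v' = v"
    using snoc.IH[OF ff] unfolding Ex1_def by metis
  show ?case
  proof (rule ex1I[of _ "v(?W := \<not> (v (fst g) \<and> v (snd g)))"])
    show "v(?W := \<not> (v (fst g) \<and> v (snd g))) \<in> assignments (wires n0 (C @ [g])) \<and>
        (\<forall>j<n0. (v(?W := \<not> (v (fst g) \<and> v (snd g)))) j = u j) \<and>
        consistent n0 (C @ [g]) (v(?W := \<not> (v (fst g) \<and> v (snd g))))"
      using v g unfolding cons local by (auto simp: assignments_def W less_Suc_eq)
    fix v' assume v': "v' \<in> assignments (wires n0 (C @ [g])) \<and> (\<forall>j<n0. v' j = u j) \<and> consistent n0 (C @ [g]) v'"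
    have eq: "v'(?W := False) = v"
    proof (rule uniq)
      show "v'(?W := False) \<in> assignments ?W"
        using v' by (auto simp: assignments_def W less_Suc_eq split: if_splits)
      show "\<forall>j<n0. (v'(?W := False)) j = u j" using v' by (simp add: W)
      show "consistent n0 C (v'(?W := False))" using v' unfolding cons local by simp
    qed
    have "v' j = v j" if "j \<noteq> ?W" for j
      using fun_cong[OF eq, of j] that by simp
    moreover have "v' ?W = (\<not> (v' (fst g) \<and> v' (snd g)))" using v' unfolding cons by simp
    ultimately show "v' = v(?W := \<not> (v (fst g) \<and> v (snd g)))"
      using g by (intro ext) simp
  qed
qed

section \<open>Binary numbers\<close>

fun binary :: "bool list \<Rightarrow> nat" where
  "binary [] = 0"
| "binary (b # bs) = of_bool b + 2 * binary bs"

lemma binary_less: "binary bs < 2 ^ length bs"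
  by (induction bs) (auto simp: less_Suc_eq_le)

lemma binary_append: "binary (xs @ ys) = binary xs + 2 ^ length xs * binary ys"
  by (induction xs) (auto simp: algebra_simps)

lemma bij_betw_binary: "bij_betw binary {bs. length bs = n} {..<2 ^ n}"
proof (rule bij_betwI')
  show "(binary xs = binary ys) = (xs = ys)" if "xs \<in> {bs. length bs = n}" "ys \<in> {bs. length bs = n}" for xs ys
    using that
  proof (induction n arbitrary: xs ys)
    case (Suc n)
    then obtain x xs' y ys' where eq: "xs = x # xs'" "ys = y # ys'" "length xs' = n" "length ys' = n"
      by (auto simp: length_Suc_conv)
    have "binary xs = binary ys \<longleftrightarrow> x = y \<and> binary xs' = binary ys'"
      unfolding eq by (cases x; cases y; simp; presburger)
    then show ?case using Suc.IH[of xs' ys'] eq by simp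
  qed auto
  show "binary xs \<in> {..<2 ^ n}" if "xs \<in> {bs. length bs = n}" for xs
    using that binary_less by auto
  show "\<exists>xs\<in>{bs. length bs = n}. k = binary xs" if "k \<in> {..<2 ^ n}" for k
    using that
  proof (induction n arbitrary: k)
    case (Suc n)
    then have "k div 2 \<in> {..<2 ^ n}" by auto
    then obtain xs where "length xs = n" "k div 2 = binary xs" using Suc.IH by blast
    moreover have "k = of_bool (odd k) + 2 * (k div 2)" by (cases "odd k"; simp; presburger)
    ultimately show ?case by (intro bexI[of _ "odd k # xs"]) (simp_all add: of_bool_def)
  qed auto
qed

text \<open>Adding fresh inputs and requiring their number to be below \<open>k\<close> multiplies
  the count of assignments by \<open>k\<close>; this realises the factors given by numerator and
  denominator of \<beta>, and also the comparison with the bound of the binary search.\<close>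

lemma card_binary_less: "k \<le> 2 ^ n \<Longrightarrow> card {bs. length bs = n \<and> binary bs < k} = k"
proof -
  assume k: "k \<le> 2 ^ n"
  let ?S = "{bs. length bs = n \<and> binary bs < k}"
  have "inj_on binary ?S"
    using bij_betw_binary[of n] by (auto simp: bij_betw_def intro: inj_on_subset)
  moreover have "binary ` ?S = {..<k}"
  proof
    show "{..<k} \<subseteq> binary ` ?S"
    proof
      fix x assume x: "x \<in> {..<k}"
      then have "x \<in> binary ` {bs. length bs = n}"
        using k bij_betw_imp_surj_on[OF bij_betw_binary[of n]] by auto
      then show "x \<in> binary ` ?S" using x by auto
    qed
  qed auto
  ultimately show ?thesis
    by (metis card_image card_lessThan)
qed

section \<open>The tableau of a computation\<close>

text \<open>A cell records, relative to the heads, one column of all tapes: the components are the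
  state and the symbol on cell 0 of tape 0 being 2 (both only at the heads), whether the heads
  are here, whether cell 0 of tape 0 is here, and the symbols. Since tapes are shifted instead of
  heads being moved, the cells of the next row only depend on three neighbours and on the cell
  under the heads.\<close>

type_synonym cell = "nat \<times> bool \<times> bool \<times> bool \<times> nat list"

definition at_heads :: "cell \<Rightarrow> bool" where "at_heads c = fst (snd (snd c))"
definition at_origin :: "cell \<Rightarrow> bool" where "at_origin c = fst (snd (snd (snd c)))"
definition symbols :: "cell \<Rightarrow> nat list" where "symbols c = snd (snd (snd (snd c)))"
definition accepts :: "cell \<Rightarrow> bool" where "accepts c = fst (snd c)"

text \<open>If the head of a tape moves by \<open>d\<close>, the column at a fixed distance from the
  head afterwards is the old neighbour in direction \<open>d\<close>.\<close>

definition pick :: "int \<Rightarrow> 'a \<Rightarrow> 'a \<Rightarrow> 'a \<Rightarrow> 'a" where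
  "pick d l m r = (if d = 1 then r else if d = 0 then m else l)"

locale tableau =
  fixes M :: tm
  assumes wf: "wf_tm M"
begin

abbreviation "K \<equiv> num_tapes M"

definition action :: "nat \<Rightarrow> nat list \<Rightarrow> nat \<times> (nat \<times> int) list" where
  "action q ss = (if q = halt M then (q, idle ss) else delta M q ss)"

definition written :: "(nat \<times> int) list \<Rightarrow> cell \<Rightarrow> nat \<Rightarrow> nat" where
  "written as c k = (if at_heads c then fst (as ! k) else symbols c ! k)"

text \<open>The flag for the symbol on cell 0 of tape 0 is carried along at the heads, however far
  that cell is. It can only change when the head of tape 0 stands there, which
  \<open>at_origin\<close> of the cell under the heads reveals.\<close>

definition next_cell :: "cell \<Rightarrow> cell \<Rightarrow> cell \<Rightarrow> cell \<Rightarrow> cell" where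
  "next_cell l m r c = (let (q', as) = action (fst c) (symbols c) in
    (if at_heads m then q' else 0,
     at_heads m \<and> (if at_origin c then fst (as ! 0) = 2 else accepts c),
     at_heads m,
     pick (snd (as ! 0)) (at_origin l) (at_origin m) (at_origin r),
     map (\<lambda>k. pick (snd (as ! k)) (written as l k) (written as m k) (written as r k)) [0..<K]))"

text \<open>Column \<open>R\<close> is always the one under the heads; column \<open>i\<close> shows
  each tape at signed distance \<open>i - R\<close> from its own head.\<close>

definition cell_of :: "nat \<Rightarrow> config \<Rightarrow> nat \<Rightarrow> cell" where
  "cell_of R = (\<lambda>(q, ts) i. (if i = R then q else 0, i = R \<and> fst (ts ! 0) 0 = 2, i = R,
    snd (ts ! 0) + (int i - int R) = 0, map (\<lambda>(c, h). c (h + (int i - int R))) ts))"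

definition initial_cell :: "bool \<Rightarrow> bool \<Rightarrow> bool \<Rightarrow> cell" where
  "initial_cell nb b z = (if z then start M else 0, z \<and> nb \<and> b, z, z,
    (if nb then (if b then 2 else 1) else 0) # replicate (K - 1) 0)"

definition valid :: "config \<Rightarrow> bool" where
  "valid = (\<lambda>(q, ts). q < num_states M \<and> length ts = K \<and> (\<forall>k<K. \<forall>i. fst (ts ! k) i < num_symbols M))"

definition cells :: "cell set" where
  "cells = {..<num_states M} \<times> UNIV \<times> UNIV \<times> UNIV \<times> {ss. set ss \<subseteq> {..<num_symbols M} \<and> length ss = K}"

lemma finite_cells: "finite cells"
  unfolding cells_def by (intro finite_cartesian_product) (auto intro: finite_lists_length_eq)

lemma K_pos: "0 < K" and sym3: "3 \<le> num_symbols M" and states: "start M < num_states M" "0 < num_states M"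
  using wf by (auto simp: wf_tm_def)

lemma step_action:
  "step M (q, ts) = (fst (action q (map (\<lambda>(c, h). c h) ts)),
    map2 act ts (snd (action q (map (\<lambda>(c, h). c h) ts))))"
  by (simp add: step_def action_def map2_act_idle split: prod.splits)

lemma action_valid:
  assumes "q < num_states M" "length ss = K" "set ss \<subseteq> {..<num_symbols M}"
  shows "fst (action q ss) < num_states M" "length (snd (action q ss)) = K"
    "\<And>k. k < K \<Longrightarrow> fst (snd (action q ss) ! k) < num_symbols M \<and> snd (snd (action q ss) ! k) \<in> {-1, 0, 1}"
proof -
  obtain q' as where qa: "delta M q ss = (q', as)" by (cases "delta M q ss")
  have *: "q' < num_states M" "length as = K" "set as \<subseteq> {..<num_symbols M} \<times> {-1, 0, 1}"
    using wf assms qa unfolding wf_tm_def by (metis (mono_tags, lifting) case_prod_conv)+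
  show "fst (action q ss) < num_states M" "length (snd (action q ss)) = K"
    using * assms qa by (auto simp: action_def idle_def)
  fix k assume k: "k < K"
  show "fst (snd (action q ss) ! k) < num_symbols M \<and> snd (snd (action q ss) ! k) \<in> {-1, 0, 1}"
  proof (cases "q = halt M")
    case True
    then show ?thesis using assms k by (auto simp: action_def idle_def subset_iff)
  next
    case False
    have "as ! k \<in> set as" using k *(2) by simp
    then have "as ! k \<in> {..<num_symbols M} \<times> {-1, 0, 1}" using *(3) by (rule subsetD[rotated])
    then show ?thesis using False qa by (auto simp: action_def mem_Times_iff)
  qed
qed

lemma valid_heads:
  assumes "valid (q, ts)"
  shows "set (map (\<lambda>(c, h). c h) ts) \<subseteq> {..<num_symbols M}" "length (map (\<lambda>(c, h). c h) ts) = K"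
  using assms by (auto simp: valid_def in_set_conv_nth) (metis fst_conv)

lemma map2_act_nth:
  "k < length ts \<Longrightarrow> length as = length ts \<Longrightarrow>
    map2 act ts as ! k = ((fst (ts ! k))(snd (ts ! k) := fst (as ! k)), snd (ts ! k) + snd (as ! k))"
  by (simp add: act_def case_prod_beta)

lemma valid_step: "valid c \<Longrightarrow> valid (step M c)"
proof -
  assume v: "valid c"
  obtain q ts where c: "c = (q, ts)" by (cases c)
  have q: "q < num_states M" "length ts = K" using v by (auto simp: c valid_def)
  note A = action_valid[OF q(1) valid_heads(2,1)[OF v[unfolded c]]]
  show ?thesis
    unfolding c step_action valid_def
    using A q v by (auto simp: c valid_def act_def case_prod_beta)
qed

lemma valid_init: "valid (init M w)"
  using K_pos states sym3
  by (auto simp: init_def valid_def word_tape_def nth_Cons split: nat.splits)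

lemma valid_run: "valid ((step M ^^ t) (init M w))"
  by (induction t) (auto intro: valid_init valid_step)

lemma valid_symbols: "valid (q, ts) \<Longrightarrow> x \<in> set ts \<Longrightarrow> fst x i < num_symbols M"
  by (auto simp: valid_def in_set_conv_nth)

lemma cell_of_cells:
  assumes "valid c"
  shows "cell_of R c i \<in> cells"
proof -
  obtain q ts where c: "c = (q, ts)" by (cases c)
  show ?thesis
    using assms states valid_symbols[OF assms[unfolded c]]
    by (auto simp: c cell_of_def cells_def valid_def case_prod_beta)
qed

lemma cell_of_init:
  "cell_of R (init M w) i = initial_cell (R \<le> i \<and> i < R + length w) (R \<le> i \<and> i < R + length w \<and> w ! (i - R)) (i = R)"
proof -
  have "word_tape w (int i - int R) =
      (if R \<le> i \<and> i < R + length w then if w ! (i - R) then 2 else 1 else 0)"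
    by (auto simp: word_tape_def nat_diff_distrib)
  then show ?thesis
    by (auto simp: cell_of_def init_def initial_cell_def word_tape_def)
qed

text \<open>After the write at the old head position, a head move by \<open>d\<close> shows in the
  new column \<open>i\<close> what was in the old column \<open>i + d\<close>, separately for each
  tape. The assumption \<open>1 \<le> i\<close> keeps the natural number \<open>i - 1\<close>
  meaningful.\<close>

lemma cell_of_step:
  assumes v: "valid c" and i: "1 \<le> i"
  shows "cell_of R (step M c) i =
    next_cell (cell_of R c (i - 1)) (cell_of R c i) (cell_of R c (i + 1)) (cell_of R c R)"
proof -
  obtain q ts where c: "c = (q, ts)" by (cases c)
  have q: "q < num_states M" "length ts = K" using v by (auto simp: c valid_def)
  define ss where "ss = map (\<lambda>(c, h). c h) ts"
  obtain q' as where qa: "action q ss = (q', as)" by (cases "action q ss")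
  note A = action_valid[OF q(1) valid_heads(2,1)[OF v[unfolded c]], folded ss_def, unfolded qa fst_conv snd_conv]
  have step: "step M c = (q', map2 act ts as)"
    unfolding c step_action ss_def[symmetric] qa by simp
  have center: "fst (cell_of R c R) = q" "symbols (cell_of R c R) = ss"
      "at_origin (cell_of R c R) = (snd (ts ! 0) = 0)" "accepts (cell_of R c R) = (fst (ts ! 0) 0 = 2)"
    by (simp_all add: c cell_of_def symbols_def at_origin_def accepts_def ss_def)
  have heads: "at_heads (cell_of R c j) = (j = R)" for j
    by (simp add: c cell_of_def at_heads_def)
  have orig: "at_origin (cell_of R c j) = (snd (ts ! 0) + (int j - int R) = 0)" for j
    by (simp add: c cell_of_def at_origin_def)
  have sy: "symbols (cell_of R c j) ! k = fst (ts ! k) (snd (ts ! k) + (int j - int R))" if "k < K" for j k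
    using that q by (simp add: c cell_of_def symbols_def case_prod_beta)
  have wr: "written as (cell_of R c j) k = ((fst (ts ! k))(snd (ts ! k) := fst (as ! k))) (snd (ts ! k) + (int j - int R))"
    if "k < K" for j k
    unfolding written_def heads sy[OF that] by auto
  define ts' where "ts' = map2 act ts as"
  have ts': "ts' ! k = ((fst (ts ! k))(snd (ts ! k) := fst (as ! k)), snd (ts ! k) + snd (as ! k))" if "k < K" for k
    using that q A(2) unfolding ts'_def by (intro map2_act_nth) auto
  have len: "length ts' = K" using q A(2) by (simp add: ts'_def)
  have d: "snd (as ! k) = -1 \<or> snd (as ! k) = 0 \<or> snd (as ! k) = 1" if "k < K" for k
    using A(3)[OF that] by auto
  have i1: "int (i - 1) = int i - 1" "int (i + 1) = int i + 1" using i by auto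
  have "pick (snd (as ! k)) (written as (cell_of R c (i - 1)) k) (written as (cell_of R c i) k)
      (written as (cell_of R c (i + 1)) k) = fst (ts' ! k) (snd (ts' ! k) + (int i - int R))" if "k < K" for k
    using d[OF that] unfolding wr[OF that] i1 ts'[OF that]
    by (auto simp: pick_def algebra_simps)
  then have "map (\<lambda>k. pick (snd (as ! k)) (written as (cell_of R c (i - 1)) k) (written as (cell_of R c i) k)
      (written as (cell_of R c (i + 1)) k)) [0..<K] = map (\<lambda>(c, h). c (h + (int i - int R))) ts'"
    using len by (intro nth_equalityI) (auto simp: case_prod_beta)
  moreover have "pick (snd (as ! 0)) (at_origin (cell_of R c (i - 1))) (at_origin (cell_of R c i))
      (at_origin (cell_of R c (i + 1))) = (snd (ts' ! 0) + (int i - int R) = 0)"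
    using d[OF K_pos] unfolding orig i1 ts'[OF K_pos] by (auto simp: pick_def algebra_simps)
  moreover have "fst (ts' ! 0) 0 = (if snd (ts ! 0) = 0 then fst (as ! 0) else fst (ts ! 0) 0)"
    unfolding ts'[OF K_pos] by auto
  ultimately show ?thesis
    unfolding next_cell_def center qa step ts'_def[symmetric] heads
    by (simp add: cell_of_def)
qed

text \<open>An output word of length one consists of cell 0 alone, so acceptance is decided by that
  cell.\<close>

lemma next_cell_accepts:
  assumes "halts_with M c [b]" "valid c"
  shows "accepts (cell_of R c R) = b"
proof -
  obtain q ts where c: "c = (q, ts)" by (cases c)
  have w: "tape_word (fst (ts ! 0)) = [b]" using assms by (simp add: c halts_with_def)
  then have "length (tape_word (fst (ts ! 0))) = 1" by simp
  then have "tape_word (fst (ts ! 0)) = [fst (ts ! 0) 0 = 2]"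
    unfolding tape_word_def by simp
  then show ?thesis using w by (simp add: c cell_of_def accepts_def)
qed

end

section \<open>The circuit of an instance\<close>

lemma nth_pair_code:
  "p < 2 * length x \<Longrightarrow> pair_code x y ! p = x ! (p div 2)"
  "pair_code x y ! (2 * length x) = False"
  "pair_code x y ! (2 * length x + 1) = True"
  "pair_code x y ! (2 * length x + 2 + k) = y ! k"
  "length (pair_code x y) = 2 * length x + 2 + length y"
proof -
  let ?c = "concat (map (\<lambda>b. [b, b]) x)"
  have len: "length ?c = 2 * length x" by (induction x) auto
  have nth: "p < 2 * length x \<Longrightarrow> ?c ! p = x ! (p div 2)" for p
  proof (induction x arbitrary: p)
    case (Cons b x)
    show ?case
    proof (cases "p < 2")
      case True
      then have "p = 0 \<or> p = 1" by auto
      then show ?thesis by auto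
    next
      case False
      then obtain p' where p: "p = Suc (Suc p')" by (metis add_2_eq_Suc le_Suc_ex not_less)
      then show ?thesis using Cons by simp
    qed
  qed simp
  show "p < 2 * length x \<Longrightarrow> pair_code x y ! p = x ! (p div 2)"
    using nth len by (simp add: pair_code_def nth_append)
  show "pair_code x y ! (2 * length x) = False" "pair_code x y ! (2 * length x + 1) = True"
    "pair_code x y ! (2 * length x + 2 + k) = y ! k"
    "length (pair_code x y) = 2 * length x + 2 + length y"
    using len by (simp_all add: pair_code_def nth_append)
qed

text \<open>Cells are coded by one bit per possible value. Input 0 selects between the initial row,
  where inputs 1 to 3 give the kind of the cell, and a later row. A single list of formulas for both
  purposes gives all blocks the same size, so positions become simple products. Codes with no or
  several bits set may produce anything.\<close>

lemma ex_cell_formulas: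
  fixes F0 :: "bool \<Rightarrow> bool \<Rightarrow> bool \<Rightarrow> 'c" and F :: "'c \<Rightarrow> 'c \<Rightarrow> 'c \<Rightarrow> 'c \<Rightarrow> 'c"
  assumes "distinct cs"
  shows "\<exists>fs. length fs = length cs \<and> (\<forall>f\<in>set fs. is_gate f \<and> inputs f \<subseteq> {..<4 + 4 * length cs}) \<and>
    (\<forall>j<length cs. \<forall>v. v 0 \<longrightarrow> feval v (fs ! j) = (cs ! j = F0 (v 1) (v 2) (v 3))) \<and>
    (\<forall>j<length cs. \<forall>v l m r c. \<not> v 0 \<longrightarrow> l \<in> set cs \<longrightarrow> m \<in> set cs \<longrightarrow> r \<in> set cs \<longrightarrow> c \<in> set cs \<longrightarrow>
      (\<forall>k<length cs. v (4 + k) = (cs ! k = l) \<and> v (4 + length cs + k) = (cs ! k = m) \<and>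
        v (4 + 2 * length cs + k) = (cs ! k = r) \<and> v (4 + 3 * length cs + k) = (cs ! k = c)) \<longrightarrow>
      feval v (fs ! j) = (cs ! j = F l m r c))"
proof -
  let ?B = "length cs"
  define bits where "bits v s x \<longleftrightarrow> (\<forall>k<?B. v (s + k) = (cs ! k = x))" for v :: "nat \<Rightarrow> bool" and s and x
  define H where "H j v = (if v 0 then cs ! j = F0 (v 1) (v 2) (v 3) else
      (\<exists>l m r c. l \<in> set cs \<and> m \<in> set cs \<and> r \<in> set cs \<and> c \<in> set cs \<and> bits v 4 l \<and> bits v (4 + ?B) m \<and>
        bits v (4 + 2 * ?B) r \<and> bits v (4 + 3 * ?B) c \<and> cs ! j = F l m r c))" for j v
  have uniq: "x = y" if "bits v s x" "bits v s y" "x \<in> set cs" for v s x y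
    using that unfolding bits_def by (metis in_set_conv_nth)
  have "\<exists>f. is_gate f \<and> inputs f \<subseteq> {..<max 1 (4 + 4 * ?B)} \<and> (\<forall>v. feval v f = H j v)" for j
  proof (rule formula_complete)
    fix v w :: "nat \<Rightarrow> bool" assume eq: "\<And>k. k < 4 + 4 * ?B \<Longrightarrow> v k = w k"
    have "bits v s x = bits w s x" if "s + ?B \<le> 4 + 4 * ?B" for s x
      using that eq unfolding bits_def by (intro all_cong) simp
    then show "H j v = H j w"
      using eq[of 0] eq[of 1] eq[of 2] eq[of 3] by (simp add: H_def)
  qed
  moreover have "max 1 (4 + 4 * ?B) = 4 + 4 * ?B" by simp
  ultimately have "\<forall>j. \<exists>f. is_gate f \<and> inputs f \<subseteq> {..<4 + 4 * ?B} \<and> (\<forall>v. feval v f = H j v)"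
    by (simp only:) simp
  from choice[OF this] obtain f where "\<forall>j. is_gate (f j) \<and> inputs (f j) \<subseteq> {..<4 + 4 * ?B} \<and> (\<forall>v. feval v (f j) = H j v)" ..
  then have f: "\<And>j. is_gate (f j)" "\<And>j. inputs (f j) \<subseteq> {..<4 + 4 * ?B}" "\<And>j v. feval v (f j) = H j v"
    by simp_all
  have "H j v = (cs ! j = F l m r c)" if "\<not> v 0" "l \<in> set cs" "m \<in> set cs" "r \<in> set cs" "c \<in> set cs"
      "bits v 4 l" "bits v (4 + ?B) m" "bits v (4 + 2 * ?B) r" "bits v (4 + 3 * ?B) c" for j v l m r c
  proof
    assume "H j v"
    then obtain l' m' r' c' where *: "bits v 4 l'" "bits v (4 + ?B) m'"
        "bits v (4 + 2 * ?B) r'" "bits v (4 + 3 * ?B) c'" "cs ! j = F l' m' r' c'"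
      using \<open>\<not> v 0\<close> by (auto simp: H_def)
    have "l = l'" "m = m'" "r = r'" "c = c'"
      using uniq[OF that(6) *(1) that(2)] uniq[OF that(7) *(2) that(3)]
        uniq[OF that(8) *(3) that(4)] uniq[OF that(9) *(4) that(5)] by auto
    then show "cs ! j = F l m r c" using * by simp
  qed (use that in \<open>auto simp: H_def\<close>)
  then show ?thesis
    using f by (intro exI[of _ "map f [0..<?B]"]) (auto simp: bits_def H_def)
qed

text \<open>\<open>fs\<close> computes a cell, \<open>fc\<close> is one step of a comparison of
  binary numbers, and \<open>ff\<close> combines everything into the output: with \<open>s\<close>
  the verifier must accept, without \<open>s\<close> the comparison must succeed, and the \<tau>
  extra bits must be below \<open>pn\<close> or \<open>qn\<close> respectively.\<close>

locale reduction = tableau M for M :: tm +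
  fixes cs :: "cell list" and fs :: "formula list" and fc ff :: formula and \<tau> pn qn :: nat
  assumes cs: "set cs = cells"
    and fs_len: "length fs = length cs"
    and fs_gate: "\<And>f. f \<in> set fs \<Longrightarrow> is_gate f"
    and fs_inputs: "\<And>f. f \<in> set fs \<Longrightarrow> inputs f \<subseteq> {..<4 + 4 * length cs}"
    and fs_init: "\<And>j v. j < length cs \<Longrightarrow> v 0 \<Longrightarrow> feval v (fs ! j) = (cs ! j = initial_cell (v 1) (v 2) (v 3))"
    and fs_next: "\<And>j v l m r c. j < length cs \<Longrightarrow> \<not> v 0 \<Longrightarrow> l \<in> cells \<Longrightarrow> m \<in> cells \<Longrightarrow> r \<in> cells \<Longrightarrow> c \<in> cells \<Longrightarrow>
      (\<forall>k<length cs. v (4 + k) = (cs ! k = l) \<and> v (4 + length cs + k) = (cs ! k = m) \<and>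
        v (4 + 2 * length cs + k) = (cs ! k = r) \<and> v (4 + 3 * length cs + k) = (cs ! k = c)) \<Longrightarrow>
      feval v (fs ! j) = (cs ! j = next_cell l m r c)"
    and fc: "is_gate fc" "inputs fc \<subseteq> {..<3}" "\<And>v. feval v fc = (if v 0 = v 1 then v 2 else v 1)"
    and ff: "is_gate ff" "inputs ff \<subseteq> {..<3 + \<tau> + length cs}"
      "\<And>v c. c \<in> cells \<Longrightarrow> (\<forall>j<length cs. v (3 + \<tau> + j) = (cs ! j = c)) \<Longrightarrow>
        feval v ff = (if v 0 then binary (map (\<lambda>j. v (3 + j)) [0..<\<tau>]) < pn \<and> \<not> v 1 \<and> accepts c
          else binary (map (\<lambda>j. v (3 + j)) [0..<\<tau>]) < qn \<and> v 2)"
    and num: "pn \<le> 2 ^ \<tau>" "qn \<le> 2 ^ \<tau>"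
begin

abbreviation "B \<equiv> length cs"
abbreviation "sg \<equiv> msize fs"
abbreviation "sc \<equiv> fsize fc"
abbreviation "sf \<equiv> fsize ff"

text \<open>The row is finite, and wrong values creep inwards from its ends by one column per step.
  The margin is large enough for the input to fit and for the column under the heads to be correct
  up to time \<open>T\<close>.\<close>

definition radius :: "nat \<Rightarrow> nat \<Rightarrow> nat \<Rightarrow> nat" where
  "radius n l T = 2 * T + (2 * n + 2 + l) + 1"

definition width :: "nat \<Rightarrow> nat \<Rightarrow> nat \<Rightarrow> nat" where
  "width n l T = 2 * radius n l T + 1"

text \<open>The constant, the marked input \<open>s\<close>, the \<tau> multiplicity bits, and
  \<open>l + 2\<close> further bits: a free one, the \<open>l\<close> bits of the witness, and a
  last one that must be 0 if \<open>s\<close> is true. If \<open>s\<close> is false, all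
  \<open>l + 2\<close> bits form the number that is compared.\<close>

definition in_wires :: "nat \<Rightarrow> nat" where
  "in_wires l = 4 + \<tau> + l"

definition cmp_base :: "nat \<Rightarrow> nat \<Rightarrow> nat \<Rightarrow> nat" where
  "cmp_base n l T = 1 + (1 + (T + 1) * width n l T) * sg"

definition fin_base :: "nat \<Rightarrow> nat \<Rightarrow> nat \<Rightarrow> nat" where
  "fin_base n l T = cmp_base n l T + 1 + (l + 2) * sc"

definition num_gates :: "nat \<Rightarrow> nat \<Rightarrow> nat \<Rightarrow> nat" where
  "num_gates n l T = fin_base n l T + sf"

definition cell_bit :: "nat \<Rightarrow> nat \<Rightarrow> nat \<Rightarrow> nat" where
  "cell_bit l u j = in_wires l + 1 + u * sg + offset fs j"

text \<open>The kind of a cell of the first row: wires telling whether it is nonblank, its bit, and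
  whether it is under the heads. The first cell is a dummy.\<close>

definition kind :: "nat \<Rightarrow> nat \<Rightarrow> nat \<Rightarrow> (nat \<Rightarrow> bool) \<Rightarrow> nat \<Rightarrow> nat \<times> nat \<times> nat" where
  "kind n l T xb u = (let R = radius n l T; one = in_wires l in
    if u < R + 1 then (0, 0, 0)
    else if u < R + 1 + 2 * n then
      (one, one * of_bool (xb ((u - (R + 1)) div 2)), one * of_bool (u = R + 1))
    else if u = R + 1 + 2 * n then (one, 0, one * of_bool (n = 0))
    else if u = R + 2 + 2 * n then (one, one, 0)
    else if u < R + 3 + 2 * n + l then (one, 3 + \<tau> + (u - (R + 3 + 2 * n)), 0)
    else (0, 0, 0))"

definition init_inp :: "nat \<Rightarrow> nat \<times> nat \<times> nat \<Rightarrow> nat \<Rightarrow> nat" where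
  "init_inp l kd k = (if k = 0 then in_wires l else if k = 1 then fst kd
    else if k = 2 then fst (snd kd) else if k = 3 then snd (snd kd) else 0)"

text \<open>Cell \<open>i\<close> of row \<open>t\<close> is block \<open>1 + t * W + i\<close>, so
  \<open>w = 0, 1, 2\<close> are its left neighbour, itself and its right neighbour, and any other
  \<open>w\<close> is the cell under the heads. At the ends of a row an index strays into an
  adjacent row or the dummy; this is harmless since the block still comes earlier.\<close>

definition neighbour :: "nat \<Rightarrow> nat \<Rightarrow> nat \<Rightarrow> nat \<Rightarrow> nat \<Rightarrow> nat \<Rightarrow> nat" where
  "neighbour n l T t i w = (if w < 3 then t * width n l T + i + w else t * width n l T + radius n l T + 1)"

definition step_inp :: "nat \<Rightarrow> nat \<Rightarrow> nat \<Rightarrow> nat \<Rightarrow> nat \<Rightarrow> nat \<Rightarrow> nat" where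
  "step_inp n l T t i k = (if k < 4 then 0
    else cell_bit l (neighbour n l T t i ((k - 4) div B)) ((k - 4) mod B))"

definition cmp_inp :: "nat \<Rightarrow> nat \<Rightarrow> nat \<Rightarrow> (nat \<Rightarrow> bool) \<Rightarrow> nat \<Rightarrow> nat \<Rightarrow> nat" where
  "cmp_inp n l T kb i k = (if k = 0 then 2 + \<tau> + i else if k = 1 then in_wires l * of_bool (kb i)
    else in_wires l + cmp_base n l T + i * sc)"

definition fin_inp :: "nat \<Rightarrow> nat \<Rightarrow> nat \<Rightarrow> nat \<Rightarrow> nat" where
  "fin_inp n l T k = (if k = 0 then 1 else if k = 1 then 2 + \<tau> + (l + 1)
    else if k = 2 then in_wires l + cmp_base n l T + (l + 2) * sc
    else if k < 3 + \<tau> then 2 + (k - 3)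
    else cell_bit l (1 + T * width n l T + radius n l T) (k - (3 + \<tau>)))"

definition init_block :: "nat \<Rightarrow> nat \<Rightarrow> nat \<Rightarrow> (nat \<Rightarrow> bool) \<Rightarrow> nat \<Rightarrow> (nat \<times> nat) list" where
  "init_block n l T xb u = mgates (init_inp l (kind n l T xb u)) (in_wires l + (1 + u * sg)) fs"

definition step_block :: "nat \<Rightarrow> nat \<Rightarrow> nat \<Rightarrow> nat \<Rightarrow> nat \<Rightarrow> (nat \<times> nat) list" where
  "step_block n l T t i = mgates (step_inp n l T t i)
    (in_wires l + (1 + (1 + (t + 1) * width n l T + i) * sg)) fs"

definition cmp_block :: "nat \<Rightarrow> nat \<Rightarrow> nat \<Rightarrow> (nat \<Rightarrow> bool) \<Rightarrow> nat \<Rightarrow> (nat \<times> nat) list" where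
  "cmp_block n l T kb i = fgates (cmp_inp n l T kb i) (in_wires l + (cmp_base n l T + 1 + i * sc)) fc"

definition fin_block :: "nat \<Rightarrow> nat \<Rightarrow> nat \<Rightarrow> (nat \<times> nat) list" where
  "fin_block n l T = fgates (fin_inp n l T) (in_wires l + fin_base n l T) ff"

text \<open>Both gates (0, 0) compute the constant 1. One supplies the constant for hardwired bits,
  the other is the starting value of the comparison.\<close>

definition circuit :: "nat \<Rightarrow> nat \<Rightarrow> nat \<Rightarrow> (nat \<Rightarrow> bool) \<Rightarrow> (nat \<Rightarrow> bool) \<Rightarrow> (nat \<times> nat) list" where
  "circuit n l T xb kb =
    [(0, 0)] @ concat (map (init_block n l T xb) [0..<Suc (width n l T)]) @
    concat (map (\<lambda>t. concat (map (step_block n l T t) [0..<width n l T])) [0..<T]) @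
    [(0, 0)] @ concat (map (cmp_block n l T kb) [0..<l + 2]) @ fin_block n l T"

lemma length_blocks [simp]:
  "length (init_block n l T xb u) = sg" "length (step_block n l T t i) = sg"
  "length (cmp_block n l T kb i) = sc" "length (fin_block n l T) = sf"
  by (simp_all add: init_block_def step_block_def cmp_block_def fin_block_def)

lemma length_rows [simp]:
  "length (concat (map (init_block n l T xb) [0..<N])) = N * sg"
  "length (concat (map (step_block n l T t) [0..<N])) = N * sg"
  "length (concat (map (cmp_block n l T kb) [0..<N])) = N * sc"
  "length (concat (map (\<lambda>t. concat (map (step_block n l T t) [0..<N])) [0..<N'])) = N' * (N * sg)"
  by (intro length_concat_upt; simp add: length_concat_upt)+

lemma length_circuit: "length (circuit n l T xb kb) = num_gates n l T"
  unfolding circuit_def num_gates_def fin_base_def cmp_base_def by (simp add: algebra_simps del: upt_Suc)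

context
  fixes n l T :: nat and xb kb :: "nat \<Rightarrow> bool"
begin

lemma circuit_occurs:
  shows "C = circuit n l T xb kb \<Longrightarrow> occurs C 0 [(0, 0)]"
    and "C = circuit n l T xb kb \<Longrightarrow> u < Suc (width n l T) \<Longrightarrow> occurs C (1 + u * sg) (init_block n l T xb u)"
    and "C = circuit n l T xb kb \<Longrightarrow> t < T \<Longrightarrow> i < width n l T \<Longrightarrow>
      occurs C (1 + (1 + (t + 1) * width n l T + i) * sg) (step_block n l T t i)"
    and "C = circuit n l T xb kb \<Longrightarrow> occurs C (cmp_base n l T) [(0, 0)]"
    and "C = circuit n l T xb kb \<Longrightarrow> i < l + 2 \<Longrightarrow> occurs C (cmp_base n l T + 1 + i * sc) (cmp_block n l T kb i)"
    and "C = circuit n l T xb kb \<Longrightarrow> occurs C (fin_base n l T) (fin_block n l T)"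
proof -
  assume C: "C = circuit n l T xb kb"
  have "occurs C 0 (circuit n l T xb kb)" by (simp add: C occurs_refl)
  note o0 = this[unfolded circuit_def]
  show "occurs C 0 [(0, 0)]" using occurs_append1[OF o0] .
  note o1 = occurs_append2[OF o0]
  show "occurs C (1 + u * sg) (init_block n l T xb u)" if "u < Suc (width n l T)" for u
    using occurs_concat[OF occurs_append1[OF o1], of sg u] that by simp
  note o2 = occurs_append2[OF o1]
  show "occurs C (1 + (1 + (t + 1) * width n l T + i) * sg) (step_block n l T t i)"
    if "t < T" "i < width n l T" for t i
  proof -
    have "occurs C (0 + length [(0::nat, 0::nat)] + length (concat (map (init_block n l T xb) [0..<Suc (width n l T)])) +
        t * (width n l T * sg)) (concat (map (step_block n l T t) [0..<width n l T]))"
      using occurs_append1[OF o2] that by (intro occurs_concat) auto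
    from occurs_concat[OF this, of sg i] show ?thesis
      using that by (simp add: algebra_simps del: upt_Suc)
  qed
  note o3 = occurs_append2[OF o2]
  have b1: "0 + length [(0::nat, 0::nat)] + length (concat (map (init_block n l T xb) [0..<Suc (width n l T)])) +
      length (concat (map (\<lambda>t. concat (map (step_block n l T t) [0..<width n l T])) [0..<T])) = cmp_base n l T"
    by (simp add: cmp_base_def algebra_simps del: upt_Suc)
  note o3 = o3[unfolded b1]
  show "occurs C (cmp_base n l T) [(0, 0)]" using occurs_append1[OF o3] .
  note o4 = occurs_append2[OF o3]
  show "occurs C (cmp_base n l T + 1 + i * sc) (cmp_block n l T kb i)" if "i < l + 2" for i
    using occurs_concat[OF occurs_append1[OF o4], of sc i] that by simp
  note o5 = occurs_append2[OF o4]
  show "occurs C (fin_base n l T) (fin_block n l T)"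
    using o5 by (simp add: fin_base_def algebra_simps)
qed

lemma offset_fs: "j < B \<Longrightarrow> offset fs j < sg"
  using offset_less[of j fs] fs_len fs_gate by simp

lemma B_pos: "0 < B"
  using cell_of_cells[OF valid_init] cs by (metis length_pos_if_in_set)

lemma sc_pos: "0 < sc" and sf_pos: "0 < sf"
  using fc(1) ff(1) fsize_gate by auto

lemma cell_bit_less: "j < B \<Longrightarrow> u < u' \<Longrightarrow> cell_bit l u j < in_wires l + (1 + u' * sg)"
proof -
  assume "j < B" "u < u'"
  then have "u * sg + offset fs j < Suc u * sg" using offset_fs[of j] by simp
  moreover have "Suc u * sg \<le> u' * sg" using \<open>u < u'\<close> by (intro mult_le_mono1) simp
  ultimately show ?thesis by (simp add: cell_bit_def)
qed

lemma neighbour_less: "i < width n l T \<Longrightarrow> neighbour n l T t i w < 1 + (t + 1) * width n l T + i"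
  by (auto simp: neighbour_def width_def radius_def)

text \<open>Even the meaningless neighbours at the ends of a row refer to earlier blocks, so unique
  evaluation applies to the whole circuit.\<close>

lemma feedforward_circuit: "feedforward (in_wires l) (circuit n l T xb kb)"
proof -
  have i: "0 < in_wires l" by (simp add: in_wires_def)
  have 1: "feedforward (in_wires l + k) [(0, 0)]" for k
    using i by (simp add: feedforward_def)
  have 2: "feedforward (in_wires l + (1 + u * sg)) (init_block n l T xb u)" if "u < Suc (width n l T)" for u
    unfolding init_block_def
  proof (rule feedforward_mgates)
    fix f j
    have "u - (radius n l T + 3 + 2 * n) < l" if "u < radius n l T + 3 + 2 * n + l" "radius n l T + 2 + 2 * n < u"
      using that by simp
    then show "init_inp l (kind n l T xb u) j < in_wires l + (1 + u * sg)"
      by (auto simp: init_inp_def kind_def Let_def in_wires_def)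
  qed
  have 3: "feedforward (in_wires l + (1 + (1 + (t + 1) * width n l T + i) * sg)) (step_block n l T t i)"
    if "i < width n l T" for t i
    unfolding step_block_def
  proof (rule feedforward_mgates)
    fix f j
    show "step_inp n l T t i j < in_wires l + (1 + (1 + (t + 1) * width n l T + i) * sg)"
    proof (cases "j < 4")
      case True
      then show ?thesis using i by (simp add: step_inp_def)
    next
      case False
      have "(j - 4) mod B < B" using B_pos by simp
      then have "cell_bit l (neighbour n l T t i ((j - 4) div B)) ((j - 4) mod B) <
          in_wires l + (1 + (1 + (t + 1) * width n l T + i) * sg)"
        using neighbour_less[OF that] by (rule cell_bit_less)
      then show ?thesis using False by (simp only: step_inp_def if_False)
    qed
  qed
  have 4: "feedforward (in_wires l + (cmp_base n l T + 1 + i * sc)) (cmp_block n l T kb i)" if "i < l + 2" for i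
    unfolding cmp_block_def
    by (rule feedforward_fgates) (use that in \<open>auto simp: cmp_inp_def in_wires_def\<close>)
  have 5: "feedforward (in_wires l + fin_base n l T) (fin_block n l T)"
    unfolding fin_block_def
  proof (rule feedforward_fgates)
    fix j assume "j \<in> inputs ff"
    then have j: "j < 3 + \<tau> + B" using ff(2) by auto
    have "cell_bit l (1 + T * width n l T + radius n l T) (j - (3 + \<tau>)) < in_wires l + fin_base n l T" if "\<not> j < 3 + \<tau>"
    proof -
      have "cell_bit l (1 + T * width n l T + radius n l T) (j - (3 + \<tau>)) <
          in_wires l + (1 + (1 + (T + 1) * width n l T) * sg)"
        using that j by (intro cell_bit_less) (auto simp: width_def)
      then show ?thesis by (simp add: fin_base_def cmp_base_def)
    qed
    then show "fin_inp n l T j < in_wires l + fin_base n l T"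
      by (auto simp: fin_inp_def in_wires_def fin_base_def)
  qed
  have A: "feedforward (in_wires l + 1) (concat (map (init_block n l T xb) [0..<Suc (width n l T)]))"
    using 2 by (intro feedforward_concat[where s = sg]) (auto simp: add.assoc)
  have Bb: "feedforward (in_wires l + 1 + Suc (width n l T) * sg)
      (concat (map (\<lambda>t. concat (map (step_block n l T t) [0..<width n l T])) [0..<T]))"
  proof (rule feedforward_concat[where s = "width n l T * sg"])
    fix t
    show "feedforward (in_wires l + 1 + Suc (width n l T) * sg + t * (width n l T * sg))
        (concat (map (step_block n l T t) [0..<width n l T]))"
    proof (rule feedforward_concat[where s = sg])
      fix i assume "i < width n l T"
      from 3[OF this, of t] show "feedforward (in_wires l + 1 + Suc (width n l T) * sg + t * (width n l T * sg) + i * sg)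
          (step_block n l T t i)"
        by (simp add: algebra_simps)
    qed simp
  qed simp
  have Cc: "feedforward (in_wires l + cmp_base n l T + 1) (concat (map (cmp_block n l T kb) [0..<l + 2]))"
    using 4 by (intro feedforward_concat[where s = sc]) (auto simp: add.assoc simp del: upt_Suc)
  show ?thesis
    unfolding circuit_def
    using 1[of 0] A Bb 1[of "cmp_base n l T"] Cc 5
    by (intro feedforward_append) (auto simp: fin_base_def cmp_base_def algebra_simps simp del: upt_Suc)
qed

end

end

section \<open>Values on the wires of the circuit and the number of its satisfying
  assignments\<close>

context reduction
begin

context
  fixes n l T :: nat and xb kb v :: "nat \<Rightarrow> bool" and C w
  assumes C: "C = circuit n l T xb kb"
    and cons: "consistent (in_wires l) C v" and v0: "\<not> v 0"
    and w: "w = pair_code (map xb [0..<n]) (map (\<lambda>i. v (3 + \<tau> + i)) [0..<l])"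
begin

abbreviation "R \<equiv> radius n l T"
abbreviation "W \<equiv> width n l T"

lemma length_w: "length w = 2 * n + 2 + l"
  by (simp add: w nth_pair_code(5))

lemma value_one: "v (in_wires l)"
  using consistent_occurs[OF cons circuit_occurs(1)[OF C]] v0 by (simp add: consistent_def)

text \<open>A known bit is hardwired by choosing between the wires of the two constants. As one of
  them has number 0, the choice is a multiplication, which the program generating the circuit can
  carry out.\<close>

lemma value_select: "v (in_wires l * of_bool b) = b"
  using value_one v0 by (cases b) auto

lemma kind_values:
  fixes i
  defines "kd \<equiv> kind n l T xb (Suc i)"
  shows "v (fst kd) = (R \<le> i \<and> i < R + length w)"
    and "v (fst (snd kd)) = (R \<le> i \<and> i < R + length w \<and> w ! (i - R))"
    and "v (snd (snd kd)) = (i = R)"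
proof -
  consider "i < R" | "R \<le> i" "i < R + 2 * n" | "i = R + 2 * n" | "i = R + 2 * n + 1"
    | k where "i = R + (2 * n + 2 + k)" "k < l" | "R + (2 * n + 2 + l) \<le> i"
  proof (cases "R + 2 * n + 2 \<le> i \<and> i < R + (2 * n + 2 + l)")
    case True
    then have "i = R + (2 * n + 2 + (i - (R + (2 * n + 2))))" "i - (R + (2 * n + 2)) < l" by auto
    then show ?thesis using that(5) by blast
  next
    case False
    then show ?thesis using that(1-4,6) by linarith
  qed
  then have "v (fst kd) = (R \<le> i \<and> i < R + length w) \<and>
      v (fst (snd kd)) = (R \<le> i \<and> i < R + length w \<and> w ! (i - R)) \<and> v (snd (snd kd)) = (i = R)"
  proof cases
    case 1
    then show ?thesis using v0 by (simp add: kd_def kind_def Let_def)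
  next
    case 2
    then have "kd = (in_wires l, in_wires l * of_bool (xb ((i - R) div 2)), in_wires l * of_bool (i = R))"
      by (auto simp: kd_def kind_def Let_def)
    moreover have "w ! (i - R) = xb ((i - R) div 2)"
      using 2 nth_pair_code(1)[of "i - R" "map xb [0..<n]"] unfolding w by (simp add: less_mult_imp_div_less)
    ultimately show ?thesis
      using 2 value_one length_w by (simp add: value_select)
  next
    case 3
    then have "kd = (in_wires l, 0, in_wires l * of_bool (n = 0))"
      by (simp add: kd_def kind_def Let_def)
    moreover have "w ! (i - R) = False"
      using 3 nth_pair_code(2)[of "map xb [0..<n]"] unfolding w by simp
    ultimately show ?thesis
      using 3 value_one v0 length_w by (simp add: value_select)
  next
    case 4
    then have "kd = (in_wires l, in_wires l, 0)"
      by (simp add: kd_def kind_def Let_def)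
    moreover have "w ! (i - R) = True"
      using 4 nth_pair_code(3)[of "map xb [0..<n]"] unfolding w by simp
    ultimately show ?thesis
      using 4 value_one v0 length_w by simp
  next
    case (5 k)
    then have "kd = (in_wires l, 3 + \<tau> + k, 0)"
      by (simp add: kd_def kind_def Let_def)
    moreover have "w ! (i - R) = v (3 + \<tau> + k)"
      using 5 nth_pair_code(4)[of "map xb [0..<n]" _ k] unfolding w by simp
    ultimately show ?thesis
      using 5 value_one v0 length_w by simp
  next
    case 6
    then show ?thesis using v0 length_w by (simp add: kd_def kind_def Let_def)
  qed
  then show "v (fst kd) = (R \<le> i \<and> i < R + length w)"
    "v (fst (snd kd)) = (R \<le> i \<and> i < R + length w \<and> w ! (i - R))" "v (snd (snd kd)) = (i = R)"
    by auto
qed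

lemma cell_bit_eq: "cell_bit l u j = in_wires l + (1 + u * sg) + offset fs j"
  by (simp add: cell_bit_def)

lemma init_values:
  assumes "i < W" "j < B"
  shows "v (cell_bit l (Suc i) j) = (cs ! j = cell_of R (init M w) i)"
proof -
  let ?kd = "kind n l T xb (Suc i)"
  have "consistent (in_wires l + (1 + Suc i * sg)) (init_block n l T xb (Suc i)) v"
    using assms by (intro consistent_occurs[OF cons circuit_occurs(2)[OF C]]) simp
  then have "v (cell_bit l (Suc i) j) = feval (\<lambda>k. v (init_inp l ?kd k)) (fs ! j)"
    unfolding init_block_def cell_bit_eq using assms fs_len fs_gate by (intro mgates_value) auto
  also have "\<dots> = (cs ! j = initial_cell (v (fst ?kd)) (v (fst (snd ?kd))) (v (snd (snd ?kd))))"
    using assms value_one by (subst fs_init) (auto simp: init_inp_def)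
  finally show ?thesis
    unfolding kind_values cell_of_init .
qed

text \<open>Each step uses the two adjacent columns, so the range of trusted columns shrinks by one
  at both ends, as in a light cone. The column \<open>R\<close>, which every cell also reads, stays
  inside because \<open>T \<le> R\<close>.\<close>

lemma step_values:
  assumes "t \<le> T" "t \<le> i" "i + t \<le> 2 * R" "j < B"
  shows "v (cell_bit l (1 + t * W + i) j) = (cs ! j = cell_of R ((step M ^^ t) (init M w)) i)"
  using assms
proof (induction t arbitrary: i j)
  case 0
  then show ?case using init_values[of i j] by (simp add: width_def)
next
  case (Suc t)
  let ?c = "(step M ^^ t) (init M w)"
  let ?v = "\<lambda>k. v (step_inp n l T t i k)"
  have i: "i < W" "1 \<le> i" "t \<le> R" "R + t \<le> 2 * R"
    using Suc.prems by (auto simp: width_def radius_def)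
  have IH: "v (cell_bit l (1 + t * W + i') k) = (cs ! k = cell_of R ?c i')"
    if "t \<le> i'" "i' + t \<le> 2 * R" "k < B" for i' k
    using that Suc.prems by (intro Suc.IH) auto
  have "consistent (in_wires l + (1 + (1 + (t + 1) * W + i) * sg)) (step_block n l T t i) v"
    using Suc.prems i by (intro consistent_occurs[OF cons circuit_occurs(3)[OF C]]) auto
  then have "v (cell_bit l (1 + (t + 1) * W + i) j) = feval ?v (fs ! j)"
    unfolding step_block_def cell_bit_eq using Suc.prems fs_len fs_gate by (intro mgates_value) auto
  also have "\<dots> = (cs ! j = next_cell (cell_of R ?c (i - 1)) (cell_of R ?c i) (cell_of R ?c (i + 1)) (cell_of R ?c R))"
  proof (rule fs_next)
    have val: "valid ?c" by (rule valid_run)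
    show "cell_of R ?c (i - 1) \<in> cells" "cell_of R ?c i \<in> cells" "cell_of R ?c (i + 1) \<in> cells" "cell_of R ?c R \<in> cells"
      using cell_of_cells[OF val] by blast+
    show "\<not> ?v 0" using v0 by (simp add: step_inp_def)
    have inp: "?v (4 + (a * B + k)) = v (cell_bit l (neighbour n l T t i a) k)" if "k < B" for a k
    proof -
      have "B \<noteq> 0" using that by linarith
      from div_mult_self3[OF this, of a k] have "(a * B + k) div B = a"
        using that by (simp only: div_less add_0_right)
      then show ?thesis using that by (simp add: step_inp_def)
    qed
    show "\<forall>k<B. ?v (4 + k) = (cs ! k = cell_of R ?c (i - 1)) \<and> ?v (4 + B + k) = (cs ! k = cell_of R ?c i) \<and>
        ?v (4 + 2 * B + k) = (cs ! k = cell_of R ?c (i + 1)) \<and> ?v (4 + 3 * B + k) = (cs ! k = cell_of R ?c R)"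
    proof (intro allI impI conjI)
      fix k assume k: "k < B"
      have "neighbour n l T t i 0 = 1 + t * W + (i - 1)" using i by (simp add: neighbour_def)
      then show "?v (4 + k) = (cs ! k = cell_of R ?c (i - 1))"
        using inp[OF k, of 0] IH[of "i - 1" k] k Suc.prems by simp
      have "neighbour n l T t i 1 = 1 + t * W + i" by (simp add: neighbour_def)
      then show "?v (4 + B + k) = (cs ! k = cell_of R ?c i)"
        using inp[OF k, of 1] IH[of i k] k Suc.prems by (simp add: add.assoc)
      have "neighbour n l T t i 2 = 1 + t * W + (i + 1)" by (simp add: neighbour_def)
      then show "?v (4 + 2 * B + k) = (cs ! k = cell_of R ?c (i + 1))"
        using inp[OF k, of 2] IH[of "i + 1" k] k Suc.prems by (simp add: add.assoc)
      have "neighbour n l T t i 3 = 1 + t * W + R" by (simp add: neighbour_def)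
      then show "?v (4 + 3 * B + k) = (cs ! k = cell_of R ?c R)"
        using inp[OF k, of 3] IH[of R k] k i by (simp add: add.assoc)
    qed
  qed (use Suc.prems in auto)
  also have "\<dots> = (cs ! j = cell_of R (step M ?c) i)"
    using cell_of_step[OF valid_run i(2), of R t w] by simp
  finally show ?case by simp
qed

text \<open>The bits come with the least significant first: a new pair of bits overrules the
  previous verdict if they differ and keeps it otherwise. Two empty words are equal, whence the
  initial value 1.\<close>

lemma cmp_values:
  "i \<le> l + 2 \<Longrightarrow> v (in_wires l + cmp_base n l T + i * sc) =
    (binary (map (\<lambda>j. v (2 + \<tau> + j)) [0..<i]) \<le> binary (map kb [0..<i]))"
proof (induction i)
  case 0
  then show ?case
    using consistent_occurs[OF cons circuit_occurs(4)[OF C]] v0 by (simp add: consistent_def)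
next
  case (Suc i)
  have "consistent (in_wires l + (cmp_base n l T + 1 + i * sc)) (cmp_block n l T kb i) v"
    using Suc.prems by (intro consistent_occurs[OF cons circuit_occurs(5)[OF C]]) simp
  then have "v (fout (cmp_inp n l T kb i) (in_wires l + (cmp_base n l T + 1 + i * sc)) fc) =
      feval (\<lambda>k. v (cmp_inp n l T kb i k)) fc"
    unfolding cmp_block_def by (rule fgates_value)
  moreover have "fout (cmp_inp n l T kb i) (in_wires l + (cmp_base n l T + 1 + i * sc)) fc =
      in_wires l + cmp_base n l T + Suc i * sc"
    using sc_pos fc(1) by (simp add: fout_gate)
  ultimately have "v (in_wires l + cmp_base n l T + Suc i * sc) =
      (if v (2 + \<tau> + i) = kb i then v (in_wires l + cmp_base n l T + i * sc) else kb i)"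
    by (simp add: fc(3) cmp_inp_def value_select)
  also have "\<dots> = (if v (2 + \<tau> + i) = kb i then binary (map (\<lambda>j. v (2 + \<tau> + j)) [0..<i]) \<le> binary (map kb [0..<i]) else kb i)"
    using Suc by simp
  also have "\<dots> = (binary (map (\<lambda>j. v (2 + \<tau> + j)) [0..<Suc i]) \<le> binary (map kb [0..<Suc i]))"
    using binary_less[of "map (\<lambda>j. v (2 + \<tau> + j)) [0..<i]"] binary_less[of "map kb [0..<i]"]
    by (auto simp: binary_append)
  finally show ?case .
qed

lemma out_value:
  assumes "halts_with M ((step M ^^ T) (init M w)) [b]"
  shows "v (in_wires l + num_gates n l T - 1) = (if v 1
    then binary (map (\<lambda>j. v (2 + j)) [0..<\<tau>]) < pn \<and> \<not> v (2 + \<tau> + (l + 1)) \<and> b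
    else binary (map (\<lambda>j. v (2 + j)) [0..<\<tau>]) < qn \<and>
      binary (map (\<lambda>j. v (2 + \<tau> + j)) [0..<l + 2]) \<le> binary (map kb [0..<l + 2]))"
proof -
  let ?v = "\<lambda>k. v (fin_inp n l T k)" and ?c = "cell_of R ((step M ^^ T) (init M w)) R"
  have "consistent (in_wires l + fin_base n l T) (fin_block n l T) v"
    by (rule consistent_occurs[OF cons circuit_occurs(6)[OF C]])
  then have "v (fout (fin_inp n l T) (in_wires l + fin_base n l T) ff) = feval ?v ff"
    unfolding fin_block_def by (rule fgates_value)
  moreover have "fout (fin_inp n l T) (in_wires l + fin_base n l T) ff = in_wires l + num_gates n l T - 1"
    using sf_pos ff(1) by (simp add: fout_gate num_gates_def)
  ultimately have "v (in_wires l + num_gates n l T - 1) = feval ?v ff" by simp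
  also have "\<dots> = (if ?v 0 then binary (map (\<lambda>j. ?v (3 + j)) [0..<\<tau>]) < pn \<and> \<not> ?v 1 \<and> accepts ?c
      else binary (map (\<lambda>j. ?v (3 + j)) [0..<\<tau>]) < qn \<and> ?v 2)"
  proof (rule ff(3))
    show "?c \<in> cells" by (rule cell_of_cells[OF valid_run])
    show "\<forall>j<B. ?v (3 + \<tau> + j) = (cs ! j = ?c)"
    proof (intro allI impI)
      fix j assume "j < B"
      then have "v (cell_bit l (1 + T * W + R) j) = (cs ! j = ?c)"
        by (intro step_values) (auto simp: radius_def)
      then show "?v (3 + \<tau> + j) = (cs ! j = ?c)" by (simp add: fin_inp_def)
    qed
  qed
  also have "accepts ?c = b"
    by (rule next_cell_accepts[OF assms valid_run])
  also have "map (\<lambda>j. ?v (3 + j)) [0..<\<tau>] = map (\<lambda>j. v (2 + j)) [0..<\<tau>]"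
    by (auto simp: fin_inp_def)
  also have "?v 2 = (binary (map (\<lambda>j. v (2 + \<tau> + j)) [0..<l + 2]) \<le> binary (map kb [0..<l + 2]))"
    using cmp_values[of "l + 2"] by (simp add: fin_inp_def del: upt_Suc)
  finally show ?thesis by (simp add: fin_inp_def del: upt_Suc)
qed

end

text \<open>Evaluation of the circuit is unique, so a consistent assignment amounts to the free
  inputs, which are all input wires except the constant 0.\<close>

lemma bij_betw_inputs:
  "bij_betw (\<lambda>v. map v [1..<in_wires l])
    {v \<in> assignments (wires (in_wires l) (circuit n l T xb kb)). \<not> v 0 \<and>
      consistent (in_wires l) (circuit n l T xb kb) v} {xs. length xs = 3 + \<tau> + l}"
proof -
  let ?n = "in_wires l" and ?C = "circuit n l T xb kb"
  let ?S = "{v \<in> assignments (wires ?n ?C). \<not> v 0 \<and> consistent ?n ?C v}"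
  have n: "?n = Suc (3 + \<tau> + l)" by (simp add: in_wires_def)
  note ex1 = ex1_consistent[OF feedforward_circuit[of l n T xb kb]]
  show ?thesis
    unfolding bij_betw_def
  proof
    show "inj_on (\<lambda>v. map v [1..<?n]) ?S"
    proof (rule inj_onI)
      fix v v' assume v: "v \<in> ?S" and v': "v' \<in> ?S" and eq: "map v [1..<?n] = map v' [1..<?n]"
      let ?u = "\<lambda>j. j < ?n \<and> v j"
      have "?u \<in> assignments ?n" by (simp add: assignments_def)
      note uniq = ex1[OF this]
      have "v j = v' j" if "j < ?n" for j
      proof (cases "j = 0")
        case False
        then have "j \<in> set [1..<?n]" using that by simp
        then show ?thesis using eq by (simp only: map_eq_conv)
      qed (use v v' in simp)
      then have a: "v' \<in> assignments (wires ?n ?C) \<and> (\<forall>j<?n. v' j = ?u j) \<and> consistent ?n ?C v'"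
        using v' by simp
      have b: "v \<in> assignments (wires ?n ?C) \<and> (\<forall>j<?n. v j = ?u j) \<and> consistent ?n ?C v"
        using v by simp
      show "v = v'" using uniq a b unfolding Ex1_def by metis
    qed
    show "(\<lambda>v. map v [1..<?n]) ` ?S = {xs. length xs = 3 + \<tau> + l}"
    proof
      show "{xs. length xs = 3 + \<tau> + l} \<subseteq> (\<lambda>v. map v [1..<?n]) ` ?S"
      proof
        fix xs :: "bool list" assume "xs \<in> {xs. length xs = 3 + \<tau> + l}"
        then have xs: "length xs = 3 + \<tau> + l" by simp
        let ?u = "\<lambda>j. 0 < j \<and> j < ?n \<and> xs ! (j - 1)"
        have "?u \<in> assignments ?n" by (simp add: assignments_def)
        from ex1[OF this] obtain v where v: "v \<in> assignments (wires ?n ?C)" "\<forall>j<?n. v j = ?u j" "consistent ?n ?C v"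
          by blast
        have "map v [1..<?n] = xs"
          using v(2) xs n by (intro nth_equalityI) auto
        moreover have "\<not> v 0" using v(2) n by simp
        ultimately show "xs \<in> (\<lambda>v. map v [1..<?n]) ` ?S" using v by (intro image_eqI[of _ _ v]) auto
      qed
    qed (auto simp: n)
  qed
qed

text \<open>With \<open>s\<close> true, the multiplicity bits contribute the factor
  \<open>pn\<close> and the free bit the factor 2. With \<open>s\<close> false they contribute
  \<open>qn\<close>, and there are \<open>Suc k\<close> numbers up to the hardwired number
  \<open>k\<close>; for even \<open>k\<close> this is odd, which rules out a tie.\<close>

theorem card_solutions:
  fixes x :: "bool list" and l T :: nat and kb :: "nat \<Rightarrow> bool"
  defines "C \<equiv> circuit (length x) l T ((!) x) kb"
  assumes halt: "\<And>y. length y = l \<Longrightarrow> halts_with M ((step M ^^ T) (init M (pair_code x y))) [pair_code x y \<in> A]"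
  shows "card {v \<in> solutions (in_wires l) C (in_wires l + num_gates (length x) l T - 1). v 1} =
      pn * (2 * card {y. length y = l \<and> pair_code x y \<in> A})"
    and "card {v \<in> solutions (in_wires l) C (in_wires l + num_gates (length x) l T - 1). \<not> v 1} =
      qn * Suc (binary (map kb [0..<l + 2]))"
proof -
  let ?n = "in_wires l" and ?out = "in_wires l + num_gates (length x) l T - 1"
  let ?S = "{v \<in> assignments (wires ?n C). \<not> v 0 \<and> consistent ?n C v}"
  let ?m = "\<lambda>v::nat \<Rightarrow> bool. map v [1..<?n]"
  let ?k = "binary (map kb [0..<l + 2])"
  \<comment> \<open>\<open>zz\<close> holds the last \<open>l + 2\<close> inputs; the witness starts
    after the free bit.\<close>
  define ys where "ys zz = map (\<lambda>i. zz ! Suc i) [0..<l]" for zz :: "bool list"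
  have n: "?n = Suc (3 + \<tau> + l)" by (simp add: in_wires_def)
  have inj: "inj_on ?m ?S" and surj: "?m ` ?S = {xs. length xs = 3 + \<tau> + l}"
    using bij_betw_inputs[of l "length x" T "(!) x" kb] unfolding C_def bij_betw_def by auto
  have sol: "solutions ?n C ?out = {v \<in> ?S. v ?out}"
    unfolding solutions_def consistent_def by auto
  have split: "\<exists>s t zz. xs = s # t @ zz \<and> length t = \<tau> \<and> length zz = l + 2" if len: "length xs = 3 + \<tau> + l" for xs :: "bool list"
  proof -
    obtain s r where xs: "xs = s # r" using len by (cases xs) auto
    then show ?thesis
      using that by (intro exI[of _ s] exI[of _ "take \<tau> r"] exI[of _ "drop \<tau> r"]) auto
  qed
  have val: "v ?out = (if s then binary t < pn \<and> \<not> zz ! (l + 1) \<and> pair_code x (ys zz) \<in> A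
      else binary t < qn \<and> binary zz \<le> ?k) \<and> v 1 = s"
    if v: "v \<in> ?S" and eq: "?m v = s # t @ zz" and len: "length t = \<tau>" "length zz = l + 2" for v s t zz
  proof -
    have nth: "v (Suc j) = (s # t @ zz) ! j" if "j < 3 + \<tau> + l" for j
      using that arg_cong[OF eq, of "\<lambda>xs. xs ! j"] n by simp
    have v1: "v 1 = s" using nth[of 0] by simp
    have tt: "map (\<lambda>j. v (2 + j)) [0..<\<tau>] = t"
      using len nth by (intro nth_equalityI) (auto simp: nth_append)
    have zv: "v (2 + \<tau> + j) = zz ! j" if "j < l + 2" for j
      using that len nth[of "1 + \<tau> + j"] by (simp add: nth_append)
    have zz: "map (\<lambda>j. v (2 + \<tau> + j)) [0..<l + 2] = zz"
      using len zv by (intro nth_equalityI) (auto simp del: upt_Suc)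
    have y: "map (\<lambda>i. v (3 + \<tau> + i)) [0..<l] = ys zz"
      unfolding ys_def
    proof (intro map_cong refl)
      fix i assume "i \<in> set [0..<l]"
      then show "v (3 + \<tau> + i) = zz ! Suc i" using zv[of "Suc i"] by (simp add: numeral_3_eq_3)
    qed
    have x: "map ((!) x) [0..<length x] = x" by (rule map_nth)
    have len_y: "length (ys zz) = l" by (simp add: ys_def)
    have "v ?out = (if v 1
      then binary (map (\<lambda>j. v (2 + j)) [0..<\<tau>]) < pn \<and> \<not> v (2 + \<tau> + (l + 1)) \<and> pair_code x (ys zz) \<in> A
      else binary (map (\<lambda>j. v (2 + j)) [0..<\<tau>]) < qn \<and>
        binary (map (\<lambda>j. v (2 + \<tau> + j)) [0..<l + 2]) \<le> binary (map kb [0..<l + 2]))"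
      using v halt[OF len_y]
      by (intro out_value[OF C_def[THEN meta_eq_to_obj_eq], where w = "pair_code x (ys zz)"]) (auto simp: y x)
    then show ?thesis
      unfolding tt zz v1 using zv[of "l + 1"] by simp
  qed
  have card: "card {v \<in> solutions ?n C ?out. v 1 = s} = card TT * card ZZ"
    if TZ: "\<And>t zz. length t = \<tau> \<Longrightarrow> length zz = l + 2 \<Longrightarrow>
        (if s then binary t < pn \<and> \<not> zz ! (l + 1) \<and> pair_code x (ys zz) \<in> A else binary t < qn \<and> binary zz \<le> ?k) \<longleftrightarrow>
        t \<in> TT \<and> zz \<in> ZZ"
      and len: "\<And>t. t \<in> TT \<Longrightarrow> length t = \<tau>" "\<And>zz. zz \<in> ZZ \<Longrightarrow> length zz = l + 2" for s TT ZZ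
  proof -
    let ?f = "\<lambda>(t, zz). s # t @ zz"
    have im: "?m ` {v \<in> solutions ?n C ?out. v 1 = s} = ?f ` (TT \<times> ZZ)"
    proof (intro set_eqI iffI)
      fix xs assume "xs \<in> ?m ` {v \<in> solutions ?n C ?out. v 1 = s}"
      then obtain v where v: "v \<in> ?S" "v ?out" "v 1 = s" "xs = ?m v" unfolding sol by auto
      have "length (?m v) = 3 + \<tau> + l" using n by simp
      from split[OF this] obtain s' t zz where eq: "?m v = s' # t @ zz" "length t = \<tau>" "length zz = l + 2"
        by (elim exE conjE) (rule that; assumption)
      have "t \<in> TT \<and> zz \<in> ZZ" "s' = s"
        using val[OF v(1) eq] v(2,3) TZ[OF eq(2,3)] by auto
      then show "xs \<in> ?f ` (TT \<times> ZZ)" using v(4) eq(1) by auto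
    next
      fix xs assume "xs \<in> ?f ` (TT \<times> ZZ)"
      then obtain t zz where tz: "t \<in> TT" "zz \<in> ZZ" "xs = s # t @ zz" by auto
      then have l: "length t = \<tau>" "length zz = l + 2" using len by auto
      then have "xs \<in> ?m ` ?S" unfolding surj using tz(3) by simp
      then obtain v where v: "v \<in> ?S" "?m v = xs" by auto
      then have eq: "?m v = s # t @ zz" using tz(3) by simp
      have "v ?out" "v 1 = s"
        using val[OF v(1) eq l] tz(1,2) TZ[OF l] by auto
      then show "xs \<in> ?m ` {v \<in> solutions ?n C ?out. v 1 = s}"
        unfolding sol using v by (intro image_eqI[of _ _ v]) auto
    qed
    have i1: "inj_on ?m {v \<in> solutions ?n C ?out. v 1 = s}"
      using inj unfolding sol by (rule inj_on_subset) auto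
    have i2: "inj_on ?f (TT \<times> ZZ)"
      using len by (intro inj_onI) auto
    have "card {v \<in> solutions ?n C ?out. v 1 = s} = card (?m ` {v \<in> solutions ?n C ?out. v 1 = s})"
      by (rule card_image[OF i1, symmetric])
    also have "\<dots> = card (TT \<times> ZZ)"
      unfolding im by (rule card_image[OF i2])
    finally have "card {v \<in> solutions ?n C ?out. v 1 = s} = card (TT \<times> ZZ)" .
    then show ?thesis by (simp add: card_cartesian_product)
  qed
  have TT: "card {t. length t = \<tau> \<and> binary t < pn} = pn" "card {t. length t = \<tau> \<and> binary t < qn} = qn"
    using num by (simp_all add: card_binary_less)
  have "card {v \<in> solutions ?n C ?out. v 1 = True} =
      pn * card {zz. length zz = l + 2 \<and> \<not> zz ! (l + 1) \<and> pair_code x (ys zz) \<in> A}"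
    by (subst card[of True "{t. length t = \<tau> \<and> binary t < pn}" "{zz. length zz = l + 2 \<and> \<not> zz ! (l + 1) \<and> pair_code x (ys zz) \<in> A}"])
      (auto simp: TT)
  moreover have "card {zz. length zz = l + 2 \<and> \<not> zz ! (l + 1) \<and> pair_code x (ys zz) \<in> A} =
      2 * card {y. length y = l \<and> pair_code x y \<in> A}"
  proof -
    let ?Y = "{y. length y = l \<and> pair_code x y \<in> A}" and ?f = "\<lambda>(e, y). e # y @ [False]"
    have ysf: "ys (e # y @ [b]) = y" if "length y = l" for e y b
      using that by (auto simp: ys_def nth_append intro!: nth_equalityI)
    have "{zz. length zz = l + 2 \<and> \<not> zz ! (l + 1) \<and> pair_code x (ys zz) \<in> A} = ?f ` (UNIV \<times> ?Y)"
    proof (intro set_eqI iffI)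
      fix zz assume "zz \<in> {zz. length zz = l + 2 \<and> \<not> zz ! (l + 1) \<and> pair_code x (ys zz) \<in> A}"
      then have zz: "length zz = l + 2" "\<not> zz ! (l + 1)" "pair_code x (ys zz) \<in> A" by auto
      obtain e r where er: "zz = e # r" using zz(1) by (cases zz) auto
      obtain y b where yb: "r = y @ [b]" using zz(1) er by (cases r rule: rev_cases) auto
      have ly: "length y = l" using zz(1) er yb by simp
      have "b = False" using zz(2) ly by (simp add: er yb nth_append)
      moreover have "y \<in> ?Y" using zz(3) ly ysf[OF ly] by (simp add: er yb)
      ultimately show "zz \<in> ?f ` (UNIV \<times> ?Y)" by (auto simp: er yb)
    next
      fix zz assume "zz \<in> ?f ` (UNIV \<times> ?Y)"
      then obtain e y where "zz = e # y @ [False]" "length y = l" "pair_code x y \<in> A" by auto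
      then show "zz \<in> {zz. length zz = l + 2 \<and> \<not> zz ! (l + 1) \<and> pair_code x (ys zz) \<in> A}"
        using ysf by (simp add: nth_append)
    qed
    moreover have "inj_on ?f (UNIV \<times> ?Y)" by (intro inj_onI) auto
    ultimately show ?thesis by (simp add: card_image card_cartesian_product)
  qed
  ultimately show "card {v \<in> solutions ?n C ?out. v 1} = pn * (2 * card {y. length y = l \<and> pair_code x y \<in> A})"
    by simp
  have "card {v \<in> solutions ?n C ?out. v 1 = False} = qn * card {zz. length zz = l + 2 \<and> binary zz < Suc ?k}"
    by (subst card[of False "{t. length t = \<tau> \<and> binary t < qn}" "{zz. length zz = l + 2 \<and> binary zz < Suc ?k}"])
      (auto simp: TT less_Suc_eq_le simp del: upt_Suc)
  moreover have "card {zz. length zz = l + 2 \<and> binary zz < Suc ?k} = Suc ?k"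
  proof (rule card_binary_less)
    \<comment> \<open>\<open>Suc ?k\<close> is admissible because the number itself is written with
      \<open>l + 2\<close> bits.\<close>
    have "?k < 2 ^ (l + 2)" using binary_less[of "map kb [0..<l + 2]"] by (simp del: upt_Suc)
    then show "Suc ?k \<le> 2 ^ (l + 2)" by simp
  qed
  ultimately show "card {v \<in> solutions ?n C ?out. \<not> v 1} = qn * Suc ?k"
    by (simp del: upt_Suc)
qed

end

section \<open>Generating the graph of an instance\<close>

text \<open>The contents of tape 1 change with every number emitted, so the expressions that
  describe the graph must have the same value for all of them.\<close>

definition evals :: "nat \<Rightarrow> expr \<Rightarrow> (nat \<Rightarrow> nat) \<Rightarrow> (int \<Rightarrow> nat) \<Rightarrow> (int \<Rightarrow> nat) \<Rightarrow> nat \<Rightarrow> bool" where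
  "evals d e env c0 c2 x \<longleftrightarrow> wf_expr d e \<and> (\<forall>v w. val e env (c0, v, w, c2) = x)"

definition emits :: "nat \<Rightarrow> cmd \<Rightarrow> (nat \<Rightarrow> nat) \<Rightarrow> (int \<Rightarrow> nat) \<Rightarrow> (int \<Rightarrow> nat) \<Rightarrow> bool list \<Rightarrow> bool" where
  "emits d c env c0 c2 w \<longleftrightarrow> wf_cmd d c \<and> queries c = 0 \<and>
    (\<forall>Q v u. sem Q d c env (c0, v, u, c2) = (c0, v, u @ w, c2))"

lemma concat_map_concat_map: "concat (map f (concat (map g xs))) = concat (map (\<lambda>x. concat (map f (g x))) xs)"
  by (induction xs) auto

lemma wf_expr_mono: "wf_expr d e \<Longrightarrow> d \<le> d' \<Longrightarrow> wf_expr d' e"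
  by (induction e) auto

lemma evals_upd: "evals d e env c0 c2 x \<Longrightarrow> d \<le> k \<Longrightarrow> d \<le> d' \<Longrightarrow> evals d' e (env(k := y)) c0 c2 x"
  unfolding evals_def using val_cong[of d e "env(k := y)" env] wf_expr_mono[of d e d'] by auto

lemma emits_Nop: "emits d Nop env c0 c2 []"
  by (simp add: emits_def)

lemma emits_Emit: "evals d e env c0 c2 x \<Longrightarrow> emits d (Emit e) env c0 c2 (unary x)"
  by (simp add: emits_def evals_def)

lemma emits_Seq: "emits d a env c0 c2 w \<Longrightarrow> emits d b env c0 c2 w' \<Longrightarrow> emits d (SeqC a b) env c0 c2 (w @ w')"
  by (simp add: emits_def)

lemma emits_Let: "evals d e env c0 c2 x \<Longrightarrow> emits (Suc d) c (env(d := x)) c0 c2 w \<Longrightarrow> emits d (LetC e c) env c0 c2 w"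
  by (simp add: emits_def evals_def del: fun_upd_apply)

lemma emits_For:
  assumes "evals d e env c0 c2 n"
    and "\<And>r i. emits (d + 2) c (env(d := r, d + 1 := i)) c0 c2 (w i)"
  shows "emits d (ForC e c) env c0 c2 (concat (map w [0..<n]))"
proof -
  have "fold (\<lambda>i. sem Q (d + 2) c (env(d := n - Suc i, Suc d := i))) [0..<k] (c0, v, u, c2) =
      (c0, v, u @ concat (map w [0..<k]), c2)" for k Q v u
  proof (induction k)
    case (Suc k)
    have "sem Q (d + 2) c (env(d := n - Suc k, Suc d := k)) (c0, v, u @ concat (map w [0..<k]), c2) =
        (c0, v, (u @ concat (map w [0..<k])) @ w k, c2)"
      using assms(2)[of "n - Suc k" k] unfolding emits_def by (simp del: fun_upd_apply)
    with Suc show ?case by (simp del: fun_upd_apply)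
  qed simp
  moreover have "wf_cmd (d + 2) c \<and> queries c = 0" using assms(2) unfolding emits_def by blast
  ultimately show ?thesis
    using assms(1) by (simp add: emits_def evals_def Let_def)
qed

definition edge_code :: "(nat \<times> nat) list \<Rightarrow> bool list" where
  "edge_code es = concat (map (\<lambda>(u, v). unary u @ unary v) es)"

lemma edge_code_append [simp]: "edge_code (xs @ ys) = edge_code xs @ edge_code ys"
  by (simp add: edge_code_def)

lemma edge_code_concat: "edge_code (concat (map f xs)) = concat (map (\<lambda>x. edge_code (f x)) xs)"
  by (induction xs) (auto simp: edge_code_def)

fun emit_edges :: "(expr \<times> expr) list \<Rightarrow> cmd" where
  "emit_edges [] = Nop"
| "emit_edges ((a, b) # es) = SeqC (Emit a) (SeqC (Emit b) (emit_edges es))"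

lemma emits_emit_edges:
  "(\<And>a b. (a, b) \<in> set es \<Longrightarrow> evals d a env c0 c2 (f a) \<and> evals d b env c0 c2 (f b)) \<Longrightarrow>
    emits d (emit_edges es) env c0 c2 (edge_code (map (map_prod f f) es))"
proof (induction es rule: emit_edges.induct)
  case 1
  then show ?case by (simp add: edge_code_def emits_Nop)
next
  case (2 a b es)
  have "emits d (emit_edges es) env c0 c2 (edge_code (map (map_prod f f) es))"
    by (rule 2(1), rule 2(2)) simp
  then have "emits d (emit_edges ((a, b) # es)) env c0 c2
      (unary (f a) @ unary (f b) @ edge_code (map (map_prod f f) es))"
    using 2(2)[of a b] by (auto intro!: emits_Seq emits_Emit)
  then show ?case by (simp add: edge_code_def)
qed

text \<open>The edges are listed by \<open>gedges\<close> with expressions as vertices. Since a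
  gadget is fixed, this unfolds to a constant number of instructions, without a loop at run
  time.\<close>

definition emit_gadget :: "gadget \<Rightarrow> expr \<Rightarrow> expr \<Rightarrow> expr \<Rightarrow> nat \<Rightarrow> cmd" where
  "emit_gadget g eu ev eb k = emit_edges (gedges g eu ev (\<lambda>j. Add eb (Cst j)) k)"

lemma gedges_range: "(a, b) \<in> set (gedges g u v i k) \<Longrightarrow> a \<in> {u, v} \<union> range i \<and> b \<in> {u, v} \<union> range i"
  by (induction g arbitrary: u v k) fastforce+

lemma emits_emit_gadget:
  assumes "evals d eu env c0 c2 u" "evals d ev env c0 c2 v" "evals d eb env c0 c2 b"
  shows "emits d (emit_gadget g eu ev eb k) env c0 c2 (edge_code (place_edges (g, u, v, b + k)))"
proof -
  define f where "f e = val e env (c0, [], [], c2)" for e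
  have f: "f eu = u" "f ev = v" "f eb = b" "f \<circ> (\<lambda>j. Add eb (Cst j)) = (\<lambda>j. b + j)"
    using assms by (auto simp: f_def evals_def fun_eq_iff)
  have ev: "evals d e env c0 c2 (f e)" if "e \<in> {eu, ev} \<union> range (\<lambda>j. Add eb (Cst j))" for e
    using that assms by (auto simp: evals_def f_def)
  have "emits d (emit_gadget g eu ev eb k) env c0 c2
      (edge_code (map (map_prod f f) (gedges g eu ev (\<lambda>j. Add eb (Cst j)) k)))"
    unfolding emit_gadget_def
  proof (rule emits_emit_edges)
    fix a b assume "(a, b) \<in> set (gedges g eu ev (\<lambda>j. Add eb (Cst j)) k)"
    from gedges_range[OF this] show "evals d a env c0 c2 (f a) \<and> evals d b env c0 c2 (f b)"
      using ev[of a] ev[of b] by (simp only:)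
  qed
  then show ?thesis
    by (simp add: map_gedges f gedges_shift place_edges_def)
qed

fun emit_pairs :: "gadget \<Rightarrow> (nat \<times> nat) list \<Rightarrow> (nat \<Rightarrow> expr) \<Rightarrow> expr \<Rightarrow> nat \<Rightarrow> cmd" where
  "emit_pairs M [] tE eb k = Nop"
| "emit_pairs M ((u, v) # es) tE eb k =
    SeqC (emit_gadget M (tE u) (tE v) eb k) (emit_pairs M es tE eb (k + gsize M))"

lemma emits_emit_pairs:
  assumes "\<And>u. evals d (tE u) env c0 c2 (t u)" "evals d eb env c0 c2 b"
  shows "emits d (emit_pairs M es tE eb k) env c0 c2
    (edge_code (concat (map place_edges (place_pairs M es t (b + k)))))"
proof (induction es arbitrary: k)
  case Nil
  then show ?case by (simp add: edge_code_def emits_Nop)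
next
  case (Cons p es)
  then show ?case
    using assms emits_emit_gadget[OF assms(1) assms(1) assms(2)]
    by (cases p) (auto intro!: emits_Seq simp: add.assoc)
qed

section \<open>The program that writes the code of the graph\<close>

locale generator = reduction M cs fs fc ff \<tau> pn qn
  for M :: tm and cs fs fc ff \<tau> pn qn +
  fixes gM gP :: gadget and gq gK gCp gCm :: nat
begin

definition span :: nat where "span = gate_span gM gq gK"

context
  fixes n l T :: nat and c0 c2 :: "int \<Rightarrow> nat"
begin

definition xbit :: "nat \<Rightarrow> bool" where "xbit i = (c0 (int i) = 2)"
definition kbit :: "nat \<Rightarrow> bool" where "kbit i = (c2 (int i) = 2)"
definition CC :: "(nat \<times> nat) list" where "CC = circuit n l T xbit kbit"
definition NG :: nat where "NG = num_gates n l T"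
definition NW :: nat where "NW = in_wires l + NG"
definition VV :: nat where "VV = NW + 5 * NG"
definition mm :: nat where "mm = gCm * Suc VV"

text \<open>The sizes that determine the layout are computed once and kept in the variables 0 to 11;
  local variables are allocated from 12 on, so binding them preserves this.\<close>

definition globals :: "(nat \<Rightarrow> nat) \<Rightarrow> bool" where
  "globals env \<longleftrightarrow> env 0 = n \<and> env 1 = l \<and> env 2 = T \<and> env 3 = radius n l T \<and> env 4 = width n l T \<and>
    env 5 = in_wires l \<and> env 6 = cmp_base n l T \<and> env 7 = NG \<and> env 8 = NW \<and> env 9 = VV \<and> env 10 = mm \<and>
    env 11 = mm * span"

lemma sizes: "wires (in_wires l) CC = NW" "core_size (in_wires l) CC = VV" "copies gCm (in_wires l) CC = mm"
  "length CC = NG" "pin_copies gCp gCm (in_wires l) CC = gCp * (mm * Suc NG)"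
  by (simp_all add: wires_def core_size_def copies_def pin_copies_def CC_def length_circuit NW_def NG_def VV_def mm_def)

lemma globals_upd: "globals env \<Longrightarrow> 12 \<le> k \<Longrightarrow> globals (env(k := x))"
  by (simp add: globals_def)

definition gate_code :: "nat \<Rightarrow> nat \<times> nat \<Rightarrow> bool list" where
  "gate_code i g = edge_code (concat (map place_edges
    (gate_placements gM gq gK mm (in_wires l) NW g i (VV + i * (mm * span)))))"

fun gates_code :: "nat \<Rightarrow> (nat \<times> nat) list \<Rightarrow> bool list" where
  "gates_code s [] = []"
| "gates_code s (g # G) = gate_code s g @ gates_code (Suc s) G"

lemma gates_code_append: "gates_code s (G @ H) = gates_code s G @ gates_code (s + length G) H"
  by (induction G arbitrary: s) auto

lemma gates_code_concat:
  assumes "\<And>k. k < N \<Longrightarrow> length (f k) = z"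
  shows "gates_code s (concat (map f [0..<N])) = concat (map (\<lambda>k. gates_code (s + k * z) (f k)) [0..<N])"
  using assms by (induction N) (auto simp: gates_code_append length_concat_upt)

lemma gates_code_nth: "gates_code s G = concat (map (\<lambda>i. gate_code (s + i) (G ! i)) [0..<length G])"
proof (induction G arbitrary: s)
  case (Cons g G)
  have "[0..<length (g # G)] = 0 # map Suc [0..<length G]"
    by (simp add: upt_conv_Cons map_Suc_upt del: upt_Suc)
  then show ?case using Cons by (simp add: comp_def del: upt_Suc)
qed simp

end

definition gate_terminal :: "nat \<Rightarrow> nat \<Rightarrow> expr" where
  "gate_terminal d k = (if k = 0 then Cst 0 else if k = 1 then Var (d + 1) else if k = 2 then Var (d + 2)
    else if k = 3 then Add (Var 5) (Var d) else Add (Var 8) (Add (Mul (Cst 5) (Var d)) (Cst (k - 4))))"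

text \<open>Number and inputs of the gate are evaluated once, into the variables \<open>d\<close> to
  \<open>d + 2\<close>; \<open>d + 4\<close> is then the index of the copy being emitted.\<close>

definition gate_cmd :: "nat \<Rightarrow> expr \<Rightarrow> expr \<Rightarrow> expr \<Rightarrow> cmd" where
  "gate_cmd d ei ea eb = LetC ei (LetC ea (LetC eb (ForC (Var 10)
    (emit_pairs gM (gate_pairs gq gK) (gate_terminal d)
      (Add (Add (Var 9) (Mul (Var d) (Var 11))) (Mul (Var (d + 4)) (Cst span))) 0))))"

fun fout_expr :: "(nat \<Rightarrow> expr) \<Rightarrow> expr \<Rightarrow> nat \<Rightarrow> formula \<Rightarrow> expr" where
  "fout_expr inpE bE k (Inp j) = inpE j"
| "fout_expr inpE bE k (Nand f g) = Add (Var 5) (Add bE (Cst (k + (fsize f + fsize g))))"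

fun formula_cmd :: "nat \<Rightarrow> (nat \<Rightarrow> expr) \<Rightarrow> expr \<Rightarrow> nat \<Rightarrow> formula \<Rightarrow> cmd" where
  "formula_cmd d inpE bE k (Inp j) = Nop"
| "formula_cmd d inpE bE k (Nand f g) = SeqC (formula_cmd d inpE bE k f)
    (SeqC (formula_cmd d inpE bE (k + fsize f) g)
      (gate_cmd d (Add bE (Cst (k + (fsize f + fsize g)))) (fout_expr inpE bE k f)
        (fout_expr inpE bE (k + fsize f) g)))"

fun formulas_cmd :: "nat \<Rightarrow> (nat \<Rightarrow> expr) \<Rightarrow> expr \<Rightarrow> nat \<Rightarrow> formula list \<Rightarrow> cmd" where
  "formulas_cmd d inpE bE k [] = Nop"
| "formulas_cmd d inpE bE k (f # gs) = SeqC (formula_cmd d inpE bE k f)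
    (formulas_cmd d inpE bE (k + fsize f) gs)"

context
  fixes n l T :: nat and c0 c2 :: "int \<Rightarrow> nat"
begin

abbreviation "ev d e env x \<equiv> evals d e env c0 c2 x"
abbreviation "em d c env w \<equiv> emits d c env c0 c2 w"
abbreviation "gl env \<equiv> globals n l T env"
abbreviation "gcode \<equiv> gate_code n l T"
abbreviation "gscode \<equiv> gates_code n l T"

lemma emits_gate_cmd:
  assumes d: "12 \<le> d" and g: "gl env" and e: "ev d ei env i" "ev d ea env a" "ev d eb env b"
  shows "em d (gate_cmd d ei ea eb) env (gcode i (a, b))"
proof -
  let ?t = "terminal (in_wires l) (NW n l T) (a, b) i"
  let ?E = "env(d := i, Suc d := a, Suc (Suc d) := b)"
  let ?b = "Add (Add (Var 9) (Mul (Var d) (Var 11))) (Mul (Var (d + 4)) (Cst span))"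
  let ?c = "emit_pairs gM (gate_pairs gq gK) (gate_terminal d) ?b 0"
  let ?w = "\<lambda>j. edge_code (concat (map place_edges
        (place_pairs gM (gate_pairs gq gK) ?t (VV n l T + i * (mm n l T * span) + j * span + 0))))"
  have a: "ev (Suc d) ea (env(d := i)) a" using e(2) by (rule evals_upd) auto
  have b: "ev (Suc (Suc d)) eb (env(d := i, Suc d := a)) b"
    by (intro evals_upd[OF evals_upd[OF e(3)]]) auto
  have "em (d + 3) (ForC (Var 10) ?c) ?E (concat (map ?w [0..<mm n l T]))"
  proof (rule emits_For)
    have "gl ?E" using g d by (intro globals_upd) auto
    then show "ev (d + 3) (Var 10) ?E (mm n l T)" using d unfolding evals_def globals_def by simp
    fix x j
    define F where "F = ?E(d + 3 := x, d + 3 + 1 := j)"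
    have "gl F" unfolding F_def using g d by (intro globals_upd) auto
    then have F5: "F 5 = in_wires l" "F 8 = NW n l T" "F 9 = VV n l T" "F 11 = mm n l T * span"
      by (simp_all add: globals_def)
    have Fd: "F d = i" "F (Suc d) = a" "F (d + 2) = b" "F (d + 4) = j" by (simp_all add: F_def)
    have "em (d + 3 + 2) ?c F (?w j)"
    proof (rule emits_emit_pairs)
      show "ev (d + 3 + 2) (gate_terminal d u) F (?t u)" for u
        using d by (simp add: evals_def gate_terminal_def terminal_def Fd F5 add.assoc del: add_2_eq_Suc')
      show "ev (d + 3 + 2) ?b F (VV n l T + i * (mm n l T * span) + j * span)"
        using d by (simp add: evals_def Fd F5)
    qed
    then show "em (d + 3 + 2) ?c (?E(d + 3 := x, d + 3 + 1 := j)) (?w j)" unfolding F_def .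
  qed
  moreover have "concat (map ?w [0..<mm n l T]) = gcode i (a, b)"
    unfolding gate_code_def gate_placements_def concat_map_concat_map edge_code_concat span_def by simp
  ultimately have "em (Suc (Suc (Suc d))) (ForC (Var 10) ?c) ?E (gcode i (a, b))"
    by (simp add: numeral_3_eq_3)
  then show ?thesis
    unfolding gate_cmd_def by (intro emits_Let[OF e(1)] emits_Let[OF a] emits_Let[OF b])
qed

context
  fixes d :: nat and env :: "nat \<Rightarrow> nat"
  assumes d: "12 \<le> d" and g: "gl env"
begin

lemma evals_fout_expr:
  assumes "ev d bE env b" "\<And>j. ev d (inpE j) env (inp j)"
  shows "ev d (fout_expr inpE bE k f) env (fout inp (in_wires l + (b + k)) f)"
proof (cases f)
  case (Inp j)
  then show ?thesis using assms(2) by simp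
next
  case (Nand f1 f2)
  then show ?thesis using assms(1) d g by (simp add: evals_def globals_def)
qed

lemma emits_formula_cmd:
  assumes b: "ev d bE env b" and inp: "\<And>j. ev d (inpE j) env (inp j)"
  shows "em d (formula_cmd d inpE bE k f) env (gscode (b + k) (fgates inp (in_wires l + (b + k)) f))"
proof (induction f arbitrary: k)
  case (Inp j)
  then show ?case by (simp add: emits_Nop)
next
  case (Nand f h)
  let ?i = "b + (k + (fsize f + fsize h))"
  let ?f = "fout inp (in_wires l + (b + k)) f" and ?h = "fout inp (in_wires l + (b + (k + fsize f))) h"
  have "ev d (Add bE (Cst (k + (fsize f + fsize h)))) env ?i"
    using b by (simp add: evals_def)
  note emits_gate_cmd[OF d g this evals_fout_expr[where k = k and f = f, OF b inp]
    evals_fout_expr[where k = "k + fsize f" and f = h, OF b inp]]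
  note emits_Seq[OF Nand.IH(1)[of k] emits_Seq[OF Nand.IH(2)[of "k + fsize f"] this]]
  then show ?case
    by (simp add: gates_code_append add.assoc)
qed

lemma emits_formulas_cmd:
  assumes b: "ev d bE env b" and inp: "\<And>j. ev d (inpE j) env (inp j)"
  shows "em d (formulas_cmd d inpE bE k gs) env (gscode (b + k) (mgates inp (in_wires l + (b + k)) gs))"
proof (induction gs arbitrary: k)
  case Nil
  then show ?case by (simp add: emits_Nop)
next
  case (Cons f gs)
  note emits_Seq[OF emits_formula_cmd[where k = k and f = f, OF b inp] Cons.IH[of "k + fsize f"]]
  then show ?case by (simp add: gates_code_append add.assoc)
qed

end

end

end

lemma concat_map_upt_shift: "concat (map w [a..<a + k]) = concat (map (\<lambda>i. w (a + i)) [0..<k])"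
  by (induction k) auto

lemma concat_map_upt_pairs:
  "concat (map w [a..<a + 2 * k]) = concat (map (\<lambda>i. w (a + 2 * i) @ w (a + 1 + 2 * i)) [0..<k])"
  by (induction k) auto

context generator
begin

fun init_expr :: "expr \<times> expr \<times> expr \<Rightarrow> nat \<Rightarrow> expr" where
  "init_expr (eb, ex, eh) k = (if k = 0 then Var 5 else if k = 1 then eb else if k = 2 then ex
    else if k = 3 then eh else Cst 0)"

definition cell_cmd :: "nat \<Rightarrow> expr \<times> expr \<times> expr \<Rightarrow> expr \<Rightarrow> cmd" where
  "cell_cmd d kd eu = formulas_cmd d (init_expr kd) (Add (Cst 1) (Mul eu (Cst sg))) 0 fs"

definition row_cmd :: "nat \<Rightarrow> cmd" where
  "row_cmd d = (let i = Var (d + 1); x = Mul (Var 5) (Bit False i); R = Var 3; m = Mul (Cst 2) (Var 0) in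
    SeqC (ForC (Add R (Cst 1)) (cell_cmd (d + 2) (Cst 0, Cst 0, Cst 0) i))
    (SeqC (ForC (Var 0) (SeqC
      (cell_cmd (d + 2) (Var 5, x, Mul (Var 5) (IsZero i)) (Add (Add R (Cst 1)) (Mul (Cst 2) i)))
      (cell_cmd (d + 2) (Var 5, x, Cst 0) (Add (Add (Add R (Cst 1)) (Cst 1)) (Mul (Cst 2) i)))))
    (SeqC (cell_cmd d (Var 5, Cst 0, Mul (Var 5) (IsZero (Var 0))) (Add (Add R (Cst 1)) m))
    (SeqC (cell_cmd d (Var 5, Var 5, Cst 0) (Add (Add R (Cst 2)) m))
    (SeqC (ForC (Var 1) (cell_cmd (d + 2) (Var 5, Add (Cst (3 + \<tau>)) i, Cst 0) (Add (Add (Add R (Cst 3)) m) i)))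
    (ForC (Add (Mul (Cst 2) (Var 2)) (Cst 2)) (cell_cmd (d + 2) (Cst 0, Cst 0, Cst 0)
      (Add (Add (Add (Add R (Cst 3)) m) (Var 1)) i))))))))"

definition bit_expr :: "expr \<Rightarrow> nat \<Rightarrow> expr" where
  "bit_expr eu j = Add (Add (Add (Var 5) (Cst 1)) (Mul eu (Cst sg))) (Cst (offset fs j))"

definition step_expr :: "nat \<Rightarrow> nat \<Rightarrow> expr" where
  "step_expr d k = (if k < 4 then Cst 0 else bit_expr (if (k - 4) div B < 3
      then Add (Add (Mul (Var (d + 1)) (Var 4)) (Var (d + 3))) (Cst ((k - 4) div B))
      else Add (Add (Mul (Var (d + 1)) (Var 4)) (Var 3)) (Cst 1)) ((k - 4) mod B))"

definition rows_cmd :: "nat \<Rightarrow> cmd" where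
  "rows_cmd d = ForC (Var 2) (ForC (Var 4) (formulas_cmd (d + 4) (step_expr d)
    (Add (Cst 1) (Mul (Add (Add (Cst 1) (Mul (Add (Var (d + 1)) (Cst 1)) (Var 4))) (Var (d + 3))) (Cst sg))) 0 fs))"

definition cmp_expr :: "nat \<Rightarrow> nat \<Rightarrow> expr" where
  "cmp_expr d k = (if k = 0 then Add (Cst (2 + \<tau>)) (Var (d + 1))
    else if k = 1 then Mul (Var 5) (Bit True (Var (d + 1)))
    else Add (Add (Var 5) (Var 6)) (Mul (Var (d + 1)) (Cst sc)))"

definition cmp_cmd :: "nat \<Rightarrow> cmd" where
  "cmp_cmd d = ForC (Add (Var 1) (Cst 2))
    (formula_cmd (d + 2) (cmp_expr d) (Add (Add (Var 6) (Cst 1)) (Mul (Var (d + 1)) (Cst sc))) 0 fc)"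

definition fin_base_expr :: expr where
  "fin_base_expr = Add (Add (Var 6) (Cst 1)) (Mul (Add (Var 1) (Cst 2)) (Cst sc))"

definition fin_expr :: "nat \<Rightarrow> expr" where
  "fin_expr k = (if k = 0 then Cst 1 else if k = 1 then Add (Cst (2 + \<tau>)) (Add (Var 1) (Cst 1))
    else if k = 2 then Add (Add (Var 5) (Var 6)) (Mul (Add (Var 1) (Cst 2)) (Cst sc))
    else if k < 3 + \<tau> then Cst (2 + (k - 3))
    else bit_expr (Add (Add (Cst 1) (Mul (Var 2) (Var 4))) (Var 3)) (k - (3 + \<tau>)))"

definition circuit_cmd :: "nat \<Rightarrow> cmd" where
  "circuit_cmd d = SeqC (gate_cmd d (Cst 0) (Cst 0) (Cst 0)) (SeqC (row_cmd d) (SeqC (rows_cmd d)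
    (SeqC (gate_cmd d (Var 6) (Cst 0) (Cst 0)) (SeqC (cmp_cmd d) (formula_cmd d fin_expr fin_base_expr 0 ff)))))"

definition pins_expr :: expr where
  "pins_expr = Mul (Cst gCp) (Mul (Var 10) (Add (Var 7) (Cst 1)))"

definition gates_end_expr :: expr where
  "gates_end_expr = Add (Var 9) (Mul (Var 7) (Var 11))"

definition pins_end_expr :: expr where
  "pins_end_expr = Add gates_end_expr (Mul pins_expr (Cst (gsize gP)))"

definition graph_cmd :: "nat \<Rightarrow> cmd" where
  "graph_cmd d = SeqC (Emit (Add pins_end_expr (Mul (Var 10) (Cst (gsize gM))))) (SeqC (circuit_cmd d)
    (SeqC (ForC pins_expr (emit_gadget gP (Cst 0) (Cst 0) (Add gates_end_expr (Mul (Var (d + 1)) (Cst (gsize gP)))) 0))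
    (SeqC (ForC (Var 10) (emit_gadget gM (Add (Var 5) (Add fin_base_expr (Cst (sf - 1)))) (Cst 0)
      (Add pins_end_expr (Mul (Var (d + 1)) (Cst (gsize gM)))) 0))
    (emit_gadget Edge (Cst 1) (Cst 0) (Add pins_end_expr (Mul (Var 10) (Cst (gsize gM)))) 0))))"

context
  fixes n l T :: nat and c0 c2 :: "int \<Rightarrow> nat"
begin

abbreviation "ev' d e env x \<equiv> evals d e env c0 c2 x"
abbreviation "em' d c env w \<equiv> emits d c env c0 c2 w"
abbreviation "gls env \<equiv> globals n l T env"
abbreviation "code \<equiv> gates_code n l T"
abbreviation "rad \<equiv> radius n l T"
abbreviation "wid \<equiv> width n l T"

definition cell_code :: "nat \<times> nat \<times> nat \<Rightarrow> nat \<Rightarrow> bool list" where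
  "cell_code kd u = code (1 + u * sg) (mgates (init_inp l kd) (in_wires l + (1 + u * sg)) fs)"

lemma globals_upd2: "gls env \<Longrightarrow> 12 \<le> d \<Longrightarrow> gls (env(d := r, d + 1 := i))"
  by (intro globals_upd) auto

lemma emits_cell_cmd:
  assumes d: "12 \<le> d" and g: "gls env"
    and e: "ev' d eb env b" "ev' d ex env x" "ev' d eh env h" "ev' d eu env u"
  shows "em' d (cell_cmd d (eb, ex, eh) eu) env (cell_code (b, x, h) u)"
proof -
  have "em' d (cell_cmd d (eb, ex, eh) eu) env (code ((1 + u * sg) + 0)
      (mgates (init_inp l (b, x, h)) (in_wires l + ((1 + u * sg) + 0)) fs))"
    unfolding cell_cmd_def
  proof (rule emits_formulas_cmd[OF d g])
    show "ev' d (Add (Cst 1) (Mul eu (Cst sg))) env (1 + u * sg)"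
      using e(4) by (simp add: evals_def)
    show "ev' d (init_expr (eb, ex, eh) j) env (init_inp l (b, x, h) j)" for j
      using e(1-3) d g by (simp add: evals_def init_inp_def globals_def)
  qed
  then show ?thesis by (simp add: cell_code_def)
qed

lemma cell_code_kind:
  "code 1 (concat (map (init_block n l T xb) [0..<N])) = concat (map (\<lambda>u. cell_code (kind n l T xb u) u) [0..<N])"
  using gates_code_concat[of N "init_block n l T xb" sg n l T 1] by (simp add: cell_code_def init_block_def)

lemma emits_row_cmd:
  assumes d: "12 \<le> d" and g: "gls env"
  shows "em' d (row_cmd d) env (code 1 (concat (map (init_block n l T (xbit c0)) [0..<Suc wid])))"
proof -
  let ?w = "\<lambda>u. cell_code (kind n l T (xbit c0) u) u"
  let ?one = "in_wires l"
  let ?a = "rad + 1 + 2 * n"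
  have W: "[0..<Suc wid] = [0..<rad + 1] @ [rad + 1..<rad + 1 + 2 * n] @ [?a] @ [?a + 1] @
      [?a + 2..<?a + 2 + l] @ [?a + 2 + l..<?a + 2 + l + (2 * T + 2)]"
  proof -
    have "Suc wid = ?a + 2 + l + (2 * T + 2)" by (simp add: width_def radius_def)
    then have "[0..<Suc wid] = [0..<?a + 2 + l] @ [?a + 2 + l..<?a + 2 + l + (2 * T + 2)]"
      using upt_add_eq_append[of 0 "?a + 2 + l" "2 * T + 2"] by simp
    also have "[0..<?a + 2 + l] = [0..<?a + 2] @ [?a + 2..<?a + 2 + l]"
      by (rule upt_add_eq_append) simp
    also have "[0..<?a + 2] = [0..<?a] @ [?a, ?a + 1]" by simp
    also have "[0..<?a] = [0..<rad + 1] @ [rad + 1..<rad + 1 + 2 * n]"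
      by (rule upt_add_eq_append) simp
    finally show ?thesis by (simp only: append_assoc append_Cons append_Nil)
  qed
  let ?w1 = "concat (map (\<lambda>u. cell_code (0, 0, 0) u) [0..<rad + 1])"
  let ?w2 = "concat (map (\<lambda>i. cell_code (?one, ?one * of_bool (xbit c0 i), ?one * of_bool (i = 0)) (rad + 1 + 2 * i) @
      cell_code (?one, ?one * of_bool (xbit c0 i), 0) (rad + 1 + 1 + 2 * i)) [0..<n])"
  let ?w3 = "cell_code (?one, 0, ?one * of_bool (n = 0)) ?a" and ?w4 = "cell_code (?one, ?one, 0) (rad + 2 + 2 * n)"
  let ?w5 = "concat (map (\<lambda>i. cell_code (?one, 3 + \<tau> + i, 0) (rad + 3 + 2 * n + i)) [0..<l])"
  let ?w6 = "concat (map (\<lambda>i. cell_code (0, 0, 0) (rad + 3 + 2 * n + l + i)) [0..<2 * T + 2])"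
  have k1: "kind n l T (xbit c0) u = (0, 0, 0)" if "u < rad + 1" for u
    using that by (simp add: kind_def Let_def)
  have k2: "kind n l T (xbit c0) (rad + 1 + 2 * i) = (?one, ?one * of_bool (xbit c0 i), ?one * of_bool (i = 0))"
    "kind n l T (xbit c0) (rad + 1 + 1 + 2 * i) = (?one, ?one * of_bool (xbit c0 i), 0)" if "i < n" for i
    using that by (simp_all add: kind_def Let_def)
  have k3: "kind n l T (xbit c0) ?a = (?one, 0, ?one * of_bool (n = 0))"
    "kind n l T (xbit c0) (?a + 1) = (?one, ?one, 0)"
    by (simp_all add: kind_def Let_def)
  have k5: "kind n l T (xbit c0) (?a + 2 + i) = (?one, 3 + \<tau> + i, 0)" if "i < l" for i
    using that by (simp add: kind_def Let_def)
  have k6: "kind n l T (xbit c0) (?a + 2 + l + i) = (0, 0, 0)" for i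
    by (simp add: kind_def Let_def)
  have e1: "concat (map ?w [0..<rad + 1]) = ?w1"
    by (intro arg_cong[of _ _ concat] map_cong refl) (subst k1, auto)
  have e2: "concat (map ?w [rad + 1..<rad + 1 + 2 * n]) = ?w2"
    unfolding concat_map_upt_pairs
    by (intro arg_cong[of _ _ concat] map_cong refl) (simp only: k2 set_upt atLeastLessThan_iff)
  have e3: "?w ?a = ?w3" "?w (?a + 1) = ?w4"
    unfolding k3 by (simp_all add: add.commute add.left_commute)
  have e5: "concat (map ?w [?a + 2..<?a + 2 + l]) = ?w5"
    unfolding concat_map_upt_shift
    by (intro arg_cong[of _ _ concat] map_cong refl)
      (simp only: k5 set_upt atLeastLessThan_iff, simp add: numeral_3_eq_3 add.commute add.left_commute)
  have e6: "concat (map ?w [?a + 2 + l..<?a + 2 + l + (2 * T + 2)]) = ?w6"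
    unfolding concat_map_upt_shift k6
    by (intro arg_cong[of _ _ concat] map_cong refl) (simp add: numeral_3_eq_3 add.commute add.left_commute)
  have eq: "code 1 (concat (map (init_block n l T (xbit c0)) [0..<Suc wid])) = ?w1 @ ?w2 @ ?w3 @ ?w4 @ ?w5 @ ?w6"
    unfolding cell_code_kind unfolding W map_append concat_append e1 e2 e5 e6
    by (simp only: list.map concat.simps append_Nil2 e3)
  have env: "env 0 = n" "env (Suc 0) = l" "env 2 = T" "env 3 = rad" "env 5 = ?one"
    using g by (simp_all add: globals_def)
  have g2: "gls (env(d := r, d + 1 := i))" for r i using globals_upd2[OF g d] .
  have d2: "12 \<le> d + 2" using d by simp
  show ?thesis
    unfolding eq row_cmd_def Let_def
    apply (intro emits_Seq emits_For emits_cell_cmd[OF d2 g2] emits_cell_cmd[OF d g])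
    using d by (simp_all add: evals_def env xbit_def)
qed

lemma emits_rows_cmd:
  assumes d: "12 \<le> d" and g: "gls env"
  shows "em' d (rows_cmd d) env (code (1 + Suc wid * sg)
    (concat (map (\<lambda>t. concat (map (step_block n l T t) [0..<wid])) [0..<T])))"
proof -
  let ?b = "\<lambda>t i. 1 + (1 + (t + 1) * wid + i) * sg"
  have env: "env 2 = T" "env 3 = rad" "env 4 = wid" "env 5 = in_wires l"
    using g by (simp_all add: globals_def)
  have "code (1 + Suc wid * sg) (concat (map (\<lambda>t. concat (map (step_block n l T t) [0..<wid])) [0..<T])) =
      concat (map (\<lambda>t. code (1 + Suc wid * sg + t * (wid * sg)) (concat (map (step_block n l T t) [0..<wid]))) [0..<T])"
    by (rule gates_code_concat) simp
  also have "\<dots> = concat (map (\<lambda>t. concat (map (\<lambda>i. code (?b t i) (step_block n l T t i)) [0..<wid])) [0..<T])"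
  proof (intro arg_cong[of _ _ concat] map_cong refl)
    fix t
    have "code (1 + Suc wid * sg + t * (wid * sg)) (concat (map (step_block n l T t) [0..<wid])) =
      concat (map (\<lambda>i. code (1 + Suc wid * sg + t * (wid * sg) + i * sg) (step_block n l T t i)) [0..<wid])"
      by (rule gates_code_concat) simp
    also have "(\<lambda>i. 1 + Suc wid * sg + t * (wid * sg) + i * sg) = ?b t"
      by (simp add: fun_eq_iff algebra_simps)
    then have "concat (map (\<lambda>i. code (1 + Suc wid * sg + t * (wid * sg) + i * sg) (step_block n l T t i)) [0..<wid]) =
        concat (map (\<lambda>i. code (?b t i) (step_block n l T t i)) [0..<wid])"
      by metis
    finally show "code (1 + Suc wid * sg + t * (wid * sg)) (concat (map (step_block n l T t) [0..<wid])) =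
        concat (map (\<lambda>i. code (?b t i) (step_block n l T t i)) [0..<wid])" .
  qed
  finally have eq: "code (1 + Suc wid * sg) (concat (map (\<lambda>t. concat (map (step_block n l T t) [0..<wid])) [0..<T])) =
      concat (map (\<lambda>t. concat (map (\<lambda>i. code (?b t i) (step_block n l T t i)) [0..<wid])) [0..<T])" .
  show ?thesis
    unfolding eq rows_cmd_def
  proof (rule emits_For)
    show "ev' d (Var 2) env T" using d by (simp add: evals_def env)
    fix r t
    show "em' (d + 2) (ForC (Var 4) (formulas_cmd (d + 4) (step_expr d)
        (Add (Cst 1) (Mul (Add (Add (Cst 1) (Mul (Add (Var (d + 1)) (Cst 1)) (Var 4))) (Var (d + 3))) (Cst sg))) 0 fs))
      (env(d := r, d + 1 := t)) (concat (map (\<lambda>i. code (?b t i) (step_block n l T t i)) [0..<wid]))"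
    proof (rule emits_For)
      show "ev' (d + 2) (Var 4) (env(d := r, d + 1 := t)) wid" using d by (simp add: evals_def env)
      fix r' i
      have d4: "d + 2 + 2 = d + 4" by simp
      define F where "F = env(d := r, d + 1 := t, d + 2 := r', d + 2 + 1 := i)"
      have F: "gls F" unfolding F_def using d g by (intro globals_upd) auto
      then have Fe: "F 3 = rad" "F 4 = wid" "F 5 = in_wires l" by (simp_all add: globals_def)
      have Fd: "F (Suc d) = t" "F (d + 3) = i" by (simp_all add: F_def)
      have "em' (d + 4) (formulas_cmd (d + 4) (step_expr d)
          (Add (Cst 1) (Mul (Add (Add (Cst 1) (Mul (Add (Var (d + 1)) (Cst 1)) (Var 4))) (Var (d + 3))) (Cst sg))) 0 fs) F
        (code (?b t i + 0) (mgates (step_inp n l T t i) (in_wires l + (?b t i + 0)) fs))"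
      proof (rule emits_formulas_cmd[OF _ F])
        show "12 \<le> d + 4" using d by simp
        show "ev' (d + 4) (Add (Cst 1) (Mul (Add (Add (Cst 1) (Mul (Add (Var (d + 1)) (Cst 1)) (Var 4))) (Var (d + 3))) (Cst sg))) F (?b t i)"
          using d by (simp add: evals_def Fe Fd)
        show "ev' (d + 4) (step_expr d k) F (step_inp n l T t i k)" for k
          using d by (simp add: evals_def step_expr_def step_inp_def bit_expr_def cell_bit_def neighbour_def Fe Fd)
      qed
      then show "em' (d + 2 + 2) (formulas_cmd (d + 4) (step_expr d)
          (Add (Cst 1) (Mul (Add (Add (Cst 1) (Mul (Add (Var (d + 1)) (Cst 1)) (Var 4))) (Var (d + 3))) (Cst sg))) 0 fs)
        (env(d := r, d + 1 := t, d + 2 := r', d + 2 + 1 := i)) (code (?b t i) (step_block n l T t i))"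
        unfolding F_def step_block_def d4 add_0_right .
    qed
  qed
qed

lemma emits_cmp_cmd:
  assumes d: "12 \<le> d" and g: "gls env"
  shows "em' d (cmp_cmd d) env (code (cmp_base n l T + 1) (concat (map (cmp_block n l T (kbit c2)) [0..<l + 2])))"
proof -
  let ?b = "\<lambda>i. cmp_base n l T + 1 + i * sc"
  have eq: "code (cmp_base n l T + 1) (concat (map (cmp_block n l T (kbit c2)) [0..<l + 2])) =
      concat (map (\<lambda>i. code (?b i) (cmp_block n l T (kbit c2) i)) [0..<l + 2])"
    by (rule gates_code_concat) simp
  show ?thesis
    unfolding eq cmp_cmd_def
  proof (rule emits_For)
    show "ev' d (Add (Var 1) (Cst 2)) env (l + 2)" using d g by (simp add: evals_def globals_def)
    fix r i
    define F where "F = env(d := r, d + 1 := i)"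
    have F: "gls F" unfolding F_def using d g by (intro globals_upd) auto
    then have Fe: "F 6 = cmp_base n l T" "F 5 = in_wires l" by (simp_all add: globals_def)
    have Fd: "F (Suc d) = i" by (simp add: F_def)
    have "em' (d + 2) (formula_cmd (d + 2) (cmp_expr d) (Add (Add (Var 6) (Cst 1)) (Mul (Var (d + 1)) (Cst sc))) 0 fc) F
        (code (?b i + 0) (fgates (cmp_inp n l T (kbit c2) i) (in_wires l + (?b i + 0)) fc))"
    proof (rule emits_formula_cmd[OF _ F])
      show "12 \<le> d + 2" using d by simp
      show "ev' (d + 2) (Add (Add (Var 6) (Cst 1)) (Mul (Var (d + 1)) (Cst sc))) F (?b i)"
        using d by (simp add: evals_def Fe Fd)
      show "ev' (d + 2) (cmp_expr d k) F (cmp_inp n l T (kbit c2) i k)" for k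
        using d by (simp add: evals_def cmp_expr_def cmp_inp_def kbit_def Fe Fd)
    qed
    then show "em' (d + 2) (formula_cmd (d + 2) (cmp_expr d) (Add (Add (Var 6) (Cst 1)) (Mul (Var (d + 1)) (Cst sc))) 0 fc)
        (env(d := r, d + 1 := i)) (code (?b i) (cmp_block n l T (kbit c2) i))"
      unfolding F_def cmp_block_def by simp
  qed
qed

lemma emits_circuit_cmd:
  assumes d: "12 \<le> d" and g: "gls env"
  shows "em' d (circuit_cmd d) env (code 0 (CC n l T c0 c2))"
proof -
  have env: "env (Suc 0) = l" "env 2 = T" "env 3 = rad" "env 4 = wid" "env 5 = in_wires l" "env 6 = cmp_base n l T"
    using g by (simp_all add: globals_def)
  have "em' d (formula_cmd d fin_expr fin_base_expr 0 ff) env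
      (code (fin_base n l T + 0) (fgates (fin_inp n l T) (in_wires l + (fin_base n l T + 0)) ff))"
  proof (rule emits_formula_cmd[OF d g])
    show "ev' d fin_base_expr env (fin_base n l T)"
      using d by (simp add: evals_def fin_base_expr_def fin_base_def env)
    show "ev' d (fin_expr k) env (fin_inp n l T k)" for k
      using d by (simp add: evals_def fin_expr_def fin_inp_def bit_expr_def cell_bit_def env)
  qed
  then have fin: "em' d (formula_cmd d fin_expr fin_base_expr 0 ff) env (code (fin_base n l T) (fin_block n l T))"
    by (simp add: fin_block_def)
  have 1: "em' d (gate_cmd d (Cst 0) (Cst 0) (Cst 0)) env (gate_code n l T 0 (0, 0))"
    by (intro emits_gate_cmd[OF d g]) (simp_all add: evals_def)
  have 2: "em' d (gate_cmd d (Var 6) (Cst 0) (Cst 0)) env (gate_code n l T (cmp_base n l T) (0, 0))"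
    using d by (intro emits_gate_cmd[OF d g]) (simp_all add: evals_def env)
  have b1: "1 + Suc wid * sg + T * (wid * sg) = cmp_base n l T"
    by (simp add: cmp_base_def algebra_simps)
  have b2: "cmp_base n l T + 1 + (l + 2) * sc = fin_base n l T"
    by (simp add: fin_base_def)
  have "code 0 (CC n l T c0 c2) = gate_code n l T 0 (0, 0) @
    code 1 (concat (map (init_block n l T (xbit c0)) [0..<Suc wid])) @
    code (1 + Suc wid * sg) (concat (map (\<lambda>t. concat (map (step_block n l T t) [0..<wid])) [0..<T])) @
    gate_code n l T (1 + Suc wid * sg + T * (wid * sg)) (0, 0) @
    code (1 + Suc wid * sg + T * (wid * sg) + 1) (concat (map (cmp_block n l T (kbit c2)) [0..<l + 2])) @
    code (1 + Suc wid * sg + T * (wid * sg) + 1 + (l + 2) * sc) (fin_block n l T)"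
    unfolding CC_def circuit_def gates_code_append length_rows gates_code.simps
    by (simp del: upt_Suc mult_Suc add_2_eq_Suc')
  also have "\<dots> = gate_code n l T 0 (0, 0) @
    code 1 (concat (map (init_block n l T (xbit c0)) [0..<Suc wid])) @
    code (1 + Suc wid * sg) (concat (map (\<lambda>t. concat (map (step_block n l T t) [0..<wid])) [0..<T])) @
    gate_code n l T (cmp_base n l T) (0, 0) @
    code (cmp_base n l T + 1) (concat (map (cmp_block n l T (kbit c2)) [0..<l + 2])) @
    code (fin_base n l T) (fin_block n l T)"
    unfolding b1 b2 ..
  finally show ?thesis
    unfolding circuit_cmd_def
    by (simp only:) (intro emits_Seq 1 2 fin emits_row_cmd[OF d g] emits_rows_cmd[OF d g] emits_cmp_cmd[OF d g])
qed

text \<open>Blocks of inner vertices are placed at addresses affine in the loop indices, so each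
  vertex number is the value of an expression and the graph can be written out without storing the
  circuit.\<close>

lemma emits_graph_cmd:
  assumes d: "12 \<le> d" and g: "gls env"
  shows "em' d (graph_cmd d) env (graph_code (graph_size gM gP gq gK gCp gCm (in_wires l) (CC n l T c0 c2))
    (concat (map place_edges (circuit_placements gM gP gq gK gCp gCm (in_wires l) (CC n l T c0 c2)
      (in_wires l + num_gates n l T - 1)))))"
proof -
  let ?C = "CC n l T c0 c2"
  let ?NG = "NG n l T" and ?V = "VV n l T" and ?m = "mm n l T"
  let ?pc = "gCp * (?m * Suc ?NG)"
  let ?b1 = "?V + ?NG * (?m * span)"
  let ?b2 = "?b1 + ?pc * gsize gP"
  let ?b3 = "?b2 + ?m * gsize gM"
  let ?out = "in_wires l + num_gates n l T - 1"
  have env: "env (Suc 0) = l" "env 5 = in_wires l" "env 6 = cmp_base n l T" "env 7 = ?NG" "env 9 = ?V" "env 10 = ?m" "env 11 = ?m * span"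
    using g by (simp_all add: globals_def)
  have env2: "env2 (Suc 0) = l \<and> env2 5 = in_wires l \<and> env2 6 = cmp_base n l T \<and> env2 7 = ?NG \<and> env2 9 = ?V \<and> env2 10 = ?m \<and> env2 11 = ?m * span
     \<and> env2 (Suc d) = j"
    if "env2 = env(d := r, d + 1 := j)" for env2 r j
    using d by (simp add: that env)
  have out: "?out = in_wires l + (fin_base n l T + (sf - 1))"
    using sf_pos by (simp add: num_gates_def)
  have code: "code 0 ?C = edge_code (concat (map place_edges (concat (map
      (\<lambda>i. gate_placements gM gq gK ?m (in_wires l) (NW n l T) (?C ! i) i (?V + i * (?m * span))) [0..<?NG]))))"
    unfolding gates_code_nth concat_map_concat_map edge_code_concat sizes
    by (simp add: gate_code_def edge_code_concat)
  have code_map: "edge_code (concat (map place_edges (map f xs))) = concat (map (\<lambda>j. edge_code (place_edges (f j))) xs)" for f :: "nat \<Rightarrow> placement" and xs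
    by (induction xs) (simp_all add: edge_code_def)
  have eq: "graph_code (graph_size gM gP gq gK gCp gCm (in_wires l) ?C)
      (concat (map place_edges (circuit_placements gM gP gq gK gCp gCm (in_wires l) ?C ?out))) =
    unary ?b3 @ code 0 ?C @ concat (map (\<lambda>j. edge_code (place_edges (gP, 0, 0, (?b1 + j * gsize gP) + 0))) [0..<?pc]) @
    concat (map (\<lambda>j. edge_code (place_edges (gM, ?out, 0, (?b2 + j * gsize gM) + 0))) [0..<?m]) @
    edge_code (place_edges (Edge, 1, 0, ?b3 + 0))"
    unfolding graph_code_def edge_code_def[symmetric] circuit_placements_def graph_size_def Let_def sizes code
      map_append concat_append edge_code_append code_map span_def
    by simp
  show ?thesis
    unfolding eq graph_cmd_def
  proof (intro emits_Seq emits_Emit emits_For emits_emit_gadget emits_circuit_cmd[OF d g])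
    fix r j
    obtain F where F: "env(d := r, d + 1 := j) = F" by blast
    note Fe = env2[OF F[symmetric]]
    show "ev' (d + 2) (Cst 0) (env(d := r, d + 1 := j)) 0" "ev' (d + 2) (Cst 0) (env(d := r, d + 1 := j)) 0"
      by (simp_all add: evals_def)
    show "ev' (d + 2) (Add gates_end_expr (Mul (Var (d + 1)) (Cst (gsize gP)))) (env(d := r, d + 1 := j)) (?b1 + j * gsize gP)"
      unfolding F using d by (simp add: evals_def gates_end_expr_def Fe)
    show "ev' (d + 2) (Add (Var 5) (Add fin_base_expr (Cst (sf - 1)))) (env(d := r, d + 1 := j)) ?out"
      unfolding F out using d by (simp add: evals_def fin_base_expr_def fin_base_def Fe)
    show "ev' (d + 2) (Add pins_end_expr (Mul (Var (d + 1)) (Cst (gsize gM)))) (env(d := r, d + 1 := j)) (?b2 + j * gsize gM)"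
      unfolding F using d by (simp add: evals_def pins_end_expr_def gates_end_expr_def pins_expr_def Fe)
  qed (use d in \<open>simp_all add: evals_def pins_end_expr_def gates_end_expr_def pins_expr_def env\<close>)
qed

end

end

section \<open>Counting by binary search\<close>

lemma binary_bits: "binary (map (\<lambda>i. odd (m div 2 ^ i)) [0..<L]) = m mod 2 ^ L"
proof (induction L arbitrary: m)
  case (Suc L)
  have "[0..<Suc L] = 0 # map Suc [0..<L]"
    by (simp add: upt_conv_Cons map_Suc_upt del: upt_Suc)
  then have "binary (map (\<lambda>i. odd (m div 2 ^ i)) [0..<Suc L]) =
      of_bool (odd m) + 2 * binary (map (\<lambda>i. odd (m div 2 div 2 ^ i)) [0..<L])"
    by (simp add: comp_def div_mult2_eq del: upt_Suc)
  also have "\<dots> = m mod 2 ^ Suc L"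
    unfolding Suc.IH by (simp add: mod_mult2_eq mod2_eq_if)
  finally show ?case .
qed simp

lemma binary_replicate_True: "Suc (binary (replicate r True)) = 2 ^ r"
  by (induction r) auto

lemma nth_nat_code: "(i < length (nat_code N) \<longleftrightarrow> 0 < N div 2 ^ i) \<and>
    (i < length (nat_code N) \<longrightarrow> nat_code N ! i = odd (N div 2 ^ i))"
proof (induction i arbitrary: N)
  case 0
  then show ?case by (subst (1 2 3) nat_code.simps) auto
next
  case (Suc i)
  show ?case
  proof (cases "N = 0")
    case True
    then show ?thesis by (simp add: nat_code.simps)
  next
    case False
    then have "nat_code N = odd N # nat_code (N div 2)" by (simp add: nat_code.simps)
    then show ?thesis using Suc[of "N div 2"] by (simp add: div_mult2_eq)
  qed
qed

lemma word_tape_nat_code: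
  "word_tape (nat_code N) p = (if 0 \<le> p \<and> 0 < N div 2 ^ nat p then if odd (N div 2 ^ nat p) then 2 else 1 else 0)"
  using nth_nat_code[of "nat p" N] by (auto simp: word_tape_def zless_nat_conj nat_less_iff)

text \<open>A query at least as long as the preceding answer leaves nothing of that answer
  behind.\<close>

lemma over_tape_longer: "length v \<le> length w \<Longrightarrow> over_tape v w = word_tape w"
  by (auto simp: over_tape_def word_tape_def fun_eq_iff)

lemma sem_For:
  assumes "val e env st = m" "I 0 st"
    and "\<And>i st. i < m \<Longrightarrow> I i st \<Longrightarrow> I (Suc i) (sem Q (d + 2) c (env(d := m - Suc i, Suc d := i)) st)"
  shows "I m (sem Q d (ForC e c) env st)"
proof -
  have "I k (fold (\<lambda>i. sem Q (d + 2) c (env(d := m - Suc i, Suc d := i))) [0..<k] st)" if "k \<le> m" for k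
    using that
  proof (induction k)
    case (Suc k)
    then show ?case using assms(3)[of k] by (simp del: fun_upd_apply)
  qed (use assms in simp)
  from this[of m] show ?thesis using assms(1) by (simp add: Let_def del: fun_upd_apply)
qed

text \<open>Horner's scheme.\<close>

lemma ex_poly_expr:
  assumes "wf_expr d e"
  shows "\<exists>f. wf_expr d f \<and> (\<forall>env st. val f env st = poly p (val e env st))"
proof (induction p)
  case 0
  then show ?case by (intro exI[of _ "Cst 0"]) simp
next
  case (pCons a p)
  then obtain f where "wf_expr d f" "\<forall>env st. val f env st = poly p (val e env st)" by blast
  then show ?case using assms by (intro exI[of _ "Add (Cst a) (Mul e f)"]) simp
qed

text \<open>Tape 2 after the bits \<open>r, \<dots>, l\<close> of \<open>N\<close> are known: bit \<open>b\<close> is in cell \<open>b + 1\<close>, and all unknown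
  bits are 1. Cell 0 stays blank, so that the tape holds an even number to be compared with
  \<open>2 * N\<close>.\<close>

definition known :: "nat \<Rightarrow> nat \<Rightarrow> nat \<Rightarrow> int \<Rightarrow> nat" where
  "known N l r p = (if 1 \<le> p \<and> p \<le> int l + 1 then if r \<le> nat p - 1 \<and> even (N div 2 ^ (nat p - 1)) then 1 else 2
    else 0)"

text \<open>Take the known bits of \<open>N\<close> above \<rho>, a 0 at \<rho> and 1 everywhere
  below. This is the largest number with these leading bits whose bit \<rho> is 0, so it is less
  than \<open>N\<close> exactly if bit \<rho> of \<open>N\<close> is 1. Both sides are doubled by
  the blank cell 0.\<close>

lemma known_query:
  assumes "\<rho> \<le> l" "N < 2 ^ Suc l"
  defines "c \<equiv> (known N l (Suc \<rho>))(int \<rho> + 1 := 1)"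
  shows "c 0 \<noteq> 2" "binary (map (\<lambda>i. c (int i) = 2) [0..<l + 2]) < 2 * N \<longleftrightarrow> odd (N div 2 ^ \<rho>)"
proof -
  let ?f = "\<lambda>i. c (int i) = 2"
  show "c 0 \<noteq> 2" by (simp add: c_def known_def)
  have e1: "[0..<l + 2] = [0] @ [1..<1 + \<rho>] @ [1 + \<rho>] @ [2 + \<rho>..<2 + \<rho> + (l - \<rho>)]"
  proof -
    have "[0..<l + 2] = [0..<2 + \<rho>] @ [2 + \<rho>..<2 + \<rho> + (l - \<rho>)]"
      using upt_add_eq_append[of 0 "2 + \<rho>" "l - \<rho>"] assms(1) by simp
    also have "[0..<2 + \<rho>] = [0] @ [1..<1 + \<rho>] @ [1 + \<rho>]"
      by (simp add: upt_conv_Cons)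
    finally show ?thesis by (simp only: append_assoc)
  qed
  have e2: "?f 0 = False" "?f (1 + \<rho>) = False"
    by (simp_all add: c_def known_def)
  have "?f j" if "1 \<le> j" "j < 1 + \<rho>" for j
    using that assms(1) by (simp add: c_def known_def) linarith
  then have e3: "map ?f [1..<1 + \<rho>] = replicate \<rho> True"
    by (intro replicate_eqI) auto
  have e4: "map ?f [2 + \<rho>..<2 + \<rho> + (l - \<rho>)] = map (\<lambda>i. odd (N div 2 ^ Suc \<rho> div 2 ^ i)) [0..<l - \<rho>]"
  proof (intro nth_equalityI)
    fix i assume "i < length (map ?f [2 + \<rho>..<2 + \<rho> + (l - \<rho>)])"
    then have "i < l - \<rho>" by (simp only: length_map length_upt)
    moreover have "N div 2 ^ Suc \<rho> div 2 ^ i = N div 2 ^ (Suc \<rho> + i)"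
      by (simp add: div_mult2_eq power_add)
    ultimately show "map ?f [2 + \<rho>..<2 + \<rho> + (l - \<rho>)] ! i = map (\<lambda>i. odd (N div 2 ^ Suc \<rho> div 2 ^ i)) [0..<l - \<rho>] ! i"
      by (simp add: c_def known_def nat_add_distrib del: upt_Suc)
  qed (simp del: upt_Suc)
  have "binary (map ?f [0..<l + 2]) =
      2 * (binary (replicate \<rho> True) + 2 ^ \<rho> * (2 * (N div 2 ^ Suc \<rho> mod 2 ^ (l - \<rho>))))"
    unfolding e1 map_append e3 e4 binary_append binary_bits list.map e2 by simp
  moreover have "N div 2 ^ Suc \<rho> < 2 ^ (l - \<rho>)"
  proof (rule less_mult_imp_div_less)
    have "2 ^ (l - \<rho>) * 2 ^ Suc \<rho> = (2::nat) ^ Suc l"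
      using assms(1) by (subst power_add[symmetric]) simp
    then show "N < 2 ^ (l - \<rho>) * 2 ^ Suc \<rho>" using assms(2) by (simp only:)
  qed
  ultimately have "binary (map ?f [0..<l + 2]) =
      2 * (binary (replicate \<rho> True) + 2 ^ \<rho> * (2 * (N div 2 ^ Suc \<rho>)))"
    by simp
  moreover have "binary (replicate \<rho> True) + 2 ^ \<rho> * (2 * (N div 2 ^ Suc \<rho>)) < N \<longleftrightarrow> odd (N div 2 ^ \<rho>)"
  proof -
    have "2 ^ \<rho> * Suc q = Suc (binary (replicate \<rho> True) + 2 ^ \<rho> * q)" for q
      using binary_replicate_True[of \<rho>] by (metis add_Suc mult_Suc_right)
    then have "binary (replicate \<rho> True) + 2 ^ \<rho> * (2 * (N div 2 ^ Suc \<rho>)) < N \<longleftrightarrow>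
        2 ^ \<rho> * Suc (2 * (N div 2 ^ Suc \<rho>)) \<le> N"
      by (simp only: Suc_le_eq)
    also have "\<dots> \<longleftrightarrow> Suc (2 * (N div 2 ^ Suc \<rho>)) \<le> N div 2 ^ \<rho>"
      by (simp add: less_eq_div_iff_mult_less_eq mult.commute)
    also have "\<dots> \<longleftrightarrow> Suc (2 * (N div 2 ^ \<rho> div 2)) \<le> N div 2 ^ \<rho>"
    proof -
      have "N div 2 ^ Suc \<rho> = N div 2 ^ \<rho> div 2" by (simp add: mult.commute flip: div_mult2_eq)
      then show ?thesis by (simp only:)
    qed
    also have "Suc (2 * (m div 2)) \<le> m \<longleftrightarrow> odd m" for m :: nat
      by presburger
    finally show ?thesis .
  qed
  ultimately show "binary (map ?f [0..<l + 2]) < 2 * N \<longleftrightarrow> odd (N div 2 ^ \<rho>)" 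
    by (simp only: mult_less_cancel1) simp
qed

lemma known_update:
  "\<rho> \<le> l \<Longrightarrow> (known N l (Suc \<rho>))(int \<rho> + 1 := (if odd (N div 2 ^ \<rho>) then 2 else 1)) = known N l \<rho>"
proof
  fix p assume "\<rho> \<le> l"
  show "((known N l (Suc \<rho>))(int \<rho> + 1 := (if odd (N div 2 ^ \<rho>) then 2 else 1))) p = known N l \<rho> p"
  proof (cases "p = int \<rho> + 1")
    case True
    then show ?thesis using \<open>\<rho> \<le> l\<close> by (auto simp: known_def nat_add_distrib)
  next
    case False
    then have "1 \<le> p \<Longrightarrow> \<rho> \<le> nat p - 1 \<longleftrightarrow> Suc \<rho> \<le> nat p - 1" by linarith
    then show ?thesis using False by (auto simp: known_def)
  qed
qed

definition fill_cmd :: cmd where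
  "fill_cmd = ForC (Add (Var 1) (Cst 1)) (Write True (Add (Var 13) (Cst 1)) 2)"

definition erase_cmd :: cmd where
  "erase_cmd = ForC (Var 0) (Write False (Var 13) 0)"

text \<open>\<open>nat_code\<close> has no leading zeros. The bits are treated from the top, and
  cell 0 of tape 2 is set at the first 1; before that nothing is written. Variable 12, the number of
  remaining iterations, is the index of the bit.\<close>

definition output_step :: cmd where
  "output_step = SeqC (IfC (Bit True (Add (Var 12) (Cst 1))) (Write True (Cst 0) 2) Nop)
    (IfC (Bit True (Cst 0)) (IfC (Bit True (Add (Var 12) (Cst 1))) (Write False (Var 12) 2) (Write False (Var 12) 1))
      Nop)"

lemma sem_output_step:
  assumes "env 12 = r" "k (int r + 1) = 2 \<longleftrightarrow> b" "k' = (if b then k(0 := 2) else k)" "k' 0 = 2 \<longleftrightarrow> z" "b \<Longrightarrow> z"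
    "z \<Longrightarrow> c(int r := (if b then 2 else 1)) = c'" "\<not> z \<Longrightarrow> c = c'"
  shows "sem Q d output_step env (c, v, w, k) = (c', v, w, k')"
proof (cases b)
  case True
  then show ?thesis using assms by (simp add: output_step_def add.commute)
next
  case False
  then show ?thesis using assms by (cases z) (simp_all add: output_step_def add.commute)
qed

definition output_cmd :: cmd where
  "output_cmd = ForC (Add (Var 1) (Cst 1)) output_step"

lemma sem_fill_cmd:
  assumes "env 1 = l"
  shows "sem Q 12 fill_cmd env (c0, v, w, \<lambda>_. 0) = (c0, v, w, known N l (Suc l))"
proof -
  let ?c = "\<lambda>i p. if 1 \<le> p \<and> p \<le> int i then 2 else 0 :: nat"
  have "sem Q 12 fill_cmd env (c0, v, w, \<lambda>_. 0) = (c0, v, w, ?c (Suc l))"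
    unfolding fill_cmd_def
  proof (rule sem_For[where I = "\<lambda>i st. st = (c0, v, w, ?c i)"])
    fix i st assume "st = (c0, v, w, ?c i)"
    moreover have "(?c i)(int i + 1 := 2) = ?c (Suc i)" by auto
    ultimately show "sem Q (12 + 2) (Write True (Add (Var 13) (Cst 1)) 2) (env(12 := Suc l - Suc i, Suc 12 := i)) st =
        (c0, v, w, ?c (Suc i))"
      by (simp add: add.commute)
  qed (use assms in auto)
  moreover have "?c (Suc l) = known N l (Suc l)" by (rule ext) (auto simp: known_def)
  ultimately show ?thesis by simp
qed

lemma sem_erase_cmd:
  assumes "env 0 = length x"
  shows "sem Q 12 erase_cmd env (word_tape x, v, w, c2) = (\<lambda>_. 0, v, w, c2)"
proof -
  let ?c = "\<lambda>i p. if p < int i then 0 else word_tape x p"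
  have "sem Q 12 erase_cmd env (word_tape x, v, w, c2) = (?c (length x), v, w, c2)"
    unfolding erase_cmd_def
  proof (rule sem_For[where I = "\<lambda>i st. st = (?c i, v, w, c2)"])
    fix i st assume "st = (?c i, v, w, c2)"
    moreover have "(?c i)(int i := 0) = ?c (Suc i)" by auto
    ultimately show "sem Q (12 + 2) (Write False (Var 13) 0) (env(12 := length x - Suc i, Suc 12 := i)) st =
        (?c (Suc i), v, w, c2)"
      by simp
  qed (use assms in \<open>auto simp: word_tape_def fun_eq_iff\<close>)
  moreover have "?c (length x) = (\<lambda>_. 0)" by (auto simp: word_tape_def)
  ultimately show ?thesis by simp
qed

lemma sem_output_cmd:
  assumes "env 1 = l" and N: "N < 2 ^ Suc l"
  shows "fst (sem Q 12 output_cmd env (\<lambda>_. 0, v, w, known N l 0)) = word_tape (nat_code N)"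
proof -
  let ?c = "\<lambda>r p. if int r \<le> p then word_tape (nat_code N) p else 0"
  \<comment> \<open>Cell 0 tells whether a bit equal to 1 has been met at position \<open>r\<close>
    or above.\<close>
  let ?k = "\<lambda>r. (known N l 0)(0 := (if 0 < N div 2 ^ r then 2 else 0))"
  have zero: "N div 2 ^ r = 0" if "Suc l \<le> r" for r
    using N power_increasing[OF that, of "2::nat"] by (intro div_less) linarith
  have "sem Q 12 output_cmd env (\<lambda>_. 0, v, w, known N l 0) = (?c (Suc l - Suc l), v, w, ?k (Suc l - Suc l))"
    unfolding output_cmd_def
  proof (rule sem_For[where I = "\<lambda>i st. st = (?c (Suc l - i), v, w, ?k (Suc l - i))"])
    have "?c (Suc l) = (\<lambda>_. 0)"
    proof
      fix p
      show "?c (Suc l) p = 0" using zero[of "nat p"] by (simp add: word_tape_nat_code)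
    qed
    moreover have "?k (Suc l) = known N l 0"
      using zero[of "Suc l"] by (auto simp: known_def)
    ultimately show "(\<lambda>_. 0, v, w, known N l 0) = (?c (Suc l - 0), v, w, ?k (Suc l - 0))" by simp
    fix i st assume i: "i < Suc l" and st: "st = (?c (Suc l - i), v, w, ?k (Suc l - i))"
    define r where "r = l - i"
    have r: "Suc l - i = Suc r" "Suc l - Suc i = r" "r \<le> l" using i by (auto simp: r_def)
    have half: "N div 2 ^ Suc r = N div 2 ^ r div 2"
      by (simp add: mult.commute flip: div_mult2_eq)
    have "sem Q (12 + 2) output_step (env(12 := r, Suc 12 := i)) (?c (Suc r), v, w, ?k (Suc r)) = (?c r, v, w, ?k r)"
    proof (rule sem_output_step)
      show "?k (Suc r) (int r + 1) = 2 \<longleftrightarrow> odd (N div 2 ^ r)"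
        using r(3) by (auto simp: known_def nat_add_distrib)
      show "?k r = (if odd (N div 2 ^ r) then (?k (Suc r))(0 := 2) else ?k (Suc r))"
        unfolding half by (rule ext) (auto elim: oddE)
      show "?k r 0 = 2 \<longleftrightarrow> 0 < N div 2 ^ r" "odd (N div 2 ^ r) \<Longrightarrow> 0 < N div 2 ^ r"
        by (auto intro: Nat.gr0I)
      show "(?c (Suc r))(int r := (if odd (N div 2 ^ r) then 2 else 1)) = ?c r" if "0 < N div 2 ^ r"
        using that by (intro ext) (auto simp: word_tape_nat_code)
      have "word_tape (nat_code N) (int r) = 0" if "\<not> 0 < N div 2 ^ r"
        using that by (simp add: word_tape_nat_code)
      moreover have "int (Suc r) \<le> p \<longleftrightarrow> int r \<le> p \<and> p \<noteq> int r" for p by linarith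
      ultimately show "?c (Suc r) = ?c r" if "\<not> 0 < N div 2 ^ r"
        using that by (intro ext) auto
    qed simp
    then show "sem Q (12 + 2) output_step (env(12 := Suc l - Suc i, Suc 12 := i)) st =
        (?c (Suc l - Suc i), v, w, ?k (Suc l - Suc i))"
      unfolding st r .
  qed (use assms in auto)
  moreover have "?c 0 = word_tape (nat_code N)" by (auto simp: word_tape_def)
  ultimately show ?thesis by simp
qed

section \<open>The answer of the oracle and the complete reduction program\<close>

context generator
begin

definition query_word :: "nat \<Rightarrow> nat \<Rightarrow> nat \<Rightarrow> (int \<Rightarrow> nat) \<Rightarrow> (int \<Rightarrow> nat) \<Rightarrow> bool list" where
  "query_word n l T c0 c2 = graph_code (graph_size gM gP gq gK gCp gCm (in_wires l) (CC n l T c0 c2))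
    (concat (map place_edges (circuit_placements gM gP gq gK gCp gCm (in_wires l) (CC n l T c0 c2)
      (in_wires l + num_gates n l T - 1))))"

lemma circuit_cong:
  assumes "\<And>i. i < n \<Longrightarrow> xb i = xb' i"
  shows "circuit n l T xb kb = circuit n l T xb' kb"
proof -
  have "kind n l T xb u = kind n l T xb' u" for u
  proof (cases "u < radius n l T + 1 + 2 * n")
    case True
    then have "\<not> u < radius n l T + 1 \<Longrightarrow> xb ((u - (radius n l T + 1)) div 2) = xb' ((u - (radius n l T + 1)) div 2)"
      by (intro assms) linarith
    then show ?thesis by (simp add: kind_def Let_def del: add_Suc_right)
  qed (simp add: kind_def Let_def)
  then have "init_block n l T xb = init_block n l T xb'"
    by (simp add: init_block_def fun_eq_iff)
  then show ?thesis by (simp add: circuit_def)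
qed

text \<open>With \<beta> = -pn/qn and the counts of the circuit, the fractions cancel and
  \<open>D\<close> becomes the integer \<open>pn * (2 * N - K - 1)\<close>. As \<open>K\<close> is
  even, it is never 0, so the sign is determined and its code is a single bit.\<close>

lemma oracle_answer:
  fixes \<beta> \<gamma> :: rat
  assumes \<beta>: "\<beta> = - of_nat pn / of_nat qn" "0 < pn" "0 < qn"
    and graph: "\<forall>n0 C out. 2 \<le> n0 \<longrightarrow> out < wires n0 C \<longrightarrow>
      (\<forall>(x, y) \<in> set C. x < wires n0 C \<and> y < wires n0 C) \<longrightarrow>
      (let D = of_nat (card {v \<in> solutions n0 C out. v 1}) +
            \<beta> * of_nat (card {v \<in> solutions n0 C out. \<not> v 1});
          es = concat (map place_edges (circuit_placements gM gP gq gK gCp gCm n0 C out));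
          n = graph_size gM gP gq gK gCp gCm n0 C in
        1 \<le> \<bar>D\<bar> \<longrightarrow> encodes (graph_code n es) (coded_graph n es) \<and>
          sgn (partition_function \<beta> \<gamma> (coded_graph n es)) = sgn D)"
    and Q: "solves Q (sign_problem \<beta> \<gamma>)"
    and halt: "\<And>y. length y = l \<Longrightarrow> halts_with M ((step M ^^ T) (init M (pair_code x y))) [pair_code x y \<in> A]"
    and c2: "c2 0 \<noteq> 2"
  shows "Q (query_word (length x) l T (word_tape x) c2) =
    [binary (map (\<lambda>i. c2 (int i) = 2) [0..<l + 2]) < 2 * card {y. length y = l \<and> pair_code x y \<in> A}]"
proof -
  let ?n = "length x" and ?iw = "in_wires l"
  let ?K = "binary (map (\<lambda>i. c2 (int i) = 2) [0..<l + 2])" and ?N = "card {y. length y = l \<and> pair_code x y \<in> A}"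
  let ?C = "CC ?n l T (word_tape x) c2" and ?out = "?iw + num_gates ?n l T - 1"
  let ?es = "concat (map place_edges (circuit_placements gM gP gq gK gCp gCm ?iw ?C ?out))"
  let ?G = "coded_graph (graph_size gM gP gq gK gCp gCm ?iw ?C) ?es"
  define D where "D = of_nat (card {v \<in> solutions ?iw ?C ?out. v 1}) +
      \<beta> * of_nat (card {v \<in> solutions ?iw ?C ?out. \<not> v 1})"
  define z where "z = int pn * (2 * int ?N - int ?K - 1)"
  have C: "?C = circuit ?n l T ((!) x) (kbit c2)"
    unfolding CC_def by (rule circuit_cong) (simp add: xbit_def word_tape_def)
  have "[0..<l + 2] = 0 # [1..<l + 2]" by (simp add: upt_conv_Cons del: upt_Suc)
  then have "even ?K" using c2 by (simp del: upt_Suc)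
  have kb: "kbit c2 = (\<lambda>i. c2 (int i) = 2)" by (simp add: fun_eq_iff kbit_def)
  have card: "card {v \<in> solutions ?iw ?C ?out. v 1} = pn * (2 * ?N)"
      "card {v \<in> solutions ?iw ?C ?out. \<not> v 1} = qn * Suc ?K"
    unfolding C kb[symmetric] by (rule card_solutions, erule halt)+
  have "D = of_nat (pn * (2 * ?N)) + \<beta> * of_nat (qn * Suc ?K)"
    unfolding D_def card ..
  also have "\<dots> = of_nat (pn * (2 * ?N)) + (\<beta> * of_nat qn) * of_nat (Suc ?K)"
    by (simp only: of_nat_mult mult.assoc)
  also have "\<beta> * of_nat qn = - of_nat pn" using \<beta> by simp
  also have "of_nat (pn * (2 * ?N)) + - of_nat pn * of_nat (Suc ?K) = (of_int z :: rat)"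
    by (simp add: z_def algebra_simps del: upt_Suc add_2_eq_Suc')
  finally have D: "D = of_int z" .
  \<comment> \<open>\<open>2 * N - K\<close> is even, so the second factor of \<open>z\<close> is
    odd.\<close>
  have "z \<noteq> 0" using \<open>even ?K\<close> \<beta>(2) unfolding z_def by simp presburger
  then have "1 \<le> \<bar>D\<bar>" unfolding D by (simp flip: of_int_abs)
  moreover have "2 \<le> ?iw" by (simp add: in_wires_def)
  moreover have "?out < wires ?iw ?C"
    using sf_pos by (simp add: wires_def C length_circuit num_gates_def)
  moreover have "\<forall>(x, y) \<in> set ?C. x < wires ?iw ?C \<and> y < wires ?iw ?C"
  proof -
    have "fst (?C ! i) < wires ?iw ?C \<and> snd (?C ! i) < wires ?iw ?C" if "i < length ?C" for i
      using feedforward_circuit[of l ?n T "xbit (word_tape x)" "kbit c2"] that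
      unfolding feedforward_def CC_def wires_def by fastforce
    then have "a < wires ?iw ?C \<and> b < wires ?iw ?C" if "(a, b) \<in> set ?C" for a b
      using that by (metis in_set_conv_nth fst_conv snd_conv)
    then show ?thesis by blast
  qed
  ultimately have enc: "encodes (query_word ?n l T (word_tape x) c2) ?G"
      and sgn: "sgn (partition_function \<beta> \<gamma> ?G) = sgn D"
    using graph[rule_format, of ?iw ?out ?C] unfolding Let_def D_def query_word_def by auto
  let ?w = "query_word ?n l T (word_tape x) c2"
  have "?w \<in> Domain (sign_problem \<beta> \<gamma>)"
    using enc unfolding sign_problem_def by blast
  then have "(?w, Q ?w) \<in> sign_problem \<beta> \<gamma>"
    using Q by (simp add: solves_def)
  then obtain G where "encodes ?w G" "Q ?w = sign_code (sgn (partition_function \<beta> \<gamma> G))"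
    unfolding sign_problem_def by auto
  with enc have "Q ?w = sign_code (sgn D)"
    using encodes_unique sgn by metis
  moreover have "0 < D \<longleftrightarrow> ?K < 2 * ?N"
    using \<beta>(2) \<open>z \<noteq> 0\<close> unfolding D by (auto simp: z_def zero_less_mult_iff)
  ultimately show ?thesis
    using \<open>z \<noteq> 0\<close> by (simp add: sign_code_def D sgn_if)
qed

definition search_step :: cmd where
  "search_step = SeqC (Write True (Add (Var 12) (Cst 1)) 1) (SeqC (graph_cmd 14)
    (SeqC QueryC (IfC Reply (Write True (Add (Var 12) (Cst 1)) 2) Nop)))"

definition search_cmd :: cmd where
  "search_cmd = ForC (Add (Var 1) (Cst 1)) search_step"

text \<open>The bits are found from the top: bit \<open>l - i\<close> is tentatively set to 0, the
  oracle is asked, and a positive answer sets it to 1 again. The invariant bounds the length of the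
  last answer, so that the next query overwrites it completely.\<close>

lemma sem_search_cmd:
  assumes g: "globals n l T env" and N: "N < 2 ^ Suc l"
    and Q: "\<And>c2. c2 0 \<noteq> 2 \<Longrightarrow>
      Q (query_word n l T c0 c2) = [binary (map (\<lambda>i. c2 (int i) = 2) [0..<l + 2]) < 2 * N]"
  shows "\<exists>v. sem Q 12 search_cmd env (c0, [], [], known N l (Suc l)) = (c0, v, [], known N l 0)"
proof -
  have "\<exists>v. length v \<le> 1 \<and> sem Q 12 search_cmd env (c0, [], [], known N l (Suc l)) =
      (c0, v, [], known N l (Suc l - Suc l))"
    unfolding search_cmd_def
  proof (rule sem_For[where I = "\<lambda>i st. \<exists>v. length v \<le> 1 \<and> st = (c0, v, [], known N l (Suc l - i))"])
    fix i and st :: store assume i: "i < Suc l" and "\<exists>v :: bool list. length v \<le> 1 \<and> st = (c0, v, [], known N l (Suc l - i))"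
    then obtain v :: "bool list" where v: "length v \<le> 1" and st: "st = (c0, v, [], known N l (Suc l - i))" by blast
    define r where "r = l - i"
    have r: "Suc l - i = Suc r" "Suc l - Suc i = r" "r \<le> l" using i by (auto simp: r_def)
    define F where "F = env(12 := r, Suc 12 := i)"
    have F: "globals n l T F" unfolding F_def using g by (intro globals_upd) auto
    have F12: "F 12 = r" by (simp add: F_def)
    define k where "k = (known N l (Suc r))(int r + 1 := 1)"
    let ?w = "query_word n l T c0 k" and ?b = "odd (N div 2 ^ r)"
    have graph: "sem Q 14 (graph_cmd 14) F (c0, v, [], k) = (c0, v, [] @ ?w, k)"
      using emits_graph_cmd[OF _ F, of 14 c0 k] unfolding emits_def query_word_def by simp
    have "length v \<le> length ?w" using v by (simp add: query_word_def graph_code_def unary_def)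
    then have w: "tape_word (over_tape v ?w) = ?w" by (simp add: over_tape_longer tape_word_word_tape)
    have q: "Q ?w = [?b]"
    proof -
      have "Q ?w = [binary (map (\<lambda>i. k (int i) = 2) [0..<l + 2]) < 2 * N]"
        unfolding k_def by (rule Q) (rule known_query(1)[OF r(3) N])
      then show ?thesis using known_query(2)[OF r(3) N] unfolding k_def by (simp only:)
    qed
    have reply: "over_tape [?b] [] 0 = (if ?b then 2 else 1)" by (simp add: over_tape_def word_tape_def)
    have upd: "(if ?b then k(int r + 1 := 2) else k) = known N l r"
      using known_update[OF r(3), of N] by (cases ?b) (simp_all add: k_def)
    have "sem Q 14 (Write True (Add (Var 12) (Cst 1)) 1) F (c0, v, [], known N l (Suc r)) = (c0, v, [], k)"
      by (simp add: F12 k_def add.commute)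
    moreover have "sem Q 14 QueryC F (c0, v, [] @ ?w, k) = (c0, [?b], [], k)"
      by (simp add: w q)
    moreover have "sem Q 14 (IfC Reply (Write True (Add (Var 12) (Cst 1)) 2) Nop) F (c0, [?b], [], k) =
        (c0, [?b], [], known N l r)"
      unfolding upd[symmetric] using reply by (simp add: F12 add.commute del: fun_upd_apply)
    ultimately have "sem Q 14 search_step F (c0, v, [], known N l (Suc r)) = (c0, [?b], [], known N l r)"
      using graph by (simp only: search_step_def sem.simps(4))
    moreover have "12 + 2 = (14::nat)" by simp
    ultimately have "sem Q (12 + 2) search_step (env(12 := Suc l - Suc i, Suc 12 := i)) st = (c0, [?b], [], known N l (Suc l - Suc i))"
      unfolding st r F_def[symmetric] by (simp only:)
    then show "\<exists>v. length v \<le> 1 \<and> sem Q (12 + 2) search_step (env(12 := Suc l - Suc i, Suc 12 := i)) st =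
        (c0, v, [], known N l (Suc l - Suc i))"
      by (intro exI[of _ "[?b]"]) simp
  qed (use g in \<open>auto simp: globals_def\<close>)
  then show ?thesis by auto
qed

definition body_cmd :: cmd where
  "body_cmd = SeqC fill_cmd (SeqC search_cmd (SeqC erase_cmd output_cmd))"

text \<open>The nested bindings create the variables 1 to 11 in the order prescribed by
  \<open>globals\<close>.\<close>

definition main_cmd :: "expr \<Rightarrow> expr \<Rightarrow> cmd" where
  "main_cmd el eT = LetC el (LetC eT
    (LetC (Add (Add (Mul (Cst 2) (Var 2)) (Add (Add (Mul (Cst 2) (Var 0)) (Cst 2)) (Var 1))) (Cst 1))
    (LetC (Add (Mul (Cst 2) (Var 3)) (Cst 1))
    (LetC (Add (Cst (4 + \<tau>)) (Var 1))
    (LetC (Add (Cst 1) (Mul (Add (Cst 1) (Mul (Add (Var 2) (Cst 1)) (Var 4))) (Cst sg)))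
    (LetC (Add fin_base_expr (Cst sf))
    (LetC (Add (Var 5) (Var 7))
    (LetC (Add (Var 8) (Mul (Cst 5) (Var 7)))
    (LetC (Mul (Cst gCm) (Add (Var 9) (Cst 1)))
    (LetC (Mul (Var 10) (Cst span)) body_cmd))))))))))"

lemma sem_main_cmd:
  assumes env: "env 0 = n" and e: "val el env st = l" "val eT (env(1 := l)) st = T"
  shows "\<exists>E. globals n l T E \<and> sem Q 1 (main_cmd el eT) env st = sem Q 12 body_cmd E st"
proof -
  let ?E = "env(1 := l, 2 := T, 3 := radius n l T, 4 := width n l T, 5 := in_wires l, 6 := cmp_base n l T,
    7 := NG n l T, 8 := NW n l T, 9 := VV n l T, 10 := mm n l T, 11 := mm n l T * span)"
  have v:
    "val (Add (Add (Mul (Cst 2) (Var 2)) (Add (Add (Mul (Cst 2) (Var 0)) (Cst 2)) (Var 1))) (Cst 1)) (env(1 := l, 2 := T)) st = radius n l T"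
    "val (Add (Mul (Cst 2) (Var 3)) (Cst 1)) (env(1 := l, 2 := T, 3 := radius n l T)) st = width n l T"
    "val (Add (Cst (4 + \<tau>)) (Var 1)) (env(1 := l, 2 := T, 3 := radius n l T, 4 := width n l T)) st = in_wires l"
    "val (Add (Cst 1) (Mul (Add (Cst 1) (Mul (Add (Var 2) (Cst 1)) (Var 4))) (Cst sg))) (env(1 := l, 2 := T, 3 := radius n l T, 4 := width n l T, 5 := in_wires l)) st = cmp_base n l T"
    "val (Add fin_base_expr (Cst sf)) (env(1 := l, 2 := T, 3 := radius n l T, 4 := width n l T, 5 := in_wires l, 6 := cmp_base n l T)) st = NG n l T"
    "val (Add (Var 5) (Var 7)) (env(1 := l, 2 := T, 3 := radius n l T, 4 := width n l T, 5 := in_wires l, 6 := cmp_base n l T, 7 := NG n l T)) st = NW n l T"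
    "val (Add (Var 8) (Mul (Cst 5) (Var 7))) (env(1 := l, 2 := T, 3 := radius n l T, 4 := width n l T, 5 := in_wires l, 6 := cmp_base n l T, 7 := NG n l T, 8 := NW n l T)) st = VV n l T"
    "val (Mul (Cst gCm) (Add (Var 9) (Cst 1))) (env(1 := l, 2 := T, 3 := radius n l T, 4 := width n l T, 5 := in_wires l, 6 := cmp_base n l T, 7 := NG n l T, 8 := NW n l T, 9 := VV n l T)) st = mm n l T"
    "val (Mul (Var 10) (Cst span)) (env(1 := l, 2 := T, 3 := radius n l T, 4 := width n l T, 5 := in_wires l, 6 := cmp_base n l T, 7 := NG n l T, 8 := NW n l T, 9 := VV n l T, 10 := mm n l T)) st = mm n l T * span"
    by (simp_all add: env radius_def width_def in_wires_def cmp_base_def fin_base_expr_def NG_def num_gates_def fin_base_def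
        NW_def VV_def mm_def)
  have "globals n l T ?E" by (simp add: globals_def env)
  moreover have "sem Q 1 (main_cmd el eT) env st = sem Q 12 body_cmd ?E st"
    unfolding main_cmd_def by (simp only: sem.simps Suc_1 Suc_numeral add_num_simps e v)
  ultimately show ?thesis by blast
qed

text \<open>Well-formedness of the large command for the graph is part of \<open>emits\<close>, so
  one arbitrary environment satisfying \<open>globals\<close> suffices to extract it.\<close>

lemma wf_main_cmd:
  assumes "wf_expr 1 el" "wf_expr 2 eT"
  shows "wf_cmd 1 (main_cmd el eT)" "queries (main_cmd el eT) = 1"
proof -
  obtain E where "globals 0 0 0 E"
    using sem_main_cmd[of "\<lambda>_. 0" 0 "Cst 0" "(\<lambda>_. 0, [], [], \<lambda>_. 0)" 0 "Cst 0" 0 id] by auto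
  from emits_graph_cmd[OF _ this, of 14] have g: "wf_cmd 14 (graph_cmd 14)" "queries (graph_cmd 14) = 0"
    unfolding emits_def by auto
  have b: "wf_cmd 12 body_cmd" "queries body_cmd = 1"
    using g by (simp_all add: body_cmd_def fill_cmd_def search_cmd_def search_step_def erase_cmd_def
        output_cmd_def output_step_def)
  show "wf_cmd 1 (main_cmd el eT)" "queries (main_cmd el eT) = 1"
    unfolding main_cmd_def fin_base_expr_def using assms b
    by (simp_all only: wf_cmd.simps queries.simps wf_expr.simps Suc_1 Suc_numeral add_num_simps) simp_all
qed

lemma main_cmd_counts:
  assumes "N < 2 ^ Suc l" and "val el ((\<lambda>_. 0)(0 := length x)) (word_tape x, [], [], \<lambda>_. 0) = l"
    "val eT ((\<lambda>_. 0)(0 := length x, 1 := l)) (word_tape x, [], [], \<lambda>_. 0) = T"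
    and Q: "\<And>c2. c2 0 \<noteq> 2 \<Longrightarrow> Q (query_word (length x) l T (word_tape x) c2) =
      [binary (map (\<lambda>i. c2 (int i) = 2) [0..<l + 2]) < 2 * N]"
  shows "tape_word (fst (sem Q 1 (main_cmd el eT) ((\<lambda>_. 0)(0 := length x)) (word_tape x, [], [], \<lambda>_. 0))) = nat_code N"
proof -
  obtain E where E: "globals (length x) l T E"
      "sem Q 1 (main_cmd el eT) ((\<lambda>_. 0)(0 := length x)) (word_tape x, [], [], \<lambda>_. 0) =
        sem Q 12 body_cmd E (word_tape x, [], [], \<lambda>_. 0)"
    using sem_main_cmd[of "(\<lambda>_. 0)(0 := length x)" "length x" el "(word_tape x, [], [], \<lambda>_. 0)" l eT T Q] assms by auto
  have E0: "E 1 = l" "E 0 = length x" using E(1) by (simp_all add: globals_def)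
  obtain v where "sem Q 12 search_cmd E (word_tape x, [], [], known N l (Suc l)) = (word_tape x, v, [], known N l 0)"
    using sem_search_cmd[OF E(1) assms(1) Q] by blast
  then show ?thesis
    unfolding E(2) body_cmd_def sem.simps sem_fill_cmd[of E l, OF E0(1), where N = N]
    using sem_output_cmd[of E l N Q v "[]", OF E0(1) assms(1)]
    by (simp add: sem_erase_cmd[of E x, OF E0(2)] tape_word_word_tape)
qed

end

text \<open>The set of cells is finite and the required formulas are Boolean functions of a number
  of inputs that is independent of the instance, so functional completeness of NAND provides
  them.\<close>

lemma (in tableau) ex_reduction:
  assumes "pn \<le> 2 ^ \<tau>" "qn \<le> 2 ^ \<tau>"
  shows "\<exists>cs fs fc ff. reduction M cs fs fc ff \<tau> pn qn"
proof -
  obtain cs where cs: "set cs = cells" "distinct cs"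
    using finite_distinct_list[OF finite_cells] by blast
  let ?B = "length cs"
  obtain fs where fs: "length fs = ?B" "\<forall>f\<in>set fs. is_gate f \<and> inputs f \<subseteq> {..<4 + 4 * ?B}"
      "\<forall>j<?B. \<forall>v. v 0 \<longrightarrow> feval v (fs ! j) = (cs ! j = initial_cell (v 1) (v 2) (v 3))"
      "\<forall>j<?B. \<forall>v l m r c. \<not> v 0 \<longrightarrow> l \<in> set cs \<longrightarrow> m \<in> set cs \<longrightarrow> r \<in> set cs \<longrightarrow> c \<in> set cs \<longrightarrow>
        (\<forall>k<?B. v (4 + k) = (cs ! k = l) \<and> v (4 + ?B + k) = (cs ! k = m) \<and>
          v (4 + 2 * ?B + k) = (cs ! k = r) \<and> v (4 + 3 * ?B + k) = (cs ! k = c)) \<longrightarrow>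
        feval v (fs ! j) = (cs ! j = next_cell l m r c)"
    using ex_cell_formulas[OF cs(2), of initial_cell next_cell] by (elim exE conjE) rule
  have "\<exists>f. is_gate f \<and> inputs f \<subseteq> {..<max 1 3} \<and> (\<forall>v. feval v f = (if v 0 = v 1 then v 2 else v 1))"
  proof (rule formula_complete)
    fix v w :: "nat \<Rightarrow> bool" assume "\<And>j. j < 3 \<Longrightarrow> v j = w j"
    from this[of 0] this[of 1] this[of 2] show "(if v 0 = v 1 then v 2 else v 1) = (if w 0 = w 1 then w 2 else w 1)"
      by simp
  qed
  then obtain fc where fc: "is_gate fc" "inputs fc \<subseteq> {..<3}" "\<forall>v. feval v fc = (if v 0 = v 1 then v 2 else v 1)"
    by auto
  define bits where "bits v c \<longleftrightarrow> (\<forall>j<?B. v (3 + \<tau> + j) = (cs ! j = c))" for v :: "nat \<Rightarrow> bool" and c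
  define F where "F v \<longleftrightarrow> (if v 0 then binary (map (\<lambda>j. v (3 + j)) [0..<\<tau>]) < pn \<and> \<not> v 1 \<and>
      (\<exists>c\<in>cells. bits v c \<and> accepts c)
    else binary (map (\<lambda>j. v (3 + j)) [0..<\<tau>]) < qn \<and> v 2)" for v
  have "\<exists>f. is_gate f \<and> inputs f \<subseteq> {..<max 1 (3 + \<tau> + ?B)} \<and> (\<forall>v. feval v f = F v)"
  proof (rule formula_complete)
    fix v w :: "nat \<Rightarrow> bool" assume eq: "\<And>j. j < 3 + \<tau> + ?B \<Longrightarrow> v j = w j"
    have "map (\<lambda>j. v (3 + j)) [0..<\<tau>] = map (\<lambda>j. w (3 + j)) [0..<\<tau>]" using eq by simp
    then have "binary (map (\<lambda>j. v (3 + j)) [0..<\<tau>]) = binary (map (\<lambda>j. w (3 + j)) [0..<\<tau>])"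
      by (rule arg_cong)
    moreover have "bits v c = bits w c" for c
      unfolding bits_def by (intro all_cong) (simp add: eq)
    ultimately show "F v = F w"
      using eq[of 0] eq[of 1] eq[of 2] by (simp add: F_def)
  qed
  moreover have "max 1 (3 + \<tau> + ?B) = 3 + \<tau> + ?B" by simp
  ultimately obtain ff where ff: "is_gate ff" "inputs ff \<subseteq> {..<3 + \<tau> + ?B}" "\<And>v. feval v ff = F v"
    by metis
  have uniq: "(\<exists>c'\<in>cells. bits v c' \<and> accepts c') = accepts c" if "c \<in> cells" "bits v c" for v c
  proof -
    obtain j where "j < ?B" "cs ! j = c" using \<open>c \<in> cells\<close> cs(1) by (metis in_set_conv_nth)
    then have "c' = c" if "bits v c'" for c' using that \<open>bits v c\<close> by (auto simp: bits_def)
    then show ?thesis using that by blast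
  qed
  have "reduction M cs fs fc ff \<tau> pn qn"
  proof (unfold_locales, goal_cases)
    case (5 j v) then show ?case using fs(3) by blast
  next
    case (6 j v l m r c) then show ?case using fs(4) unfolding cs(1) by blast
  next
    case (12 v c)
    then have "bits v c" by (simp add: bits_def)
    then show ?case unfolding ff(3) F_def using uniq[OF \<open>c \<in> cells\<close> \<open>bits v c\<close>] by simp
  qed (use cs fs fc ff assms in auto)
  then show ?thesis by blast
qed

theorem sharpP_hard_sorted:
  fixes \<beta> \<gamma> :: rat
  assumes "\<beta> \<le> \<gamma>" "\<beta> < 0" "-2 < \<beta> + \<gamma>" "\<beta> + \<gamma> < 1" "(\<beta>, \<gamma>) \<noteq> (-1, 1)"
  shows "sharpP_hard (sign_problem \<beta> \<gamma>)"
  unfolding sharpP_hard_def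
proof
  fix f assume "f \<in> sharpP"
  then obtain A p where "polytime_decidable A"
    and f: "\<And>x. f x = card {y. length y = poly p (length x) \<and> pair_code x y \<in> A}"
    unfolding sharpP_def by auto
  then obtain M :: tm and t :: "nat poly" where "wf_tm M"
    and halt: "\<And>w. halts_with M ((step M ^^ poly t (length w)) (init M w)) [w \<in> A]"
    unfolding polytime_decidable_def polytime_computable_def by auto
  then interpret tableau M by unfold_locales
  obtain a b where ab: "quotient_of \<beta> = (a, b)" by fastforce
  define pn qn where "pn = nat (- a)" and "qn = nat b"
  have "b > 0" using quotient_of_denom_pos[OF ab] .
  moreover have \<beta>: "\<beta> = of_int a / of_int b" using quotient_of_div[OF ab] .
  ultimately have "a < 0" using \<open>\<beta> < 0\<close> by (simp add: divide_less_0_iff)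
  have pq: "\<beta> = - of_nat pn / of_nat qn" "0 < pn" "0 < qn"
    using \<open>a < 0\<close> \<open>b > 0\<close> \<beta> by (simp_all add: pn_def qn_def)
  \<comment> \<open>Any \<tau> with both multiplicities at most \<open>2 ^ \<tau>\<close> would do;
    it is a constant of the reduction.\<close>
  define \<tau> where "\<tau> = pn + qn"
  have "pn \<le> 2 ^ \<tau>" "qn \<le> 2 ^ \<tau>"
    using less_exp[of \<tau>] unfolding \<tau>_def by linarith+
  from ex_reduction[OF this] obtain cs fs fc ff where "reduction M cs fs fc ff \<tau> pn qn" by blast
  then interpret reduction M cs fs fc ff \<tau> pn qn .
  obtain gM gP gq gK gCp gCm where graph: "\<forall>n0 C out. 2 \<le> n0 \<longrightarrow> out < wires n0 C \<longrightarrow>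
      (\<forall>(x, y) \<in> set C. x < wires n0 C \<and> y < wires n0 C) \<longrightarrow>
      (let D = of_nat (card {v \<in> solutions n0 C out. v 1}) +
            \<beta> * of_nat (card {v \<in> solutions n0 C out. \<not> v 1});
          es = concat (map place_edges (circuit_placements gM gP gq gK gCp gCm n0 C out));
          n = graph_size gM gP gq gK gCp gCm n0 C in
        1 \<le> \<bar>D\<bar> \<longrightarrow> encodes (graph_code n es) (coded_graph n es) \<and>
          sgn (partition_function \<beta> \<gamma> (coded_graph n es)) = sgn D)"
    using ex_circuit_graph[OF assms] by (elim exE) rule
  interpret generator M cs fs fc ff \<tau> pn qn gM gP gq gK gCp gCm by unfold_locales
  obtain el where el: "wf_expr 1 el" "\<And>env st. val el env st = poly p (env 0)"
    using ex_poly_expr[of 1 "Var 0" p] by auto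
  \<comment> \<open>The length of the code of an instance together with a witness, at which the time
    bound of the verifier is taken.\<close>
  let ?len = "Add (Add (Mul (Cst 2) (Var 0)) (Cst 2)) (Var 1)"
  obtain eT where eT: "wf_expr 2 eT" "\<And>env st. val eT env st = poly t (val ?len env st)"
    using ex_poly_expr[of 2 ?len t] by auto
  show "polytime_turing_reducible f (sign_problem \<beta> \<gamma>)"
  proof (rule polytime_turing_reducibleI)
    show "wf_cmd 1 (main_cmd el eT)" "queries (main_cmd el eT) = 1"
      using wf_main_cmd[OF el(1) eT(1)] .
    fix Q and x :: "bool list" assume Q: "solves Q (sign_problem \<beta> \<gamma>)"
    let ?l = "poly p (length x)"
    let ?T = "poly t (2 * length x + 2 + ?l)"
    have run: "halts_with M ((step M ^^ ?T) (init M (pair_code x y))) [pair_code x y \<in> A]" if "length y = ?l" for y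
      using halt[of "pair_code x y"] unfolding nth_pair_code(5) that .
    \<comment> \<open>All witnesses may be accepted, so the count can reach \<open>2 ^ ?l\<close>
      and needs \<open>?l + 1\<close> bits.\<close>
    have "f x \<le> card {y :: bool list. set y \<subseteq> UNIV \<and> length y = ?l}"
      unfolding f by (intro card_mono finite_lists_length_eq) auto
    then have "f x \<le> 2 ^ ?l" using card_lists_length_eq[of "UNIV :: bool set" ?l] by simp
    then have "f x < 2 ^ Suc ?l" by (rule le_less_trans) simp
    then show "tape_word (fst (sem Q 1 (main_cmd el eT) ((\<lambda>_. 0)(0 := length x)) (word_tape x, [], [], \<lambda>_. 0))) =
        nat_code (f x)"
    proof (rule main_cmd_counts)
      show "val el ((\<lambda>_. 0)(0 := length x)) (word_tape x, [], [], \<lambda>_. 0) = ?l"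
        by (simp add: el)
      show "val eT ((\<lambda>_. 0)(0 := length x, 1 := ?l)) (word_tape x, [], [], \<lambda>_. 0) = ?T"
        by (simp add: eT)
      show "Q (query_word (length x) ?l ?T (word_tape x) c2) =
          [binary (map (\<lambda>i. c2 (int i) = 2) [0..<?l + 2]) < 2 * f x]" if "c2 0 \<noteq> 2" for c2
        unfolding f using pq graph Q run that by (rule oracle_answer)
    qed
  qed
qed

theorem theorem1:
  fixes \<beta> \<gamma> :: rat
  assumes "min \<beta> \<gamma> < 0"
    and "-2 < \<beta> + \<gamma>" and "\<beta> + \<gamma> < 1"
    and "(\<beta>, \<gamma>) \<notin> {(1, -1), (-1, 1)}"
  shows "sharpP_hard (sign_problem \<beta> \<gamma>)"
proof (cases "\<beta> \<le> \<gamma>")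
  case True
  then show ?thesis using assms by (intro sharpP_hard_sorted) auto
next
  case False
  then have "sharpP_hard (sign_problem \<gamma> \<beta>)"
    using assms by (intro sharpP_hard_sorted) auto
  then show ?thesis by (simp add: sign_problem_swap)
qed

end
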